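(* Let $h:\mathbb R\times\mathbb R^{2d}\to\mathbb R$ be continuous in time, smooth and of subquadratic growth in phase space, and let $H(t)=\mathrm{op}_{\mathrm{Weyl}}(h(t))$. Let $u_0\in\mathcal M$ with $\|u_0\|_{L^2}=1$ have parameters $q_0,p_0,\mathcal C_0,\zeta_0$. Then the parameters of the variational approximation $u(t)\in\mathcal M$ defined by $$i\varepsilon\partial_tu(t)=P_{u(t)}(H(t)u(t)),\qquad u(0)=u_0,$$ satisfy $$\dot q=\langle\nabla_ph\rangle_u,\qquad \dot p=-\langle\nabla_qh\rangle_u,$$ $$\dot{\mathcal C}=-\langle\nabla_{qq}h\rangle_u-\langle\nabla_{qp}h\rangle_u\mathcal C-\mathcal C\langle\nabla_{pq}h\rangle_u-\mathcal C\langle\nabla_{pp}h\rangle_u\mathcal C,$$ $$\dot\zeta=-\langle h\rangle_u+\tfrac{\varepsilon}{4}\mathrm{tr}(B\,\mathcal C_I^{-1})+p^T\langle\nabla_ph\rangle_u,\qquad B=\begin{pmatrix}\mathrm{Id}&\mathcal C\end{pmatrix}\langle\nabla^2h\rangle_u\begin{pmatrix}\mathrm{Id}\\\mathcal C\end{pmatrix}\in\mathbb C^{d\times d},$$ with $(q(0),p(0),\mathcal C(0),\zeta(0))=(q_0,p_0,\mathcal C_0,\zeta_0)$. The Hagedorn parameter matrices $Q,P\in\mathbb C^{d\times d}$ of the variational wave packet (the factors in $\mathcal C=PQ^{-1}$, with initial matrices satisfying $\mathcal C_0=P_0Q_0^{-1}$) satisfy $$\dot P=-\langle\nabla_{qq}h\rangle_uQ-\langle\nabla_{qp}h\rangle_uP,\qquad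 \dot Q=\langle\nabla_{pq}h\rangle_uQ+\langle\nabla_{pp}h\rangle_uP.$$ Moreover, the matrix factors $Q,P$ are symplectic, provided that the initial matrices $Q_0,P_0$ of the factorization $\mathcal C_0=P_0Q_0^{-1}$ are symplectic.
   Context: $\varepsilon\in(0,1]$ is a semiclassical parameter. Subquadratic growth of $h$: for all $\alpha\in\mathbb N_0^{2d}$ with $|\alpha|\ge2$ there is $C_\alpha>0$ with $|\partial^\alpha h(t,\tilde q,\tilde p)|\le C_\alpha$ for all $t\in\mathbb R$, $(\tilde q,\tilde p)\in\mathbb R^{2d}$. Weyl quantization: $\mathrm{op}_{\mathrm{Weyl}}(a)\varphi(x)=(2\pi\varepsilon)^{-d}\int_{\mathbb R^{2d}}a(\frac{x+\tilde q}{2},\tilde p)e^{i\tilde p\cdot(x-\tilde q)/\varepsilon}\varphi(\tilde q)\,d(\tilde q,\tilde p)$. $\mathcal M$ is the set of Gaussian wave packets $g(x)=\exp\big(\frac{i}{\varepsilon}(\frac12(x-q)^T\mathcal C(x-q)+(x-q)^Tp+\zeta)\big)$ with $q,p\in\mathbb R^d$, $\mathcal C=\mathcal C^T\in\mathbb C^{d\times d}$ with positive definite imaginary part $\mathcal C_I=\mathrm{Im}\,\mathcal C$, $\zeta\in\mathbb C$. The tangent space is $\mathcal T_u\mathcal M=\{\varphi u:\varphi$ a $d$-variate complex polynomial of degree at most $2\}$, and $P_u:L^2(\mathbb R^d)\to\mathcal T_u\mathcal M$ is the orthogonal projection. For a smooth (scalar-, vector- or matrix-valued) symbol $a$ on $\mathbb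 R^{2d}$, $\langle a\rangle_u=\langle u|\mathrm{op}_{\mathrm{Weyl}}(a)u\rangle$ (entrywise). $\nabla_qh,\nabla_ph$ are the gradients in the first (position) and second (momentum) $d$ variables; $\nabla_{qq}h,\nabla_{qp}h,\nabla_{pq}h,\nabla_{pp}h$ are the corresponding $d\times d$ blocks of the Hessian $\nabla^2h=\begin{pmatrix}\nabla_{qq}h&\nabla_{qp}h\\\nabla_{pq}h&\nabla_{pp}h\end{pmatrix}$. The time dependence of $h$ is suppressed. Complex matrices $Q,P\in\mathbb C^{d\times d}$ are called symplectic if $Q^TP-P^TQ=0$ and $Q^*P-P^*Q=2i\,\mathrm{Id}$. *)

theory Defs
  imports "HOL-Analysis.Analysis"
begin

subsection \<open>Derivatives and symbols\<close>

definition pderiv_at ::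
  "'a::real_normed_vector \<Rightarrow> ('a \<Rightarrow> real) \<Rightarrow> 'a \<Rightarrow> real" where
  "pderiv_at b f z = frechet_derivative f (at z) b"

text \<open>The partial derivative of multi-index order \<open>\<alpha>\<close> is encoded by a list of basis vectors in
  which the \<open>i\<close>-th basis vector occurs \<open>\<alpha>\<^sub>i\<close> times, so that \<open>|\<alpha>|\<close> is the length of the list.
  For smooth functions the order of the list is irrelevant.\<close>

primrec iter_pderiv ::
  "'a::real_normed_vector list \<Rightarrow> ('a \<Rightarrow> real) \<Rightarrow> 'a \<Rightarrow> real" where
  "iter_pderiv [] f = f"
| "iter_pderiv (b # bs) f = pderiv_at b (iter_pderiv bs f)"

definition smooth_fun :: "('a::euclidean_space \<Rightarrow> real) \<Rightarrow> bool" where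
  "smooth_fun f \<longleftrightarrow>
     (\<forall>bs. set bs \<subseteq> Basis \<longrightarrow> iter_pderiv bs f differentiable_on UNIV)"

text \<open>The bounds are uniform in time.\<close>

definition subquadratic :: "(real \<Rightarrow> 'a::euclidean_space \<Rightarrow> real) \<Rightarrow> bool" where
  "subquadratic h \<longleftrightarrow>
     (\<forall>bs. set bs \<subseteq> Basis \<and> length bs \<ge> 2 \<longrightarrow>
        (\<exists>C>0. \<forall>t z. \<bar>iter_pderiv bs (h t) z\<bar> \<le> C))"

text \<open>Phase space is the product of position and momentum space; its \<open>2d\<close> coordinates
  are indexed by the sum type, \<open>Inl\<close> for positions and \<open>Inr\<close> for momenta.\<close>

type_synonym 'n phase = "(real^'n) \<times> (real^'n)"

primrec phase_axis :: "'n::finite + 'n \<Rightarrow> 'n phase" where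
  "phase_axis (Inl i) = (axis i 1, 0)"
| "phase_axis (Inr i) = (0, axis i 1)"

definition grad_q :: "('n::finite phase \<Rightarrow> real) \<Rightarrow> 'n phase \<Rightarrow> real^'n" where
  "grad_q h z = (\<chi> i. pderiv_at (phase_axis (Inl i)) h z)"

definition grad_p :: "('n::finite phase \<Rightarrow> real) \<Rightarrow> 'n phase \<Rightarrow> real^'n" where
  "grad_p h z = (\<chi> i. pderiv_at (phase_axis (Inr i)) h z)"

definition hess :: "('n::finite phase \<Rightarrow> real) \<Rightarrow> 'n phase \<Rightarrow> real^('n+'n)^('n+'n)" where
  "hess h z = (\<chi> k l. pderiv_at (phase_axis k) (pderiv_at (phase_axis l) h) z)"

definition hess_qq :: "('n::finite phase \<Rightarrow> real) \<Rightarrow> 'n phase \<Rightarrow> real^'n^'n" where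
  "hess_qq h z = (\<chi> i j. hess h z $ Inl i $ Inl j)"

definition hess_qp :: "('n::finite phase \<Rightarrow> real) \<Rightarrow> 'n phase \<Rightarrow> real^'n^'n" where
  "hess_qp h z = (\<chi> i j. hess h z $ Inl i $ Inr j)"

definition hess_pq :: "('n::finite phase \<Rightarrow> real) \<Rightarrow> 'n phase \<Rightarrow> real^'n^'n" where
  "hess_pq h z = (\<chi> i j. hess h z $ Inr i $ Inl j)"

definition hess_pp :: "('n::finite phase \<Rightarrow> real) \<Rightarrow> 'n phase \<Rightarrow> real^'n^'n" where
  "hess_pp h z = (\<chi> i j. hess h z $ Inr i $ Inr j)"


subsection \<open>Complex vectors and matrices\<close>

definition cvec :: "real^'n \<Rightarrow> complex^'n" where
  "cvec v = (\<chi> i. complex_of_real (v $ i))"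

definition cmat :: "real^'n^'m \<Rightarrow> complex^'n^'m" where
  "cmat A = (\<chi> i j. complex_of_real (A $ i $ j))"

definition Im_mat :: "complex^'n^'m \<Rightarrow> real^'n^'m" where
  "Im_mat A = (\<chi> i j. Im (A $ i $ j))"

text \<open>\<open>bdot v w\<close> is \<open>v\<^sup>T w\<close>, without complex conjugation
  (the library's inner product on complex vectors is real-valued).\<close>

definition bdot :: "complex^'n \<Rightarrow> complex^'n \<Rightarrow> complex" where
  "bdot v w = (\<Sum>i\<in>UNIV. v $ i * w $ i)"

definition conj_transpose :: "complex^'n^'m \<Rightarrow> complex^'m^'n" where
  "conj_transpose A = (\<chi> i j. cnj (A $ j $ i))"

definition symplectic_pair :: "complex^'n^'n \<Rightarrow> complex^'n^'n \<Rightarrow> bool" where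
  "symplectic_pair Q P \<longleftrightarrow>
     transpose Q ** P - transpose P ** Q = 0 \<and>
     conj_transpose Q ** P - conj_transpose P ** Q = mat (2 * \<i>)"

text \<open>The \<open>d \<times> 2d\<close> matrix \<open>(Id C)\<close>, and the \<open>2d \<times> d\<close> matrix obtained by stacking \<open>Id\<close>
  on top of \<open>C\<close>.\<close>

definition Id_row :: "complex^'n^'n \<Rightarrow> complex^('n+'n)^'n" where
  "Id_row C = (\<chi> i k. case k of Inl j \<Rightarrow> mat 1 $ i $ j | Inr j \<Rightarrow> C $ i $ j)"

definition Id_col :: "complex^'n^'n \<Rightarrow> complex^'n^('n+'n)" where
  "Id_col C = (\<chi> k j. case k of Inl i \<Rightarrow> mat 1 $ i $ j | Inr i \<Rightarrow> C $ i $ j)"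


subsection \<open>Weyl quantization and expectation values\<close>

definition L2_inner :: "(real^'n \<Rightarrow> complex) \<Rightarrow> (real^'n \<Rightarrow> complex) \<Rightarrow> complex" where
  "L2_inner f g = (LINT x|lborel. cnj (f x) * g x)"

definition L2_norm :: "(real^'n \<Rightarrow> complex) \<Rightarrow> real" where
  "L2_norm f = sqrt (LINT x|lborel. (cmod (f x))\<^sup>2)"

text \<open>The phase-space integral in Weyl quantization is oscillatory: even for a Schwartz function
  \<open>\<phi>\<close> the integrand is in general not jointly Lebesgue integrable, since it does not decay
  in \<open>\<eta>\<close>.  It is therefore read as an iterated integral, first over the position variable
  \<open>y\<close> and then over the momentum variable \<open>\<eta>\<close>. For a smooth symbol of subquadratic growth
  and a Schwartz function \<open>\<phi>\<close> the inner integral is rapidly decreasing in \<open>\<eta>\<close> and both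
  integrals converge absolutely.\<close>

definition op_weyl ::
  "real \<Rightarrow> ('n::finite phase \<Rightarrow> real) \<Rightarrow> (real^'n \<Rightarrow> complex) \<Rightarrow> real^'n \<Rightarrow> complex" where
  "op_weyl \<epsilon> a \<phi> x =
     complex_of_real (1 / (2 * pi * \<epsilon>) ^ CARD('n)) *
     (LINT \<eta>|lborel. (LINT y|lborel.
        complex_of_real (a ((1/2) *\<^sub>R (x + y), \<eta>)) *
        exp (\<i> * complex_of_real (\<eta> \<bullet> (x - y) / \<epsilon>)) * \<phi> y))"

definition avg ::
  "real \<Rightarrow> (real^'n \<Rightarrow> complex) \<Rightarrow> ('n::finite phase \<Rightarrow> real) \<Rightarrow> complex" where
  "avg \<epsilon> u a = L2_inner u (op_weyl \<epsilon> a u)"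

definition avg_vec ::
  "real \<Rightarrow> (real^'n \<Rightarrow> complex) \<Rightarrow> ('n::finite phase \<Rightarrow> real^'k) \<Rightarrow> complex^'k" where
  "avg_vec \<epsilon> u a = (\<chi> i. avg \<epsilon> u (\<lambda>z. a z $ i))"

definition avg_mat ::
  "real \<Rightarrow> (real^'n \<Rightarrow> complex) \<Rightarrow> ('n::finite phase \<Rightarrow> real^'k^'l) \<Rightarrow> complex^'k^'l" where
  "avg_mat \<epsilon> u a = (\<chi> i j. avg \<epsilon> u (\<lambda>z. a z $ i $ j))"

definition B_mat ::
  "real \<Rightarrow> (real^'n \<Rightarrow> complex) \<Rightarrow> ('n::finite phase \<Rightarrow> real) \<Rightarrow> complex^'n^'n \<Rightarrow> complex^'n^'n" where
  "B_mat \<epsilon> u h C = Id_row C ** avg_mat \<epsilon> u (hess h) ** Id_col C"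


subsection \<open>Gaussian wave packets\<close>

definition gauss ::
  "real \<Rightarrow> real^'n \<Rightarrow> real^'n \<Rightarrow> complex^'n^'n \<Rightarrow> complex \<Rightarrow> real^'n \<Rightarrow> complex" where
  "gauss \<epsilon> q p C \<zeta> x =
     exp (\<i> / complex_of_real \<epsilon> *
       (1/2 * bdot (cvec (x - q)) (C *v cvec (x - q)) + complex_of_real ((x - q) \<bullet> p) + \<zeta>))"

definition width_matrix :: "complex^'n^'n \<Rightarrow> bool" where
  "width_matrix C \<longleftrightarrow> transpose C = C \<and> (\<forall>v. v \<noteq> 0 \<longrightarrow> v \<bullet> (Im_mat C *v v) > 0)"

definition wave_packets :: "real \<Rightarrow> (real^'n \<Rightarrow> complex) set" where
  "wave_packets \<epsilon> = {gauss \<epsilon> q p C \<zeta> | q p C \<zeta>. width_matrix C}"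

definition quad_polys :: "(real^'n \<Rightarrow> complex) set" where
  "quad_polys =
     {\<lambda>x. c + bdot b (cvec x) + bdot (cvec x) (A *v cvec x) | c b A. True}"

definition tangent_space :: "(real^'n \<Rightarrow> complex) \<Rightarrow> (real^'n \<Rightarrow> complex) set" where
  "tangent_space u = {\<lambda>x. \<phi> x * u x | \<phi>. \<phi> \<in> quad_polys}"

text \<open>Orthogonal projection of a square-integrable function onto the tangent space at a wave
  packet \<open>u\<close>. The tangent space is finite-dimensional and consists of continuous functions, so
  the element is unique as a function, not only almost everywhere.\<close>

definition tangent_proj ::
  "(real^'n \<Rightarrow> complex) \<Rightarrow> (real^'n \<Rightarrow> complex) \<Rightarrow> real^'n \<Rightarrow> complex" where
  "tangent_proj u f =
     (THE g. g \<in> tangent_space u \<and>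
        (\<forall>v\<in>tangent_space u. L2_inner v (\<lambda>x. f x - g x) = 0))"

text \<open>\<open>i \<epsilon> \<partial>\<^sub>t u = P\<^sub>u (H u)\<close> on a time interval \<open>I\<close> (one-sided derivatives at end points
  in \<open>I\<close>), with values in the manifold of wave packets.\<close>

definition variational_solution ::
  "real \<Rightarrow> (real \<Rightarrow> 'n::finite phase \<Rightarrow> real) \<Rightarrow> real set \<Rightarrow>
   (real \<Rightarrow> real^'n \<Rightarrow> complex) \<Rightarrow> bool" where
  "variational_solution \<epsilon> h I u \<longleftrightarrow>
     (\<forall>t\<in>I. u t \<in> wave_packets \<epsilon> \<and>
       (\<forall>x. \<exists>D. ((\<lambda>s. u s x) has_vector_derivative D) (at t within I) \<and>
          \<i> * complex_of_real \<epsilon> * D = tangent_proj (u t) (op_weyl \<epsilon> (h t) (u t)) x))"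

text \<open>A wave packet determines \<open>q\<close>, \<open>p\<close> and \<open>C\<close>, but \<open>\<zeta>\<close> only modulo \<open>2 \<pi> \<epsilon>\<close>. Along a curve
  of wave packets, \<open>\<zeta>\<close> is a continuous choice.\<close>

definition packet_params ::
  "real \<Rightarrow> real set \<Rightarrow> (real \<Rightarrow> real^'n \<Rightarrow> complex) \<Rightarrow>
   (real \<Rightarrow> real^'n) \<Rightarrow> (real \<Rightarrow> real^'n) \<Rightarrow> (real \<Rightarrow> complex^'n^'n) \<Rightarrow> (real \<Rightarrow> complex) \<Rightarrow> bool" where
  "packet_params \<epsilon> I u q p C \<zeta> \<longleftrightarrow>
     continuous_on I \<zeta> \<and>
     (\<forall>t\<in>I. width_matrix (C t) \<and> u t = gauss \<epsilon> (q t) (p t) (C t) (\<zeta> t))"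

text \<open>The equations of motion. The position and momentum equations are equalities of complex
  vectors, so they include the claim that the averages on the right are real.\<close>

definition parameter_equations ::
  "real \<Rightarrow> (real \<Rightarrow> 'n::finite phase \<Rightarrow> real) \<Rightarrow> real set \<Rightarrow> (real \<Rightarrow> real^'n \<Rightarrow> complex) \<Rightarrow>
   (real \<Rightarrow> real^'n) \<Rightarrow> (real \<Rightarrow> real^'n) \<Rightarrow> (real \<Rightarrow> complex^'n^'n) \<Rightarrow> (real \<Rightarrow> complex) \<Rightarrow> bool" where
  "parameter_equations \<epsilon> h I u q p C \<zeta> \<longleftrightarrow> (\<forall>t\<in>I.
     ((\<lambda>s. cvec (q s)) has_vector_derivative avg_vec \<epsilon> (u t) (grad_p (h t))) (at t within I) \<and>
     ((\<lambda>s. cvec (p s)) has_vector_derivative - avg_vec \<epsilon> (u t) (grad_q (h t))) (at t within I) \<and>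
     (C has_vector_derivative
        - avg_mat \<epsilon> (u t) (hess_qq (h t))
        - avg_mat \<epsilon> (u t) (hess_qp (h t)) ** C t
        - C t ** avg_mat \<epsilon> (u t) (hess_pq (h t))
        - C t ** avg_mat \<epsilon> (u t) (hess_pp (h t)) ** C t) (at t within I) \<and>
     (\<zeta> has_vector_derivative
        - avg \<epsilon> (u t) (h t)
        + complex_of_real (\<epsilon> / 4) *
            trace (B_mat \<epsilon> (u t) (h t) (C t) ** cmat (matrix_inv (Im_mat (C t))))
        + bdot (cvec (p t)) (avg_vec \<epsilon> (u t) (grad_p (h t)))) (at t within I))"

definition hagedorn_equations ::
  "real \<Rightarrow> (real \<Rightarrow> 'n::finite phase \<Rightarrow> real) \<Rightarrow> real set \<Rightarrow> (real \<Rightarrow> real^'n \<Rightarrow> complex) \<Rightarrow>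
   (real \<Rightarrow> complex^'n^'n) \<Rightarrow> (real \<Rightarrow> complex^'n^'n) \<Rightarrow> bool" where
  "hagedorn_equations \<epsilon> h I u Q P \<longleftrightarrow> (\<forall>t\<in>I.
     (P has_vector_derivative
        - avg_mat \<epsilon> (u t) (hess_qq (h t)) ** Q t
        - avg_mat \<epsilon> (u t) (hess_qp (h t)) ** P t) (at t within I) \<and>
     (Q has_vector_derivative
        avg_mat \<epsilon> (u t) (hess_pq (h t)) ** Q t
        + avg_mat \<epsilon> (u t) (hess_pp (h t)) ** P t) (at t within I))"

definition factorizes :: "complex^'n^'n \<Rightarrow> complex^'n^'n \<Rightarrow> complex^'n^'n \<Rightarrow> bool" where
  "factorizes C Q P \<longleftrightarrow> invertible Q \<and> C = P ** matrix_inv Q"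

end

theory Submission
  imports Defs "HOL-Probability.Sinc_Integral"
begin

text \<open>On rapidly decreasing functions the form \<open>\<langle>v, op(a) w\<rangle>\<close> is Hermitian, and commuting \<open>op(a)\<close> with \<open>x\<^sub>j\<close> and
  \<open>-i\<epsilon>\<partial>\<^sub>j\<close> differentiates the symbol. For a Gaussian \<open>u\<close> the operator \<open>-i\<epsilon>\<partial>\<^sub>j\<close> multiplies \<open>u\<close> by an affine
  function, so these commutators express \<open>\<langle>f u, op(h) u\<rangle>\<close> for quadratic \<open>f\<close> by averages of \<open>h\<close>, \<open>\<nabla>h\<close> and
  \<open>\<nabla>\<^sup>2h\<close>; comparing with the Gaussian moments of \<open>|u|\<^sup>2\<close> gives \<open>P\<^sub>u(op(h) u)\<close> explicitly. Pointwise
  convergence of Gaussians forces convergence of the parameters (second differences in \<open>x\<close> reduce it to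
  the convergence of characters), so the parameters of a differentiable curve in the manifold are
  differentiable and comparing coefficients yields their equations. The norm is conserved because \<open>\<langle>u, op(h) u\<rangle>\<close> is real.
  The averaged Hessian is continuous in time by dominated convergence, so \<open>Q\<close> and \<open>P\<close> solve a
  linear equation; \<open>P - C Q\<close> solves a homogeneous one with zero initial value, and \<open>Q\<^sup>TP - P\<^sup>TQ\<close>
  and \<open>Q\<^sup>*P - P\<^sup>*Q\<close> are constant.\<close>

subsection \<open>Integration of rapidly decreasing functions\<close>

text \<open>The Weyl integral is only iterated: the triple integrand in x, \<eta>, y has no decay in
  \<eta>, so Fubini is never applied to all three variables. Integration by parts in y makes the
  inner integral decay in \<eta>; then x and \<eta> may be exchanged, while x and y are exchanged at
  fixed \<eta>, where Hermitian symmetry is proved. The solution is given only pointwise in x. Its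
  values determine the exponent modulo \<open>2 \<pi> \<epsilon>\<close>, so limits are first taken
  of exponentials, and logarithms only once a bound or the continuity of \<zeta> has fixed the
  branch. The Gram matrix of the tangent space is never inverted: the Weyl moments and those of
  |u|^2 solve linear systems with the same matrix Im C, so the projection can be written down and
  then checked. It carries the factor 1/||u||^2, whereas the averages in the equations are not
  normalised; this is where conservation of the norm enters. Invertibility of Q at other times is
  not given and follows from uniqueness run from that time back to 0.\<close>

lemma integrable_inverse_1_plus_square_real: "integrable lborel (\<lambda>x::real. inverse (1 + x\<^sup>2))"
  using integrable_inverse_1_plus_square by (simp add: set_integrable_def)

text \<open>Lebesgue measure is the image of a product measure under the coordinate expansion, so
  integrability reduces to that of the one-dimensional weight 1/(1 + t^2).\<close>

lemma integrable_prod_weight: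
  "integrable lborel (\<lambda>x::'a::euclidean_space. \<Prod>b\<in>Basis. inverse (1 + (x \<bullet> b)\<^sup>2))"
proof -
  interpret product_sigma_finite "\<lambda>_::'a. lborel :: real measure" ..
  have "integrable (\<Pi>\<^sub>M b\<in>(Basis::'a set). lborel)
      (\<lambda>f. \<Prod>b\<in>Basis. inverse (1 + (f b)\<^sup>2) :: real)"
    using product_integrable_prod[of Basis "\<lambda>_ y. inverse (1 + y\<^sup>2)"]
    by (simp add: integrable_inverse_1_plus_square_real)
  then have "integrable (\<Pi>\<^sub>M b\<in>(Basis::'a set). lborel)
      (\<lambda>f. \<Prod>b\<in>Basis. inverse (1 + ((\<Sum>b\<in>Basis. f b *\<^sub>R b) \<bullet> b :: real)\<^sup>2))"
    by (rule Bochner_Integration.integrable_cong[THEN iffD1, rotated -1])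
      (auto simp: inner_sum_left inner_Basis if_distrib cong: if_cong)
  then show ?thesis
    unfolding lborel_eq[where 'a='a]
    by (subst integrable_distr_eq) auto
qed

text \<open>Each of the \<open>DIM('a)\<close> factors 1 + (x . b)^2 is at most (1 + norm x)^2. This
  is the source of the exponent \<open>2 * DIM('a)\<close> in the later decay estimates.\<close>

lemma integrable_norm_weight:
  "integrable lborel (\<lambda>x::'a::euclidean_space. inverse ((1 + norm x) ^ (2 * DIM('a))))"
proof (rule Bochner_Integration.integrable_bound[OF integrable_prod_weight])
  show "AE x::'a in lborel. norm (inverse ((1 + norm x) ^ (2 * DIM('a))))
      \<le> norm (\<Prod>b\<in>Basis. inverse (1 + (x \<bullet> b)\<^sup>2))"
  proof (rule AE_I2)
    fix x :: 'a
    have "(\<Prod>b\<in>Basis. 1 + (x \<bullet> b)\<^sup>2) \<le> (\<Prod>b\<in>(Basis::'a set). (1 + norm x)\<^sup>2)"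
    proof (rule prod_mono)
      fix b :: 'a assume "b \<in> Basis"
      then have "(x \<bullet> b)\<^sup>2 \<le> (norm x)\<^sup>2"
        using Basis_le_norm[of b x] abs_le_square_iff[of "x \<bullet> b" "norm x"] by simp
      moreover have "1 + (norm x)\<^sup>2 \<le> (1 + norm x)\<^sup>2"
        by (simp add: power2_sum)
      ultimately show "0 \<le> 1 + (x \<bullet> b)\<^sup>2 \<and> 1 + (x \<bullet> b)\<^sup>2 \<le> (1 + norm x)\<^sup>2"
        by (auto intro: add_nonneg_nonneg)
    qed
    also have "\<dots> = (1 + norm x) ^ (2 * DIM('a))"
      by (simp add: power_mult)
    finally have "inverse ((1 + norm x) ^ (2 * DIM('a))) \<le> inverse (\<Prod>b\<in>Basis. 1 + (x \<bullet> b)\<^sup>2)"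
      by (intro le_imp_inverse_le) (auto intro!: prod_pos add_pos_nonneg)
    then show "norm (inverse ((1 + norm x) ^ (2 * DIM('a))))
      \<le> norm (\<Prod>b\<in>Basis. inverse (1 + (x \<bullet> b)\<^sup>2))"
      by (simp add: prod_inversef[unfolded o_def] prod_nonneg abs_prod del: prod_inversef)
  qed
qed (auto intro!: borel_measurable_continuous_onI continuous_intros)

lemma integrable_weight_bound:
  fixes f :: "'a::euclidean_space \<Rightarrow> complex"
  assumes "f \<in> borel_measurable borel"
    and "\<And>x. (1 + norm x) ^ (2 * DIM('a)) * cmod (f x) \<le> K"
  shows "integrable lborel f"
proof (rule Bochner_Integration.integrable_bound)
  show "integrable lborel (\<lambda>x::'a. K * inverse ((1 + norm x) ^ (2 * DIM('a))))"
    by (intro integrable_mult_right integrable_norm_weight)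
  show "AE x in lborel. norm (f x) \<le> norm (K * inverse ((1 + norm x) ^ (2 * DIM('a))))"
  proof (rule AE_I2)
    fix x :: 'a
    have pos: "(1 + norm x) ^ (2 * DIM('a)) > 0"
      by (intro zero_less_power add_pos_nonneg) auto
    have "cmod (f x) \<le> K * inverse ((1 + norm x) ^ (2 * DIM('a)))"
      using assms(2)[of x] pos by (simp add: field_simps)
    then show "norm (f x) \<le> norm (K * inverse ((1 + norm x) ^ (2 * DIM('a))))"
      using order_trans abs_ge_self by fastforce
  qed
qed (use assms(1) in simp)

subsection \<open>Directional derivatives and integration by parts\<close>

text \<open>A derivative along lines only: the one-variable rules carry over directly, and
  integration in one direction uses nothing else.\<close>

definition dir_deriv :: "('a::real_normed_vector \<Rightarrow> complex) \<Rightarrow> 'a \<Rightarrow> ('a \<Rightarrow> complex) \<Rightarrow> bool" where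
  "dir_deriv f b f' \<longleftrightarrow> (\<forall>x. ((\<lambda>s. f (x + s *\<^sub>R b)) has_vector_derivative f' x) (at 0))"

lemma dir_deriv_at:
  assumes "dir_deriv f b f'"
  shows "((\<lambda>s. f (x + s *\<^sub>R b)) has_vector_derivative f' (x + s *\<^sub>R b)) (at s)"
proof -
  have "((\<lambda>r. f ((x + s *\<^sub>R b) + r *\<^sub>R b)) has_vector_derivative f' (x + s *\<^sub>R b)) (at (s - s))"
    using assms unfolding dir_deriv_def by simp
  moreover have "((\<lambda>t. t - s) has_vector_derivative 1) (at s)"
    by (auto intro!: derivative_eq_intros)
  ultimately have "((\<lambda>r. f ((x + s *\<^sub>R b) + r *\<^sub>R b)) \<circ> (\<lambda>t. t - s) has_vector_derivative
      1 *\<^sub>R f' (x + s *\<^sub>R b)) (at s)"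
    by (intro vector_diff_chain_at)
  then show ?thesis
    by (simp add: o_def algebra_simps)
qed

lemma dir_deriv_add:
  "dir_deriv f b f' \<Longrightarrow> dir_deriv g b g' \<Longrightarrow> dir_deriv (\<lambda>x. f x + g x) b (\<lambda>x. f' x + g' x)"
  unfolding dir_deriv_def by (auto intro!: has_vector_derivative_add)

lemma dir_deriv_mult:
  assumes "dir_deriv f b f'" "dir_deriv g b g'"
  shows "dir_deriv (\<lambda>x. f x * g x) b (\<lambda>x. f x * g' x + f' x * g x)"
  unfolding dir_deriv_def
proof
  fix x
  have "((\<lambda>s. f (x + s *\<^sub>R b) * g (x + s *\<^sub>R b)) has_vector_derivative
      f (x + 0 *\<^sub>R b) * g' x + f' x * g (x + 0 *\<^sub>R b)) (at 0)"
    using assms unfolding dir_deriv_def by (intro has_vector_derivative_mult) auto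
  then show "((\<lambda>s. f (x + s *\<^sub>R b) * g (x + s *\<^sub>R b)) has_vector_derivative
      f x * g' x + f' x * g x) (at 0)" by simp
qed

lemma dir_deriv_const: "dir_deriv (\<lambda>x. c) b (\<lambda>x. 0)"
  unfolding dir_deriv_def by simp

lemma dir_deriv_cmult:
  "dir_deriv f b f' \<Longrightarrow> dir_deriv (\<lambda>x. c * f x) b (\<lambda>x. c * f' x)"
  using dir_deriv_mult[OF dir_deriv_const[of c b], of f f'] by simp

lemma dir_deriv_cnj:
  "dir_deriv f b f' \<Longrightarrow> dir_deriv (\<lambda>x. cnj (f x)) b (\<lambda>x. cnj (f' x))"
  unfolding dir_deriv_def by (auto intro: has_vector_derivative_cnj)

lemma dir_deriv_exp:
  assumes "dir_deriv f b f'"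
  shows "dir_deriv (\<lambda>x. exp (f x)) b (\<lambda>x. f' x * exp (f x))"
  unfolding dir_deriv_def
proof
  fix x
  have 1: "((\<lambda>s. f (x + s *\<^sub>R b)) has_vector_derivative f' x) (at 0)"
    using assms unfolding dir_deriv_def by simp
  have 2: "(exp has_field_derivative exp (f (x + 0 *\<^sub>R b))) (at (f (x + 0 *\<^sub>R b)))"
    by (rule DERIV_exp)
  from field_vector_diff_chain_at[OF 1 2]
  show "((\<lambda>s. exp (f (x + s *\<^sub>R b))) has_vector_derivative f' x * exp (f x)) (at 0)"
    by (simp add: o_def)
qed

lemma dir_deriv_inner:
  "dir_deriv (\<lambda>x. complex_of_real (x \<bullet> c)) b (\<lambda>x. complex_of_real (b \<bullet> c))"
  unfolding dir_deriv_def
proof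
  fix x
  have "((\<lambda>s. (x + s *\<^sub>R b) \<bullet> c) has_vector_derivative b \<bullet> c) (at 0)"
    by (auto intro!: derivative_eq_intros simp: has_real_derivative_iff_has_vector_derivative[symmetric]
        inner_add_left)
  then show "((\<lambda>s. complex_of_real ((x + s *\<^sub>R b) \<bullet> c)) has_vector_derivative complex_of_real (b \<bullet> c)) (at 0)"
    by (rule bounded_linear.has_vector_derivative[OF bounded_linear_of_real])
qed

lemma dir_deriv_of_real:
  assumes "f differentiable (at x)"
  shows "((\<lambda>s. complex_of_real (f (x + s *\<^sub>R b))) has_vector_derivative
     complex_of_real (frechet_derivative f (at x) b)) (at 0)"
proof -
  have 1: "(f has_derivative frechet_derivative f (at x)) (at (x + 0 *\<^sub>R b))"
    using assms by (simp add: frechet_derivative_works)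
  have 2: "((\<lambda>s. x + s *\<^sub>R b) has_vector_derivative b) (at 0)"
    by (auto intro!: derivative_eq_intros)
  have "(f \<circ> (\<lambda>s. x + s *\<^sub>R b) has_derivative (frechet_derivative f (at x) \<circ> (\<lambda>s. s *\<^sub>R b))) (at 0)"
    using 2 unfolding has_vector_derivative_def by (rule diff_chain_at) (use 1 in simp)
  moreover have "frechet_derivative f (at x) (s *\<^sub>R b) = s *\<^sub>R frechet_derivative f (at x) b" for s
    using assms linear_frechet_derivative linear_scale by blast
  ultimately have "((\<lambda>s. f (x + s *\<^sub>R b)) has_vector_derivative frechet_derivative f (at x) b) (at 0)"
    by (simp add: has_vector_derivative_def o_def)
  then show ?thesis
    by (rule bounded_linear.has_vector_derivative[OF bounded_linear_of_real])
qed

lemma dir_deriv_increment: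
  fixes f f' :: "'a::euclidean_space \<Rightarrow> complex"
  assumes "dir_deriv f b f'" "continuous_on UNIV f'"
  shows "f (x + b) - f x = (\<integral>s. indicator {0..1} s *\<^sub>R f' (x + s *\<^sub>R b) \<partial>lborel)"
proof -
  have "(\<integral>s. indicator {0..1} s *\<^sub>R f' (x + s *\<^sub>R b) \<partial>lborel) = f (x + 1 *\<^sub>R b) - f (x + 0 *\<^sub>R b)"
  proof (rule integral_FTC_atLeastAtMost)
    show "((\<lambda>s. f (x + s *\<^sub>R b)) has_vector_derivative f' (x + s *\<^sub>R b)) (at s within {0..1})" for s
      using dir_deriv_at[OF assms(1)] has_vector_derivative_at_within by blast
    show "continuous_on {0..1} (\<lambda>s. f' (x + s *\<^sub>R b))"
      by (intro continuous_on_compose2[OF assms(2)] continuous_intros) auto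
  qed simp
  then show ?thesis by simp
qed

lemma lborel_integral_translation:
  fixes f :: "'a::euclidean_space \<Rightarrow> 'b::{banach, second_countable_topology}"
  assumes [measurable]: "f \<in> borel_measurable borel"
  shows "(\<integral>x. f (c + x) \<partial>lborel) = (\<integral>x. f x \<partial>lborel)"
proof -
  have "(\<integral>x. f x \<partial>lborel) = (\<integral>x. f x \<partial>distr lborel borel ((+) c))"
    by (simp add: lborel_distr_plus)
  also have "\<dots> = (\<integral>x. f (c + x) \<partial>lborel)"
    by (rule integral_distr) auto
  finally show ?thesis by simp
qed

lemma lborel_integrable_translation:
  fixes f :: "'a::euclidean_space \<Rightarrow> 'b::{banach, second_countable_topology}"
  assumes "integrable lborel f"
  shows "integrable lborel (\<lambda>x. f (c + x))"
proof -
  have "integrable (distr lborel borel ((+) c)) f"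
    using assms by (simp add: lborel_distr_plus)
  then show ?thesis
    by (subst (asm) integrable_distr_eq) (use assms in auto)
qed

text \<open>Only the integrated form of \<open>f' = \<partial>\<^sub>b f\<close> is assumed: it is what Fubini gives for functions
  defined by parameter integrals.\<close>

lemma integral_increment_zero:
  fixes f f' :: "'a::euclidean_space \<Rightarrow> complex"
  assumes f: "integrable lborel f" and f': "integrable lborel f'"
    and incr: "\<And>x. f (x + b) - f x = (\<integral>s. indicator {0..1} s *\<^sub>R f' (x + s *\<^sub>R b) \<partial>lborel)"
  shows "(\<integral>x. f' x \<partial>lborel) = 0"
proof -
  have [measurable]: "f \<in> borel_measurable borel" "f' \<in> borel_measurable borel"
    using f f' by auto
  define g :: "real \<Rightarrow> 'a \<Rightarrow> complex" where "g s x = indicator {0..1} s *\<^sub>R f' (x + s *\<^sub>R b)" for s x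
  have g_meas: "case_prod g \<in> borel_measurable (lborel \<Otimes>\<^sub>M lborel)"
    unfolding g_def by measurable
  have shift: "(\<integral>x. f' (x + s *\<^sub>R b) \<partial>lborel) = (\<integral>x. f' x \<partial>lborel)"
    "(\<integral>x. cmod (f' (x + s *\<^sub>R b)) \<partial>lborel) = (\<integral>x. cmod (f' x) \<partial>lborel)"
    "integrable lborel (\<lambda>x. f' (x + s *\<^sub>R b))" for s
    using lborel_integral_translation[of f' "s *\<^sub>R b"] lborel_integrable_translation[OF f', of "s *\<^sub>R b"]
      lborel_integral_translation[of "\<lambda>x. cmod (f' x)" "s *\<^sub>R b"]
    by (simp_all add: add.commute)
  have int01: "integrable lborel (\<lambda>s::real. indicator {0..1} s *\<^sub>R c)" for c :: real
    by (simp add: integrable_real_indicator)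
  have int01': "integrable lborel (\<lambda>s::real. indicator {0..1} s *\<^sub>R c)" for c :: complex
    by simp
  have g_int: "integrable (lborel \<Otimes>\<^sub>M lborel) (case_prod g)"
  proof (rule lborel_pair.Fubini_integrable)
    have "(\<integral>x. norm (case_prod g (s, x)) \<partial>lborel) = indicator {0..1} s *\<^sub>R (\<integral>x. cmod (f' x) \<partial>lborel)" for s
      using shift(2)[of s] by (simp add: g_def)
    then show "integrable lborel (\<lambda>s. \<integral>x. norm (case_prod g (s, x)) \<partial>lborel)"
      using int01 by simp
    show "AE s in lborel. integrable lborel (\<lambda>x. case_prod g (s, x))"
      using shift(3) by (auto simp: g_def)
  qed (rule g_meas)
  \<comment> \<open>Translation invariance is used twice: for \<open>f\<close> it makes the
    integrated increment vanish, and for \<open>f'\<close>, after Fubini, it makes every slice in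
    \<open>s\<close> contribute the same integral.\<close>
  have "0 = (\<integral>x. f (x + b) \<partial>lborel) - (\<integral>x. f x \<partial>lborel)"
    using lborel_integral_translation[of f b] by (simp add: add.commute)
  also have "\<dots> = (\<integral>x. f (x + b) - f x \<partial>lborel)"
    using lborel_integrable_translation[OF f, of b] f by (simp add: add.commute)
  also have "\<dots> = (\<integral>x. (\<integral>s. g s x \<partial>lborel) \<partial>lborel)"
    unfolding incr g_def ..
  also have "\<dots> = (\<integral>s. (\<integral>x. g s x \<partial>lborel) \<partial>lborel)"
    using g_int by (rule lborel_pair.Fubini_integral)
  also have "\<dots> = (\<integral>s. indicator {0..1::real} s *\<^sub>R (\<integral>x. f' x \<partial>lborel) \<partial>lborel)"
    by (simp add: g_def shift)
  also have "\<dots> = (\<integral>x. f' x \<partial>lborel)"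
    by simp
  finally show ?thesis by simp
qed

lemma integral_dir_deriv_zero:
  fixes f f' :: "'a::euclidean_space \<Rightarrow> complex"
  assumes "integrable lborel f" "integrable lborel f'"
    and "dir_deriv f b f'" "continuous_on UNIV f'"
  shows "(\<integral>x. f' x \<partial>lborel) = 0"
  using assms by (intro integral_increment_zero[of f f' b] dir_deriv_increment)

subsection \<open>Symbols\<close>

lemma iter_pderiv_append: "iter_pderiv bs (iter_pderiv cs f) = iter_pderiv (bs @ cs) f"
  by (induction bs) simp_all

lemma smooth_fun_iter_pderiv:
  "smooth_fun f \<Longrightarrow> set bs \<subseteq> Basis \<Longrightarrow> smooth_fun (iter_pderiv bs f)"
  unfolding smooth_fun_def by (simp add: iter_pderiv_append)

lemma smooth_fun_pderiv: "smooth_fun f \<Longrightarrow> b \<in> Basis \<Longrightarrow> smooth_fun (pderiv_at b f)"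
  using smooth_fun_iter_pderiv[of f "[b]"] by simp

lemma smooth_fun_differentiable: "smooth_fun f \<Longrightarrow> f differentiable (at z)"
proof -
  assume "smooth_fun f"
  then have "iter_pderiv [] f differentiable_on UNIV"
    unfolding smooth_fun_def by (metis empty_set empty_subsetI)
  then show ?thesis by (simp add: differentiable_on_def)
qed

lemma smooth_fun_continuous: "smooth_fun f \<Longrightarrow> continuous_on A f"
  using smooth_fun_differentiable differentiable_imp_continuous_within
  by (metis continuous_at_imp_continuous_on)

lemma smooth_fun_line:
  assumes "smooth_fun f"
  shows "((\<lambda>s. f (z + s *\<^sub>R b)) has_real_derivative pderiv_at b f (z + s *\<^sub>R b)) (at s)"
proof -
  let ?D = "frechet_derivative f (at (z + s *\<^sub>R b))"
  have 1: "(f has_derivative ?D) (at (z + s *\<^sub>R b))"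
    using smooth_fun_differentiable[OF assms] by (simp add: frechet_derivative_works)
  have 2: "((\<lambda>s. z + s *\<^sub>R b) has_derivative (\<lambda>r. r *\<^sub>R b)) (at s)"
    by (auto intro!: derivative_eq_intros)
  have "(f \<circ> (\<lambda>s. z + s *\<^sub>R b) has_derivative (?D \<circ> (\<lambda>r. r *\<^sub>R b))) (at s)"
    using 2 1 by (rule diff_chain_at)
  moreover have "?D (r *\<^sub>R b) = r * ?D b" for r
    using linear_scale[OF linear_frechet_derivative[OF smooth_fun_differentiable[OF assms]]] by simp
  ultimately show ?thesis
    by (simp add: has_field_derivative_def o_def pderiv_at_def mult.commute[of _ "?D b"])
qed

lemma smooth_fun_increment:
  assumes "smooth_fun f" "s > 0"
  obtains r where "0 < r" "r < s" "f (z + s *\<^sub>R b) - f z = s * pderiv_at b f (z + r *\<^sub>R b)"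
proof -
  have "\<exists>r>0. r < s \<and> f (z + s *\<^sub>R b) - f (z + 0 *\<^sub>R b) = (s - 0) * pderiv_at b f (z + r *\<^sub>R b)"
    by (rule MVT2) (use assms smooth_fun_line in auto)
  then show ?thesis using that by auto
qed

lemma smooth_fun_second_difference:
  fixes f :: "'a::euclidean_space \<Rightarrow> real"
  assumes "smooth_fun f" "s > 0" "b \<in> Basis"
  obtains r q where "0 < r" "r < s" "0 < q" "q < s"
    "f (z + s *\<^sub>R a + s *\<^sub>R b) - f (z + s *\<^sub>R a) - f (z + s *\<^sub>R b) + f z
      = s\<^sup>2 * pderiv_at a (pderiv_at b f) (z + q *\<^sub>R a + r *\<^sub>R b)"
proof -
  \<comment> \<open>The first difference in direction \<open>a\<close>, as a function of the step in
    direction \<open>b\<close>. The mean value theorem in \<open>t\<close>, and then in direction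
    \<open>a\<close>, turns its increment into one mixed derivative.\<close>
  let ?d = "\<lambda>t. f (z + s *\<^sub>R a + t *\<^sub>R b) - f (z + t *\<^sub>R b)"
  have "\<exists>r>0. r < s \<and> ?d s - ?d 0 = (s - 0) * (pderiv_at b f (z + s *\<^sub>R a + r *\<^sub>R b) - pderiv_at b f (z + r *\<^sub>R b))"
    by (rule MVT2) (use assms in \<open>auto intro!: DERIV_diff smooth_fun_line\<close>)
  then obtain r where r: "0 < r" "r < s"
    "?d s - ?d 0 = s * (pderiv_at b f ((z + r *\<^sub>R b) + s *\<^sub>R a) - pderiv_at b f (z + r *\<^sub>R b))"
    by (auto simp: algebra_simps)
  obtain q where q: "0 < q" "q < s" "pderiv_at b f ((z + r *\<^sub>R b) + s *\<^sub>R a) - pderiv_at b f (z + r *\<^sub>R b)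
      = s * pderiv_at a (pderiv_at b f) ((z + r *\<^sub>R b) + q *\<^sub>R a)"
    using smooth_fun_increment[OF smooth_fun_pderiv[OF assms(1,3)] assms(2)] by blast
  have eq: "z + r *\<^sub>R b + q *\<^sub>R a = z + q *\<^sub>R a + r *\<^sub>R b" by simp
  have "?d s - ?d 0 = s\<^sup>2 * pderiv_at a (pderiv_at b f) (z + q *\<^sub>R a + r *\<^sub>R b)"
    unfolding r(3) q(3) eq by (simp add: power2_eq_square)
  then show ?thesis
    using that[OF r(1,2) q(1,2)] by simp
qed

text \<open>Schwarz's theorem: the second difference is symmetric in the two directions, and divided
  by s^2 it converges to either iterated derivative.\<close>

lemma pderiv_at_commute:
  fixes f :: "'a::euclidean_space \<Rightarrow> real"
  assumes f: "smooth_fun f" and ab: "a \<in> Basis" "b \<in> Basis"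
  shows "pderiv_at a (pderiv_at b f) z = pderiv_at b (pderiv_at a f) z"
proof -
  define s :: "nat \<Rightarrow> real" where "s n = 1 / Suc n" for n
  have s: "s n > 0" "s \<longlonglongrightarrow> 0" for n
    unfolding s_def using LIMSEQ_Suc[OF lim_1_over_n] by auto
  have lim: "(\<lambda>n. (f (z + s n *\<^sub>R c + s n *\<^sub>R d) - f (z + s n *\<^sub>R c) - f (z + s n *\<^sub>R d) + f z) / (s n)\<^sup>2)
      \<longlonglongrightarrow> pderiv_at c (pderiv_at d f) z" if cd: "c \<in> Basis" "d \<in> Basis" for c d
  proof -
    have "\<exists>r q. 0 < r \<and> r < s n \<and> 0 < q \<and> q < s n \<and>
      f (z + s n *\<^sub>R c + s n *\<^sub>R d) - f (z + s n *\<^sub>R c) - f (z + s n *\<^sub>R d) + f z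
      = (s n)\<^sup>2 * pderiv_at c (pderiv_at d f) (z + q *\<^sub>R c + r *\<^sub>R d)" for n
      by (rule smooth_fun_second_difference[OF f s(1)[of n] cd(2), of z c]) blast
    then obtain r q where rq: "\<And>n. 0 < r n" "\<And>n. r n < s n" "\<And>n. 0 < q n" "\<And>n. q n < s n" and
      eq: "\<And>n. f (z + s n *\<^sub>R c + s n *\<^sub>R d) - f (z + s n *\<^sub>R c) - f (z + s n *\<^sub>R d) + f z
      = (s n)\<^sup>2 * pderiv_at c (pderiv_at d f) (z + q n *\<^sub>R c + r n *\<^sub>R d)"
      by metis
    have "r \<longlonglongrightarrow> 0"
      by (rule tendsto_sandwich[OF _ _ tendsto_const s(2)]) (use rq in \<open>auto intro!: always_eventually less_imp_le\<close>)
    moreover have "q \<longlonglongrightarrow> 0"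
      by (rule tendsto_sandwich[OF _ _ tendsto_const s(2)]) (use rq in \<open>auto intro!: always_eventually less_imp_le\<close>)
    ultimately have qr: "(\<lambda>n. z + q n *\<^sub>R c + r n *\<^sub>R d) \<longlonglongrightarrow> z + 0 *\<^sub>R c + 0 *\<^sub>R d"
      by (intro tendsto_intros)
    have "isCont (pderiv_at c (pderiv_at d f)) z"
      using smooth_fun_continuous[OF smooth_fun_pderiv[OF smooth_fun_pderiv[OF f cd(2)] cd(1)], of UNIV]
      by (simp add: continuous_on_eq_continuous_at)
    then have "(\<lambda>n. pderiv_at c (pderiv_at d f) (z + q n *\<^sub>R c + r n *\<^sub>R d))
        \<longlonglongrightarrow> pderiv_at c (pderiv_at d f) z"
      using isCont_tendsto_compose[OF _ qr, of "pderiv_at c (pderiv_at d f)"] by simp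
    moreover have "pderiv_at c (pderiv_at d f) (z + q n *\<^sub>R c + r n *\<^sub>R d) =
       (f (z + s n *\<^sub>R c + s n *\<^sub>R d) - f (z + s n *\<^sub>R c) - f (z + s n *\<^sub>R d) + f z) / (s n)\<^sup>2" for n
      unfolding eq using s(1)[of n] by simp
    ultimately show ?thesis by simp
  qed
  have eq: "f (z + s n *\<^sub>R a + s n *\<^sub>R b) - f (z + s n *\<^sub>R a) - f (z + s n *\<^sub>R b) + f z
      = f (z + s n *\<^sub>R b + s n *\<^sub>R a) - f (z + s n *\<^sub>R b) - f (z + s n *\<^sub>R a) + f z" for n
    by (simp add: algebra_simps)
  show ?thesis
    using lim[OF ab] lim[OF ab(2,1)] unfolding eq by (rule LIMSEQ_unique)
qed

text \<open>The same quadratic growth is allowed for derivatives of every order, which makes the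
  class stable under differentiation and lets it contain both \<open>h t\<close> and its second
  derivatives. The constants do not depend on the index, which will be the time.\<close>

definition symbol_family :: "('i \<Rightarrow> 'a::euclidean_space \<Rightarrow> real) \<Rightarrow> bool" where
  "symbol_family a \<longleftrightarrow> (\<forall>k. smooth_fun (a k)) \<and>
     (\<forall>bs. set bs \<subseteq> Basis \<longrightarrow> (\<exists>K. \<forall>k z. \<bar>iter_pderiv bs (a k) z\<bar> \<le> K * (1 + norm z)\<^sup>2))"

lemma symbol_family_smooth: "symbol_family a \<Longrightarrow> smooth_fun (a k)"
  unfolding symbol_family_def by blast

lemma symbol_family_bound:
  assumes "symbol_family a"
  obtains K where "K > 0" "\<And>k z. \<bar>a k z\<bar> \<le> K * (1 + norm z)\<^sup>2"
proof -
  obtain K where K: "\<And>k z. \<bar>a k z\<bar> \<le> K * (1 + norm z)\<^sup>2"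
    using assms[unfolded symbol_family_def, THEN conjunct2, rule_format, of "[]"] by auto
  have "\<bar>a k z\<bar> \<le> (\<bar>K\<bar> + 1) * (1 + norm z)\<^sup>2" for k z
    by (rule order_trans[OF K]) (auto intro: mult_right_mono)
  then show ?thesis using that[of "\<bar>K\<bar> + 1"] by simp
qed

lemma symbol_family_pderiv:
  assumes "symbol_family a" "b \<in> Basis"
  shows "symbol_family (\<lambda>k. pderiv_at b (a k))"
proof -
  have "iter_pderiv bs (pderiv_at b f) = iter_pderiv (bs @ [b]) f" for bs and f :: "'b \<Rightarrow> real"
    using iter_pderiv_append[of bs "[b]" f] by simp
  then show ?thesis
    using assms unfolding symbol_family_def by (auto intro!: smooth_fun_pderiv)
qed

text \<open>A gradient bound on the ball of radius \<open>norm z\<close>, integrated from the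
  origin, raises the growth order by one. Two applications lead from bounded second derivatives to
  linear growth of the gradient and quadratic growth of the function.\<close>

lemma linear_growth:
  fixes f :: "'a::euclidean_space \<Rightarrow> real"
  assumes f: "smooth_fun f" and bd: "\<And>b z. b \<in> Basis \<Longrightarrow> \<bar>pderiv_at b f z\<bar> \<le> K * (1 + norm z) ^ m"
  shows "\<exists>K'. \<forall>z. \<bar>f z\<bar> \<le> K' * (1 + norm z) ^ Suc m"
proof (intro exI allI)
  fix z :: 'a
  let ?B = "real DIM('a) * K * (1 + norm z) ^ m"
  \<comment> \<open>At the origin the weight equals 1, and some basis vector exists.\<close>
  have K0: "0 \<le> K"
    using bd[of "SOME b. b \<in> Basis" 0] by (simp add: some_in_eq)
  have D: "(f has_derivative frechet_derivative f (at x)) (at x)" for x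
    using smooth_fun_differentiable[OF f] by (simp add: frechet_derivative_works)
  have "norm (f z - f 0) \<le> ?B * norm (z - 0)"
  proof (rule differentiable_bound)
    show "(f has_derivative frechet_derivative f (at x)) (at x within cball 0 (norm z))" for x
      using D by (rule has_derivative_at_withinI)
    fix x :: 'a assume x: "x \<in> cball 0 (norm z)"
    let ?D = "frechet_derivative f (at x)"
    show "onorm ?D \<le> ?B"
    proof (rule onorm_le)
      fix v
      have "?D v = ?D (\<Sum>b\<in>Basis. (v \<bullet> b) *\<^sub>R b)"
        by (simp add: euclidean_representation)
      also have "\<dots> = (\<Sum>b\<in>Basis. (v \<bullet> b) * pderiv_at b f x)"
        using has_derivative_linear[OF D, of x] by (simp add: linear_sum linear_scale pderiv_at_def)
      finally have "norm (?D v) \<le> (\<Sum>b\<in>Basis. \<bar>v \<bullet> b\<bar> * \<bar>pderiv_at b f x\<bar>)"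
        by (simp add: abs_mult[symmetric] sum_abs)
      also have "\<dots> \<le> (\<Sum>b\<in>(Basis::'a set). norm v * (K * (1 + norm z) ^ m))"
      proof (intro sum_mono mult_mono)
        fix b :: 'a assume "b \<in> Basis"
        then show "\<bar>v \<bullet> b\<bar> \<le> norm v" by (rule Basis_le_norm)
        have "\<bar>pderiv_at b f x\<bar> \<le> K * (1 + norm x) ^ m"
          by (rule bd) fact
        also have "\<dots> \<le> K * (1 + norm z) ^ m"
          using x K0 by (intro mult_left_mono power_mono) auto
        finally show "\<bar>pderiv_at b f x\<bar> \<le> K * (1 + norm z) ^ m" .
      qed auto
      finally show "norm (?D v) \<le> ?B * norm v" by (simp add: mult_ac)
    qed
  qed auto
  then have "\<bar>f z\<bar> \<le> \<bar>f 0\<bar> + ?B * norm z" by simp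
  also have "\<dots> \<le> \<bar>f 0\<bar> * (1 + norm z) ^ Suc m + ?B * (1 + norm z)"
  proof (intro add_mono mult_left_mono)
    have "1 \<le> (1 + norm z) ^ Suc m" by (rule one_le_power) simp
    from mult_left_mono[OF this, of "\<bar>f 0\<bar>"] show "\<bar>f 0\<bar> \<le> \<bar>f 0\<bar> * (1 + norm z) ^ Suc m" by simp
  qed (use K0 in auto)
  also have "\<dots> = (\<bar>f 0\<bar> + real DIM('a) * K) * (1 + norm z) ^ Suc m"
    by (simp add: algebra_simps)
  finally show "\<bar>f z\<bar> \<le> (\<bar>f 0\<bar> + real DIM('a) * K) * (1 + norm z) ^ Suc m" .
qed

text \<open>Only derivatives of order at least two are bounded uniformly in time; the constants
  obtained by integration for orders 0 and 1 depend on \<open>t\<close>. Hence the family is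
  constant, at one fixed time.\<close>

lemma subquadratic_symbol:
  fixes h :: "real \<Rightarrow> 'a::euclidean_space \<Rightarrow> real"
  assumes h: "smooth_fun (h t)" "subquadratic h"
  shows "symbol_family (\<lambda>_. h t)"
  unfolding symbol_family_def
proof (intro conjI allI impI)
  fix bs :: "'a list" assume bs: "set bs \<subseteq> Basis"
  have bd2: "\<exists>K. \<forall>z. \<bar>iter_pderiv cs (h t) z\<bar> \<le> K * (1 + norm z) ^ 0"
    if "length cs \<ge> 2" "set cs \<subseteq> Basis" for cs
    using h(2)[unfolded subquadratic_def, rule_format, of cs] that by auto
  have step: "\<exists>K'. \<forall>z. \<bar>iter_pderiv cs (h t) z\<bar> \<le> K' * (1 + norm z) ^ Suc m"
    if "\<forall>b\<in>Basis. \<exists>K. \<forall>z. \<bar>iter_pderiv (b # cs) (h t) z\<bar> \<le> K * (1 + norm z) ^ m" "set cs \<subseteq> Basis" for cs m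
  proof -
    from bchoice[OF that(1)]
    obtain K where K: "\<And>b z. b \<in> Basis \<Longrightarrow> \<bar>iter_pderiv (b # cs) (h t) z\<bar> \<le> K b * (1 + norm z) ^ m"
      by blast
    show ?thesis
    proof (rule linear_growth)
      show "smooth_fun (iter_pderiv cs (h t))"
        using h(1) that(2) by (rule smooth_fun_iter_pderiv)
      fix b z :: 'a assume b: "b \<in> Basis"
      have "\<bar>pderiv_at b (iter_pderiv cs (h t)) z\<bar> \<le> K b * (1 + norm z) ^ m"
        using K[OF b] by simp
      also have "\<dots> \<le> (\<Sum>b\<in>Basis. \<bar>K b\<bar>) * (1 + norm z) ^ m"
        by (intro mult_right_mono order_trans[OF abs_ge_self member_le_sum[OF b]]) auto
      finally show "\<bar>pderiv_at b (iter_pderiv cs (h t)) z\<bar> \<le> (\<Sum>b\<in>Basis. \<bar>K b\<bar>) * (1 + norm z) ^ m" .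
    qed
  qed
  have bd1: "\<exists>K. \<forall>z. \<bar>iter_pderiv cs (h t) z\<bar> \<le> K * (1 + norm z) ^ 1"
    if "length cs = 1" "set cs \<subseteq> Basis" for cs
    using step[of cs 0] bd2[of "_ # cs"] that by simp
  have bd0: "\<exists>K. \<forall>z. \<bar>iter_pderiv [] (h t) z\<bar> \<le> K * (1 + norm z) ^ 2"
    using step[of "[]" 1] bd1[of "[_]"] by (simp add: numeral_2_eq_2)
  have weaken: "\<exists>K. \<forall>z. \<bar>f z\<bar> \<le> K * (1 + norm z) ^ 2"
    if "\<exists>K. \<forall>z. \<bar>f z\<bar> \<le> K * (1 + norm z) ^ m" "m \<le> 2" for f :: "'a \<Rightarrow> real" and m
  proof -
    from that(1) obtain K where K: "\<And>z. \<bar>f z\<bar> \<le> K * (1 + norm z) ^ m" by blast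
    have "\<bar>f z\<bar> \<le> \<bar>K\<bar> * (1 + norm z) ^ 2" for z
      by (rule order_trans[OF K mult_mono]) (use that(2) in \<open>auto intro: power_increasing\<close>)
    then show ?thesis by blast
  qed
  consider "length bs \<ge> 2" | "length bs = 1" | "bs = []"
    by (cases "length bs") (auto simp: Suc_le_eq)
  then show "\<exists>K. \<forall>k z. \<bar>iter_pderiv bs (h t) z\<bar> \<le> K * (1 + norm z)\<^sup>2"
    by cases (use weaken[OF bd2, of bs] weaken[OF bd1, of bs] bd0 bs in auto)
qed (rule h)

text \<open>All derivatives of Hessian entries have order at least two, so their bounds hold at all
  times. Hessian entries at varying times thus form one family, as dominated convergence in time
  requires.\<close>

lemma subquadratic_symbol_hess:
  fixes h :: "real \<Rightarrow> 'a::euclidean_space \<Rightarrow> real"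
  assumes h: "\<And>t. smooth_fun (h t)" "subquadratic h" and b: "b \<in> Basis" "c \<in> Basis"
  shows "symbol_family (\<lambda>k. pderiv_at b (pderiv_at c (h (t k))))"
  unfolding symbol_family_def
proof (intro conjI allI impI)
  fix bs :: "'a list" assume bs: "set bs \<subseteq> Basis"
  obtain K where K: "K > 0" "\<And>t z. \<bar>iter_pderiv (bs @ [b, c]) (h t) z\<bar> \<le> K"
    using h(2)[unfolded subquadratic_def, rule_format, of "bs @ [b, c]"] bs b by auto
  have "iter_pderiv bs (pderiv_at b (pderiv_at c f)) = iter_pderiv (bs @ [b, c]) f" for f :: "'a \<Rightarrow> real"
    using iter_pderiv_append[of bs "[b, c]" f] by simp
  moreover have "K \<le> K * (1 + norm z)\<^sup>2" for z :: 'a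
    using K(1) by (intro mult_le_cancel_left1[THEN iffD2]) (auto intro: one_le_power)
  ultimately have "\<bar>iter_pderiv bs (pderiv_at b (pderiv_at c (h (t k)))) z\<bar> \<le> K * (1 + norm z)\<^sup>2" for k z
    using order_trans[OF K(2)] by simp
  then show "\<exists>K. \<forall>k z. \<bar>iter_pderiv bs (pderiv_at b (pderiv_at c (h (t k)))) z\<bar> \<le> K * (1 + norm z)\<^sup>2"
    by blast
qed (use h b in \<open>auto intro!: smooth_fun_pderiv\<close>)

text \<open>Difference quotients converge, and the bound on the second derivative makes them
  approximate the derivative uniformly along the sequence.\<close>

lemma pderiv_at_tendsto:
  fixes f :: "nat \<Rightarrow> 'a::euclidean_space \<Rightarrow> real"
  assumes f: "\<And>n. smooth_fun (f n)" "smooth_fun g" and lim: "\<And>z. (\<lambda>n. f n z) \<longlonglongrightarrow> g z"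
    and b: "b \<in> Basis" and K: "\<And>n z. \<bar>pderiv_at b (pderiv_at b (f n)) z\<bar> \<le> K"
      "\<And>z. \<bar>pderiv_at b (pderiv_at b g) z\<bar> \<le> K"
  shows "(\<lambda>n. pderiv_at b (f n) z) \<longlonglongrightarrow> pderiv_at b g z"
proof (rule LIMSEQ_I)
  fix e :: real assume e: "e > 0"
  have K0: "0 \<le> K" using K(2)[of 0] by simp
  have approx: "\<bar>(\<phi> (z + s *\<^sub>R b) - \<phi> z) / s - pderiv_at b \<phi> z\<bar> \<le> K * s"
    if s: "s > 0" and \<phi>: "smooth_fun \<phi>" "\<And>z. \<bar>pderiv_at b (pderiv_at b \<phi>) z\<bar> \<le> K" for \<phi> s
  proof -
    obtain r where r: "0 < r" "r < s" "\<phi> (z + s *\<^sub>R b) - \<phi> z = s * pderiv_at b \<phi> (z + r *\<^sub>R b)"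
      using smooth_fun_increment[OF \<phi>(1) s] by blast
    obtain q where q: "pderiv_at b \<phi> (z + r *\<^sub>R b) - pderiv_at b \<phi> z
        = r * pderiv_at b (pderiv_at b \<phi>) (z + q *\<^sub>R b)"
      using smooth_fun_increment[OF smooth_fun_pderiv[OF \<phi>(1) b] r(1)] by metis
    have "\<bar>(\<phi> (z + s *\<^sub>R b) - \<phi> z) / s - pderiv_at b \<phi> z\<bar> = r * \<bar>pderiv_at b (pderiv_at b \<phi>) (z + q *\<^sub>R b)\<bar>"
      using r s q by (simp add: abs_mult)
    also have "\<dots> \<le> s * K"
      using r \<phi>(2) K0 by (intro mult_mono) auto
    finally show ?thesis by (simp add: mult.commute)
  qed
  \<comment> \<open>With \<open>K + 1\<close> in the denominator the step is defined also for
    \<open>K = 0\<close>, and each of the two errors \<open>K * s\<close> stays below e/3.\<close>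
  define s where "s = e / (4 * (K + 1))"
  have s: "s > 0" "K * s < e / 3"
  proof -
    show "s > 0" using e K0 by (simp add: s_def)
    have "K * s \<le> (K + 1) * s" using \<open>s > 0\<close> by simp
    also have "\<dots> = e / 4" using K0 by (simp add: s_def field_simps)
    finally show "K * s < e / 3" using e by simp
  qed
  have "(\<lambda>n. (f n (z + s *\<^sub>R b) - f n z) / s) \<longlonglongrightarrow> (g (z + s *\<^sub>R b) - g z) / s"
    using s by (intro tendsto_intros lim) auto
  then obtain N where N: "\<And>n. n \<ge> N \<Longrightarrow>
      \<bar>(f n (z + s *\<^sub>R b) - f n z) / s - (g (z + s *\<^sub>R b) - g z) / s\<bar> < e / 3"
    using LIMSEQ_D[of _ _ "e / 3"] e by fastforce
  have "norm (pderiv_at b (f n) z - pderiv_at b g z) < e" if "n \<ge> N" for n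
    using approx[OF s(1) f(1)[of n] K(1)] approx[OF s(1) f(2) K(2)] N[OF that] s(2)
    unfolding real_norm_def by linarith
  then show "\<exists>N. \<forall>n\<ge>N. norm (pderiv_at b (f n) z - pderiv_at b g z) < e" by blast
qed

text \<open>Continuity in time is assumed for \<open>h\<close> alone. It passes to the first
  derivative by the bound on order \<open>[c, c]\<close>, and from there to the second by the bound
  on order \<open>[b, b, c]\<close>.\<close>

lemma subquadratic_hess_tendsto:
  fixes h :: "real \<Rightarrow> 'a::euclidean_space \<Rightarrow> real"
  assumes h: "\<And>t. smooth_fun (h t)" "subquadratic h" "\<And>z. continuous_on UNIV (\<lambda>t. h t z)"
    and b: "b \<in> Basis" "c \<in> Basis" and s: "s \<longlonglongrightarrow> t"
  shows "(\<lambda>n. pderiv_at b (pderiv_at c (h (s n))) z) \<longlonglongrightarrow> pderiv_at b (pderiv_at c (h t)) z"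
proof -
  have bound: "\<exists>K. \<forall>t z. \<bar>iter_pderiv bs (h t) z\<bar> \<le> K" if "set bs \<subseteq> Basis" "length bs \<ge> 2" for bs
    using h(2) that unfolding subquadratic_def by blast
  obtain K where K: "\<And>t z. \<bar>pderiv_at c (pderiv_at c (h t)) z\<bar> \<le> K"
    using bound[of "[c, c]"] b by auto
  obtain L where L: "\<And>t z. \<bar>pderiv_at b (pderiv_at b (pderiv_at c (h t))) z\<bar> \<le> L"
    using bound[of "[b, b, c]"] b by auto
  have "(\<lambda>n. h (s n) z) \<longlonglongrightarrow> h t z" for z
    using h(3)[of z] s by (auto simp: continuous_on_eq_continuous_at intro: isCont_tendsto_compose)
  then have "(\<lambda>n. pderiv_at c (h (s n)) z) \<longlonglongrightarrow> pderiv_at c (h t) z" for z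
    by (intro pderiv_at_tendsto[OF h(1) h(1) _ b(2) K K])
  then show ?thesis
    by (intro pderiv_at_tendsto[OF smooth_fun_pderiv[OF h(1) b(2)] smooth_fun_pderiv[OF h(1) b(2)] _ b(1) L L])
qed

subsection \<open>Weyl quantization on rapidly decreasing functions\<close>

lemma borel_measurable_parameter_integral:
  fixes f :: "'a::euclidean_space \<Rightarrow> 'b::euclidean_space \<Rightarrow> complex"
  assumes "continuous_on UNIV (\<lambda>z. f (fst z) (snd z))"
  shows "(\<lambda>x. \<integral>y. f x y \<partial>lborel) \<in> borel_measurable borel"
proof -
  have "(\<lambda>z. f (fst z) (snd z)) \<in> borel_measurable (lborel \<Otimes>\<^sub>M lborel)"
    unfolding lborel_prod using assms by (simp add: borel_measurable_continuous_onI)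
  then have "case_prod f \<in> borel_measurable (lborel \<Otimes>\<^sub>M lborel)"
    by (simp add: case_prod_beta')
  then have "(\<lambda>x. \<integral>y. f x y \<partial>lborel) \<in> borel_measurable lborel"
    by (rule lborel.borel_measurable_lebesgue_integral)
  then show ?thesis by simp
qed

text \<open>Since 1 + norm z is at most the product of the weights of the two components, a bound
  with the product weight gives the joint integrability that Fubini asks for.\<close>

lemma integrable_product_weight_bound:
  fixes f :: "'a::euclidean_space \<Rightarrow> 'b::euclidean_space \<Rightarrow> complex"
  assumes "(\<lambda>z. f (fst z) (snd z)) \<in> borel_measurable borel"
    and "\<And>x y. (1 + norm x) ^ (2 * DIM('a \<times> 'b)) * (1 + norm y) ^ (2 * DIM('a \<times> 'b)) * cmod (f x y) \<le> K"
  shows "integrable lborel (\<lambda>z. f (fst z) (snd z))"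
    and "integrable (lborel \<Otimes>\<^sub>M lborel) (case_prod f)"
proof -
  show 1: "integrable lborel (\<lambda>z. f (fst z) (snd z))"
  proof (rule integrable_weight_bound[OF assms(1)])
    fix z :: "'a \<times> 'b"
    have "1 + norm z \<le> (1 + norm (fst z)) * (1 + norm (snd z))"
      using norm_Pair_le[of "fst z" "snd z"] mult_nonneg_nonneg[OF norm_ge_zero[of "fst z"] norm_ge_zero[of "snd z"]]
      by (simp only: distrib_left distrib_right mult_1 mult_1_right prod.collapse)
    then have "(1 + norm z) ^ (2 * DIM('a \<times> 'b)) \<le> ((1 + norm (fst z)) * (1 + norm (snd z))) ^ (2 * DIM('a \<times> 'b))"
      by (intro power_mono) auto
    then have "(1 + norm z) ^ (2 * DIM('a \<times> 'b)) * cmod (f (fst z) (snd z)) \<le>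
      (1 + norm (fst z)) ^ (2 * DIM('a \<times> 'b)) * (1 + norm (snd z)) ^ (2 * DIM('a \<times> 'b)) * cmod (f (fst z) (snd z))"
      by (intro mult_right_mono) (auto simp: power_mult_distrib)
    also have "\<dots> \<le> K" by (rule assms(2))
    finally show "(1 + norm z) ^ (2 * DIM('a \<times> 'b)) * cmod (f (fst z) (snd z)) \<le> K" .
  qed
  then show "integrable (lborel \<Otimes>\<^sub>M lborel) (case_prod f)"
    unfolding lborel_prod by (simp add: case_prod_beta')
qed

definition weyl_integrand ::
  "real \<Rightarrow> ('n::finite phase \<Rightarrow> real) \<Rightarrow> (real^'n \<Rightarrow> complex) \<Rightarrow> real^'n \<Rightarrow> real^'n \<Rightarrow> real^'n \<Rightarrow> complex" where
  "weyl_integrand \<epsilon> a w x \<eta> y = complex_of_real (a ((1/2) *\<^sub>R (x + y), \<eta>)) *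
     exp (\<i> * complex_of_real (\<eta> \<bullet> (x - y) / \<epsilon>)) * w y"

definition weyl_inner ::
  "real \<Rightarrow> ('n::finite phase \<Rightarrow> real) \<Rightarrow> (real^'n \<Rightarrow> complex) \<Rightarrow> real^'n \<Rightarrow> real^'n \<Rightarrow> complex" where
  "weyl_inner \<epsilon> a w x \<eta> = (\<integral>y. weyl_integrand \<epsilon> a w x \<eta> y \<partial>lborel)"

definition weyl_const :: "real \<Rightarrow> 'n::finite itself \<Rightarrow> complex" where
  "weyl_const \<epsilon> _ = complex_of_real (1 / (2 * pi * \<epsilon>) ^ CARD('n))"

lemma op_weyl_eq:
  fixes a :: "'n::finite phase \<Rightarrow> real"
  shows "op_weyl \<epsilon> a w x = weyl_const \<epsilon> TYPE('n) * (\<integral>\<eta>. weyl_inner \<epsilon> a w x \<eta> \<partial>lborel)"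
  by (simp add: op_weyl_def weyl_inner_def weyl_integrand_def weyl_const_def)

definition weyl_form ::
  "real \<Rightarrow> ('n::finite phase \<Rightarrow> real) \<Rightarrow> (real^'n \<Rightarrow> complex) \<Rightarrow> (real^'n \<Rightarrow> complex) \<Rightarrow> complex" where
  "weyl_form \<epsilon> a v w = L2_inner v (op_weyl \<epsilon> a w)"

text \<open>Splits the growth of a symbol into separate weights in x, \<eta> and y, because each is
  absorbed differently: y by \<open>w\<close>, \<eta> by oscillation, x by the function paired with
  \<open>op_weyl\<close>.\<close>

lemma norm_midpoint_bound:
  fixes x y \<eta> :: "'a::real_normed_vector"
  shows "(1 + norm ((1/2) *\<^sub>R (x + y), \<eta>))\<^sup>2 \<le> (1 + norm x)\<^sup>2 * (1 + norm \<eta>)\<^sup>2 * (1 + norm y)\<^sup>2"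
proof -
  have "norm ((1/2) *\<^sub>R (x + y), \<eta>) \<le> norm ((1/2) *\<^sub>R (x + y)) + norm \<eta>"
    by (rule norm_Pair_le)
  also have "norm ((1/2) *\<^sub>R (x + y)) \<le> norm x + norm y"
    using norm_triangle_ineq[of x y] norm_ge_zero[of x] norm_ge_zero[of y] by (simp del: norm_ge_zero)
  finally have "1 + norm ((1/2) *\<^sub>R (x + y), \<eta>) \<le> 1 + norm x + norm y + norm \<eta>"
    by simp
  also have "\<dots> \<le> (1 + norm x) * (1 + norm \<eta>) * (1 + norm y)"
    by (simp add: algebra_simps)
  finally have "(1 + norm ((1/2) *\<^sub>R (x + y), \<eta>))\<^sup>2 \<le> ((1 + norm x) * (1 + norm \<eta>) * (1 + norm y))\<^sup>2"
    by (intro power_mono) auto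
  then show ?thesis by (simp add: power_mult_distrib)
qed

lemma axis_Basis_phase: "(axis j 1, 0) \<in> (Basis :: ('n::finite phase) set)"
  "(0, axis j 1) \<in> (Basis :: ('n::finite phase) set)"
  by (auto simp: Basis_prod_def axis_in_Basis_iff)

text \<open>A class of Schwartz functions. The index makes all bounds uniform
  along a family; it is needed only for the continuity of averages in time.\<close>

locale schwartz_class =
  fixes W :: "('i \<Rightarrow> real^'n \<Rightarrow> complex) set" and \<epsilon> :: real
  assumes eps: "\<epsilon> > 0"
    and W_cont: "w \<in> W \<Longrightarrow> continuous_on UNIV (w k)"
    and W_rapid: "w \<in> W \<Longrightarrow> \<exists>K. \<forall>k x. (1 + norm x) ^ N * cmod (w k x) \<le> K"
    and W_deriv: "w \<in> W \<Longrightarrow> \<exists>w'\<in>W. \<forall>k. dir_deriv (w k) (axis j 1) (w' k)"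
    and W_coord: "w \<in> W \<Longrightarrow> (\<lambda>k x. complex_of_real (x $ j) * w k x) \<in> W"
    and W_add: "w \<in> W \<Longrightarrow> w' \<in> W \<Longrightarrow> (\<lambda>k x. w k x + w' k x) \<in> W"
    and W_cmult: "w \<in> W \<Longrightarrow> (\<And>k. cmod (c k) \<le> K) \<Longrightarrow> (\<lambda>k x. c k * w k x) \<in> W"
begin

section \<open>Bounds and momentum decay of the inner integral\<close>

lemma integrand_continuous:
  assumes "symbol_family a" "w \<in> W"
    and "continuous_on A f" "continuous_on A g" "continuous_on A h"
  shows "continuous_on A (\<lambda>z. weyl_integrand \<epsilon> (a k) (w k) (f z) (g z) (h z))"
proof -
  have "continuous_on A (\<lambda>z. a k ((1/2) *\<^sub>R (f z + h z), g z))"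
    by (rule continuous_on_compose2[OF smooth_fun_continuous[OF symbol_family_smooth[OF assms(1)], of UNIV]])
      (use assms in \<open>auto intro!: continuous_intros\<close>)
  moreover have "continuous_on A (\<lambda>z. w k (h z))"
    by (rule continuous_on_compose2[OF W_cont[OF assms(2)]]) (use assms in auto)
  ultimately show ?thesis
    unfolding weyl_integrand_def using assms eps by (auto intro!: continuous_intros)
qed

lemma integrand_bound:
  assumes "symbol_family a" "w \<in> W"
  shows "\<exists>K\<ge>0. \<forall>k x \<eta> y. (1 + norm y) ^ N * cmod (weyl_integrand \<epsilon> (a k) (w k) x \<eta> y)
     \<le> K * (1 + norm x)\<^sup>2 * (1 + norm \<eta>)\<^sup>2"
proof -
  obtain K where K: "K > 0" "\<And>k z. \<bar>a k z\<bar> \<le> K * (1 + norm z)\<^sup>2"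
    using symbol_family_bound[OF assms(1)] by metis
  \<comment> \<open>Two additional powers of decay pay for the quadratic growth of the symbol in
    y.\<close>
  obtain L where L: "\<And>k x. (1 + norm x) ^ (N + 2) * cmod (w k x) \<le> L"
    using W_rapid[OF assms(2)] by blast
  have L0: "L \<ge> 0" using order_trans[OF _ L[of 0 undefined]] by simp
  have "(1 + norm y) ^ N * cmod (weyl_integrand \<epsilon> (a k) (w k) x \<eta> y) \<le> (K * L) * (1 + norm x)\<^sup>2 * (1 + norm \<eta>)\<^sup>2" for k x \<eta> y
  proof -
    have "cmod (weyl_integrand \<epsilon> (a k) (w k) x \<eta> y) = \<bar>a k ((1/2) *\<^sub>R (x + y), \<eta>)\<bar> * cmod (w k y)"
      by (simp add: weyl_integrand_def norm_mult)
    also have "\<dots> \<le> (K * ((1 + norm x)\<^sup>2 * (1 + norm \<eta>)\<^sup>2 * (1 + norm y)\<^sup>2)) * cmod (w k y)"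
      by (intro mult_right_mono order_trans[OF K(2)] mult_left_mono norm_midpoint_bound) (use K in auto)
    finally have "(1 + norm y) ^ N * cmod (weyl_integrand \<epsilon> (a k) (w k) x \<eta> y) \<le>
      (1 + norm y) ^ N * ((K * ((1 + norm x)\<^sup>2 * (1 + norm \<eta>)\<^sup>2 * (1 + norm y)\<^sup>2)) * cmod (w k y))"
      by (intro mult_left_mono) auto
    also have "\<dots> = K * ((1 + norm x)\<^sup>2 * (1 + norm \<eta>)\<^sup>2) * ((1 + norm y) ^ (N + 2) * cmod (w k y))"
      by (simp add: power_add power2_eq_square mult_ac)
    also have "\<dots> \<le> K * ((1 + norm x)\<^sup>2 * (1 + norm \<eta>)\<^sup>2) * L"
      by (intro mult_left_mono L) (use K in auto)
    finally show ?thesis by (simp add: mult_ac)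
  qed
  then show ?thesis using K L0 by (intro exI[of _ "K * L"]) auto
qed

lemma integrand_integrable:
  assumes "symbol_family a" "w \<in> W"
  shows "integrable lborel (weyl_integrand \<epsilon> (a k) (w k) x \<eta>)"
proof -
  obtain K where "\<And>k x \<eta> y. (1 + norm y) ^ (2 * DIM(real^'n)) * cmod (weyl_integrand \<epsilon> (a k) (w k) x \<eta> y)
     \<le> K * (1 + norm x)\<^sup>2 * (1 + norm \<eta>)\<^sup>2"
    using integrand_bound[OF assms] by blast
  then show ?thesis
    by (rule integrable_weight_bound[rotated])
      (auto intro!: borel_measurable_continuous_onI integrand_continuous assms continuous_intros)
qed

text \<open>Absolute values discard the oscillation, so there is no decay in \<eta> yet. This is the
  start of the induction in \<open>weyl_inner_decay_aux\<close>.\<close>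

lemma weyl_inner_crude_bound:
  assumes "symbol_family a" "w \<in> W"
  shows "\<exists>K. \<forall>k x \<eta>. cmod (weyl_inner \<epsilon> (a k) (w k) x \<eta>) \<le> K * (1 + norm x)\<^sup>2 * (1 + norm \<eta>)\<^sup>2"
proof -
  let ?D = "2 * DIM(real^'n)"
  obtain K where K: "\<And>k x \<eta> y. (1 + norm y) ^ ?D * cmod (weyl_integrand \<epsilon> (a k) (w k) x \<eta> y)
     \<le> K * (1 + norm x)\<^sup>2 * (1 + norm \<eta>)\<^sup>2"
    using integrand_bound[OF assms] by blast
  let ?J = "LINT y|lborel. inverse ((1 + norm (y::real^'n)) ^ ?D)"
  have "cmod (weyl_inner \<epsilon> (a k) (w k) x \<eta>) \<le> K * ?J * (1 + norm x)\<^sup>2 * (1 + norm \<eta>)\<^sup>2" for k x \<eta>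
  proof -
    have "cmod (weyl_inner \<epsilon> (a k) (w k) x \<eta>) \<le>
      (LINT y|lborel. (K * (1 + norm x)\<^sup>2 * (1 + norm \<eta>)\<^sup>2) * inverse ((1 + norm (y::real^'n)) ^ ?D))"
      unfolding weyl_inner_def
    proof (rule order_trans[OF integral_norm_bound integral_mono])
      show "integrable lborel (\<lambda>y. cmod (weyl_integrand \<epsilon> (a k) (w k) x \<eta> y))"
        by (intro integrable_norm integrand_integrable[OF assms])
      show "integrable lborel (\<lambda>y::real^'n. (K * (1 + norm x)\<^sup>2 * (1 + norm \<eta>)\<^sup>2) * inverse ((1 + norm y) ^ ?D))"
        by (intro integrable_mult_right integrable_norm_weight)
      fix y :: "real^'n"
      have "(1 + norm y) ^ ?D > 0" by (intro zero_less_power add_pos_nonneg) auto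
      then show "cmod (weyl_integrand \<epsilon> (a k) (w k) x \<eta> y) \<le> (K * (1 + norm x)\<^sup>2 * (1 + norm \<eta>)\<^sup>2) * inverse ((1 + norm y) ^ ?D)"
        using K[of y k x \<eta>] by (simp add: field_simps)
    qed
    then show ?thesis by (simp add: mult_ac)
  qed
  then show ?thesis by blast
qed

text \<open>The factor 1/2 is the inner derivative of the midpoint. In
  \<open>weyl_form_derivative\<close> two such halves, one from each argument of the form, add up to
  the full derivative of the symbol.\<close>

lemma dir_deriv_symbol:
  assumes "smooth_fun f"
  shows "dir_deriv (\<lambda>y::real^'n. complex_of_real (f ((1/2) *\<^sub>R (x + y), \<eta>))) b
    (\<lambda>y. 1/2 * complex_of_real (pderiv_at (b, 0) f ((1/2) *\<^sub>R (x + y), \<eta>)))"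
    and "dir_deriv (\<lambda>\<eta>::real^'n. complex_of_real (f (z, \<eta>))) b
    (\<lambda>\<eta>. complex_of_real (pderiv_at (0, b) f (z, \<eta>)))"
proof -
  show "dir_deriv (\<lambda>\<eta>::real^'n. complex_of_real (f (z, \<eta>))) b
    (\<lambda>\<eta>. complex_of_real (pderiv_at (0, b) f (z, \<eta>)))"
    unfolding dir_deriv_def pderiv_at_def
    using dir_deriv_of_real[OF smooth_fun_differentiable[OF assms], of _ "(0, b)"] by auto
  show "dir_deriv (\<lambda>y::real^'n. complex_of_real (f ((1/2) *\<^sub>R (x + y), \<eta>))) b
    (\<lambda>y. 1/2 * complex_of_real (pderiv_at (b, 0) f ((1/2) *\<^sub>R (x + y), \<eta>)))"
    unfolding dir_deriv_def
  proof
    fix y :: "real^'n"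
    let ?z = "((1/2) *\<^sub>R (x + y), \<eta>)"
    have "frechet_derivative f (at ?z) ((1/2) *\<^sub>R (b, 0)) = (1/2) * pderiv_at (b, 0) f ?z"
      unfolding pderiv_at_def
      by (subst linear_scale[OF linear_frechet_derivative[OF smooth_fun_differentiable[OF assms]]]) simp
    then have "complex_of_real (frechet_derivative f (at ?z) ((1/2) *\<^sub>R (b, 0))) = 1/2 * complex_of_real (pderiv_at (b, 0) f ?z)"
      by (simp only: of_real_mult of_real_divide of_real_1 of_real_numeral)
    moreover have "?z + s *\<^sub>R (1/2) *\<^sub>R (b, 0) = ((1/2) *\<^sub>R (x + (y + s *\<^sub>R b)), \<eta>)" for s
      by (simp add: algebra_simps)
    ultimately show "((\<lambda>s. complex_of_real (f ((1/2) *\<^sub>R (x + (y + s *\<^sub>R b)), \<eta>))) has_vector_derivative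
        1/2 * complex_of_real (pderiv_at (b, 0) f ?z)) (at 0)"
      using dir_deriv_of_real[OF smooth_fun_differentiable[OF assms], of ?z "(1/2) *\<^sub>R (b, 0)"]
      by (simp only:)
  qed
qed

lemma dir_deriv_phase:
  "dir_deriv (\<lambda>y::real^'n. exp (\<i> * complex_of_real (\<eta> \<bullet> (x - y) / \<epsilon>))) b
    (\<lambda>y. (- \<i> / \<epsilon> * complex_of_real (\<eta> \<bullet> b)) * exp (\<i> * complex_of_real (\<eta> \<bullet> (x - y) / \<epsilon>)))"
  "dir_deriv (\<lambda>\<eta>::real^'n. exp (\<i> * complex_of_real (\<eta> \<bullet> z / \<epsilon>))) b
    (\<lambda>\<eta>. (\<i> / \<epsilon> * complex_of_real (b \<bullet> z)) * exp (\<i> * complex_of_real (\<eta> \<bullet> z / \<epsilon>)))"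
proof -
  have "dir_deriv (\<lambda>y. \<i> * complex_of_real (\<eta> \<bullet> x) / \<epsilon> + (- \<i> / \<epsilon>) * complex_of_real (y \<bullet> \<eta>)) b
    (\<lambda>y. 0 + (- \<i> / \<epsilon>) * complex_of_real (b \<bullet> \<eta>))"
    by (intro dir_deriv_add dir_deriv_const dir_deriv_cmult dir_deriv_inner)
  from dir_deriv_exp[OF this]
  show "dir_deriv (\<lambda>y::real^'n. exp (\<i> * complex_of_real (\<eta> \<bullet> (x - y) / \<epsilon>))) b
    (\<lambda>y. (- \<i> / \<epsilon> * complex_of_real (\<eta> \<bullet> b)) * exp (\<i> * complex_of_real (\<eta> \<bullet> (x - y) / \<epsilon>)))"
    by (simp add: inner_diff_right inner_commute diff_divide_distrib right_diff_distrib)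
  have "dir_deriv (\<lambda>\<eta>. (\<i> / \<epsilon>) * complex_of_real (\<eta> \<bullet> z)) b (\<lambda>\<eta>. (\<i> / \<epsilon>) * complex_of_real (b \<bullet> z))"
    by (intro dir_deriv_cmult dir_deriv_inner)
  from dir_deriv_exp[OF this]
  show "dir_deriv (\<lambda>\<eta>::real^'n. exp (\<i> * complex_of_real (\<eta> \<bullet> z / \<epsilon>))) b
    (\<lambda>\<eta>. (\<i> / \<epsilon> * complex_of_real (b \<bullet> z)) * exp (\<i> * complex_of_real (\<eta> \<bullet> z / \<epsilon>)))"
    by simp
qed

text \<open>Integration by parts in y trades the factor \<eta>_j for a derivative of the symbol or
  of \<open>w\<close>. It serves twice: iterated it gives decay in \<eta>, and used once it gives
  the commutator with the derivative.\<close>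

lemma weyl_inner_by_parts:
  assumes a: "symbol_family a" and w: "w \<in> W" "w' \<in> W" "dir_deriv (w k) (axis j 1) (w' k)"
  shows "1/2 * weyl_inner \<epsilon> (pderiv_at (axis j 1, 0) (a k)) (w k) x \<eta> + weyl_inner \<epsilon> (a k) (w' k) x \<eta>
    = \<i> / \<epsilon> * complex_of_real (\<eta> $ j) * weyl_inner \<epsilon> (a k) (w k) x \<eta>"
proof -
  let ?b = "axis j 1 :: real^'n"
  note a' = symbol_family_pderiv[OF a axis_Basis_phase(1)[of j]]
  define f' where "f' y = 1/2 * weyl_integrand \<epsilon> (pderiv_at (?b, 0) (a k)) (w k) x \<eta> y + weyl_integrand \<epsilon> (a k) (w' k) x \<eta> y
    - \<i> / \<epsilon> * complex_of_real (\<eta> $ j) * weyl_integrand \<epsilon> (a k) (w k) x \<eta> y" for y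
  note int = integrand_integrable[OF a' w(1), of k] integrand_integrable[OF a w(2), of k] integrand_integrable[OF a w(1), of k]
  have "(\<integral>y. f' y \<partial>lborel) = 0"
  proof (rule integral_dir_deriv_zero)
    show "integrable lborel (weyl_integrand \<epsilon> (a k) (w k) x \<eta>)"
      by (rule int)
    show "integrable lborel f'"
      unfolding f'_def by (intro Bochner_Integration.integrable_diff Bochner_Integration.integrable_add integrable_mult_right int)
    have "dir_deriv (weyl_integrand \<epsilon> (a k) (w k) x \<eta>) ?b (\<lambda>y.
       complex_of_real (a k ((1/2) *\<^sub>R (x + y), \<eta>)) * exp (\<i> * complex_of_real (\<eta> \<bullet> (x - y) / \<epsilon>)) * w' k y +
       (complex_of_real (a k ((1/2) *\<^sub>R (x + y), \<eta>)) *
          ((- \<i> / \<epsilon> * complex_of_real (\<eta> \<bullet> ?b)) * exp (\<i> * complex_of_real (\<eta> \<bullet> (x - y) / \<epsilon>))) +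
        (1/2 * complex_of_real (pderiv_at (?b, 0) (a k) ((1/2) *\<^sub>R (x + y), \<eta>))) *
          exp (\<i> * complex_of_real (\<eta> \<bullet> (x - y) / \<epsilon>))) * w k y)"
      unfolding weyl_integrand_def
      by (intro dir_deriv_mult dir_deriv_symbol symbol_family_smooth[OF a] dir_deriv_phase w(3))
    also have "(\<lambda>y.
       complex_of_real (a k ((1/2) *\<^sub>R (x + y), \<eta>)) * exp (\<i> * complex_of_real (\<eta> \<bullet> (x - y) / \<epsilon>)) * w' k y +
       (complex_of_real (a k ((1/2) *\<^sub>R (x + y), \<eta>)) *
          ((- \<i> / \<epsilon> * complex_of_real (\<eta> \<bullet> ?b)) * exp (\<i> * complex_of_real (\<eta> \<bullet> (x - y) / \<epsilon>))) +
        (1/2 * complex_of_real (pderiv_at (?b, 0) (a k) ((1/2) *\<^sub>R (x + y), \<eta>))) *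
          exp (\<i> * complex_of_real (\<eta> \<bullet> (x - y) / \<epsilon>))) * w k y) = f'"
      by (rule ext) (simp add: f'_def weyl_integrand_def inner_axis algebra_simps)
    finally show "dir_deriv (weyl_integrand \<epsilon> (a k) (w k) x \<eta>) ?b f'" .
    show "continuous_on UNIV f'"
      unfolding f'_def by (intro continuous_intros integrand_continuous[OF a' w(1)] integrand_continuous[OF a] w)
  qed
  moreover have "(\<integral>y. f' y \<partial>lborel) = 1/2 * weyl_inner \<epsilon> (pderiv_at (?b, 0) (a k)) (w k) x \<eta> + weyl_inner \<epsilon> (a k) (w' k) x \<eta>
    - \<i> / \<epsilon> * complex_of_real (\<eta> $ j) * weyl_inner \<epsilon> (a k) (w k) x \<eta>"
    unfolding f'_def weyl_inner_def using int by simp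
  ultimately show ?thesis by simp
qed

text \<open>Each integration by parts gains one factor \<eta>_j. The weight is built from the l1
  norm because its next power expands linearly into the terms that
  \<open>weyl_inner_by_parts\<close> controls; the hypothesis is also used for the differentiated
  symbol and for \<open>w'\<close>, hence arbitrary \<open>a\<close> and \<open>w\<close>.\<close>

lemma weyl_inner_decay_aux:
  "symbol_family a \<Longrightarrow> w \<in> W \<Longrightarrow>
    \<exists>K. \<forall>k x \<eta>. (1 + (\<Sum>j\<in>UNIV. \<bar>\<eta> $ j\<bar>)) ^ N * cmod (weyl_inner \<epsilon> (a k) (w k) x \<eta>)
      \<le> K * (1 + norm x)\<^sup>2 * (1 + norm \<eta>)\<^sup>2"
proof (induction N arbitrary: a w)
  case 0
  then show ?case using weyl_inner_crude_bound by simp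
next
  case (Suc N)
  note a = Suc.prems(1) and w = Suc.prems(2)
  obtain w' where w': "\<And>j. w' j \<in> W" "\<And>j k. dir_deriv (w k) (axis j 1) (w' j k)"
    using W_deriv[OF w] by metis
  let ?s = "\<lambda>\<eta>::real^'n. 1 + (\<Sum>j\<in>UNIV. \<bar>\<eta> $ j\<bar>)"
  let ?R = "\<lambda>(x::real^'n) (\<eta>::real^'n). (1 + norm x)\<^sup>2 * (1 + norm \<eta>)\<^sup>2"
  obtain K where K: "\<And>k x \<eta>. ?s \<eta> ^ N * cmod (weyl_inner \<epsilon> (a k) (w k) x \<eta>) \<le> K * ?R x \<eta>"
    using Suc.IH[OF a w] by (auto simp: mult.assoc)
  have "\<exists>L. \<forall>k x \<eta>. ?s \<eta> ^ N * cmod (weyl_inner \<epsilon> (pderiv_at (axis j 1, 0) (a k)) (w k) x \<eta>) \<le> L * ?R x \<eta>" for j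
    using Suc.IH[OF symbol_family_pderiv[OF a axis_Basis_phase(1)[of j]] w] by (auto simp: mult.assoc)
  then obtain L where L: "\<And>j k x \<eta>. ?s \<eta> ^ N * cmod (weyl_inner \<epsilon> (pderiv_at (axis j 1, 0) (a k)) (w k) x \<eta>) \<le> L j * ?R x \<eta>"
    by metis
  have "\<exists>M. \<forall>k x \<eta>. ?s \<eta> ^ N * cmod (weyl_inner \<epsilon> (a k) (w' j k) x \<eta>) \<le> M * ?R x \<eta>" for j
    using Suc.IH[OF a w'(1)[of j]] by (auto simp: mult.assoc)
  then obtain M where M: "\<And>j k x \<eta>. ?s \<eta> ^ N * cmod (weyl_inner \<epsilon> (a k) (w' j k) x \<eta>) \<le> M j * ?R x \<eta>"
    by metis
  have "?s \<eta> ^ Suc N * cmod (weyl_inner \<epsilon> (a k) (w k) x \<eta>) \<le> (K + (\<Sum>j\<in>UNIV. \<epsilon> * (L j + M j))) * ?R x \<eta>" for k x \<eta>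
  proof -
    have s0: "?s \<eta> ^ N \<ge> 0" by (intro zero_le_power add_nonneg_nonneg sum_nonneg) auto
    have j: "?s \<eta> ^ N * (\<bar>\<eta> $ j\<bar> * cmod (weyl_inner \<epsilon> (a k) (w k) x \<eta>)) \<le> \<epsilon> * (L j + M j) * ?R x \<eta>" for j
    proof -
      let ?A = "weyl_inner \<epsilon> (pderiv_at (axis j 1, 0) (a k)) (w k) x \<eta>"
      let ?B = "weyl_inner \<epsilon> (a k) (w' j k) x \<eta>"
      have "cmod (\<i> / \<epsilon> * complex_of_real (\<eta> $ j) * weyl_inner \<epsilon> (a k) (w k) x \<eta>) \<le> cmod ?A + cmod ?B"
        unfolding weyl_inner_by_parts[where w = w and w' = "w' j" and j = j, OF a w w'(1) w'(2), symmetric]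
        by (rule order_trans[OF norm_triangle_ineq]) (simp add: norm_mult)
      then have "\<bar>\<eta> $ j\<bar> * cmod (weyl_inner \<epsilon> (a k) (w k) x \<eta>) \<le> \<epsilon> * (cmod ?A + cmod ?B)"
        using eps by (simp add: norm_mult norm_divide field_simps)
      then have "?s \<eta> ^ N * (\<bar>\<eta> $ j\<bar> * cmod (weyl_inner \<epsilon> (a k) (w k) x \<eta>)) \<le> ?s \<eta> ^ N * (\<epsilon> * (cmod ?A + cmod ?B))"
        using s0 by (rule mult_left_mono)
      also have "\<dots> = \<epsilon> * (?s \<eta> ^ N * cmod ?A + ?s \<eta> ^ N * cmod ?B)" by (simp add: algebra_simps)
      also have "\<dots> \<le> \<epsilon> * (L j * ?R x \<eta> + M j * ?R x \<eta>)"
        using eps by (intro mult_left_mono add_mono L M) auto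
      finally show ?thesis by (simp add: algebra_simps)
    qed
    have "?s \<eta> ^ Suc N * cmod (weyl_inner \<epsilon> (a k) (w k) x \<eta>) = ?s \<eta> ^ N * cmod (weyl_inner \<epsilon> (a k) (w k) x \<eta>)
      + (\<Sum>j\<in>UNIV. ?s \<eta> ^ N * (\<bar>\<eta> $ j\<bar> * cmod (weyl_inner \<epsilon> (a k) (w k) x \<eta>)))"
      by (simp add: sum_distrib_left[symmetric] sum_distrib_right[symmetric]) (simp add: algebra_simps)
    also have "\<dots> \<le> K * ?R x \<eta> + (\<Sum>j\<in>UNIV. \<epsilon> * (L j + M j) * ?R x \<eta>)"
      by (intro add_mono K sum_mono j)
    also have "\<dots> = (K + (\<Sum>j\<in>UNIV. \<epsilon> * (L j + M j))) * ?R x \<eta>"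
      by (simp only: distrib_right sum_distrib_right)
    finally show ?thesis .
  qed
  then show ?case by (auto simp: mult.assoc)
qed

lemma weyl_inner_decay:
  assumes "symbol_family a" "w \<in> W"
  shows "\<exists>K\<ge>0. \<forall>k x \<eta>. (1 + norm \<eta>) ^ N * cmod (weyl_inner \<epsilon> (a k) (w k) x \<eta>) \<le> K * (1 + norm x)\<^sup>2"
proof -
  \<comment> \<open>Two further powers cancel the factor (1 + norm \<eta>)^2 left by the crude
    bound.\<close>
  obtain K where K: "\<And>k x \<eta>. (1 + (\<Sum>j\<in>UNIV. \<bar>\<eta> $ j\<bar>)) ^ (N + 2) * cmod (weyl_inner \<epsilon> (a k) (w k) x \<eta>)
      \<le> K * (1 + norm x)\<^sup>2 * (1 + norm \<eta>)\<^sup>2"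
    using weyl_inner_decay_aux[OF assms] by blast
  have "(1 + norm \<eta>) ^ N * cmod (weyl_inner \<epsilon> (a k) (w k) x \<eta>) \<le> \<bar>K\<bar> * (1 + norm x)\<^sup>2" for k x \<eta>
  proof -
    have "norm \<eta> \<le> (\<Sum>j\<in>UNIV. \<bar>\<eta> $ j\<bar>)" by (rule norm_le_l1_cart)
    then have "(1 + norm \<eta>) ^ (N + 2) * cmod (weyl_inner \<epsilon> (a k) (w k) x \<eta>)
      \<le> (1 + (\<Sum>j\<in>UNIV. \<bar>\<eta> $ j\<bar>)) ^ (N + 2) * cmod (weyl_inner \<epsilon> (a k) (w k) x \<eta>)"
      by (intro mult_right_mono power_mono) auto
    also have "\<dots> \<le> K * (1 + norm x)\<^sup>2 * (1 + norm \<eta>)\<^sup>2" by (rule K)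
    also have "\<dots> \<le> \<bar>K\<bar> * (1 + norm x)\<^sup>2 * (1 + norm \<eta>)\<^sup>2" by (intro mult_right_mono) auto
    finally have "(1 + norm \<eta>)\<^sup>2 * ((1 + norm \<eta>) ^ N * cmod (weyl_inner \<epsilon> (a k) (w k) x \<eta>))
       \<le> (1 + norm \<eta>)\<^sup>2 * (\<bar>K\<bar> * (1 + norm x)\<^sup>2)"
      by (simp add: power_add power2_eq_square mult_ac)
    moreover have "(1 + norm \<eta>)\<^sup>2 > 0" by (intro zero_less_power add_pos_nonneg) auto
    ultimately show ?thesis by simp
  qed
  then show ?thesis by (intro exI[of _ "\<bar>K\<bar>"]) auto
qed

lemma weyl_inner_measurable:
  assumes "symbol_family a" "w \<in> W"
  shows "(\<lambda>z. weyl_inner \<epsilon> (a k) (w k) (fst z) (snd z)) \<in> borel_measurable borel"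
    and "(\<lambda>\<eta>. weyl_inner \<epsilon> (a k) (w k) x \<eta>) \<in> borel_measurable borel"
    and "(\<lambda>x. weyl_inner \<epsilon> (a k) (w k) x \<eta>) \<in> borel_measurable borel"
  unfolding weyl_inner_def
  by (intro borel_measurable_parameter_integral integrand_continuous assms continuous_intros)+

lemma weyl_inner_integrable:
  assumes "symbol_family a" "w \<in> W"
  shows "integrable lborel (\<lambda>\<eta>. weyl_inner \<epsilon> (a k) (w k) x \<eta>)"
proof -
  obtain K where "\<And>k x \<eta>. (1 + norm \<eta>) ^ (2 * DIM(real^'n)) * cmod (weyl_inner \<epsilon> (a k) (w k) x \<eta>) \<le> K * (1 + norm x)\<^sup>2"
    using weyl_inner_decay[OF assms] by blast
  then show ?thesis
    by (rule integrable_weight_bound[OF weyl_inner_measurable(2)[OF assms]])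
qed

text \<open>The growth in x that remains is absorbed by the decay of \<open>v\<close>, so the
  pairing decreases rapidly in x and \<eta> jointly. This justifies Fubini in these two
  variables.\<close>

lemma weyl_inner_product_bound:
  assumes "symbol_family a" "w \<in> W" "v \<in> W"
  shows "\<exists>K. \<forall>k x \<eta>. (1 + norm x) ^ N * (1 + norm \<eta>) ^ M * cmod (cnj (v k x) * weyl_inner \<epsilon> (a k) (w k) x \<eta>) \<le> K"
proof -
  obtain K where K: "K \<ge> 0" "\<And>k x \<eta>. (1 + norm \<eta>) ^ M * cmod (weyl_inner \<epsilon> (a k) (w k) x \<eta>) \<le> K * (1 + norm x)\<^sup>2"
    using weyl_inner_decay[OF assms(1,2)] by blast
  obtain L where L: "\<And>k x. (1 + norm x) ^ (N + 2) * cmod (v k x) \<le> L"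
    using W_rapid[OF assms(3)] by blast
  have "(1 + norm x) ^ N * (1 + norm \<eta>) ^ M * cmod (cnj (v k x) * weyl_inner \<epsilon> (a k) (w k) x \<eta>) \<le> K * L" for k x \<eta>
  proof -
    have "(1 + norm x) ^ N * (1 + norm \<eta>) ^ M * cmod (cnj (v k x) * weyl_inner \<epsilon> (a k) (w k) x \<eta>)
      = ((1 + norm x) ^ N * cmod (v k x)) * ((1 + norm \<eta>) ^ M * cmod (weyl_inner \<epsilon> (a k) (w k) x \<eta>))"
      by (simp add: norm_mult mult_ac)
    also have "\<dots> \<le> ((1 + norm x) ^ N * cmod (v k x)) * (K * (1 + norm x)\<^sup>2)"
      by (intro mult_left_mono K) auto
    also have "\<dots> = K * ((1 + norm x) ^ (N + 2) * cmod (v k x))"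
      by (simp add: power_add power2_eq_square mult_ac)
    also have "\<dots> \<le> K * L" by (intro mult_left_mono K L)
    finally show ?thesis .
  qed
  then show ?thesis by blast
qed

end

section \<open>The sesquilinear form of a Weyl operator and its commutators\<close>

context schwartz_class
begin

lemma W_zero: "w \<in> W \<Longrightarrow> (\<lambda>k x. 0) \<in> W"
  using W_cmult[of w "\<lambda>_. 0" 0] by simp

lemma W_cmult': "w \<in> W \<Longrightarrow> (\<lambda>k x. c * w k x) \<in> W"
  by (rule W_cmult[of w "\<lambda>_. c" "cmod c"]) auto

lemma W_sum: "finite S \<Longrightarrow> v \<in> W \<Longrightarrow> (\<And>j. j \<in> S \<Longrightarrow> w j \<in> W) \<Longrightarrow> (\<lambda>k x. \<Sum>j\<in>S. w j k x) \<in> W"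
proof (induction S rule: finite_induct)
  case empty
  then show ?case using W_zero by simp
next
  case (insert j S)
  then show ?case using W_add[of "w j" "\<lambda>k x. \<Sum>j\<in>S. w j k x"] by simp
qed

lemma weyl_pairing_integrable:
  assumes "symbol_family a" "w \<in> W" "v \<in> W"
  shows "integrable lborel (\<lambda>z. cnj (v k (fst z)) * weyl_inner \<epsilon> (a k) (w k) (fst z) (snd z))"
    and "integrable (lborel \<Otimes>\<^sub>M lborel) (\<lambda>(x, \<eta>). cnj (v k x) * weyl_inner \<epsilon> (a k) (w k) x \<eta>)"
proof -
  let ?M = "2 * DIM((real^'n) \<times> (real^'n))"
  obtain K where K: "\<And>k x \<eta>. (1 + norm x) ^ ?M * (1 + norm \<eta>) ^ ?M * cmod (cnj (v k x) * weyl_inner \<epsilon> (a k) (w k) x \<eta>) \<le> K"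
    using weyl_inner_product_bound[OF assms] by blast
  have "(\<lambda>z. cnj (v k (fst z))) \<in> borel_measurable borel"
    by (intro borel_measurable_continuous_onI continuous_on_cnj continuous_on_compose2[OF W_cont[OF assms(3)]] continuous_intros) auto
  then have meas: "(\<lambda>z. cnj (v k (fst z)) * weyl_inner \<epsilon> (a k) (w k) (fst z) (snd z)) \<in> borel_measurable borel"
    by (intro borel_measurable_times weyl_inner_measurable(1)[OF assms(1,2)])
  note * = integrable_product_weight_bound[of "\<lambda>x \<eta>. cnj (v k x) * weyl_inner \<epsilon> (a k) (w k) x \<eta>", OF meas K]
  show "integrable lborel (\<lambda>z. cnj (v k (fst z)) * weyl_inner \<epsilon> (a k) (w k) (fst z) (snd z))"
    by (rule *(1))
  show "integrable (lborel \<Otimes>\<^sub>M lborel) (\<lambda>(x, \<eta>). cnj (v k x) * weyl_inner \<epsilon> (a k) (w k) x \<eta>)"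
    by (rule *(2))
qed

lemma op_weyl_pairing:
  "cnj (v x) * op_weyl \<epsilon> a w x = weyl_const \<epsilon> TYPE('n) * (\<integral>\<eta>. cnj (v x) * weyl_inner \<epsilon> a w x \<eta> \<partial>lborel)"
  for v w :: "real^'n \<Rightarrow> complex"
  by (simp add: op_weyl_eq)

lemma op_weyl_pairing_integrable:
  assumes "symbol_family a" "w \<in> W" "v \<in> W"
  shows "integrable lborel (\<lambda>x. cnj (v k x) * op_weyl \<epsilon> (a k) (w k) x)"
  unfolding op_weyl_pairing
  by (intro integrable_mult_right lborel_pair.integrable_fst weyl_pairing_integrable(2)[OF assms, of k])

lemma weyl_form_eq_phase_integral:
  assumes "symbol_family a" "w \<in> W" "v \<in> W"
  shows "weyl_form \<epsilon> (a k) (v k) (w k) = weyl_const \<epsilon> TYPE('n) *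
     (\<integral>z. cnj (v k (fst z)) * weyl_inner \<epsilon> (a k) (w k) (fst z) (snd z) \<partial>lborel)"
proof -
  have "weyl_form \<epsilon> (a k) (v k) (w k) = weyl_const \<epsilon> TYPE('n) *
     (\<integral>x. (\<integral>\<eta>. cnj (v k x) * weyl_inner \<epsilon> (a k) (w k) x \<eta> \<partial>lborel) \<partial>lborel)"
    unfolding weyl_form_def L2_inner_def op_weyl_pairing by simp
  also have "\<dots> = weyl_const \<epsilon> TYPE('n) *
     (\<integral>z. (\<lambda>(x, \<eta>). cnj (v k x) * weyl_inner \<epsilon> (a k) (w k) x \<eta>) z \<partial>(lborel \<Otimes>\<^sub>M lborel))"
    by (subst lborel_pair.integral_fst[OF weyl_pairing_integrable(2)[OF assms, of k]]) simp
  finally show ?thesis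
    unfolding lborel_prod by (simp add: case_prod_beta')
qed

text \<open>The form with \<eta> held fixed. There the double integral over x and y converges
  absolutely, so \<open>v\<close> and \<open>w\<close> can exchange roles before the oscillatory
  integration over \<eta>.\<close>

definition weyl_slice ::
  "((real^'n) \<times> (real^'n) \<Rightarrow> real) \<Rightarrow> (real^'n \<Rightarrow> complex) \<Rightarrow> (real^'n \<Rightarrow> complex) \<Rightarrow> real^'n \<Rightarrow> complex" where
  "weyl_slice a v w \<eta> = (\<integral>x. cnj (v x) * weyl_inner \<epsilon> a w x \<eta> \<partial>lborel)"

lemma weyl_form_eq_slice:
  assumes "symbol_family a" "w \<in> W" "v \<in> W"
  shows "weyl_form \<epsilon> (a k) (v k) (w k) = weyl_const \<epsilon> TYPE('n) * (\<integral>\<eta>. weyl_slice (a k) (v k) (w k) \<eta> \<partial>lborel)"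
    and "integrable lborel (weyl_slice (a k) (v k) (w k))"
proof -
  note int = weyl_pairing_integrable(2)[OF assms, of k]
  show "integrable lborel (weyl_slice (a k) (v k) (w k))"
    unfolding weyl_slice_def by (rule lborel_pair.integrable_snd[OF int])
  have "(\<integral>z. cnj (v k (fst z)) * weyl_inner \<epsilon> (a k) (w k) (fst z) (snd z) \<partial>lborel)
    = (\<integral>z. (\<lambda>(x, \<eta>). cnj (v k x) * weyl_inner \<epsilon> (a k) (w k) x \<eta>) z \<partial>(lborel \<Otimes>\<^sub>M lborel))"
    unfolding lborel_prod by (simp add: case_prod_beta')
  also have "\<dots> = (\<integral>\<eta>. weyl_slice (a k) (v k) (w k) \<eta> \<partial>lborel)"
    unfolding weyl_slice_def by (subst lborel_pair.integral_snd[OF int]) simp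
  finally show "weyl_form \<epsilon> (a k) (v k) (w k) = weyl_const \<epsilon> TYPE('n) * (\<integral>\<eta>. weyl_slice (a k) (v k) (w k) \<eta> \<partial>lborel)"
    unfolding weyl_form_eq_phase_integral[OF assms] by simp
qed

lemma slice_integrable:
  assumes "symbol_family a" "w \<in> W" "v \<in> W"
  shows "integrable lborel (\<lambda>x. cnj (v k x) * weyl_inner \<epsilon> (a k) (w k) x \<eta>)"
proof -
  let ?D = "2 * DIM(real^'n)"
  obtain K where K: "\<And>k x \<eta>. (1 + norm x) ^ ?D * (1 + norm \<eta>) ^ 0 * cmod (cnj (v k x) * weyl_inner \<epsilon> (a k) (w k) x \<eta>) \<le> K"
    using weyl_inner_product_bound[OF assms] by blast
  have "(\<lambda>x. cnj (v k x)) \<in> borel_measurable borel"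
    by (intro borel_measurable_continuous_onI continuous_on_cnj W_cont[OF assms(3)])
  then have meas: "(\<lambda>x. cnj (v k x) * weyl_inner \<epsilon> (a k) (w k) x \<eta>) \<in> borel_measurable borel"
    by (intro borel_measurable_times weyl_inner_measurable(3)[OF assms(1,2)])
  show ?thesis
  proof (rule integrable_weight_bound)
    show "(1 + norm x) ^ ?D * cmod (cnj (v k x) * weyl_inner \<epsilon> (a k) (w k) x \<eta>) \<le> K" for x
      using K[of x \<eta> k] by simp
  qed (rule meas)
qed

text \<open>The symbol is real and evaluated at the midpoint of x and y, so exchanging x and y
  conjugates the kernel. The function \<open>f\<close> reads the same integrand from either
  side.\<close>

lemma weyl_slice_hermitian:
  assumes a: "symbol_family a" and wv: "w \<in> W" "v \<in> W"
  shows "cnj (weyl_slice (a k) (v k) (w k) \<eta>) = weyl_slice (a k) (w k) (v k) \<eta>"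
proof -
  define f where "f x y = cnj (w k y) * weyl_integrand \<epsilon> (a k) (v k) y \<eta> x" for x y
  have f_eq: "f x y = v k x * cnj (weyl_integrand \<epsilon> (a k) (w k) x \<eta> y)" for x y
    by (simp add: f_def weyl_integrand_def exp_cnj add.commute inner_diff_right algebra_simps flip: of_real_minus of_real_divide)
      (simp add: minus_divide_left[symmetric] diff_divide_distrib algebra_simps)
  let ?M = "2 * DIM((real^'n) \<times> (real^'n))"
  have int: "integrable (lborel \<Otimes>\<^sub>M lborel) (case_prod f)"
  proof -
    obtain K where K: "K \<ge> 0" "\<And>k x \<eta> y. (1 + norm y) ^ ?M * cmod (weyl_integrand \<epsilon> (a k) (w k) x \<eta> y) \<le> K * (1 + norm x)\<^sup>2 * (1 + norm \<eta>)\<^sup>2"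
      using integrand_bound[OF a wv(1)] by blast
    obtain L where L: "\<And>k x. (1 + norm x) ^ (?M + 2) * cmod (v k x) \<le> L"
      using W_rapid[OF wv(2)] by blast
    show ?thesis
    proof (rule integrable_product_weight_bound(2))
      have "continuous_on UNIV (\<lambda>z. f (fst z) (snd z))"
        unfolding f_def
        by (intro continuous_intros integrand_continuous[OF a wv(2)] continuous_on_compose2[OF W_cont[OF wv(1)]]) auto
      then show "(\<lambda>z. f (fst z) (snd z)) \<in> borel_measurable borel"
        by (rule borel_measurable_continuous_onI)
      fix x y :: "real^'n"
      have "(1 + norm x) ^ ?M * (1 + norm y) ^ ?M * cmod (f x y)
        = ((1 + norm x) ^ ?M * cmod (v k x)) * ((1 + norm y) ^ ?M * cmod (weyl_integrand \<epsilon> (a k) (w k) x \<eta> y))"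
        unfolding f_eq by (simp add: norm_mult mult_ac)
      also have "\<dots> \<le> ((1 + norm x) ^ ?M * cmod (v k x)) * (K * (1 + norm x)\<^sup>2 * (1 + norm \<eta>)\<^sup>2)"
        by (intro mult_left_mono K) auto
      also have "\<dots> = (K * (1 + norm \<eta>)\<^sup>2) * ((1 + norm x) ^ (?M + 2) * cmod (v k x))"
        by (simp add: power_add power2_eq_square mult_ac)
      also have "\<dots> \<le> (K * (1 + norm \<eta>)\<^sup>2) * L"
        by (intro mult_left_mono L) (use K in auto)
      finally show "(1 + norm x) ^ ?M * (1 + norm y) ^ ?M * cmod (f x y) \<le> (K * (1 + norm \<eta>)\<^sup>2) * L" .
    qed
  qed
  have "cnj (weyl_slice (a k) (v k) (w k) \<eta>) = (\<integral>x. v k x * cnj (weyl_inner \<epsilon> (a k) (w k) x \<eta>) \<partial>lborel)"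
    using Bochner_Integration.integral_cnj[of lborel "\<lambda>x. cnj (v k x) * weyl_inner \<epsilon> (a k) (w k) x \<eta>"] unfolding weyl_slice_def by simp
  also have "\<dots> = (\<integral>x. (\<integral>y. f x y \<partial>lborel) \<partial>lborel)"
    unfolding f_eq weyl_inner_def by simp
  also have "\<dots> = (\<integral>y. (\<integral>x. f x y \<partial>lborel) \<partial>lborel)"
    by (rule lborel_pair.Fubini_integral[OF int, symmetric])
  also have "\<dots> = weyl_slice (a k) (w k) (v k) \<eta>"
    unfolding f_def weyl_slice_def weyl_inner_def by simp
  finally show ?thesis .
qed

lemma weyl_form_hermitian:
  assumes "symbol_family a" "w \<in> W" "v \<in> W"
  shows "cnj (weyl_form \<epsilon> (a k) (v k) (w k)) = weyl_form \<epsilon> (a k) (w k) (v k)"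
proof -
  have "cnj (weyl_const \<epsilon> TYPE('n)) = weyl_const \<epsilon> TYPE('n)"
    by (simp add: weyl_const_def)
  moreover have "(\<integral>\<eta>. weyl_slice (a k) (w k) (v k) \<eta> \<partial>lborel) = (\<integral>\<eta>. cnj (weyl_slice (a k) (v k) (w k) \<eta>) \<partial>lborel)"
    by (simp only: weyl_slice_hermitian[OF assms])
  ultimately show ?thesis
    unfolding weyl_form_eq_slice(1)[OF assms] weyl_form_eq_slice(1)[OF assms(1,3,2)] by simp
qed

lemma weyl_slice_by_parts:
  assumes a: "symbol_family a" and w: "w \<in> W" "w' \<in> W" "dir_deriv (w k) (axis j 1) (w' k)" and v: "v \<in> W"
  shows "1/2 * weyl_slice (pderiv_at (axis j 1, 0) (a k)) (v k) (w k) \<eta> + weyl_slice (a k) (v k) (w' k) \<eta>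
    = \<i> / \<epsilon> * complex_of_real (\<eta> $ j) * weyl_slice (a k) (v k) (w k) \<eta>"
proof -
  note a' = symbol_family_pderiv[OF a axis_Basis_phase(1)[of j]]
  note int = slice_integrable[OF a' w(1) v, of k \<eta>] slice_integrable[OF a w(1) v, of k \<eta>] slice_integrable[OF a w(2) v, of k \<eta>]
  have "1/2 * weyl_slice (pderiv_at (axis j 1, 0) (a k)) (v k) (w k) \<eta> + weyl_slice (a k) (v k) (w' k) \<eta> =
    (\<integral>x. 1/2 * (cnj (v k x) * weyl_inner \<epsilon> (pderiv_at (axis j 1, 0) (a k)) (w k) x \<eta>) +
       cnj (v k x) * weyl_inner \<epsilon> (a k) (w' k) x \<eta> \<partial>lborel)"
    unfolding weyl_slice_def using int by simp
  also have "\<dots> = (\<integral>x. \<i> / \<epsilon> * complex_of_real (\<eta> $ j) * (cnj (v k x) * weyl_inner \<epsilon> (a k) (w k) x \<eta>) \<partial>lborel)"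
  proof (rule Bochner_Integration.integral_cong[OF refl])
    fix x
    have "1/2 * (cnj (v k x) * weyl_inner \<epsilon> (pderiv_at (axis j 1, 0) (a k)) (w k) x \<eta>) +
       cnj (v k x) * weyl_inner \<epsilon> (a k) (w' k) x \<eta> =
       cnj (v k x) * (1/2 * weyl_inner \<epsilon> (pderiv_at (axis j 1, 0) (a k)) (w k) x \<eta> + weyl_inner \<epsilon> (a k) (w' k) x \<eta>)"
      by (simp add: algebra_simps)
    then show "1/2 * (cnj (v k x) * weyl_inner \<epsilon> (pderiv_at (axis j 1, 0) (a k)) (w k) x \<eta>) +
       cnj (v k x) * weyl_inner \<epsilon> (a k) (w' k) x \<eta> =
       \<i> / \<epsilon> * complex_of_real (\<eta> $ j) * (cnj (v k x) * weyl_inner \<epsilon> (a k) (w k) x \<eta>)"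
      unfolding weyl_inner_by_parts[OF a w] by (simp add: mult_ac)
  qed
  also have "\<dots> = \<i> / \<epsilon> * complex_of_real (\<eta> $ j) * weyl_slice (a k) (v k) (w k) \<eta>"
    unfolding weyl_slice_def by simp
  finally show ?thesis .
qed

text \<open>The commutator of the derivative with \<open>op(a)\<close>. The second half of the identity for slices
  is the complex conjugate of the first with \<open>v\<close> and \<open>w\<close> exchanged.\<close>

lemma weyl_form_derivative:
  assumes a: "symbol_family a" and w: "w \<in> W" "w' \<in> W" "dir_deriv (w k) (axis j 1) (w' k)"
    and v: "v \<in> W" "v' \<in> W" "dir_deriv (v k) (axis j 1) (v' k)"
  shows "weyl_form \<epsilon> (a k) (v' k) (w k) + weyl_form \<epsilon> (a k) (v k) (w' k)
    + weyl_form \<epsilon> (pderiv_at (axis j 1, 0) (a k)) (v k) (w k) = 0"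
proof -
  let ?a' = "\<lambda>k. pderiv_at (axis j 1, 0) (a k)"
  note a' = symbol_family_pderiv[OF a axis_Basis_phase(1)[of j]]
  have zero: "weyl_slice (a k) (v' k) (w k) \<eta> + weyl_slice (a k) (v k) (w' k) \<eta> + weyl_slice (?a' k) (v k) (w k) \<eta> = 0" for \<eta>
  proof -
    have "cnj (1/2 * weyl_slice (?a' k) (w k) (v k) \<eta> + weyl_slice (a k) (w k) (v' k) \<eta>)
      = cnj (\<i> / \<epsilon> * complex_of_real (\<eta> $ j) * weyl_slice (a k) (w k) (v k) \<eta>)"
      by (simp only: weyl_slice_by_parts[OF a v w(1)])
    then have "1/2 * weyl_slice (?a' k) (v k) (w k) \<eta> + weyl_slice (a k) (v' k) (w k) \<eta>
      = - (\<i> / \<epsilon> * complex_of_real (\<eta> $ j) * weyl_slice (a k) (v k) (w k) \<eta>)"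
      by (simp add: weyl_slice_hermitian[OF a' v(1) w(1)] weyl_slice_hermitian[OF a v(1) w(1)] weyl_slice_hermitian[OF a v(2) w(1)])
    \<comment> \<open>The boundary terms \<open>Z\<close> cancel, and the two halves of the
      differentiated symbol add up.\<close>
    moreover have "S1 + S2 + S = 0" if "1/2 * S + S1 = - Z" "1/2 * S + S2 = Z" for S S1 S2 Z :: complex
      using that by algebra
    ultimately show ?thesis
      using weyl_slice_by_parts[OF a w v(1), of \<eta>] by blast
  qed
  note int = weyl_form_eq_slice(2)[OF a w(1) v(2), of k] weyl_form_eq_slice(2)[OF a w(2) v(1), of k] weyl_form_eq_slice(2)[OF a' w(1) v(1), of k]
  have "weyl_form \<epsilon> (a k) (v' k) (w k) + weyl_form \<epsilon> (a k) (v k) (w' k) + weyl_form \<epsilon> (?a' k) (v k) (w k) =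
    weyl_const \<epsilon> TYPE('n) * (\<integral>\<eta>. weyl_slice (a k) (v' k) (w k) \<eta> + weyl_slice (a k) (v k) (w' k) \<eta> + weyl_slice (?a' k) (v k) (w k) \<eta> \<partial>lborel)"
    unfolding weyl_form_eq_slice(1)[OF a w(1) v(2)] weyl_form_eq_slice(1)[OF a w(2) v(1)] weyl_form_eq_slice(1)[OF a' w(1) v(1)]
    using int by (simp add: algebra_simps)
  then show ?thesis by (simp only: zero integral_zero mult_zero_right)
qed

text \<open>\<open>F'\<close> is the formal derivative in \<eta>_j: the phase contributes i(x_j -
  y_j)/\<epsilon>, and the factor y_j is moved onto \<open>w\<close>. Instead of differentiating
  under the integral, Fubini is applied on the unit segment from \<eta> to \<eta> + b.\<close>

lemma weyl_inner_increment:
  fixes j :: 'n and k :: 'i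
  defines "b \<equiv> axis j 1 :: real^'n"
  assumes a: "symbol_family a" and w: "w \<in> W"
  defines "F' \<equiv> \<lambda>x \<eta>. weyl_inner \<epsilon> (pderiv_at (0, b) (a k)) (w k) x \<eta> + \<i> / \<epsilon> * complex_of_real (x $ j) * weyl_inner \<epsilon> (a k) (w k) x \<eta>
     - \<i> / \<epsilon> * weyl_inner \<epsilon> (a k) (\<lambda>y. complex_of_real (y $ j) * w k y) x \<eta>"
  shows "weyl_inner \<epsilon> (a k) (w k) x (\<eta> + b) - weyl_inner \<epsilon> (a k) (w k) x \<eta>
    = (\<integral>s. indicator {0..1} s *\<^sub>R F' x (\<eta> + s *\<^sub>R b) \<partial>lborel)"
proof -
  note a' = symbol_family_pderiv[OF a axis_Basis_phase(2)[of j], folded b_def]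
  note wj = W_coord[OF w, of j]
  define P where "P \<eta> y = weyl_integrand \<epsilon> (pderiv_at (0, b) (a k)) (w k) x \<eta> y
     + \<i> / \<epsilon> * complex_of_real (x $ j) * weyl_integrand \<epsilon> (a k) (w k) x \<eta> y
     - \<i> / \<epsilon> * weyl_integrand \<epsilon> (a k) (\<lambda>y. complex_of_real (y $ j) * w k y) x \<eta> y" for \<eta> y
  note cont = integrand_continuous[OF a' w, of _ _ _ _ k] integrand_continuous[OF a w, of _ _ _ _ k] integrand_continuous[OF a wj, of _ _ _ _ k]
  note int = integrand_integrable[OF a' w, of k x] integrand_integrable[OF a w, of k x] integrand_integrable[OF a wj, of k x]
  have P_incr: "weyl_integrand \<epsilon> (a k) (w k) x (\<eta> + b) y - weyl_integrand \<epsilon> (a k) (w k) x \<eta> y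
    = (\<integral>s. indicator {0..1} s *\<^sub>R P (\<eta> + s *\<^sub>R b) y \<partial>lborel)" for y
  proof (rule dir_deriv_increment)
    have "dir_deriv (\<lambda>\<eta>. weyl_integrand \<epsilon> (a k) (w k) x \<eta> y) b
      (\<lambda>\<eta>. (complex_of_real (a k ((1/2) *\<^sub>R (x + y), \<eta>)) * exp (\<i> * complex_of_real (\<eta> \<bullet> (x - y) / \<epsilon>))) * 0 +
       (complex_of_real (a k ((1/2) *\<^sub>R (x + y), \<eta>)) *
         ((\<i> / \<epsilon> * complex_of_real (b \<bullet> (x - y))) * exp (\<i> * complex_of_real (\<eta> \<bullet> (x - y) / \<epsilon>))) +
        complex_of_real (pderiv_at (0, b) (a k) ((1/2) *\<^sub>R (x + y), \<eta>)) *
         exp (\<i> * complex_of_real (\<eta> \<bullet> (x - y) / \<epsilon>))) * w k y)"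
      unfolding weyl_integrand_def
      by (intro dir_deriv_mult dir_deriv_symbol symbol_family_smooth[OF a] dir_deriv_phase dir_deriv_const)
    also have "(\<lambda>\<eta>. (complex_of_real (a k ((1/2) *\<^sub>R (x + y), \<eta>)) * exp (\<i> * complex_of_real (\<eta> \<bullet> (x - y) / \<epsilon>))) * 0 +
       (complex_of_real (a k ((1/2) *\<^sub>R (x + y), \<eta>)) *
         ((\<i> / \<epsilon> * complex_of_real (b \<bullet> (x - y))) * exp (\<i> * complex_of_real (\<eta> \<bullet> (x - y) / \<epsilon>))) +
        complex_of_real (pderiv_at (0, b) (a k) ((1/2) *\<^sub>R (x + y), \<eta>)) *
         exp (\<i> * complex_of_real (\<eta> \<bullet> (x - y) / \<epsilon>))) * w k y) = (\<lambda>\<eta>. P \<eta> y)"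
      by (rule ext) (simp add: P_def weyl_integrand_def b_def inner_axis' algebra_simps)
    finally show "dir_deriv (\<lambda>\<eta>. weyl_integrand \<epsilon> (a k) (w k) x \<eta> y) b (\<lambda>\<eta>. P \<eta> y)" .
    show "continuous_on UNIV (\<lambda>\<eta>. P \<eta> y)"
      unfolding P_def by (intro continuous_intros cont)
  qed
  have P_int: "(\<integral>y. P \<eta> y \<partial>lborel) = F' x \<eta>" for \<eta>
    unfolding P_def F'_def weyl_inner_def using int[of \<eta>] by simp
  have P_int': "integrable lborel (P \<eta>)" for \<eta>
    unfolding P_def using int[of \<eta>] by simp
  define g where "g s y = indicator {0..1} s *\<^sub>R P (\<eta> + s *\<^sub>R b) y" for s :: real and y
  let ?M = "2 * DIM(real \<times> (real^'n))"
  have g_int: "integrable (lborel \<Otimes>\<^sub>M lborel) (case_prod g)"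
  proof -
    have bd: "\<exists>K. \<forall>s\<in>{0..1}. \<forall>y. (1 + norm y) ^ ?M * cmod (weyl_integrand \<epsilon> (c k) (u k) x (\<eta> + s *\<^sub>R b) y) \<le> K"
      if cu: "symbol_family c" "u \<in> W" for c u
    proof -
      obtain K where K: "K \<ge> 0" "\<And>k x \<eta> y. (1 + norm y) ^ ?M * cmod (weyl_integrand \<epsilon> (c k) (u k) x \<eta> y) \<le> K * (1 + norm x)\<^sup>2 * (1 + norm \<eta>)\<^sup>2"
        using integrand_bound[OF cu] by blast
      have "(1 + norm y) ^ ?M * cmod (weyl_integrand \<epsilon> (c k) (u k) x (\<eta> + s *\<^sub>R b) y) \<le> K * (1 + norm x)\<^sup>2 * (2 + norm \<eta>)\<^sup>2"
        if "s \<in> {0..1}" for s y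
      proof -
        have "norm (\<eta> + s *\<^sub>R b) \<le> norm \<eta> + 1"
          by (rule order_trans[OF norm_triangle_ineq]) (use that in \<open>simp add: b_def\<close>)
        then have "(1 + norm (\<eta> + s *\<^sub>R b))\<^sup>2 \<le> (2 + norm \<eta>)\<^sup>2"
          by (intro power_mono) auto
        then show ?thesis
          using K(1) by (intro order_trans[OF K(2)] mult_left_mono) auto
      qed
      then show ?thesis by blast
    qed
    obtain K1 where K1: "\<And>s y. s \<in> {0..1} \<Longrightarrow> (1 + norm y) ^ ?M * cmod (weyl_integrand \<epsilon> (pderiv_at (0, b) (a k)) (w k) x (\<eta> + s *\<^sub>R b) y) \<le> K1"
      using bd[OF a' w] by blast
    obtain K2 where K2: "\<And>s y. s \<in> {0..1} \<Longrightarrow> (1 + norm y) ^ ?M * cmod (weyl_integrand \<epsilon> (a k) (w k) x (\<eta> + s *\<^sub>R b) y) \<le> K2"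
      using bd[OF a w] by blast
    obtain K3 where K3: "\<And>s y. s \<in> {0..1} \<Longrightarrow> (1 + norm y) ^ ?M * cmod (weyl_integrand \<epsilon> (a k) (\<lambda>y. complex_of_real (y $ j) * w k y) x (\<eta> + s *\<^sub>R b) y) \<le> K3"
      using bd[OF a wj] by blast
    define L where "L = K1 + cmod (\<i> / \<epsilon> * complex_of_real (x $ j)) * K2 + cmod (\<i> / \<epsilon>) * K3"
    show ?thesis
    proof (rule integrable_product_weight_bound(2))
      have P_meas: "(\<lambda>z. P (\<eta> + fst z *\<^sub>R b) (snd z)) \<in> borel_measurable borel"
        unfolding P_def by (intro borel_measurable_continuous_onI continuous_intros cont)
      have ind_meas: "(\<lambda>z. indicator {0..1} (fst z) :: real) \<in> borel_measurable (borel :: (real \<times> (real^'n)) measure)"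
        by (simp add: borel_prod[symmetric])
      show "(\<lambda>z. g (fst z) (snd z)) \<in> borel_measurable borel"
        unfolding g_def by (intro borel_measurable_scaleR P_meas ind_meas)
      fix s :: real and y :: "real^'n"
      show "(1 + norm s) ^ ?M * (1 + norm y) ^ ?M * cmod (g s y) \<le> 2 ^ ?M * \<bar>L\<bar>"
      proof (cases "s \<in> {0..1}")
        case True
        have "(1 + norm y) ^ ?M * cmod (P (\<eta> + s *\<^sub>R b) y) \<le> (1 + norm y) ^ ?M * (
           cmod (weyl_integrand \<epsilon> (pderiv_at (0, b) (a k)) (w k) x (\<eta> + s *\<^sub>R b) y)
           + cmod (\<i> / \<epsilon> * complex_of_real (x $ j)) * cmod (weyl_integrand \<epsilon> (a k) (w k) x (\<eta> + s *\<^sub>R b) y)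
           + cmod (\<i> / \<epsilon>) * cmod (weyl_integrand \<epsilon> (a k) (\<lambda>y. complex_of_real (y $ j) * w k y) x (\<eta> + s *\<^sub>R b) y))"
          unfolding P_def
          by (intro mult_left_mono order_trans[OF norm_triangle_ineq4] add_mono order_trans[OF norm_triangle_ineq])
            (auto simp: norm_mult norm_divide)
        also have "\<dots> = (1 + norm y) ^ ?M * cmod (weyl_integrand \<epsilon> (pderiv_at (0, b) (a k)) (w k) x (\<eta> + s *\<^sub>R b) y)
           + cmod (\<i> / \<epsilon> * complex_of_real (x $ j)) * ((1 + norm y) ^ ?M * cmod (weyl_integrand \<epsilon> (a k) (w k) x (\<eta> + s *\<^sub>R b) y))
           + cmod (\<i> / \<epsilon>) * ((1 + norm y) ^ ?M * cmod (weyl_integrand \<epsilon> (a k) (\<lambda>y. complex_of_real (y $ j) * w k y) x (\<eta> + s *\<^sub>R b) y))"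
          by (simp only: distrib_left mult_ac)
        also have "\<dots> \<le> L"
          unfolding L_def using True by (intro add_mono mult_left_mono K1 K2 K3) auto
        finally have 1: "(1 + norm y) ^ ?M * cmod (P (\<eta> + s *\<^sub>R b) y) \<le> \<bar>L\<bar>" by simp
        have 2: "(1 + norm s) ^ ?M \<le> 2 ^ ?M"
          by (rule power_mono) (use True in auto)
        have "(1 + norm s) ^ ?M * ((1 + norm y) ^ ?M * cmod (P (\<eta> + s *\<^sub>R b) y)) \<le> 2 ^ ?M * \<bar>L\<bar>"
          by (rule mult_mono[OF 2 1]) auto
        then show ?thesis using True by (simp add: g_def mult.assoc)
      qed (simp add: g_def)
    qed
  qed
  have "weyl_inner \<epsilon> (a k) (w k) x (\<eta> + b) - weyl_inner \<epsilon> (a k) (w k) x \<eta> =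
    (\<integral>y. weyl_integrand \<epsilon> (a k) (w k) x (\<eta> + b) y - weyl_integrand \<epsilon> (a k) (w k) x \<eta> y \<partial>lborel)"
    unfolding weyl_inner_def using int(2) by simp
  also have "\<dots> = (\<integral>y. (\<integral>s. g s y \<partial>lborel) \<partial>lborel)"
    unfolding P_incr g_def ..
  also have "\<dots> = (\<integral>s. (\<integral>y. g s y \<partial>lborel) \<partial>lborel)"
    by (rule lborel_pair.Fubini_integral[OF g_int])
  also have "\<dots> = (\<integral>s. indicator {0..1} s *\<^sub>R F' x (\<eta> + s *\<^sub>R b) \<partial>lborel)"
    unfolding g_def P_int[symmetric] by simp
  finally show ?thesis .
qed

text \<open>The derivative of the inner integral in \<eta>_j has zero integral over \<eta>. Its
  three terms are those of the commutator of x_j with op(a), up to the factor i \<epsilon>.\<close>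

lemma op_weyl_commute_coord:
  assumes a: "symbol_family a" and w: "w \<in> W"
  shows "complex_of_real (x $ j) * op_weyl \<epsilon> (a k) (w k) x - op_weyl \<epsilon> (a k) (\<lambda>y. complex_of_real (y $ j) * w k y) x
    = \<i> * \<epsilon> * op_weyl \<epsilon> (pderiv_at (0, axis j 1) (a k)) (w k) x"
proof -
  note a' = symbol_family_pderiv[OF a axis_Basis_phase(2)[of j]]
  note wj = W_coord[OF w, of j]
  note int = weyl_inner_integrable[OF a' w, of k x] weyl_inner_integrable[OF a w, of k x] weyl_inner_integrable[OF a wj, of k x]
  let ?A = "weyl_inner \<epsilon> (pderiv_at (0, axis j 1) (a k)) (w k) x" and ?B = "weyl_inner \<epsilon> (a k) (w k) x"
    and ?C = "weyl_inner \<epsilon> (a k) (\<lambda>y. complex_of_real (y $ j) * w k y) x"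
  have "(\<integral>\<eta>. ?A \<eta> + \<i> / \<epsilon> * complex_of_real (x $ j) * ?B \<eta> - \<i> / \<epsilon> * ?C \<eta> \<partial>lborel) = 0"
    by (rule integral_increment_zero[OF int(2) _ weyl_inner_increment[OF a w]])
      (use int in \<open>auto intro!: Bochner_Integration.integrable_add Bochner_Integration.integrable_diff\<close>)
  then have zero: "(\<integral>\<eta>. ?A \<eta> \<partial>lborel) + \<i> / \<epsilon> * complex_of_real (x $ j) * (\<integral>\<eta>. ?B \<eta> \<partial>lborel) - \<i> / \<epsilon> * (\<integral>\<eta>. ?C \<eta> \<partial>lborel) = 0"
    using int by simp
  have alg: "c * A = x * B - C" if "A + d * x * B - d * C = 0" "c * d = -1" for A B C c d x :: complex
    using that by algebra
  have "\<i> * \<epsilon> * (\<i> / \<epsilon>) = -1" using eps by simp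
  from alg[OF zero this] have "\<i> * \<epsilon> * (\<integral>\<eta>. ?A \<eta> \<partial>lborel) = complex_of_real (x $ j) * (\<integral>\<eta>. ?B \<eta> \<partial>lborel) - (\<integral>\<eta>. ?C \<eta> \<partial>lborel)" .
  from arg_cong[OF this, of "\<lambda>z. weyl_const \<epsilon> TYPE('n) * z"] show ?thesis
    unfolding op_weyl_eq by (simp only: right_diff_distrib mult_ac)
qed

lemma weyl_form_coord:
  assumes a: "symbol_family a" and w: "w \<in> W" and v: "v \<in> W"
  shows "weyl_form \<epsilon> (a k) (\<lambda>x. complex_of_real (x $ j) * v k x) (w k)
     - weyl_form \<epsilon> (a k) (v k) (\<lambda>x. complex_of_real (x $ j) * w k x)
    = \<i> * \<epsilon> * weyl_form \<epsilon> (pderiv_at (0, axis j 1) (a k)) (v k) (w k)"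
proof -
  note a' = symbol_family_pderiv[OF a axis_Basis_phase(2)[of j]]
  note int = op_weyl_pairing_integrable[OF a w W_coord[OF v, of j], of k] op_weyl_pairing_integrable[OF a W_coord[OF w, of j] v, of k]
  have "weyl_form \<epsilon> (a k) (\<lambda>x. complex_of_real (x $ j) * v k x) (w k)
     - weyl_form \<epsilon> (a k) (v k) (\<lambda>x. complex_of_real (x $ j) * w k x) =
     (\<integral>x. cnj (complex_of_real (x $ j) * v k x) * op_weyl \<epsilon> (a k) (w k) x
        - cnj (v k x) * op_weyl \<epsilon> (a k) (\<lambda>x. complex_of_real (x $ j) * w k x) x \<partial>lborel)"
    unfolding weyl_form_def L2_inner_def using int by simp
  also have "\<dots> = (\<integral>x. (\<i> * \<epsilon>) * (cnj (v k x) * op_weyl \<epsilon> (pderiv_at (0, axis j 1) (a k)) (w k) x) \<partial>lborel)"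
  proof (rule Bochner_Integration.integral_cong[OF refl])
    fix x :: "real^'n"
    show "cnj (complex_of_real (x $ j) * v k x) * op_weyl \<epsilon> (a k) (w k) x
        - cnj (v k x) * op_weyl \<epsilon> (a k) (\<lambda>x. complex_of_real (x $ j) * w k x) x
      = (\<i> * \<epsilon>) * (cnj (v k x) * op_weyl \<epsilon> (pderiv_at (0, axis j 1) (a k)) (w k) x)"
      using arg_cong[OF op_weyl_commute_coord[OF a w, of x j k], of "\<lambda>z. cnj (v k x) * z"]
      by (simp add: algebra_simps)
  qed
  also have "\<dots> = \<i> * \<epsilon> * weyl_form \<epsilon> (pderiv_at (0, axis j 1) (a k)) (v k) (w k)"
    unfolding weyl_form_def L2_inner_def by simp
  finally show ?thesis .
qed

lemma weyl_form_add_left: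
  assumes "symbol_family a" "w \<in> W" "v \<in> W" "v' \<in> W"
  shows "weyl_form \<epsilon> (a k) (\<lambda>x. v k x + v' k x) (w k) = weyl_form \<epsilon> (a k) (v k) (w k) + weyl_form \<epsilon> (a k) (v' k) (w k)"
  unfolding weyl_form_def L2_inner_def
  using op_weyl_pairing_integrable[OF assms(1,2,3), of k] op_weyl_pairing_integrable[OF assms(1,2,4), of k]
  by (simp add: distrib_right)

lemma weyl_form_cmult_left: "weyl_form \<epsilon> f (\<lambda>x. c * v x) w = cnj c * weyl_form \<epsilon> f v w"
  unfolding weyl_form_def L2_inner_def by (simp add: mult.assoc)

lemma weyl_form_sum_left:
  assumes "symbol_family a" "w \<in> W" and "finite S" "\<And>j. j \<in> S \<Longrightarrow> v j \<in> W"
  shows "weyl_form \<epsilon> (a k) (\<lambda>x. \<Sum>j\<in>S. c j * v j k x) (w k) = (\<Sum>j\<in>S. cnj (c j) * weyl_form \<epsilon> (a k) (v j k) (w k))"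
  using assms(3,4)
proof (induction S rule: finite_induct)
  case empty
  show ?case by (simp add: weyl_form_def L2_inner_def)
next
  case (insert j S)
  have 1: "(\<lambda>k x. c j * v j k x) \<in> W" using insert.prems by (intro W_cmult') auto
  have 2: "(\<lambda>k x. \<Sum>j\<in>S. c j * v j k x) \<in> W"
    using insert by (intro W_sum[OF _ assms(2)] W_cmult') auto
  show ?case
    using weyl_form_add_left[OF assms(1,2) 1 2, of k] insert
    by (simp add: weyl_form_cmult_left)
qed

text \<open>Deduced from additivity on the left by Hermitian symmetry, which avoids splitting the
  iterated integral inside \<open>op_weyl\<close>.\<close>

lemma weyl_form_sum_right:
  assumes "symbol_family a" "w \<in> W" and "finite S" "\<And>j. j \<in> S \<Longrightarrow> v j \<in> W"
  shows "weyl_form \<epsilon> (a k) (w k) (\<lambda>x. \<Sum>j\<in>S. c j * v j k x) = (\<Sum>j\<in>S. c j * weyl_form \<epsilon> (a k) (w k) (v j k))"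
proof -
  have 2: "(\<lambda>k x. \<Sum>j\<in>S. c j * v j k x) \<in> W"
    using assms by (intro W_sum[OF _ assms(2)] W_cmult') auto
  have "weyl_form \<epsilon> (a k) (w k) (\<lambda>x. \<Sum>j\<in>S. c j * v j k x) = cnj (weyl_form \<epsilon> (a k) (\<lambda>x. \<Sum>j\<in>S. c j * v j k x) (w k))"
    by (rule weyl_form_hermitian[OF assms(1,2) 2, symmetric])
  also have "\<dots> = (\<Sum>j\<in>S. c j * cnj (weyl_form \<epsilon> (a k) (v j k) (w k)))"
    by (simp add: weyl_form_sum_left[OF assms])
  also have "\<dots> = (\<Sum>j\<in>S. c j * weyl_form \<epsilon> (a k) (w k) (v j k))"
    using assms by (intro sum.cong refl) (simp add: weyl_form_hermitian)
  finally show ?thesis .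
qed

text \<open>Dominated convergence twice, in y for the inner integral and in (x, \<eta>) for the
  pairing. The bounds are uniform in the index and therefore supply the dominating
  functions.\<close>

lemma weyl_form_tendsto:
  assumes a: "symbol_family a" and w: "w \<in> W" and v: "v \<in> W"
    and lim: "\<And>z. (\<lambda>n. a (\<kappa> n) z) \<longlonglongrightarrow> a l z" "\<And>x. (\<lambda>n. w (\<kappa> n) x) \<longlonglongrightarrow> w l x"
      "\<And>x. (\<lambda>n. v (\<kappa> n) x) \<longlonglongrightarrow> v l x"
  shows "(\<lambda>n. weyl_form \<epsilon> (a (\<kappa> n)) (v (\<kappa> n)) (w (\<kappa> n))) \<longlonglongrightarrow> weyl_form \<epsilon> (a l) (v l) (w l)"
proof -
  let ?D = "2 * DIM(real^'n)" and ?M = "2 * DIM((real^'n) \<times> (real^'n))"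
  obtain K where K: "\<And>k x \<eta> y. (1 + norm y) ^ ?D * cmod (weyl_integrand \<epsilon> (a k) (w k) x \<eta> y) \<le> K * (1 + norm x)\<^sup>2 * (1 + norm \<eta>)\<^sup>2"
    using integrand_bound[OF a w] by blast
  have inner: "(\<lambda>n. weyl_inner \<epsilon> (a (\<kappa> n)) (w (\<kappa> n)) x \<eta>) \<longlonglongrightarrow> weyl_inner \<epsilon> (a l) (w l) x \<eta>" for x \<eta>
    unfolding weyl_inner_def
  proof (rule integral_dominated_convergence)
    show "integrable lborel (\<lambda>y::real^'n. (K * (1 + norm x)\<^sup>2 * (1 + norm \<eta>)\<^sup>2) * inverse ((1 + norm y) ^ ?D))"
      by (intro integrable_mult_right integrable_norm_weight)
    show "AE y in lborel. (\<lambda>n. weyl_integrand \<epsilon> (a (\<kappa> n)) (w (\<kappa> n)) x \<eta> y) \<longlonglongrightarrow> weyl_integrand \<epsilon> (a l) (w l) x \<eta> y"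
      unfolding weyl_integrand_def by (intro AE_I2 tendsto_intros lim)
    show "AE y in lborel. norm (weyl_integrand \<epsilon> (a (\<kappa> n)) (w (\<kappa> n)) x \<eta> y) \<le> (K * (1 + norm x)\<^sup>2 * (1 + norm \<eta>)\<^sup>2) * inverse ((1 + norm y) ^ ?D)" for n
    proof (rule AE_I2)
      fix y :: "real^'n"
      have "(1 + norm y) ^ ?D > 0" by (intro zero_less_power add_pos_nonneg) auto
      then show "norm (weyl_integrand \<epsilon> (a (\<kappa> n)) (w (\<kappa> n)) x \<eta> y) \<le> (K * (1 + norm x)\<^sup>2 * (1 + norm \<eta>)\<^sup>2) * inverse ((1 + norm y) ^ ?D)"
        using K[of y "\<kappa> n" x \<eta>] by (simp add: field_simps)
    qed
  qed (use integrand_integrable[OF a w] in auto)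
  obtain L where L: "\<And>k x \<eta>. (1 + norm x) ^ ?M * (1 + norm \<eta>) ^ ?M * cmod (cnj (v k x) * weyl_inner \<epsilon> (a k) (w k) x \<eta>) \<le> L"
    using weyl_inner_product_bound[OF a w v] by blast
  have "(\<lambda>n. \<integral>z. cnj (v (\<kappa> n) (fst z)) * weyl_inner \<epsilon> (a (\<kappa> n)) (w (\<kappa> n)) (fst z) (snd z) \<partial>lborel)
    \<longlonglongrightarrow> (\<integral>z. cnj (v l (fst z)) * weyl_inner \<epsilon> (a l) (w l) (fst z) (snd z) \<partial>lborel)"
  proof (rule integral_dominated_convergence)
    show "integrable lborel (\<lambda>z::(real^'n) \<times> (real^'n). L * inverse ((1 + norm z) ^ ?M))"
      by (intro integrable_mult_right integrable_norm_weight)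
    show "AE z in lborel. (\<lambda>n. cnj (v (\<kappa> n) (fst z)) * weyl_inner \<epsilon> (a (\<kappa> n)) (w (\<kappa> n)) (fst z) (snd z))
       \<longlonglongrightarrow> cnj (v l (fst z)) * weyl_inner \<epsilon> (a l) (w l) (fst z) (snd z)"
      by (intro AE_I2 tendsto_intros lim inner)
    show "AE z in lborel. norm (cnj (v (\<kappa> n) (fst z)) * weyl_inner \<epsilon> (a (\<kappa> n)) (w (\<kappa> n)) (fst z) (snd z)) \<le> L * inverse ((1 + norm z) ^ ?M)" for n
    proof (rule AE_I2)
      fix z :: "(real^'n) \<times> (real^'n)"
      let ?f = "cnj (v (\<kappa> n) (fst z)) * weyl_inner \<epsilon> (a (\<kappa> n)) (w (\<kappa> n)) (fst z) (snd z)"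
      have "1 + norm z \<le> (1 + norm (fst z)) * (1 + norm (snd z))"
        using norm_Pair_le[of "fst z" "snd z"] mult_nonneg_nonneg[OF norm_ge_zero[of "fst z"] norm_ge_zero[of "snd z"]]
        by (simp only: distrib_left distrib_right mult_1 mult_1_right prod.collapse)
      then have "(1 + norm z) ^ ?M \<le> ((1 + norm (fst z)) * (1 + norm (snd z))) ^ ?M"
        by (rule power_mono) auto
      then have "(1 + norm z) ^ ?M * cmod ?f \<le> (1 + norm (fst z)) ^ ?M * (1 + norm (snd z)) ^ ?M * cmod ?f"
        unfolding power_mult_distrib by (rule mult_right_mono) auto
      also have "\<dots> \<le> L" by (rule L)
      finally have "(1 + norm z) ^ ?M * cmod ?f \<le> L" .
      moreover have "(1 + norm z) ^ ?M > 0" by (intro zero_less_power add_pos_nonneg) auto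
      ultimately show "norm ?f \<le> L * inverse ((1 + norm z) ^ ?M)"
        by (simp add: field_simps)
    qed
  qed (use weyl_pairing_integrable(1)[OF a w v] in auto)
  then show ?thesis
    unfolding weyl_form_eq_phase_integral[OF a w v] by (rule tendsto_mult[OF tendsto_const])
qed

end

subsection \<open>Gaussian wave packets\<close>

text \<open>Polynomial multiples of the packet, uniformly along a family. Coefficients may vary with
  the index as long as they are bounded, since the gradient of \<open>u k\<close> has coefficients
  depending on \<open>k\<close>. Closure under derivatives is not a rule; it follows from the
  Gaussian form of \<open>u\<close>.\<close>

inductive_set packets :: "('i \<Rightarrow> real^'n \<Rightarrow> complex) \<Rightarrow> ('i \<Rightarrow> real^'n \<Rightarrow> complex) set" for u where
  packets_base: "u \<in> packets u"
| packets_coord: "w \<in> packets u \<Longrightarrow> (\<lambda>k x. complex_of_real (x $ j) * w k x) \<in> packets u"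
| packets_add: "w \<in> packets u \<Longrightarrow> w' \<in> packets u \<Longrightarrow> (\<lambda>k x. w k x + w' k x) \<in> packets u"
| packets_cmult: "w \<in> packets u \<Longrightarrow> (\<And>k. cmod (c k) \<le> K) \<Longrightarrow> (\<lambda>k x. c k * w k x) \<in> packets u"

lemma packets_sum:
  assumes "finite S" "\<And>j. j \<in> S \<Longrightarrow> w j \<in> packets u"
  shows "(\<lambda>k x. \<Sum>j\<in>S. w j k x) \<in> packets u"
  using assms
proof (induction S rule: finite_induct)
  case empty
  then show ?case using packets_cmult[OF packets_base, of "\<lambda>_. 0" 0] by simp
next
  case (insert j S)
  then show ?case using packets_add[of "w j" u "\<lambda>k x. \<Sum>j\<in>S. w j k x"] by simp
qed

definition centered :: "real^'n \<Rightarrow> 'n \<Rightarrow> real^'n \<Rightarrow> complex" where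
  "centered q j x = complex_of_real (x $ j - q $ j)"

text \<open>The logarithmic derivative of the packet in direction \<open>j\<close>.\<close>

definition packet_gradient ::
  "real \<Rightarrow> real^'n \<Rightarrow> real^'n \<Rightarrow> complex^'n^'n \<Rightarrow> 'n \<Rightarrow> real^'n \<Rightarrow> complex" where
  "packet_gradient \<epsilon> q p C j x = \<i> / \<epsilon> * (complex_of_real (p $ j) + (\<Sum>l\<in>UNIV. C $ j $ l * centered q l x))"

definition gauss_exponent ::
  "real^'n \<Rightarrow> real^'n \<Rightarrow> complex^'n^'n \<Rightarrow> complex \<Rightarrow> real^'n \<Rightarrow> complex" where
  "gauss_exponent q p C \<zeta> x = 1/2 * (\<Sum>i\<in>UNIV. \<Sum>l\<in>UNIV. C $ i $ l * centered q i x * centered q l x)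
     + (\<Sum>i\<in>UNIV. p $ i * centered q i x) + \<zeta>"

lemma gauss_eq: "gauss \<epsilon> q p C \<zeta> x = exp (\<i> / \<epsilon> * gauss_exponent q p C \<zeta> x)"
proof -
  have "bdot (cvec (x - q)) (C *v cvec (x - q)) = (\<Sum>i\<in>UNIV. \<Sum>l\<in>UNIV. C $ i $ l * centered q i x * centered q l x)"
    by (simp add: bdot_def cvec_def matrix_vector_mult_def centered_def sum_distrib_left mult_ac)
  moreover have "complex_of_real ((x - q) \<bullet> p) = (\<Sum>i\<in>UNIV. p $ i * centered q i x)"
    by (simp add: inner_vec_def centered_def mult.commute)
  ultimately show ?thesis by (simp add: gauss_def gauss_exponent_def)
qed

lemma dir_deriv_sum:
  "(\<And>i. i \<in> S \<Longrightarrow> dir_deriv (f i) b (f' i)) \<Longrightarrow> dir_deriv (\<lambda>x. \<Sum>i\<in>S. f i x) b (\<lambda>x. \<Sum>i\<in>S. f' i x)"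
  unfolding dir_deriv_def by (auto intro!: has_vector_derivative_sum)

lemma dir_deriv_centered:
  fixes q :: "real^'n"
  shows "dir_deriv (centered q i) (axis j 1) (\<lambda>x. if i = j then 1 else 0)"
proof -
  have "dir_deriv (\<lambda>x::real^'n. complex_of_real (x \<bullet> axis i 1) + - complex_of_real (q $ i)) (axis j 1)
    (\<lambda>x. complex_of_real ((axis j 1 :: real^'n) \<bullet> axis i 1) + 0)"
    by (intro dir_deriv_add dir_deriv_inner dir_deriv_const)
  moreover have "(\<lambda>x. complex_of_real (x \<bullet> axis i 1) + - complex_of_real (q $ i)) = centered q i"
    by (rule ext) (simp add: centered_def inner_axis)
  moreover have "complex_of_real ((axis j 1 :: real^'n) \<bullet> axis i 1) + 0 = (if i = j then 1 else 0)"
    by (simp add: inner_axis_axis)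
  ultimately show ?thesis by simp
qed

lemma dir_deriv_gauss:
  assumes "transpose C = C"
  shows "dir_deriv (gauss \<epsilon> q p C \<zeta>) (axis j 1) (\<lambda>x. packet_gradient \<epsilon> q p C j x * gauss \<epsilon> q p C \<zeta> x)"
proof -
  have sym: "C $ i $ l = C $ l $ i" for i l
    using assms by (metis transpose_def vec_lambda_beta)
  let ?d = "\<lambda>i. (if i = j then 1 else 0) :: complex"
  have "dir_deriv (\<lambda>x. \<i> / \<epsilon> * gauss_exponent q p C \<zeta> x) (axis j 1)
     (\<lambda>x. \<i> / \<epsilon> * (1/2 * (\<Sum>i\<in>UNIV. \<Sum>l\<in>UNIV. C $ i $ l * centered q i x * ?d l + C $ i $ l * ?d i * centered q l x)
       + (\<Sum>i\<in>UNIV. p $ i * ?d i) + 0))"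
    unfolding gauss_exponent_def
    by (intro dir_deriv_add dir_deriv_cmult dir_deriv_const dir_deriv_sum dir_deriv_mult dir_deriv_centered)
  also have "(\<lambda>x. \<i> / \<epsilon> * (1/2 * (\<Sum>i\<in>UNIV. \<Sum>l\<in>UNIV. C $ i $ l * centered q i x * ?d l + C $ i $ l * ?d i * centered q l x)
       + (\<Sum>i\<in>UNIV. p $ i * ?d i) + 0)) = packet_gradient \<epsilon> q p C j"
  proof (rule ext)
    fix x
    have "(\<Sum>i\<in>UNIV. \<Sum>l\<in>UNIV. C $ i $ l * centered q i x * ?d l) = (\<Sum>i\<in>UNIV. C $ j $ i * centered q i x)"
      by (simp add: if_distrib sym[of _ j] cong: if_cong)
    moreover have "(\<Sum>i\<in>UNIV. \<Sum>l\<in>UNIV. C $ i $ l * ?d i * centered q l x) = (\<Sum>l\<in>UNIV. C $ j $ l * centered q l x)"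
      by (subst sum.swap) (simp add: if_distrib if_distribR[of _ "(*) _"] cong: if_cong)
    moreover have "(\<Sum>i\<in>UNIV. p $ i * ?d i) = complex_of_real (p $ j)"
      by (simp add: if_distrib cong: if_cong)
    ultimately show "\<i> / \<epsilon> * (1/2 * (\<Sum>i\<in>UNIV. \<Sum>l\<in>UNIV. C $ i $ l * centered q i x * ?d l + C $ i $ l * ?d i * centered q l x)
       + (\<Sum>i\<in>UNIV. p $ i * ?d i) + 0) = packet_gradient \<epsilon> q p C j x"
      unfolding sum.distrib packet_gradient_def by simp
  qed
  finally have "dir_deriv (\<lambda>x. \<i> / \<epsilon> * gauss_exponent q p C \<zeta> x) (axis j 1) (packet_gradient \<epsilon> q p C j)" .
  from dir_deriv_exp[OF this] show ?thesis
    by (simp only: gauss_eq[abs_def])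
qed

lemma norm_gauss:
  assumes "\<epsilon> > 0"
  shows "cmod (gauss \<epsilon> q p C \<zeta> x) = exp (- (1/2 * ((x - q) \<bullet> (Im_mat C *v (x - q))) + Im \<zeta>) / \<epsilon>)"
proof -
  have "Im (bdot (cvec v) (C *v cvec v)) = v \<bullet> (Im_mat C *v v)" for v
    by (simp add: bdot_def cvec_def matrix_vector_mult_def inner_vec_def Im_mat_def Im_sum sum_distrib_left)
  moreover have "Re (\<i> / \<epsilon> * z) = - Im z / \<epsilon>" for z
  proof -
    have "\<i> / \<epsilon> * z = (\<i> * z) / complex_of_real \<epsilon>" by simp
    then show ?thesis by (simp only: Re_divide_of_real Re_i_times)
  qed
  ultimately show ?thesis
    unfolding gauss_def norm_exp_eq_Re by simp
qed

lemma gauss_continuous: "continuous_on A (gauss \<epsilon> q p C \<zeta>)"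
  unfolding gauss_eq[abs_def] gauss_exponent_def centered_def
  by (cases "\<epsilon> = 0") (auto intro!: continuous_intros)

text \<open>By (1 + r)^N \<le> exp(N r) it remains to maximise N r - \<delta> r^2; completing the
  square gives the constant.\<close>

lemma polynomial_gaussian_bound:
  fixes \<delta> r :: real
  assumes "\<delta> > 0" "r \<ge> 0"
  shows "(1 + r) ^ N * exp (- \<delta> * r\<^sup>2) \<le> exp ((real N)\<^sup>2 / (4 * \<delta>))"
proof -
  have "(1 + r) ^ N \<le> exp r ^ N"
    using assms by (intro power_mono) (auto intro: exp_ge_add_one_self)
  then have "(1 + r) ^ N * exp (- \<delta> * r\<^sup>2) \<le> exp (real N * r) * exp (- \<delta> * r\<^sup>2)"
    by (intro mult_right_mono) (auto simp: exp_of_nat_mult)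
  also have "\<dots> = exp (real N * r - \<delta> * r\<^sup>2)"
    by (simp add: exp_add[symmetric])
  also have "real N * r - \<delta> * r\<^sup>2 = (real N)\<^sup>2 / (4 * \<delta>) - \<delta> * (r - real N / (2 * \<delta>))\<^sup>2"
    using assms by (simp add: power2_eq_square field_simps)
  also have "exp \<dots> \<le> exp ((real N)\<^sup>2 / (4 * \<delta>))"
    using assms by simp
  finally show ?thesis .
qed

text \<open>A common coercivity constant for Im C and a common bound on the parameters make all
  Gaussian estimates independent of the index. Rapid decay passes to coordinate multiples at the
  cost of one power.\<close>

lemma packets_schwartz:
  fixes q p :: "'i \<Rightarrow> real^'n"
  assumes eps: "\<epsilon> > 0" and c: "c > 0"
    and sym: "\<And>k. transpose (C k) = C k"
    and pos: "\<And>k v. c * (norm v)\<^sup>2 \<le> v \<bullet> (Im_mat (C k) *v v)"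
    and bd: "\<And>k. norm (q k) \<le> R" "\<And>k. norm (p k) \<le> R" "\<And>k. norm (C k) \<le> R" "\<And>k. cmod (\<zeta> k) \<le> R"
  shows "schwartz_class (packets (\<lambda>k. gauss \<epsilon> (q k) (p k) (C k) (\<zeta> k))) \<epsilon>"
proof
  let ?u = "\<lambda>k. gauss \<epsilon> (q k) (p k) (C k) (\<zeta> k)"
  show "\<epsilon> > 0" by fact
  have R0: "R \<ge> 0" using order_trans[OF norm_ge_zero bd(1)] .
  show "continuous_on UNIV (w k)" if "w \<in> packets ?u" for w k
    using that by induction (auto intro!: continuous_intros gauss_continuous)
  show "\<exists>K. \<forall>k x. (1 + norm x) ^ N * cmod (w k x) \<le> K" if "w \<in> packets ?u" for w N
    using that
  proof (induction arbitrary: N)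
    case packets_base
    \<comment> \<open>The rate at which the modulus decays: it is at most a constant times exp(-c |x
      - q|^2 / (2 \<epsilon>)).\<close>
    define \<delta> where "\<delta> = c / (2 * \<epsilon>)"
    have \<delta>: "\<delta> > 0" using c eps by (simp add: \<delta>_def)
    let ?K = "(1 + R) ^ N * (exp (R / \<epsilon>) * exp ((real N)\<^sup>2 / (4 * \<delta>)))"
    have "(1 + norm x) ^ N * cmod (?u k x) \<le> ?K" for k x
    proof -
      define r where "r = norm (x - q k)"
      have r: "r \<ge> 0" by (simp add: r_def)
      have "- (1/2 * ((x - q k) \<bullet> (Im_mat (C k) *v (x - q k))) + Im (\<zeta> k)) / \<epsilon> \<le> - (1/2 * (c * r\<^sup>2) - R) / \<epsilon>"
        using pos[of "x - q k" k] bd(4)[of k] abs_Im_le_cmod[of "\<zeta> k"] eps unfolding r_def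
        by (intro divide_right_mono) auto
      also have "\<dots> = R / \<epsilon> + - \<delta> * r\<^sup>2"
        using eps by (simp add: \<delta>_def field_simps)
      finally have u: "cmod (?u k x) \<le> exp (R / \<epsilon>) * exp (- \<delta> * r\<^sup>2)"
        unfolding norm_gauss[OF eps] by (simp add: exp_add[symmetric])
      have "norm x \<le> norm (x - q k) + norm (q k)"
        using norm_triangle_ineq[of "x - q k" "q k"] by simp
      then have "1 + norm x \<le> (1 + R) * (1 + r)"
        using bd(1)[of k] mult_nonneg_nonneg[OF R0 r] unfolding r_def distrib_left distrib_right by linarith
      then have "(1 + norm x) ^ N \<le> ((1 + R) * (1 + r)) ^ N"
        by (intro power_mono) auto
      then have "(1 + norm x) ^ N * cmod (?u k x) \<le> ((1 + R) * (1 + r)) ^ N * (exp (R / \<epsilon>) * exp (- \<delta> * r\<^sup>2))"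
        using u R0 r by (intro mult_mono) auto
      also have "\<dots> = (1 + R) ^ N * (exp (R / \<epsilon>) * ((1 + r) ^ N * exp (- \<delta> * r\<^sup>2)))"
        by (simp add: power_mult_distrib mult_ac)
      also have "\<dots> \<le> ?K"
        using R0 by (intro mult_left_mono polynomial_gaussian_bound \<delta> r) auto
      finally show ?thesis .
    qed
    then show ?case by blast
  next
    case (packets_coord w j)
    obtain K where K: "\<And>k x. (1 + norm x) ^ Suc N * cmod (w k x) \<le> K"
      using packets_coord.IH by blast
    have "(1 + norm x) ^ N * cmod (complex_of_real (x $ j) * w k x) \<le> K" for k x
    proof -
      have "\<bar>x $ j\<bar> \<le> 1 + norm x" using component_le_norm_cart[of x j] by simp
      then have "(1 + norm x) ^ N * (\<bar>x $ j\<bar> * cmod (w k x)) \<le> (1 + norm x) ^ N * ((1 + norm x) * cmod (w k x))"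
        by (intro mult_left_mono mult_right_mono) auto
      also have "\<dots> \<le> K" using K[of x k] by (simp add: mult_ac)
      finally show ?thesis by (simp add: norm_mult)
    qed
    then show ?case by blast
  next
    case (packets_add w w')
    obtain K where K: "\<And>k x. (1 + norm x) ^ N * cmod (w k x) \<le> K"
      using packets_add.IH by blast
    obtain K' where K': "\<And>k x. (1 + norm x) ^ N * cmod (w' k x) \<le> K'"
      using packets_add.IH by blast
    have "(1 + norm x) ^ N * cmod (w k x + w' k x) \<le> K + K'" for k x
    proof -
      have "(1 + norm x) ^ N * cmod (w k x + w' k x) \<le> (1 + norm x) ^ N * (cmod (w k x) + cmod (w' k x))"
        by (intro mult_left_mono norm_triangle_ineq) auto
      also have "\<dots> \<le> K + K'" using K[of x k] K'[of x k] by (simp add: distrib_left)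
      finally show ?thesis .
    qed
    then show ?case by blast
  next
    case (packets_cmult w b L)
    obtain K where K: "\<And>k x. (1 + norm x) ^ N * cmod (w k x) \<le> K"
      using packets_cmult.IH by blast
    have "(1 + norm x) ^ N * cmod (b k * w k x) \<le> L * K" for k x
    proof -
      have "(1 + norm x) ^ N * cmod (b k * w k x) = cmod (b k) * ((1 + norm x) ^ N * cmod (w k x))"
        by (simp add: norm_mult mult_ac)
      also have "\<dots> \<le> L * K"
        using packets_cmult.hyps(2)[of k] K order_trans[OF norm_ge_zero packets_cmult.hyps(2)]
        by (intro mult_mono) auto
      finally show ?thesis .
    qed
    then show ?case by blast
  qed
  show "\<exists>w'\<in>packets ?u. \<forall>k. dir_deriv (w k) (axis j 1) (w' k)" if "w \<in> packets ?u" for w j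
    using that
  proof induction
    case packets_base
    \<comment> \<open>The product of \<open>packet_gradient\<close> and the packet, multiplied out
      so that every term is produced by the rules of \<open>packets\<close> with coefficients
      bounded in \<open>k\<close>.\<close>
    define Du where "Du k x = \<i> / \<epsilon> * (complex_of_real (p k $ j) * ?u k x + (\<Sum>l\<in>UNIV. (C k $ j $ l) * (complex_of_real (x $ l) * ?u k x + - complex_of_real (q k $ l) * ?u k x)))" for k x
    have "Du \<in> packets ?u"
      unfolding Du_def
    proof (intro packets.packets_cmult packets.packets_add packets_sum packets.packets_coord packets.packets_base)
      show "cmod (\<i> / \<epsilon>) \<le> cmod (\<i> / \<epsilon>)" by simp
      show "cmod (complex_of_real (p k $ j)) \<le> R" for k
        using component_le_norm_cart[of "p k" j] bd(2)[of k] by simp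
      show "cmod (- complex_of_real (q k $ l)) \<le> R" for k l
        using component_le_norm_cart[of "q k" l] bd(1)[of k] by simp
      show "cmod (C k $ j $ l) \<le> R" for k l
        using Finite_Cartesian_Product.norm_nth_le[of "C k $ j" l] Finite_Cartesian_Product.norm_nth_le[of "C k" j] bd(3)[of k] by simp
    qed simp
    moreover have "dir_deriv (?u k) (axis j 1) (Du k)" for k
    proof -
      have "Du k = (\<lambda>x. packet_gradient \<epsilon> (q k) (p k) (C k) j x * ?u k x)"
        by (rule ext) (simp add: Du_def packet_gradient_def centered_def sum_distrib_right
            left_diff_distrib right_diff_distrib distrib_right mult.assoc)
      then show ?thesis using dir_deriv_gauss[OF sym, of \<epsilon> "q k" "p k" k "\<zeta> k" j] by simp
    qed
    ultimately show ?case by blast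
  next
    case (packets_coord w l)
    then obtain w' where w': "w' \<in> packets ?u" "\<And>k. dir_deriv (w k) (axis j 1) (w' k)" by blast
    let ?d = "(if l = j then 1 else 0) :: complex"
    have "(\<lambda>k x. complex_of_real (x $ l) * w' k x + ?d * w k x) \<in> packets ?u"
      by (rule packets.packets_add[OF packets.packets_coord[OF w'(1)] packets.packets_cmult[where K = 1]])
        (use packets_coord in auto)
    moreover have "dir_deriv (\<lambda>x. complex_of_real (x $ l) * w k x) (axis j 1) (\<lambda>x. complex_of_real (x $ l) * w' k x + ?d * w k x)" for k
      using dir_deriv_mult[OF dir_deriv_centered[of 0 l j] w'(2)[of k]] by (simp add: centered_def)
    ultimately show ?case by (intro bexI[of _ "\<lambda>k x. complex_of_real (x $ l) * w' k x + ?d * w k x"] allI)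
  next
    case (packets_add w v)
    obtain w' where w': "w' \<in> packets ?u" "\<And>k. dir_deriv (w k) (axis j 1) (w' k)"
      using packets_add.IH(1) by blast
    obtain v' where v': "v' \<in> packets ?u" "\<And>k. dir_deriv (v k) (axis j 1) (v' k)"
      using packets_add.IH(2) by blast
    show ?case
      by (intro bexI[of _ "\<lambda>k x. w' k x + v' k x"] allI dir_deriv_add w' v' packets.packets_add)
  next
    case (packets_cmult w b L)
    obtain w' where w': "w' \<in> packets ?u" "\<And>k. dir_deriv (w k) (axis j 1) (w' k)"
      using packets_cmult.IH by blast
    show ?case
      by (intro bexI[of _ "\<lambda>k x. b k * w' k x"] allI dir_deriv_cmult w' packets.packets_cmult)
        (rule packets_cmult.hyps)
  qed
qed (auto intro: packets.intros)

text \<open>The constant is the minimum of the quadratic form on the compact unit sphere;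
  homogeneity extends the bound to all vectors.\<close>

lemma positive_definite_coercive:
  fixes A :: "real^'n^'n"
  assumes "\<And>v. v \<noteq> 0 \<Longrightarrow> v \<bullet> (A *v v) > 0"
  obtains c where "c > 0" "\<And>v. c * (norm v)\<^sup>2 \<le> v \<bullet> (A *v v)"
proof -
  let ?f = "\<lambda>v. v \<bullet> (A *v v)"
  have "compact (sphere (0::real^'n) 1)" "sphere (0::real^'n) 1 \<noteq> {}"
    by auto
  moreover have "continuous_on (sphere 0 1) ?f"
    by (intro continuous_intros linear_continuous_on matrix_vector_mul_bounded_linear)
  ultimately obtain v0 where v0: "v0 \<in> sphere 0 1" "\<And>v. v \<in> sphere 0 1 \<Longrightarrow> ?f v0 \<le> ?f v"
    using continuous_attains_inf by meson
  have "?f v0 * (norm v)\<^sup>2 \<le> ?f v" for v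
  proof (cases "v = 0")
    case False
    then have "?f v0 \<le> ?f ((1 / norm v) *\<^sub>R v)" by (intro v0(2)) simp
    also have "\<dots> = ?f v / (norm v)\<^sup>2"
      by (simp add: matrix_vector_mult_scaleR power2_eq_square)
    finally show ?thesis using False by (simp add: field_simps)
  qed simp
  moreover have "?f v0 > 0" using v0(1) by (intro assms) auto
  ultimately show ?thesis using that by blast
qed

subsection \<open>Moments of a Gaussian and projection onto the tangent space\<close>

lemma
  fixes A :: "'a::semiring_1^'n^'n"
  assumes "invertible A"
  shows matrix_inv_right: "A ** matrix_inv A = mat 1" and matrix_inv_left: "matrix_inv A ** A = mat 1"
  using someI_ex[OF assms[unfolded invertible_def]] unfolding matrix_inv_def by auto

lemma matrix_inv_entries:
  fixes A :: "real^'n^'n"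
  assumes "invertible A"
  shows "(\<Sum>j\<in>UNIV. matrix_inv A $ k $ j * A $ j $ l) = (if k = l then 1 else 0)"
proof -
  have "(matrix_inv A ** A) $ k $ l = (\<Sum>j\<in>UNIV. matrix_inv A $ k $ j * A $ j $ l)"
    by (simp add: matrix_matrix_mult_def)
  then show ?thesis
    using matrix_inv_left[OF assms] by (simp add: mat_def)
qed

lemma matrix_inv_symmetric:
  fixes A :: "real^'n^'n"
  assumes "invertible A" "transpose A = A"
  shows "transpose (matrix_inv A) = matrix_inv A"
proof -
  have "transpose (matrix_inv A) ** A = mat 1"
    using arg_cong[OF matrix_inv_right[OF assms(1)], of transpose]
    by (simp add: matrix_transpose_mul assms(2) transpose_mat)
  then have "transpose (matrix_inv A) ** (A ** matrix_inv A) = matrix_inv A"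
    by (simp add: matrix_mul_assoc)
  then show ?thesis
    by (simp add: matrix_inv_right[OF assms(1)])
qed

lemma AE_zero_imp_zero:
  fixes f :: "'a::euclidean_space \<Rightarrow> complex"
  assumes "continuous_on UNIV f" "AE x in lborel. f x = 0"
  shows "f x = 0"
proof -
  have "closed {x. f x = 0}"
    using continuous_closed_preimage_constant[OF assms(1) closed_UNIV, of 0] by simp
  moreover have "AE x \<in> UNIV in lebesgue. x \<in> {x. f x = 0}"
    using AE_completion[OF assms(2)] by simp
  ultimately show ?thesis
    using mem_closed_if_AE_lebesgue_open[OF open_UNIV] by blast
qed

text \<open>Continuity turns vanishing almost everywhere into vanishing everywhere; the definite
  description in \<open>tangent_proj\<close> requires uniqueness as a function.\<close>

lemma L2_inner_self_zero:
  assumes "continuous_on UNIV g" "integrable lborel (\<lambda>x. cnj (g x) * g x)" "L2_inner g g = 0"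
  shows "g x = 0"
proof -
  have eq: "cnj (g x) * g x = complex_of_real ((cmod (g x))\<^sup>2)" for x
    by (simp only: complex_norm_square mult.commute)
  have int: "integrable lborel (\<lambda>x. (cmod (g x))\<^sup>2)"
    using integrable_Re[OF assms(2)] by (simp add: eq)
  have "(\<integral>x. (cmod (g x))\<^sup>2 \<partial>lborel) = 0"
    using assms(3) unfolding L2_inner_def eq by (simp del: of_real_power)
  then have "AE x in lborel. (cmod (g x))\<^sup>2 = 0"
    using int by (subst (asm) integral_nonneg_eq_0_iff_AE) auto
  then have "AE x in lborel. g x = 0" by simp
  then show ?thesis by (rule AE_zero_imp_zero[OF assms(1)])
qed

text \<open>Polynomials in coordinates centred at \<open>q\<close>: for the centre of the packet the
  odd moments of |u|^2 vanish, and coefficients can be compared at each time although the centre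
  moves.\<close>

definition shifted_quad ::
  "real^'n \<Rightarrow> complex \<Rightarrow> ('n \<Rightarrow> complex) \<Rightarrow> ('n \<Rightarrow> 'n \<Rightarrow> complex) \<Rightarrow> real^'n \<Rightarrow> complex" where
  "shifted_quad q c b A x = c + (\<Sum>j\<in>UNIV. b j * centered q j x)
     + (\<Sum>i\<in>UNIV. \<Sum>j\<in>UNIV. A i j * (centered q i x * centered q j x))"

lemma shifted_quad_shift:
  "shifted_quad q c b A x = shifted_quad r
     (c + (\<Sum>j\<in>UNIV. b j * centered q j r) + (\<Sum>i\<in>UNIV. \<Sum>j\<in>UNIV. A i j * (centered q i r * centered q j r)))
     (\<lambda>j. b j + (\<Sum>i\<in>UNIV. (A i j + A j i) * centered q i r)) A x"
proof -
  have cq: "centered q j x = centered r j x + centered q j r" for j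
    by (simp add: centered_def)
  have "(\<Sum>i\<in>UNIV. \<Sum>j\<in>UNIV. A i j * (centered q i x * centered q j x)) =
    (\<Sum>i\<in>UNIV. \<Sum>j\<in>UNIV. A i j * (centered r i x * centered r j x)) +
    (\<Sum>i\<in>UNIV. \<Sum>j\<in>UNIV. A i j * centered q j r * centered r i x) +
    (\<Sum>i\<in>UNIV. \<Sum>j\<in>UNIV. A i j * centered q i r * centered r j x) +
    (\<Sum>i\<in>UNIV. \<Sum>j\<in>UNIV. A i j * (centered q i r * centered q j r))"
    unfolding cq by (simp add: sum.distrib algebra_simps)
  also have "(\<Sum>i\<in>UNIV. \<Sum>j\<in>UNIV. A i j * centered q j r * centered r i x)
    = (\<Sum>j\<in>UNIV. (\<Sum>i\<in>UNIV. A j i * centered q i r) * centered r j x)"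
    by (simp add: sum_distrib_right)
  also have "(\<Sum>i\<in>UNIV. \<Sum>j\<in>UNIV. A i j * centered q i r * centered r j x)
    = (\<Sum>j\<in>UNIV. (\<Sum>i\<in>UNIV. A i j * centered q i r) * centered r j x)"
    by (subst sum.swap) (simp add: sum_distrib_right)
  finally show ?thesis
    unfolding shifted_quad_def by (simp add: cq sum.distrib algebra_simps)
qed

lemma quad_polys_iff: "\<phi> \<in> quad_polys \<longleftrightarrow> (\<exists>c b A. \<phi> = shifted_quad q c b A)"
proof
  assume "\<phi> \<in> quad_polys"
  then obtain c b A where \<phi>: "\<phi> = (\<lambda>x. c + bdot b (cvec x) + bdot (cvec x) (A *v cvec x))"
    unfolding quad_polys_def by blast
  have "\<phi> = shifted_quad 0 c (\<lambda>j. b $ j) (\<lambda>i j. A $ i $ j)"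
    unfolding \<phi> by (rule ext) (simp add: shifted_quad_def bdot_def cvec_def matrix_vector_mult_def
        centered_def sum_distrib_left mult_ac)
  then show "\<exists>c b A. \<phi> = shifted_quad q c b A"
    using shifted_quad_shift[of 0 c "\<lambda>j. b $ j" "\<lambda>i j. A $ i $ j" _ q] by fastforce
next
  assume "\<exists>c b A. \<phi> = shifted_quad q c b A"
  then obtain c b A where "\<phi> = shifted_quad q c b A" by blast
  then obtain c' b' where "\<phi> = shifted_quad 0 c' b' A"
    using shifted_quad_shift[of q c b A _ 0] by fastforce
  then have "\<phi> = (\<lambda>x. c' + bdot (\<chi> j. b' j) (cvec x) + bdot (cvec x) ((\<chi> i j. A i j) *v cvec x))"
    by (auto simp: fun_eq_iff shifted_quad_def bdot_def cvec_def matrix_vector_mult_def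
        centered_def sum_distrib_left mult_ac)
  then show "\<phi> \<in> quad_polys" unfolding quad_polys_def by blast
qed

section \<open>Calculus with a single packet\<close>

locale gaussian =
  fixes \<epsilon> :: real and q p :: "real^'n" and C :: "complex^'n^'n" and \<zeta> :: complex
  assumes eps_pos: "\<epsilon> > 0" and width: "width_matrix C"
begin

abbreviation u :: "real^'n \<Rightarrow> complex" where "u \<equiv> gauss \<epsilon> q p C \<zeta>"

text \<open>The index type \<open>unit\<close> turns the uniform statements of
  \<open>schwartz_class\<close> into statements about single functions.\<close>

abbreviation W1 :: "(unit \<Rightarrow> real^'n \<Rightarrow> complex) set" where "W1 \<equiv> packets (\<lambda>_::unit. u)"

abbreviation pk :: "(real^'n \<Rightarrow> complex) \<Rightarrow> bool" where "pk w \<equiv> (\<lambda>_::unit. w) \<in> W1"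

abbreviation sym :: "((real^'n) \<times> (real^'n) \<Rightarrow> real) \<Rightarrow> bool" where "sym a \<equiv> symbol_family (\<lambda>_::unit. a)"

abbreviation T :: "((real^'n) \<times> (real^'n) \<Rightarrow> real) \<Rightarrow> (real^'n \<Rightarrow> complex) \<Rightarrow> (real^'n \<Rightarrow> complex) \<Rightarrow> complex" where
  "T \<equiv> weyl_form \<epsilon>"

abbreviation Y :: "'n \<Rightarrow> real^'n \<Rightarrow> complex" where "Y \<equiv> centered q"

abbreviation dq :: "'n \<Rightarrow> ((real^'n) \<times> (real^'n) \<Rightarrow> real) \<Rightarrow> (real^'n) \<times> (real^'n) \<Rightarrow> real" where
  "dq j \<equiv> pderiv_at (axis j 1, 0)"

abbreviation dp :: "'n \<Rightarrow> ((real^'n) \<times> (real^'n) \<Rightarrow> real) \<Rightarrow> (real^'n) \<times> (real^'n) \<Rightarrow> real" where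
  "dp j \<equiv> pderiv_at (0, axis j 1)"

text \<open>Up to the factor \<epsilon>/2 this is the covariance matrix of the normalised density
  |u|^2.\<close>

abbreviation S :: "'n \<Rightarrow> 'n \<Rightarrow> complex" where "S i j \<equiv> complex_of_real (matrix_inv (Im_mat C) $ i $ j)"

lemma C_symmetric: "transpose C = C" "C $ i $ j = C $ j $ i"
  using width unfolding width_matrix_def by (auto, metis transpose_def vec_lambda_beta)

lemma Im_C_invertible: "invertible (Im_mat C)"
proof -
  have "v = 0" if "Im_mat C *v v = 0" for v
    using width that unfolding width_matrix_def by (metis inner_zero_right less_irrefl)
  then show ?thesis
    using invertible_left_inverse matrix_left_invertible_ker by blast
qed

lemma S_symmetric: "S i j = S j i"
proof -
  have "transpose (Im_mat C) = Im_mat C"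
    using C_symmetric(2) by (simp add: transpose_def Im_mat_def vec_eq_iff)
  from arg_cong[OF matrix_inv_symmetric[OF Im_C_invertible this], of "\<lambda>A. A $ j $ i"] show ?thesis
    by (simp add: transpose_def)
qed

lemma S_inverse: "(\<Sum>j\<in>UNIV. S k j * Im (C $ j $ l)) = (if k = l then 1 else 0)"
proof -
  have "(\<Sum>j\<in>UNIV. S k j * Im (C $ j $ l)) = complex_of_real (\<Sum>j\<in>UNIV. matrix_inv (Im_mat C) $ k $ j * Im_mat C $ j $ l)"
    by (simp add: Im_mat_def)
  then show ?thesis
    unfolding matrix_inv_entries[OF Im_C_invertible] by simp
qed

text \<open>Every moment identity below arrives as a linear system with matrix (2/\<epsilon>) Im C;
  this inverts it.\<close>

lemma S_solve:
  assumes "\<And>j. (2 / \<epsilon>) * (\<Sum>l\<in>UNIV. complex_of_real (Im (C $ j $ l)) * t l) = r j"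
  shows "t k = (\<epsilon> / 2) * (\<Sum>j\<in>UNIV. S k j * r j)"
proof -
  have "(\<epsilon> / 2) * (\<Sum>j\<in>UNIV. S k j * r j) = (\<Sum>j\<in>UNIV. S k j * (\<Sum>l\<in>UNIV. complex_of_real (Im (C $ j $ l)) * t l))"
    unfolding assms[symmetric] sum_distrib_left
    by (intro sum.cong refl) (use eps_pos in \<open>simp add: field_simps sum_distrib_left\<close>)
  also have "\<dots> = (\<Sum>l\<in>UNIV. (\<Sum>j\<in>UNIV. S k j * Im (C $ j $ l)) * t l)"
    unfolding sum_distrib_left sum_distrib_right by (subst sum.swap) (simp add: mult_ac)
  also have "\<dots> = t k"
    unfolding S_inverse by (simp add: if_distribR if_distrib[of "\<lambda>x. x * _"] cong: if_cong)
  finally show ?thesis ..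
qed

sublocale schwartz_class W1 \<epsilon>
proof -
  obtain c where c: "c > 0" "\<And>v. c * (norm v)\<^sup>2 \<le> v \<bullet> (Im_mat C *v v)"
    using positive_definite_coercive[of "Im_mat C"] width unfolding width_matrix_def by metis
  let ?R = "norm q + norm p + norm C + norm \<zeta>"
  show "schwartz_class W1 \<epsilon>"
    by (rule packets_schwartz[where c = c and R = ?R]) (use eps_pos c C_symmetric in auto)
qed

lemma pk_u: "pk u"
  by (rule packets_base)

lemma pk_add: "pk v \<Longrightarrow> pk w \<Longrightarrow> pk (\<lambda>x. v x + w x)"
  by (rule packets_add)

lemma pk_cmult: "pk v \<Longrightarrow> pk (\<lambda>x. c * v x)"
  by (rule W_cmult')

lemma pk_sum: "finite I \<Longrightarrow> (\<And>j. j \<in> I \<Longrightarrow> pk (v j)) \<Longrightarrow> pk (\<lambda>x. \<Sum>j\<in>I. v j x)"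
  by (rule packets_sum)

lemma pk_coord: "pk v \<Longrightarrow> pk (\<lambda>x. complex_of_real (x $ j) * v x)"
  by (rule packets_coord)

lemma centered_mult: "Y j x * z = complex_of_real (x $ j) * z + - complex_of_real (q $ j) * z"
  by (simp add: centered_def algebra_simps)

lemma pk_Y: "pk v \<Longrightarrow> pk (\<lambda>x. Y j x * v x)"
  unfolding centered_mult by (intro pk_add pk_coord pk_cmult)

lemma pk_poly: "pk (\<lambda>x. shifted_quad q c b A x * u x)"
proof -
  have eq: "(\<lambda>x. shifted_quad q c b A x * u x) = (\<lambda>x. c * u x + ((\<Sum>j\<in>UNIV. b j * (Y j x * u x))
     + (\<Sum>i\<in>UNIV. \<Sum>j\<in>UNIV. A i j * (Y i x * (Y j x * u x)))))"
    by (rule ext) (simp add: shifted_quad_def sum_distrib_right distrib_right mult.assoc add.assoc)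
  show ?thesis
    unfolding eq by (intro pk_add pk_sum pk_cmult pk_Y pk_u) auto
qed

lemma pk_continuous: "pk v \<Longrightarrow> continuous_on UNIV v"
  by (rule W_cont)

lemma pk_integrable:
  assumes "pk v" "pk w"
  shows "integrable lborel (\<lambda>x. cnj (v x) * w x)"
proof -
  let ?D = "2 * DIM(real^'n)"
  obtain K where K: "\<And>x. (1 + norm x) ^ ?D * cmod (v x) \<le> K"
    using W_rapid[OF assms(1)] by blast
  obtain L where L: "\<And>x. (1 + norm x) ^ 0 * cmod (w x) \<le> L"
    using W_rapid[OF assms(2)] by blast
  show ?thesis
  proof (rule integrable_weight_bound)
    show "(\<lambda>x. cnj (v x) * w x) \<in> borel_measurable borel"
      by (intro borel_measurable_continuous_onI continuous_intros pk_continuous assms)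
    fix x
    have "(1 + norm x) ^ ?D * cmod (cnj (v x) * w x) = ((1 + norm x) ^ ?D * cmod (v x)) * ((1 + norm x) ^ 0 * cmod (w x))"
      by (simp add: norm_mult mult_ac)
    also have "\<dots> \<le> K * L"
      using order_trans[OF _ K] by (intro mult_mono K L) auto
    finally show "(1 + norm x) ^ ?D * cmod (cnj (v x) * w x) \<le> K * L" .
  qed
qed

lemma pk_op_integrable: "sym a \<Longrightarrow> pk v \<Longrightarrow> pk w \<Longrightarrow> integrable lborel (\<lambda>x. cnj (v x) * op_weyl \<epsilon> a w x)"
  by (rule op_weyl_pairing_integrable)

lemmas sym_dq = symbol_family_pderiv[OF _ axis_Basis_phase(1)]
lemmas sym_dp = symbol_family_pderiv[OF _ axis_Basis_phase(2)]

lemma T_hermitian: "sym a \<Longrightarrow> pk v \<Longrightarrow> pk w \<Longrightarrow> cnj (T a v w) = T a w v"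
  by (rule weyl_form_hermitian)

lemma T_add_left: "sym a \<Longrightarrow> pk w \<Longrightarrow> pk v \<Longrightarrow> pk v' \<Longrightarrow> T a (\<lambda>x. v x + v' x) w = T a v w + T a v' w"
  by (rule weyl_form_add_left)

lemma T_sum_left: "sym a \<Longrightarrow> pk w \<Longrightarrow> finite I \<Longrightarrow> (\<And>j. j \<in> I \<Longrightarrow> pk (v j)) \<Longrightarrow>
    T a (\<lambda>x. \<Sum>j\<in>I. c j * v j x) w = (\<Sum>j\<in>I. cnj (c j) * T a (v j) w)"
  by (rule weyl_form_sum_left)

lemma T_sum_right: "sym a \<Longrightarrow> pk w \<Longrightarrow> finite I \<Longrightarrow> (\<And>j. j \<in> I \<Longrightarrow> pk (v j)) \<Longrightarrow>
    T a w (\<lambda>x. \<Sum>j\<in>I. c j * v j x) = (\<Sum>j\<in>I. c j * T a w (v j))"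
  by (rule weyl_form_sum_right)

lemma T_add_right:
  assumes "sym a" "pk w" "pk v" "pk v'"
  shows "T a w (\<lambda>x. v x + v' x) = T a w v + T a w v'"
  using arg_cong[OF T_add_left[OF assms], of cnj] assms by (simp add: T_hermitian pk_add)

lemma T_cmult_right:
  assumes "sym a" "pk w" "pk v"
  shows "T a w (\<lambda>x. c * v x) = c * T a w v"
proof -
  have "T a w (\<lambda>x. c * v x) = cnj (T a (\<lambda>x. c * v x) w)"
    by (rule T_hermitian[OF assms(1) pk_cmult[OF assms(3)] assms(2), symmetric])
  also have "\<dots> = c * cnj (T a v w)"
    by (simp add: weyl_form_cmult_left)
  also have "\<dots> = c * T a w v"
    by (simp only: T_hermitian[OF assms(1) assms(3,2)])
  finally show ?thesis .
qed

lemma T_commute_Y: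
  assumes "sym a" "pk w" "pk v"
  shows "T a v (\<lambda>x. Y j x * w x) = T a (\<lambda>x. Y j x * v x) w - \<i> * \<epsilon> * T (dp j a) v w"
proof -
  have l: "T a (\<lambda>x. Y j x * v x) w = T a (\<lambda>x. complex_of_real (x $ j) * v x) w + cnj (- complex_of_real (q $ j)) * T a v w"
    unfolding centered_mult T_add_left[OF assms(1,2) pk_coord[OF assms(3)] pk_cmult[OF assms(3)]] weyl_form_cmult_left ..
  have r: "T a v (\<lambda>x. Y j x * w x) = T a v (\<lambda>x. complex_of_real (x $ j) * w x) + - complex_of_real (q $ j) * T a v w"
    unfolding centered_mult T_add_right[OF assms(1,3) pk_coord[OF assms(2)] pk_cmult[OF assms(2)]] T_cmult_right[OF assms(1,3,2)] ..
  have "T a (\<lambda>x. Y j x * v x) w - T a v (\<lambda>x. Y j x * w x)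
    = T a (\<lambda>x. complex_of_real (x $ j) * v x) w - T a v (\<lambda>x. complex_of_real (x $ j) * w x)"
    unfolding l r by simp
  also have "\<dots> = \<i> * \<epsilon> * T (dp j a) v w"
    by (rule weyl_form_coord[OF assms])
  finally show ?thesis by (simp add: algebra_simps)
qed

abbreviation Du :: "'n \<Rightarrow> real^'n \<Rightarrow> complex" where
  "Du j x \<equiv> packet_gradient \<epsilon> q p C j x * u x"

lemma Du_times: "Du j x * z = (\<i> / \<epsilon> * p $ j) * (z * u x) + (\<Sum>l\<in>UNIV. (\<i> / \<epsilon> * C $ j $ l) * (Y l x * (z * u x)))"
  by (simp add: packet_gradient_def distrib_left distrib_right sum_distrib_left sum_distrib_right mult_ac)

text \<open>The identity behind all moments: commuting \<open>-i\<epsilon>\<partial>\<^sub>j\<close> through \<open>op(a)\<close>, with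
  \<open>-i\<epsilon>\<partial>\<^sub>j u = (p\<^sub>j + (C(x - q))\<^sub>j) u\<close> on both sides, leaves \<open>C - C\<^sup>* = 2i Im C\<close> acting on \<open>x - q\<close>.\<close>

lemma T_moment:
  assumes a: "sym a" and f: "pk (\<lambda>x. f x * u x)" "dir_deriv f (axis j 1) f'" "pk (\<lambda>x. f' x * u x)"
  defines "v \<equiv> \<lambda>x. f x * u x"
  shows "(2 / \<epsilon>) * (\<Sum>l\<in>UNIV. complex_of_real (Im (C $ j $ l)) * T a (\<lambda>x. Y l x * v x) u)
    = T a (\<lambda>x. f' x * u x) u + (\<Sum>l\<in>UNIV. C $ j $ l * T (dp l a) v u) + T (dq j a) v u"
proof -
  have v: "pk v" using f(1) by (simp add: v_def)
  define Dv where "Dv x = ((\<i> / \<epsilon> * p $ j) * v x + (\<Sum>l\<in>UNIV. (\<i> / \<epsilon> * C $ j $ l) * (Y l x * v x))) + f' x * u x" for x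
  define Du' where "Du' x = (\<i> / \<epsilon> * p $ j) * u x + (\<Sum>l\<in>UNIV. (\<i> / \<epsilon> * C $ j $ l) * (Y l x * u x))" for x
  note pk_rules = pk_add pk_sum pk_cmult pk_Y pk_u v f
  have pks: "pk (\<lambda>x. (\<i> / \<epsilon> * p $ j) * v x)" "pk (\<lambda>x. \<Sum>l\<in>UNIV. (\<i> / \<epsilon> * C $ j $ l) * (Y l x * v x))"
    "pk (\<lambda>x. (\<i> / \<epsilon> * p $ j) * u x)" "pk (\<lambda>x. \<Sum>l\<in>UNIV. (\<i> / \<epsilon> * C $ j $ l) * (Y l x * u x))"
    by (intro pk_rules; simp)+
  have dv: "dir_deriv v (axis j 1) Dv"
  proof -
    have "Dv = (\<lambda>x. f x * Du j x + f' x * u x)"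
      unfolding Dv_def v_def Du_times[of j _ "f _", symmetric] by (simp only: mult.commute)
    then show ?thesis
      unfolding v_def using dir_deriv_mult[OF f(2) dir_deriv_gauss[OF C_symmetric(1)]] by simp
  qed
  have du: "dir_deriv u (axis j 1) Du'"
  proof -
    have "Du' = Du j"
      using Du_times[of j _ 1] by (auto simp: Du'_def)
    then show ?thesis using dir_deriv_gauss[OF C_symmetric(1)] by simp
  qed
  have pkD: "pk Dv" "pk Du'"
    unfolding Dv_def Du'_def by (intro pk_add pks f)+
  define t where "t l = T a (\<lambda>x. Y l x * v x) u" for l
  have TDv: "T a Dv u = - (\<i> / \<epsilon> * p $ j) * T a v u + (\<Sum>l\<in>UNIV. - (\<i> / \<epsilon>) * cnj (C $ j $ l) * t l) + T a (\<lambda>x. f' x * u x) u"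
    unfolding Dv_def t_def
    by (simp only: T_add_left[OF a pk_u pk_add[OF pks(1,2)] f(3)] T_add_left[OF a pk_u pks(1,2)] weyl_form_cmult_left
        T_sum_left[OF a pk_u finite_class.finite pk_Y[OF v]]) simp
  \<comment> \<open>Only moments with the factor \<open>Y l\<close> in the left argument are kept.
    Transferring it from the right costs -i \<epsilon> \<open>T (dp l a) v u\<close>, and this is
    how the averages of the momentum derivatives enter.\<close>
  have TDu: "T a v Du' = (\<i> / \<epsilon> * p $ j) * T a v u + (\<Sum>l\<in>UNIV. (\<i> / \<epsilon> * C $ j $ l) * (t l - \<i> * \<epsilon> * T (dp l a) v u))"
    unfolding Du'_def t_def
    by (simp only: T_add_right[OF a v pks(3,4)] T_cmult_right[OF a v pk_u]
        T_sum_right[OF a v finite_class.finite pk_Y[OF pk_u]] T_commute_Y[OF a pk_u v])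
  have "0 = T a Dv u + T a v Du' + T (dq j a) v u"
    using weyl_form_derivative[where k="()", OF a pk_u pkD(2) du v pkD(1) dv] by simp
  also have "\<dots> = (\<Sum>l\<in>UNIV. - (\<i> / \<epsilon>) * cnj (C $ j $ l) * t l + (\<i> / \<epsilon> * C $ j $ l) * (t l - \<i> * \<epsilon> * T (dp l a) v u))
     + T a (\<lambda>x. f' x * u x) u + T (dq j a) v u"
    unfolding TDv TDu sum.distrib by simp
  also have "(\<Sum>l\<in>UNIV. - (\<i> / \<epsilon>) * cnj (C $ j $ l) * t l + (\<i> / \<epsilon> * C $ j $ l) * (t l - \<i> * \<epsilon> * T (dp l a) v u))
    = (\<Sum>l\<in>UNIV. C $ j $ l * T (dp l a) v u - (2 / \<epsilon>) * (complex_of_real (Im (C $ j $ l)) * t l))"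
  proof (intro sum.cong refl)
    fix l
    have "C $ j $ l - cnj (C $ j $ l) = 2 * \<i> * complex_of_real (Im (C $ j $ l))"
      by (simp add: complex_eq_iff)
    then have C: "C $ j $ l = cnj (C $ j $ l) + 2 * \<i> * complex_of_real (Im (C $ j $ l))"
      by (simp add: algebra_simps)
    have e: "complex_of_real \<epsilon> \<noteq> 0" using eps_pos by simp
    have alg: "- (i * e') * d * t + (i * e' * c) * (t - i * e * r) = c * r - (2 * e') * (m * t)"
      if "c = d + 2 * i * m" "e * e' = 1" "i * i = - 1" for c d m t r e e' i :: complex
      using that by algebra
    show "- (\<i> / \<epsilon>) * cnj (C $ j $ l) * t l + (\<i> / \<epsilon> * C $ j $ l) * (t l - \<i> * \<epsilon> * T (dp l a) v u)
      = C $ j $ l * T (dp l a) v u - (2 / \<epsilon>) * (complex_of_real (Im (C $ j $ l)) * t l)"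
      unfolding divide_inverse of_real_mult of_real_inverse of_real_numeral by (rule alg[OF C]) (use e in auto)
  qed
  finally show ?thesis
    unfolding sum_subtractf sum_distrib_left[symmetric] t_def by (simp add: algebra_simps)
qed

text \<open>The counterpart of \<open>T_moment\<close> with the identity in place of op(a): the
  total derivative of the conjugate of f u times u integrates to zero. In
  \<open>packet_gradient\<close> plus its conjugate the momentum drops out and -(2/\<epsilon>) Im C
  (x - q) remains.\<close>

lemma L2_moment:
  assumes f: "pk (\<lambda>x. f x * u x)" "dir_deriv f (axis j 1) f'" "pk (\<lambda>x. f' x * u x)"
  shows "(2 / \<epsilon>) * (\<Sum>l\<in>UNIV. complex_of_real (Im (C $ j $ l)) * L2_inner (\<lambda>x. Y l x * (f x * u x)) u)
    = L2_inner (\<lambda>x. f' x * u x) u"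
proof -
  define v where "v x = f x * u x" for x
  have v: "pk v" using f(1) by (simp add: v_def[abs_def])
  define D where "D x = cnj (f' x * u x) * u x + (\<Sum>l\<in>UNIV. - ((2 / \<epsilon>) * complex_of_real (Im (C $ j $ l))) * (cnj (Y l x * v x) * u x))" for x
  note int = pk_integrable[OF f(3) pk_u] pk_integrable[OF pk_Y[OF v] pk_u]
  have "(\<integral>x. D x \<partial>lborel) = 0"
  proof (rule integral_dir_deriv_zero)
    show "integrable lborel (\<lambda>x. cnj (v x) * u x)"
      by (rule pk_integrable[OF v pk_u])
    show "integrable lborel D"
      unfolding D_def by (intro Bochner_Integration.integrable_add Bochner_Integration.integrable_sum integrable_mult_right int)
    have "dir_deriv (\<lambda>x. cnj (v x) * u x) (axis j 1) (\<lambda>x. cnj (f x * u x) * Du j x + cnj (f x * Du j x + f' x * u x) * u x)"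
      unfolding v_def by (intro dir_deriv_mult dir_deriv_cnj f dir_deriv_gauss C_symmetric)
    also have "(\<lambda>x. cnj (f x * u x) * Du j x + cnj (f x * Du j x + f' x * u x) * u x) = D"
    proof (rule ext)
      fix x
      let ?g = "packet_gradient \<epsilon> q p C j x"
      have "?g + cnj ?g = (\<Sum>l\<in>UNIV. - ((2 / \<epsilon>) * complex_of_real (Im (C $ j $ l))) * cnj (Y l x))"
      proof -
        have "\<i> / \<epsilon> * (C $ j $ l * Y l x) - \<i> / \<epsilon> * (cnj (C $ j $ l) * cnj (Y l x)) = - ((2 / \<epsilon>) * complex_of_real (Im (C $ j $ l))) * cnj (Y l x)" for l
        proof -
          have Yr: "cnj (Y l x) = Y l x" by (simp add: centered_def)
          have "C $ j $ l = cnj (C $ j $ l) + 2 * \<i> * complex_of_real (Im (C $ j $ l))"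
            by (simp add: complex_eq_iff)
          then have "\<i> / \<epsilon> * (C $ j $ l * Y l x) - \<i> / \<epsilon> * (cnj (C $ j $ l) * cnj (Y l x))
            = \<i> / \<epsilon> * (2 * \<i> * complex_of_real (Im (C $ j $ l))) * Y l x"
            unfolding Yr by (metis (no_types, lifting) add_diff_cancel_left' left_diff_distrib right_diff_distrib mult.assoc)
          moreover have "i * e' * (2 * i * m) * y = - ((2 * e') * m) * y" if "i * i = - 1" for i e' m y :: complex
            using that by algebra
          ultimately show ?thesis unfolding Yr divide_inverse by simp
        qed
        moreover have "?g + cnj ?g = (\<Sum>l\<in>UNIV. \<i> / \<epsilon> * (C $ j $ l * Y l x) - \<i> / \<epsilon> * (cnj (C $ j $ l) * cnj (Y l x)))"
          unfolding packet_gradient_def by (simp add: distrib_left sum_distrib_left sum_subtractf sum_negf)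
        ultimately show ?thesis by (simp only:)
      qed
      then have "cnj (f x * u x) * u x * (?g + cnj ?g) = (\<Sum>l\<in>UNIV. - ((2 / \<epsilon>) * complex_of_real (Im (C $ j $ l))) * (cnj (Y l x * v x) * u x))"
        by (simp add: sum_distrib_left v_def mult_ac)
      then show "cnj (f x * u x) * Du j x + cnj (f x * Du j x + f' x * u x) * u x = D x"
        unfolding D_def by (simp add: algebra_simps)
    qed
    finally show "dir_deriv (\<lambda>x. cnj (v x) * u x) (axis j 1) D" .
    show "continuous_on UNIV D"
      unfolding D_def by (intro continuous_intros pk_continuous f pk_Y v pk_u)
  qed
  moreover have "(\<integral>x. D x \<partial>lborel) = L2_inner (\<lambda>x. f' x * u x) u +
    (\<Sum>l\<in>UNIV. - ((2 / \<epsilon>) * complex_of_real (Im (C $ j $ l))) * L2_inner (\<lambda>x. Y l x * v x) u)"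
    unfolding D_def L2_inner_def
    by (subst Bochner_Integration.integral_add; (intro int Bochner_Integration.integrable_sum integrable_mult_right)?)
      (subst Bochner_Integration.integral_sum; (intro int integrable_mult_right)?; simp)
  ultimately show ?thesis
    by (simp add: sum_distrib_left v_def sum_negf mult.assoc)
qed

end

lemma sum_UNIV_Plus:
  fixes f :: "'a::finite + 'b::finite \<Rightarrow> 'c::comm_monoid_add"
  shows "(\<Sum>k\<in>UNIV. f k) = (\<Sum>i\<in>UNIV. f (Inl i)) + (\<Sum>i\<in>UNIV. f (Inr i))"
  unfolding UNIV_Plus_UNIV[symmetric] by (subst sum.Plus) auto

lemma avg_weyl_form: "avg \<epsilon> u a = weyl_form \<epsilon> a u u"
  by (simp add: avg_def weyl_form_def)

lemma avg_mat_hess: "avg_mat \<epsilon> u (hess h) $ k $ l = avg \<epsilon> u (pderiv_at (phase_axis k) (pderiv_at (phase_axis l) h))"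
  by (simp add: avg_mat_def hess_def)

lemma B_mat_entry:
  "B_mat \<epsilon> u h C $ i $ j = avg \<epsilon> u (pderiv_at (axis i 1, 0) (pderiv_at (axis j 1, 0) h))
    + (\<Sum>k\<in>UNIV. C $ i $ k * avg \<epsilon> u (pderiv_at (0, axis k 1) (pderiv_at (axis j 1, 0) h)))
    + (\<Sum>l\<in>UNIV. (avg \<epsilon> u (pderiv_at (axis i 1, 0) (pderiv_at (0, axis l 1) h))
       + (\<Sum>k\<in>UNIV. C $ i $ k * avg \<epsilon> u (pderiv_at (0, axis k 1) (pderiv_at (0, axis l 1) h)))) * C $ l $ j)"
proof -
  have delta: "(\<Sum>k\<in>UNIV. mat 1 $ i $ k * f k) = f i" "(\<Sum>k\<in>UNIV. f k * mat 1 $ k $ i) = f i"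
    for i :: 'a and f :: "'a \<Rightarrow> complex"
    by (simp_all add: mat_def if_distrib if_distribR cong: if_cong)
  have row: "(Id_row C ** avg_mat \<epsilon> u (hess h)) $ i $ k = avg \<epsilon> u (pderiv_at (axis i 1, 0) (pderiv_at (phase_axis k) h))
      + (\<Sum>m\<in>UNIV. C $ i $ m * avg \<epsilon> u (pderiv_at (0, axis m 1) (pderiv_at (phase_axis k) h)))" for k
    by (simp add: matrix_matrix_mult_def sum_UNIV_Plus Id_row_def avg_mat_hess delta)
  have "B_mat \<epsilon> u h C $ i $ j = (\<Sum>k\<in>UNIV. (Id_row C ** avg_mat \<epsilon> u (hess h)) $ i $ k * Id_col C $ k $ j)"
    unfolding B_mat_def by (simp add: matrix_matrix_mult_def)
  then show ?thesis
    unfolding sum_UNIV_Plus row by (simp add: Id_col_def delta)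
qed

section \<open>Weyl moments up to degree two and Gaussian moments up to degree four\<close>

context gaussian
begin

abbreviation N :: complex where "N \<equiv> L2_inner u u"

abbreviation B :: "((real^'n) \<times> (real^'n) \<Rightarrow> real) \<Rightarrow> 'n \<Rightarrow> 'n \<Rightarrow> complex" where
  "B a i j \<equiv> B_mat \<epsilon> u a C $ i $ j"

text \<open>The averaged gradient multiplied by the row (Id C), the first-order analogue of
  \<open>B_mat\<close>.\<close>

definition grad_form :: "((real^'n) \<times> (real^'n) \<Rightarrow> real) \<Rightarrow> 'n \<Rightarrow> complex" where
  "grad_form a j = avg \<epsilon> u (dq j a) + (\<Sum>l\<in>UNIV. C $ j $ l * avg \<epsilon> u (dp l a))"

lemma avg_real: "sym a \<Longrightarrow> cnj (avg \<epsilon> u a) = avg \<epsilon> u a"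
  unfolding avg_weyl_form by (rule T_hermitian[OF _ pk_u pk_u])

text \<open>The second-order form is the first-order one taken twice, which reduces second moments
  of \<open>a\<close> to first moments of its derivatives.\<close>

lemma B_eq:
  "B a i j = grad_form (dq j a) i + (\<Sum>l\<in>UNIV. C $ j $ l * grad_form (dp l a) i)"
  unfolding B_mat_entry grad_form_def C_symmetric(2)[of _ j] by (simp add: mult.commute)

lemma B_symmetric:
  assumes "sym a"
  shows "B a i j = B a j i"
proof -
  note comm = pderiv_at_commute[OF symbol_family_smooth[OF assms]]
  have qq: "dq i (dq j a) = dq j (dq i a)" for i j
    by (rule ext) (rule comm[OF axis_Basis_phase(1) axis_Basis_phase(1)])
  have pp: "dp i (dp j a) = dp j (dp i a)" for i j
    by (rule ext) (rule comm[OF axis_Basis_phase(2) axis_Basis_phase(2)])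
  have qp: "dq i (dp j a) = dp j (dq i a)" for i j
    by (rule ext) (rule comm[OF axis_Basis_phase(1) axis_Basis_phase(2)])
  have "(\<Sum>l\<in>UNIV. \<Sum>k\<in>UNIV. C $ j $ l * (C $ i $ k * avg \<epsilon> u (dp k (dp l a))))
    = (\<Sum>l\<in>UNIV. \<Sum>k\<in>UNIV. C $ i $ l * (C $ j $ k * avg \<epsilon> u (dp k (dp l a))))"
    by (subst sum.swap, subst pp) (simp add: mult_ac)
  then show ?thesis
    unfolding B_eq grad_form_def
    by (simp add: qq[of j i] qp distrib_left sum.distrib sum_distrib_left algebra_simps)
qed

lemma T_zero_left: "T a (\<lambda>x. 0) w = 0"
  by (simp add: weyl_form_def L2_inner_def)

lemma dir_deriv_Y: "dir_deriv (Y k) (axis j 1) (\<lambda>x. if k = j then 1 else 0)"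
  by (rule dir_deriv_centered)

lemma T_first_moment:
  assumes "sym a"
  shows "T a (\<lambda>x. Y k x * u x) u = (\<epsilon> / 2) * (\<Sum>j\<in>UNIV. S k j * grad_form a j)"
proof (rule S_solve)
  fix j
  show "(2 / \<epsilon>) * (\<Sum>l\<in>UNIV. complex_of_real (Im (C $ j $ l)) * T a (\<lambda>x. Y l x * u x) u) = grad_form a j"
    using T_moment[OF assms _ dir_deriv_const[of 1], of j] pk_u pk_cmult[OF pk_u, of 0]
    by (simp add: T_zero_left grad_form_def avg_weyl_form)
qed

text \<open>\<open>T_moment\<close> with f = \<open>Y m\<close>: the derivative of f contributes the
  average itself, and the first moments of \<open>dq j a\<close> and \<open>dp l a\<close> assemble
  to \<open>B\<close> by \<open>B_eq\<close>.\<close>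

lemma T_second_moment:
  assumes a: "sym a"
  shows "T a (\<lambda>x. Y k x * (Y m x * u x)) u = (\<epsilon> / 2) * S k m * avg \<epsilon> u a
    + (\<epsilon> / 2)\<^sup>2 * (\<Sum>j\<in>UNIV. \<Sum>i\<in>UNIV. S k j * S m i * B a i j)"
proof -
  have "T a (\<lambda>x. Y k x * (Y m x * u x)) u = (\<epsilon> / 2) * (\<Sum>j\<in>UNIV. S k j *
     ((if m = j then avg \<epsilon> u a else 0) + (\<Sum>l\<in>UNIV. C $ j $ l * T (dp l a) (\<lambda>x. Y m x * u x) u) + T (dq j a) (\<lambda>x. Y m x * u x) u))"
  proof (rule S_solve)
    fix j
    have "T a (\<lambda>x. (if m = j then 1 else 0) * u x) u = (if m = j then avg \<epsilon> u a else 0)"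
      by (simp add: T_zero_left avg_weyl_form)
    then show "(2 / \<epsilon>) * (\<Sum>l\<in>UNIV. complex_of_real (Im (C $ j $ l)) * T a (\<lambda>x. Y l x * (Y m x * u x)) u) =
      (if m = j then avg \<epsilon> u a else 0) + (\<Sum>l\<in>UNIV. C $ j $ l * T (dp l a) (\<lambda>x. Y m x * u x) u) + T (dq j a) (\<lambda>x. Y m x * u x) u"
      using T_moment[OF a pk_Y[OF pk_u] dir_deriv_Y pk_cmult[OF pk_u], of j m] by simp
  qed
  also have "(\<Sum>j\<in>UNIV. S k j *
     ((if m = j then avg \<epsilon> u a else 0) + (\<Sum>l\<in>UNIV. C $ j $ l * T (dp l a) (\<lambda>x. Y m x * u x) u) + T (dq j a) (\<lambda>x. Y m x * u x) u))
    = S k m * avg \<epsilon> u a + (\<Sum>j\<in>UNIV. S k j * ((\<epsilon> / 2) * (\<Sum>i\<in>UNIV. S m i * B a i j)))"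
  proof -
    have eq: "(\<Sum>l\<in>UNIV. C $ j $ l * T (dp l a) (\<lambda>x. Y m x * u x) u) + T (dq j a) (\<lambda>x. Y m x * u x) u
      = (\<epsilon> / 2) * (\<Sum>i\<in>UNIV. S m i * B a i j)" for j
    proof -
      have "(\<Sum>l\<in>UNIV. C $ j $ l * ((\<epsilon> / 2) * (\<Sum>i\<in>UNIV. S m i * grad_form (dp l a) i)))
        = (\<epsilon> / 2) * (\<Sum>i\<in>UNIV. S m i * (\<Sum>l\<in>UNIV. C $ j $ l * grad_form (dp l a) i))"
        unfolding sum_distrib_left by (subst sum.swap) (simp add: mult_ac)
      then show ?thesis
        unfolding T_first_moment[OF sym_dp[OF a]] T_first_moment[OF sym_dq[OF a]] B_eq
        by (simp add: distrib_left sum.distrib)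
    qed
    have mult_if: "z * (if P then y else 0) = (if P then z * y else 0)" for P and y z :: complex
      by simp
    have "S k j * ((if m = j then avg \<epsilon> u a else 0) + (\<Sum>l\<in>UNIV. C $ j $ l * T (dp l a) (\<lambda>x. Y m x * u x) u) + T (dq j a) (\<lambda>x. Y m x * u x) u)
      = (if m = j then S k j * avg \<epsilon> u a else 0) + S k j * ((\<epsilon> / 2) * (\<Sum>i\<in>UNIV. S m i * B a i j))" for j
      by (simp only: add.assoc eq distrib_left mult_if)
    then show ?thesis by (simp add: sum.distrib)
  qed
  also have "(\<epsilon> / 2) * (S k m * avg \<epsilon> u a + (\<Sum>j\<in>UNIV. S k j * ((\<epsilon> / 2) * (\<Sum>i\<in>UNIV. S m i * B a i j))))
    = (\<epsilon> / 2) * S k m * avg \<epsilon> u a + (\<epsilon> / 2)\<^sup>2 * (\<Sum>j\<in>UNIV. \<Sum>i\<in>UNIV. S k j * S m i * B a i j)"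
    by (simp add: distrib_left sum_distrib_left power2_eq_square mult_ac)
  finally show ?thesis .
qed

lemma L2_add_left:
  assumes "pk v" "pk v'"
  shows "L2_inner (\<lambda>x. v x + v' x) u = L2_inner v u + L2_inner v' u"
  unfolding L2_inner_def using pk_integrable[OF assms(1) pk_u] pk_integrable[OF assms(2) pk_u]
  by (simp add: distrib_right)

lemma L2_delta_left: "L2_inner (\<lambda>x. (if P then 1 else 0) * v x) w = (if P then L2_inner v w else 0)"
  by (simp add: L2_inner_def)

lemma L2_first_moment: "L2_inner (\<lambda>x. Y k x * u x) u = 0"
proof -
  have "L2_inner (\<lambda>x. Y k x * u x) u = (\<epsilon> / 2) * (\<Sum>j\<in>UNIV. S k j * 0)"
    by (rule S_solve) (use L2_moment[OF _ dir_deriv_const[of 1]] pk_u pk_cmult[OF pk_u, of 0] in \<open>simp add: L2_inner_def\<close>)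
  then show ?thesis by simp
qed

lemma L2_second_moment: "L2_inner (\<lambda>x. Y k x * (Y m x * u x)) u = (\<epsilon> / 2) * S k m * N"
proof -
  have "L2_inner (\<lambda>x. Y k x * (Y m x * u x)) u = (\<epsilon> / 2) * (\<Sum>j\<in>UNIV. S k j * (if m = j then N else 0))"
    by (rule S_solve) (simp only: L2_moment[OF pk_Y[OF pk_u] dir_deriv_Y pk_cmult[OF pk_u]] L2_delta_left)
  then show ?thesis by (simp add: if_distrib cong: if_cong)
qed

lemma dir_deriv_YY:
  "dir_deriv (\<lambda>x. Y k x * Y m x) (axis j 1) (\<lambda>x. Y k x * (if m = j then 1 else 0) + (if k = j then 1 else 0) * Y m x)"
  by (intro dir_deriv_mult dir_deriv_Y)

lemma L2_third_moment: "L2_inner (\<lambda>x. Y k x * (Y l x * (Y m x * u x))) u = 0"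
proof -
  have "L2_inner (\<lambda>x. Y k x * (Y l x * (Y m x * u x))) u = (\<epsilon> / 2) * (\<Sum>j\<in>UNIV. S k j * 0)"
  proof (rule S_solve)
    fix j
    have eq: "(\<lambda>x. (Y l x * (if m = j then 1 else 0) + (if l = j then 1 else 0) * Y m x) * u x)
      = (\<lambda>x. (if m = j then 1 else 0) * (Y l x * u x) + (if l = j then 1 else 0) * (Y m x * u x))"
      by (rule ext) (simp add: algebra_simps)
    have pk: "pk (\<lambda>x. (Y l x * (if m = j then 1 else 0) + (if l = j then 1 else 0) * Y m x) * u x)"
      unfolding eq by (intro pk_add pk_cmult pk_Y pk_u)
    have "L2_inner (\<lambda>x. (Y l x * (if m = j then 1 else 0) + (if l = j then 1 else 0) * Y m x) * u x) u = 0"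
      unfolding eq
      by (subst L2_add_left; (intro pk_cmult pk_Y pk_u)?) (simp only: L2_delta_left L2_first_moment, simp)
    then show "(2 / \<epsilon>) * (\<Sum>n\<in>UNIV. complex_of_real (Im (C $ j $ n)) * L2_inner (\<lambda>x. Y n x * (Y l x * (Y m x * u x))) u) = 0"
      using L2_moment[OF _ dir_deriv_YY pk, unfolded mult.assoc, OF pk_Y[OF pk_Y[OF pk_u]]] by simp
  qed
  then show ?thesis by simp
qed

text \<open>Isserlis' formula for a centred Gaussian with covariance (\<epsilon>/2) S. Removing the
  factor \<open>Y k\<close> by \<open>L2_moment\<close> pairs it with each of the other three and
  leaves a second moment.\<close>

lemma L2_fourth_moment:
  "L2_inner (\<lambda>x. Y k x * (Y l x * (Y m x * (Y r x * u x)))) u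
    = (\<epsilon> / 2)\<^sup>2 * N * (S k l * S m r + S k m * S l r + S k r * S l m)"
proof -
  let ?d = "\<lambda>k j. (if k = j then 1 else 0) :: complex"
  have "L2_inner (\<lambda>x. Y k x * (Y l x * (Y m x * (Y r x * u x)))) u = (\<epsilon> / 2) * (\<Sum>j\<in>UNIV. S k j *
     ((if l = j then (\<epsilon> / 2) * S m r * N else 0) + ((if m = j then (\<epsilon> / 2) * S l r * N else 0) + (if r = j then (\<epsilon> / 2) * S l m * N else 0))))"
  proof (rule S_solve)
    fix j
    let ?f' = "\<lambda>x. Y l x * (Y m x * ?d r j + ?d m j * Y r x) + ?d l j * (Y m x * Y r x)"
    have eq: "(\<lambda>x. ?f' x * u x) = (\<lambda>x. ?d l j * (Y m x * (Y r x * u x)) + (?d m j * (Y l x * (Y r x * u x)) + ?d r j * (Y l x * (Y m x * u x))))"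
      by (rule ext) (simp add: algebra_simps)
    have pk: "pk (\<lambda>x. ?f' x * u x)"
      unfolding eq by (intro pk_add pk_cmult pk_Y pk_u)
    have "L2_inner (\<lambda>x. ?f' x * u x) u = (if l = j then (\<epsilon> / 2) * S m r * N else 0) + ((if m = j then (\<epsilon> / 2) * S l r * N else 0) + (if r = j then (\<epsilon> / 2) * S l m * N else 0))"
      unfolding eq
      by (subst L2_add_left; (intro pk_add pk_cmult pk_Y pk_u)?)+ (simp only: L2_delta_left L2_second_moment)
    then show "(2 / \<epsilon>) * (\<Sum>n\<in>UNIV. complex_of_real (Im (C $ j $ n)) * L2_inner (\<lambda>x. Y n x * (Y l x * (Y m x * (Y r x * u x)))) u)
      = (if l = j then (\<epsilon> / 2) * S m r * N else 0) + ((if m = j then (\<epsilon> / 2) * S l r * N else 0) + (if r = j then (\<epsilon> / 2) * S l m * N else 0))"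
      using L2_moment[OF _ dir_deriv_mult[OF dir_deriv_Y dir_deriv_YY] pk, unfolded mult.assoc, OF pk_Y[OF pk_Y[OF pk_Y[OF pk_u]]]]
      by (simp add: mult.assoc)
  qed
  also have "(\<Sum>j\<in>UNIV. S k j * ((if l = j then (\<epsilon> / 2) * S m r * N else 0) + ((if m = j then (\<epsilon> / 2) * S l r * N else 0) + (if r = j then (\<epsilon> / 2) * S l m * N else 0))))
    = S k l * ((\<epsilon> / 2) * S m r * N) + (S k m * ((\<epsilon> / 2) * S l r * N) + S k r * ((\<epsilon> / 2) * S l m * N))"
    unfolding distrib_left sum.distrib by (simp add: if_distrib cong: if_cong)
  finally show ?thesis by (simp add: algebra_simps power2_eq_square)
qed

section \<open>The orthogonal projection onto the tangent space\<close>

lemma N_nonzero: "N \<noteq> 0"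
proof
  assume "N = 0"
  then have "u 0 = 0"
    using L2_inner_self_zero[OF pk_continuous[OF pk_u] pk_integrable[OF pk_u pk_u]] by blast
  then show False by (simp add: gauss_def)
qed

text \<open>The quadratic part (1/2) Y^T B Y of the projection has mean (\<epsilon>/4) tr(B S),
  which is subtracted so that the total mean equals the average of \<open>a\<close>. This is the
  origin of the trace term in the equation for \<zeta>.\<close>

definition proj_const :: "((real^'n) \<times> (real^'n) \<Rightarrow> real) \<Rightarrow> complex" where
  "proj_const a = avg \<epsilon> u a - (\<epsilon> / 4) * (\<Sum>i\<in>UNIV. \<Sum>j\<in>UNIV. B a i j * S i j)"

text \<open>A second-order expansion at the centre with averaged derivatives in place of pointwise
  ones. The averages are not normalised, hence the division by \<open>N\<close>.\<close>

definition proj_poly :: "((real^'n) \<times> (real^'n) \<Rightarrow> real) \<Rightarrow> real^'n \<Rightarrow> complex" where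
  "proj_poly a = shifted_quad q (proj_const a / N) (\<lambda>j. grad_form a j / N) (\<lambda>i j. B a i j / (2 * N))"

lemma L2_proj_poly:
  assumes v: "pk v"
  shows "N * L2_inner v (\<lambda>x. proj_poly a x * u x) = proj_const a * L2_inner v u
    + (\<Sum>j\<in>UNIV. grad_form a j * L2_inner (\<lambda>x. Y j x * v x) u)
    + (\<Sum>i\<in>UNIV. \<Sum>j\<in>UNIV. B a i j / 2 * L2_inner (\<lambda>x. Y i x * (Y j x * v x)) u)"
proof -
  have Yr: "cnj (Y j x) = Y j x" for j x by (simp add: centered_def)
  have "N * L2_inner v (\<lambda>x. proj_poly a x * u x) = (\<integral>x. N * (cnj (v x) * (proj_poly a x * u x)) \<partial>lborel)"
    by (simp add: L2_inner_def)
  also have "\<dots> = (\<integral>x. proj_const a * (cnj (v x) * u x) + (\<Sum>j\<in>UNIV. grad_form a j * (cnj (Y j x * v x) * u x))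
    + (\<Sum>i\<in>UNIV. \<Sum>j\<in>UNIV. B a i j / 2 * (cnj (Y i x * (Y j x * v x)) * u x)) \<partial>lborel)"
  proof (rule Bochner_Integration.integral_cong[OF refl])
    fix x
    have "N * proj_poly a x = proj_const a + (\<Sum>j\<in>UNIV. grad_form a j * Y j x) + (\<Sum>i\<in>UNIV. \<Sum>j\<in>UNIV. B a i j / 2 * (Y i x * Y j x))"
      using N_nonzero by (simp add: proj_poly_def shifted_quad_def distrib_left sum_distrib_left)
    then have "N * (cnj (v x) * (proj_poly a x * u x)) = (proj_const a + (\<Sum>j\<in>UNIV. grad_form a j * Y j x)
        + (\<Sum>i\<in>UNIV. \<Sum>j\<in>UNIV. B a i j / 2 * (Y i x * Y j x))) * (cnj (v x) * u x)"
      by (simp only: mult.assoc[symmetric] mult.commute[of "cnj (v x)"]) (simp only: mult_ac)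
    also have "\<dots> = proj_const a * (cnj (v x) * u x) + (\<Sum>j\<in>UNIV. grad_form a j * (cnj (Y j x * v x) * u x))
      + (\<Sum>i\<in>UNIV. \<Sum>j\<in>UNIV. B a i j / 2 * (cnj (Y i x * (Y j x * v x)) * u x))"
      by (simp only: distrib_right sum_distrib_right complex_cnj_mult Yr mult.assoc)
    finally show "N * (cnj (v x) * (proj_poly a x * u x)) = proj_const a * (cnj (v x) * u x) + (\<Sum>j\<in>UNIV. grad_form a j * (cnj (Y j x * v x) * u x))
      + (\<Sum>i\<in>UNIV. \<Sum>j\<in>UNIV. B a i j / 2 * (cnj (Y i x * (Y j x * v x)) * u x))" .
  qed
  also have "\<dots> = proj_const a * L2_inner v u
    + (\<Sum>j\<in>UNIV. grad_form a j * L2_inner (\<lambda>x. Y j x * v x) u)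
    + (\<Sum>i\<in>UNIV. \<Sum>j\<in>UNIV. B a i j / 2 * L2_inner (\<lambda>x. Y i x * (Y j x * v x)) u)"
  proof -
    note int = pk_integrable[OF v pk_u] pk_integrable[OF pk_Y[OF v] pk_u] pk_integrable[OF pk_Y[OF pk_Y[OF v]] pk_u]
    have 1: "integrable lborel (\<lambda>x. proj_const a * (cnj (v x) * u x))"
      "integrable lborel (\<lambda>x. \<Sum>j\<in>UNIV. grad_form a j * (cnj (Y j x * v x) * u x))"
      "integrable lborel (\<lambda>x. \<Sum>j\<in>UNIV. B a i j / 2 * (cnj (Y i x * (Y j x * v x)) * u x))"
      "integrable lborel (\<lambda>x. \<Sum>i\<in>UNIV. \<Sum>j\<in>UNIV. B a i j / 2 * (cnj (Y i x * (Y j x * v x)) * u x))" for i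
      by (intro Bochner_Integration.integrable_sum integrable_mult_right int)+
    have 2: "(\<integral>x. (\<Sum>j\<in>UNIV. grad_form a j * (cnj (Y j x * v x) * u x)) \<partial>lborel) = (\<Sum>j\<in>UNIV. grad_form a j * L2_inner (\<lambda>x. Y j x * v x) u)"
      unfolding L2_inner_def by (subst Bochner_Integration.integral_sum) (intro integrable_mult_right int, simp)
    have 3: "(\<integral>x. (\<Sum>i\<in>UNIV. \<Sum>j\<in>UNIV. B a i j / 2 * (cnj (Y i x * (Y j x * v x)) * u x)) \<partial>lborel)
      = (\<Sum>i\<in>UNIV. \<Sum>j\<in>UNIV. B a i j / 2 * L2_inner (\<lambda>x. Y i x * (Y j x * v x)) u)"
      unfolding L2_inner_def
      by (subst Bochner_Integration.integral_sum, rule 1(3), intro sum.cong refl,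
          subst Bochner_Integration.integral_sum, intro integrable_mult_right int, simp)
    show ?thesis
      unfolding Bochner_Integration.integral_add[OF Bochner_Integration.integrable_add[OF 1(1,2)] 1(4)]
        Bochner_Integration.integral_add[OF 1(1,2)] 2 3
      by (simp add: L2_inner_def)
  qed
  finally show ?thesis .
qed

lemma proj_poly_moments:
  assumes a: "sym a"
  shows "L2_inner u (\<lambda>x. proj_poly a x * u x) = T a u u"
    and "L2_inner (\<lambda>x. Y k x * u x) (\<lambda>x. proj_poly a x * u x) = T a (\<lambda>x. Y k x * u x) u"
    and "L2_inner (\<lambda>x. Y k x * (Y m x * u x)) (\<lambda>x. proj_poly a x * u x) = T a (\<lambda>x. Y k x * (Y m x * u x)) u"
proof -
  have "N * L2_inner u (\<lambda>x. proj_poly a x * u x) = N * T a u u"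
  proof -
    have "(\<Sum>i\<in>UNIV. \<Sum>j\<in>UNIV. B a i j / 2 * ((\<epsilon> / 2) * S i j * N)) = N * (\<epsilon> / 4) * (\<Sum>i\<in>UNIV. \<Sum>j\<in>UNIV. B a i j * S i j)"
      by (simp add: sum_distrib_left mult_ac)
    then show ?thesis
      unfolding L2_proj_poly[OF pk_u] L2_first_moment L2_second_moment proj_const_def avg_weyl_form
      by (simp add: algebra_simps)
  qed
  then show "L2_inner u (\<lambda>x. proj_poly a x * u x) = T a u u"
    using N_nonzero by simp
  have "N * L2_inner (\<lambda>x. Y k x * u x) (\<lambda>x. proj_poly a x * u x) = N * T a (\<lambda>x. Y k x * u x) u"
    unfolding L2_proj_poly[OF pk_Y[OF pk_u]] L2_first_moment L2_second_moment L2_third_moment T_first_moment[OF a]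
    by (simp add: sum_distrib_left S_symmetric[of _ k] mult_ac)
  then show "L2_inner (\<lambda>x. Y k x * u x) (\<lambda>x. proj_poly a x * u x) = T a (\<lambda>x. Y k x * u x) u"
    using N_nonzero by simp
  have "N * L2_inner (\<lambda>x. Y k x * (Y m x * u x)) (\<lambda>x. proj_poly a x * u x) = N * T a (\<lambda>x. Y k x * (Y m x * u x)) u"
  proof -
    \<comment> \<open>Of the three pairings in the fourth moment, (i j)(k m) cancels against the
      trace term in \<open>proj_const\<close>. The other two agree by symmetry of \<open>B\<close>
      and give the second Weyl moment.\<close>
    let ?Q = "\<Sum>i\<in>UNIV. \<Sum>j\<in>UNIV. B a i j * (S i m * S j k)"
    have Q': "(\<Sum>i\<in>UNIV. \<Sum>j\<in>UNIV. B a i j * (S i k * S j m)) = ?Q"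
      by (subst sum.swap) (simp add: B_symmetric[OF a] mult_ac)
    have Q'': "(\<Sum>j\<in>UNIV. \<Sum>i\<in>UNIV. S k j * S m i * B a i j) = ?Q"
      by (subst sum.swap) (simp add: S_symmetric[of k] S_symmetric[of m] mult_ac)
    have "(\<Sum>i\<in>UNIV. \<Sum>j\<in>UNIV. B a i j / 2 * ((\<epsilon> / 2)\<^sup>2 * N * (S i j * S k m + S i k * S j m + S i m * S j k)))
      = (\<epsilon> / 2)\<^sup>2 * N / 2 * ((\<Sum>i\<in>UNIV. \<Sum>j\<in>UNIV. B a i j * S i j) * S k m + (\<Sum>i\<in>UNIV. \<Sum>j\<in>UNIV. B a i j * (S i k * S j m)) + ?Q)"
      by (simp add: sum_distrib_left sum_distrib_right sum.distrib algebra_simps)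
    also have "\<dots> = (\<epsilon> / 2)\<^sup>2 * N / 2 * ((\<Sum>i\<in>UNIV. \<Sum>j\<in>UNIV. B a i j * S i j) * S k m + 2 * ?Q)"
      unfolding Q' by simp
    finally have 4: "(\<Sum>i\<in>UNIV. \<Sum>j\<in>UNIV. B a i j / 2 * ((\<epsilon> / 2)\<^sup>2 * N * (S i j * S k m + S i k * S j m + S i m * S j k)))
      = (\<epsilon> / 2)\<^sup>2 * N / 2 * ((\<Sum>i\<in>UNIV. \<Sum>j\<in>UNIV. B a i j * S i j) * S k m + 2 * ?Q)" .
    have alg: "(v - e / 4 * X) * (e / 2 * s * n) + (e / 2)\<^sup>2 * n / 2 * (X * s + 2 * Q)
      = n * (e / 2 * s * v + (e / 2)\<^sup>2 * Q)" for v e X s n Q :: complex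
      by (simp add: power2_eq_square field_simps)
    show ?thesis
      unfolding L2_proj_poly[OF pk_Y[OF pk_Y[OF pk_u]]] L2_second_moment L2_third_moment L2_fourth_moment 4 T_second_moment[OF a] Q''
        proj_const_def
      using alg[of "avg \<epsilon> u a" "complex_of_real \<epsilon>" "\<Sum>i\<in>UNIV. \<Sum>j\<in>UNIV. B a i j * S i j" "S k m" N ?Q]
      by simp
  qed
  then show "L2_inner (\<lambda>x. Y k x * (Y m x * u x)) (\<lambda>x. proj_poly a x * u x) = T a (\<lambda>x. Y k x * (Y m x * u x)) u"
    using N_nonzero by simp
qed

lemma tangent_space_iff: "v \<in> tangent_space u \<longleftrightarrow> (\<exists>c b A. v = (\<lambda>x. shifted_quad q c b A x * u x))"
  unfolding tangent_space_def quad_polys_iff[of _ q] by blast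

lemma proj_orthogonal:
  assumes a: "sym a" and v: "v \<in> tangent_space u"
  shows "L2_inner v (\<lambda>x. op_weyl \<epsilon> a u x - proj_poly a x * u x) = 0"
proof -
  define F where "F x = op_weyl \<epsilon> a u x - proj_poly a x * u x" for x
  have int1: "integrable lborel (\<lambda>x. cnj (v x) * op_weyl \<epsilon> a u x)"
    and int2: "integrable lborel (\<lambda>x. cnj (v x) * (proj_poly a x * u x))" if "pk v" for v
    using pk_op_integrable[OF a that pk_u] pk_integrable[OF that pk_poly] unfolding proj_poly_def by auto
  have int: "integrable lborel (\<lambda>x. cnj (v x) * F x)" if "pk v" for v
    unfolding F_def right_diff_distrib using int1[OF that] int2[OF that] by (rule Bochner_Integration.integrable_diff)
  have F_eq: "L2_inner v F = T a v u - L2_inner v (\<lambda>x. proj_poly a x * u x)" if "pk v" for v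
    unfolding F_def L2_inner_def weyl_form_def right_diff_distrib
    using int1[OF that] int2[OF that] by (rule Bochner_Integration.integral_diff)
  have zero: "L2_inner u F = 0" "L2_inner (\<lambda>x. Y k x * u x) F = 0" "L2_inner (\<lambda>x. Y k x * (Y m x * u x)) F = 0" for k m
    by (simp_all add: F_eq pk_u pk_Y proj_poly_moments[OF a])
  \<comment> \<open>Orthogonality to the residual \<open>F\<close> is carried together with
    membership in the packet class, because additivity of the inner product needs
    integrability.\<close>
  have add: "pk (\<lambda>x. v x + w x) \<and> L2_inner (\<lambda>x. v x + w x) F = 0"
    if "pk v \<and> L2_inner v F = 0" "pk w \<and> L2_inner w F = 0" for v w
    using that int[of v] int[of w] pk_add[of v w] by (simp add: L2_inner_def distrib_right)
  have cmult: "pk (\<lambda>x. c * v x) \<and> L2_inner (\<lambda>x. c * v x) F = 0" if "pk v \<and> L2_inner v F = 0" for v c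
    using that pk_cmult[of v c] by (simp add: L2_inner_def mult.assoc)
  have sum: "pk (\<lambda>x. \<Sum>j\<in>I. v j x) \<and> L2_inner (\<lambda>x. \<Sum>j\<in>I. v j x) F = 0"
    if "finite I" "\<And>j. pk (v j) \<and> L2_inner (v j) F = 0" for v and I :: "'n set"
    using that(1)
  proof (induction I rule: finite_induct)
    case empty
    then show ?case using pk_cmult[OF pk_u, of 0] by (simp add: L2_inner_def)
  next
    case (insert j I)
    then show ?case using add[OF that(2)[of j] insert.IH] by simp
  qed
  obtain c b A where v: "v = (\<lambda>x. shifted_quad q c b A x * u x)"
    using assms(2) tangent_space_iff by blast
  have v_eq: "v = (\<lambda>x. (c * u x + (\<Sum>j\<in>UNIV. b j * (Y j x * u x)))
     + (\<Sum>i\<in>UNIV. \<Sum>j\<in>UNIV. A i j * (Y i x * (Y j x * u x))))"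
    unfolding v by (rule ext) (simp add: shifted_quad_def sum_distrib_right distrib_right mult.assoc)
  have "pk v \<and> L2_inner v F = 0"
    unfolding v_eq by (intro add sum cmult) (simp_all add: pk_u pk_Y zero)
  then show ?thesis unfolding F_def by blast
qed

theorem tangent_proj_gauss:
  assumes a: "sym a"
  shows "tangent_proj u (op_weyl \<epsilon> a u) = (\<lambda>x. proj_poly a x * u x)"
  unfolding tangent_proj_def
proof (rule the_equality)
  have "(\<lambda>x. proj_poly a x * u x) \<in> tangent_space u"
    unfolding tangent_space_iff proj_poly_def by (intro exI) (rule refl)
  then show "(\<lambda>x. proj_poly a x * u x) \<in> tangent_space u \<and>
    (\<forall>v\<in>tangent_space u. L2_inner v (\<lambda>x. op_weyl \<epsilon> a u x - proj_poly a x * u x) = 0)"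
    using proj_orthogonal[OF a] by simp
  fix g assume g: "g \<in> tangent_space u \<and> (\<forall>v\<in>tangent_space u. L2_inner v (\<lambda>x. op_weyl \<epsilon> a u x - g x) = 0)"
  then obtain c b A where g_eq: "g = (\<lambda>x. shifted_quad q c b A x * u x)"
    using tangent_space_iff[of g] by metis
  \<comment> \<open>The difference of two candidates. It lies in the tangent space, so it is
    orthogonal to both residuals and hence to itself.\<close>
  define d where "d x = g x + (-1) * (proj_poly a x * u x)" for x
  have pk_g: "pk g" unfolding g_eq by (rule pk_poly)
  have pk_p: "pk (\<lambda>x. proj_poly a x * u x)" unfolding proj_poly_def by (rule pk_poly)
  have pk_d: "pk d" unfolding d_def by (intro pk_add pk_cmult pk_g pk_p)
  have d_tan: "d \<in> tangent_space u"
    unfolding tangent_space_iff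
  proof (intro exI)
    show "d = (\<lambda>x. shifted_quad q (c - proj_const a / N) (\<lambda>j. b j - grad_form a j / N) (\<lambda>i j. A i j - B a i j / (2 * N)) x * u x)"
      by (rule ext) (simp add: d_def g_eq proj_poly_def shifted_quad_def left_diff_distrib distrib_right sum_subtractf)
  qed
  have int: "integrable lborel (\<lambda>x. cnj (d x) * (op_weyl \<epsilon> a u x - proj_poly a x * u x))"
    "integrable lborel (\<lambda>x. cnj (d x) * (op_weyl \<epsilon> a u x - g x))"
    unfolding right_diff_distrib
    by (intro Bochner_Integration.integrable_diff pk_op_integrable[OF a pk_d pk_u] pk_integrable[OF pk_d] pk_p pk_g)+
  have "L2_inner d d = L2_inner d (\<lambda>x. op_weyl \<epsilon> a u x - proj_poly a x * u x) - L2_inner d (\<lambda>x. op_weyl \<epsilon> a u x - g x)"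
    unfolding L2_inner_def Bochner_Integration.integral_diff[OF int, symmetric]
    by (rule Bochner_Integration.integral_cong) (simp_all add: d_def algebra_simps)
  also have "\<dots> = 0"
    using g d_tan proj_orthogonal[OF a d_tan] by simp
  finally have "d x = 0" for x
    by (rule L2_inner_self_zero[OF pk_continuous[OF pk_d] pk_integrable[OF pk_d pk_d]])
  then show "g = (\<lambda>x. proj_poly a x * u x)"
    by (auto simp: d_def)
qed

end

subsection \<open>Regularity of the parameters\<close>

lemma has_vector_derivative_iff_quotient:
  "(f has_vector_derivative D) (at t within S) \<longleftrightarrow> ((\<lambda>s. (f s - f t) /\<^sub>R (s - t)) \<longlongrightarrow> D) (at t within S)"
proof -
  have eq: "norm (f s - f t - (s - t) *\<^sub>R D) / norm (s - t) = norm ((f s - f t) /\<^sub>R (s - t) - D)" if "s \<noteq> t" for s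
  proof -
    have "(f s - f t) /\<^sub>R (s - t) - D = (f s - f t - (s - t) *\<^sub>R D) /\<^sub>R (s - t)"
      using that by (simp add: scaleR_diff_right)
    then show ?thesis by (simp add: divide_inverse mult.commute)
  qed
  have "(f has_vector_derivative D) (at t within S) \<longleftrightarrow>
    ((\<lambda>s. norm (f s - f t - (s - t) *\<^sub>R D) / norm (s - t)) \<longlongrightarrow> 0) (at t within S)"
    by (simp add: has_vector_derivative_def has_derivative_iff_norm bounded_linear_scaleR_left)
  also have "\<dots> \<longleftrightarrow> ((\<lambda>s. norm ((f s - f t) /\<^sub>R (s - t) - D)) \<longlongrightarrow> 0) (at t within S)"
    by (rule tendsto_cong) (auto simp: eventually_at_filter eq[unfolded real_norm_def] intro!: always_eventually)
  also have "\<dots> \<longleftrightarrow> ((\<lambda>s. (f s - f t) /\<^sub>R (s - t)) \<longlongrightarrow> D) (at t within S)"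
    by (simp add: tendsto_norm_zero_iff LIM_zero_iff)
  finally show ?thesis .
qed

lemma has_vector_derivative_vecI:
  fixes f :: "real \<Rightarrow> 'a::real_normed_vector^'n"
  assumes "\<And>i. ((\<lambda>s. f s $ i) has_vector_derivative D $ i) (at t within S)"
  shows "(f has_vector_derivative D) (at t within S)"
  using assms unfolding has_vector_derivative_iff_quotient
  by (intro vec_tendstoI) (simp add: vector_minus_component vector_scaleR_component)

section \<open>Convergence of characters\<close>

lemma norm_integral_exp_le:
  fixes c :: real
  assumes "c \<noteq> 0"
  shows "cmod (\<integral>l. indicator {0..1} l *\<^sub>R exp (\<i> * complex_of_real (l * c)) \<partial>lborel) \<le> 2 / \<bar>c\<bar>"
proof -
  have "(\<integral>l. indicator {0..1} l *\<^sub>R exp (\<i> * complex_of_real (l * c)) \<partial>lborel)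
    = exp (\<i> * complex_of_real (1 * c)) / (\<i> * c) - exp (\<i> * complex_of_real (0 * c)) / (\<i> * c)"
  proof (rule integral_FTC_atLeastAtMost)
    fix x :: real
    have "((\<lambda>l. exp ((\<i> * complex_of_real c) * of_real l) / (\<i> * c)) has_vector_derivative
        1 * (exp ((\<i> * complex_of_real c) * of_real x) * (\<i> * complex_of_real c) / (\<i> * c))) (at x within {0..1})"
      unfolding mult_1
      by (rule has_vector_derivative_real_field)
        (auto intro!: derivative_eq_intros)
    then show "((\<lambda>l. exp (\<i> * complex_of_real (l * c)) / (\<i> * c)) has_vector_derivative
        exp (\<i> * complex_of_real (x * c))) (at x within {0..1})"
      using assms by (simp add: mult_ac)
    show "continuous_on {0..1} (\<lambda>l. exp (\<i> * complex_of_real (l * c)))"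
      by (intro continuous_intros)
  qed simp
  then have "cmod (\<integral>l. indicator {0..1} l *\<^sub>R exp (\<i> * complex_of_real (l * c)) \<partial>lborel)
    \<le> cmod (exp (\<i> * complex_of_real (1 * c)) / (\<i> * c)) + cmod (exp (\<i> * complex_of_real (0 * c)) / (\<i> * c))"
    using norm_triangle_ineq4 by metis
  also have "\<dots> = 2 / \<bar>c\<bar>"
    by (simp add: norm_divide norm_mult)
  finally show ?thesis .
qed

text \<open>Averaging the characters over \<open>0 \<le> \<lambda> \<le> 1\<close> shows that \<open>c\<close> is eventually bounded, and then
  the principal branch of the logarithm applies.\<close>

lemma characters_tendsto_real:
  fixes c :: "nat \<Rightarrow> real"
  assumes "\<And>l::real. (\<lambda>n. exp (\<i> * complex_of_real (l * c n))) \<longlonglongrightarrow> 1"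
  shows "c \<longlonglongrightarrow> 0"
proof -
  define J where "J r = (\<integral>l. indicator {0..1} l *\<^sub>R exp (\<i> * complex_of_real (l * r)) \<partial>lborel)" for r :: real
  have int: "integrable lborel (\<lambda>l. indicator {0..1} l *\<^sub>R exp (\<i> * complex_of_real (l * r)))" for r
    using borel_integrable_atLeastAtMost'[of 0 1 "\<lambda>l. exp (\<i> * complex_of_real (l * r))"]
    by (simp add: set_integrable_def continuous_intros)
  have "(\<lambda>n. J (c n)) \<longlonglongrightarrow> (\<integral>l. indicator {0..1::real} l *\<^sub>R (1::complex) \<partial>lborel)"
    unfolding J_def
  proof (rule integral_dominated_convergence)
    show "integrable lborel (\<lambda>l. indicator {0..1::real} l :: real)"
      by (simp add: integrable_real_indicator)
    show "AE l in lborel. (\<lambda>n. indicator {0..1} l *\<^sub>R exp (\<i> * complex_of_real (l * c n))) \<longlonglongrightarrow> indicator {0..1::real} l *\<^sub>R 1"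
      by (intro AE_I2 tendsto_intros assms)
    show "AE l in lborel. norm (indicator {0..1} l *\<^sub>R exp (\<i> * complex_of_real (l * c n))) \<le> indicator {0..1::real} l" for n
      by (auto simp: indicator_def)
  qed (use int in auto)
  then have "(\<lambda>n. J (c n)) \<longlonglongrightarrow> 1" by simp
  then have "\<forall>\<^sub>F n in sequentially. dist (J (c n)) 1 < 1/2"
    by (rule tendstoD) simp
  \<comment> \<open>For |c n| at least 4 the averaged character has modulus at most 2/4, which is
    incompatible with a distance below 1/2 from 1.\<close>
  then have bd: "\<forall>\<^sub>F n in sequentially. \<bar>c n\<bar> < 4"
  proof eventually_elim
    case (elim n)
    show ?case
    proof (rule ccontr)
      assume "\<not> \<bar>c n\<bar> < 4"
      then have "c n \<noteq> 0" "2 / \<bar>c n\<bar> \<le> 1/2"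
        by (auto simp: field_simps)
      moreover from \<open>c n \<noteq> 0\<close> have "cmod (J (c n)) \<le> 2 / \<bar>c n\<bar>"
        unfolding J_def by (rule norm_integral_exp_le)
      moreover have "1 \<le> cmod (J (c n)) + dist (J (c n)) 1"
        using norm_triangle_ineq[of "J (c n)" "1 - J (c n)"] by (simp add: dist_norm norm_minus_commute)
      ultimately show False using elim by linarith
    qed
  qed
  \<comment> \<open>The character at l = 1/2 is used so that the argument stays below 4/2 < \<pi>,
    inside the strip where \<open>Ln\<close> inverts the exponential.\<close>
  have "(\<lambda>n. Ln (exp (\<i> * complex_of_real (1/2 * c n)))) \<longlonglongrightarrow> Ln 1"
    by (intro tendsto_Ln assms) auto
  moreover from bd have "\<forall>\<^sub>F n in sequentially. Ln (exp (\<i> * complex_of_real (1/2 * c n))) = \<i> * complex_of_real (1/2 * c n)"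
  proof eventually_elim
    case (elim n)
    show ?case by (rule Ln_exp) (use elim pi_gt3 in auto)
  qed
  ultimately have "(\<lambda>n. \<i> * complex_of_real (1/2 * c n)) \<longlonglongrightarrow> Ln 1"
    by (rule Lim_transform_eventually)
  from tendsto_Im[OF this] have "(\<lambda>n. 1/2 * c n) \<longlonglongrightarrow> 0" by simp
  from tendsto_mult[OF tendsto_const[of 2] this] show ?thesis by simp
qed

text \<open>The modulus at l = 1 controls the imaginary part through the real logarithm. Once the
  modulus is divided out, the real part falls under the unimodular case.\<close>

lemma characters_tendsto:
  fixes c :: "nat \<Rightarrow> complex"
  assumes "\<And>l::real. (\<lambda>n. exp (\<i> * (complex_of_real l * c n))) \<longlonglongrightarrow> 1"
  shows "c \<longlonglongrightarrow> 0"
proof -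
  have "(\<lambda>n. exp (- Im (c n))) \<longlonglongrightarrow> 1"
    using tendsto_norm[OF assms[of 1]] by simp
  then have "(\<lambda>n. ln (exp (- Im (c n)))) \<longlonglongrightarrow> ln 1"
    by (intro tendsto_ln) auto
  from tendsto_minus[OF this] have Im: "(\<lambda>n. Im (c n)) \<longlonglongrightarrow> 0" by simp
  have Re: "(\<lambda>n. Re (c n)) \<longlonglongrightarrow> 0"
  proof (rule characters_tendsto_real)
    fix l :: real
    have "(\<lambda>n. exp (\<i> * (complex_of_real l * c n)) * exp (complex_of_real (l * Im (c n)))) \<longlonglongrightarrow> 1 * exp (complex_of_real (l * 0))"
      by (intro tendsto_intros assms Im)
    moreover have "exp (\<i> * (complex_of_real l * c n)) * exp (complex_of_real (l * Im (c n))) = exp (\<i> * complex_of_real (l * Re (c n)))" for n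
    proof -
      have "\<i> * (complex_of_real l * c n) + complex_of_real (l * Im (c n)) = \<i> * complex_of_real (l * Re (c n))"
        by (simp add: complex_eq_iff)
      then show ?thesis by (simp only: exp_add[symmetric])
    qed
    ultimately show "(\<lambda>n. exp (\<i> * complex_of_real (l * Re (c n)))) \<longlonglongrightarrow> 1" by simp
  qed
  have "(\<lambda>n. Complex (Re (c n)) (Im (c n))) \<longlonglongrightarrow> Complex 0 0"
    by (rule tendsto_Complex[OF Re Im])
  then show ?thesis by (simp add: complex_eq_iff zero_complex.code)
qed

section \<open>Recovering parameters from values of a Gaussian\<close>

lemma shifted_quad_at:
  "shifted_quad q c b A (q + r *\<^sub>R axis i 1 + s *\<^sub>R axis j 1)
    = c + r * b i + s * b j + r\<^sup>2 * A i i + r * s * (A i j + A j i) + s\<^sup>2 * A j j"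
proof -
  let ?y = "\<lambda>k. complex_of_real r * (if k = i then 1 else 0) + complex_of_real s * (if k = j then 1 else 0)"
  have y: "centered q k (q + r *\<^sub>R axis i 1 + s *\<^sub>R axis j 1) = ?y k" for k
    by (simp add: centered_def axis_def)
  have lin: "(\<Sum>k\<in>UNIV. f k * ?y k) = r * f i + s * f j" for f :: "'a \<Rightarrow> complex"
    unfolding distrib_left sum.distrib by (simp add: if_distrib cong: if_cong)
  have "(\<Sum>k\<in>UNIV. \<Sum>l\<in>UNIV. A k l * (?y k * ?y l)) = (\<Sum>k\<in>UNIV. (\<Sum>l\<in>UNIV. A k l * ?y l) * ?y k)"
    by (intro sum.cong refl, subst sum_distrib_right, simp only: mult_ac)
  also have "\<dots> = r * (r * A i i + s * A i j) + s * (r * A j i + s * A j j)"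
    unfolding lin ..
  finally show ?thesis
    unfolding shifted_quad_def y lin by (simp add: power2_eq_square algebra_simps)
qed

text \<open>Values on combinations of two coordinate vectors separate the coefficients. The double
  sum sees only \<open>A i j + A j i\<close>, so only the symmetric part of \<open>A\<close> is
  determined.\<close>

lemma shifted_quad_unique:
  assumes eq: "\<And>x. shifted_quad q c b A x = shifted_quad q c' b' A' x"
  shows "c = c'" "b = b'" "A i j + A j i = A' i j + A' j i"
proof -
  have at: "c + r * b i + s * b j + r\<^sup>2 * A i i + r * s * (A i j + A j i) + s\<^sup>2 * A j j
    = c' + r * b' i + s * b' j + r\<^sup>2 * A' i i + r * s * (A' i j + A' j i) + s\<^sup>2 * A' j j" for r s :: real and i j
    using eq[of "q + r *\<^sub>R axis i 1 + s *\<^sub>R axis j 1"] unfolding shifted_quad_at by simp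
  show c: "c = c'" using at[of 0 _ 0] by simp
  have 1: "b i + A i i = b' i + A' i i" for i
    using at[of 1 i 0 i] c by simp
  have 2: "- b i + A i i = - b' i + A' i i" for i
    using at[of "-1" i 0 i] c by (simp add: algebra_simps)
  have b: "b i = b' i" for i
  proof -
    have "2 * b i = 2 * b' i"
      using arg_cong2[OF 1[of i] 2[of i], of "(-)"] by simp
    then show ?thesis by simp
  qed
  then show "b = b'" by auto
  have A: "A i i = A' i i" for i using 1[of i] b[of i] by simp
  show "A i j + A j i = A' i j + A' j i"
    using at[of 1 i 1 j] c b[of i] b[of j] A[of i] A[of j] by simp
qed

text \<open>Linear coefficient of the exponent as a polynomial about the fixed origin, that is p - C
  q. Unlike \<open>q\<close> and \<open>p\<close> it is a linear combination of values of the
  exponent at fixed points.\<close>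

definition lin_coeff :: "real^'n \<Rightarrow> real^'n \<Rightarrow> complex^'n^'n \<Rightarrow> 'n \<Rightarrow> complex" where
  "lin_coeff q p C j = complex_of_real (p $ j) - (\<Sum>l\<in>UNIV. C $ j $ l * complex_of_real (q $ l))"

definition const_coeff :: "real^'n \<Rightarrow> real^'n \<Rightarrow> complex^'n^'n \<Rightarrow> complex \<Rightarrow> complex" where
  "const_coeff q p C \<zeta> = gauss_exponent q p C \<zeta> 0"

lemma gauss_exponent_shifted:
  "gauss_exponent q p C \<zeta> x = shifted_quad q \<zeta> (\<lambda>j. complex_of_real (p $ j)) (\<lambda>i j. C $ i $ j / 2) x"
  by (simp add: gauss_exponent_def shifted_quad_def sum_distrib_left mult.assoc)

lemma gauss_exponent_expand:
  assumes "transpose C = C"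
  shows "gauss_exponent q p C \<zeta> x = shifted_quad 0 (const_coeff q p C \<zeta>) (lin_coeff q p C) (\<lambda>i j. C $ i $ j / 2) x"
proof -
  have sym: "C $ i $ j = C $ j $ i" for i j
    using arg_cong[OF assms, of "\<lambda>A. A $ j $ i"] by (simp add: transpose_def)
  have "lin_coeff q p C = (\<lambda>j. complex_of_real (p $ j) + (\<Sum>i\<in>UNIV. (C $ i $ j / 2 + C $ j $ i / 2) * centered q i 0))"
    by (rule ext) (simp add: lin_coeff_def centered_def sym[of _ "_ :: 'a"] sum_negf)
  moreover have "const_coeff q p C \<zeta> = \<zeta> + (\<Sum>j\<in>UNIV. complex_of_real (p $ j) * centered q j 0)
     + (\<Sum>i\<in>UNIV. \<Sum>j\<in>UNIV. C $ i $ j / 2 * (centered q i 0 * centered q j 0))"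
    unfolding const_coeff_def gauss_exponent_shifted by (simp add: shifted_quad_def)
  ultimately show ?thesis
    unfolding gauss_exponent_shifted shifted_quad_shift[of q _ _ _ x 0] by simp
qed

lemma gauss_exponent_at:
  assumes "transpose C = C"
  shows "gauss_exponent q p C \<zeta> (r *\<^sub>R axis i 1 + s *\<^sub>R axis j 1) = const_coeff q p C \<zeta> + r * lin_coeff q p C i + s * lin_coeff q p C j
    + r\<^sup>2 * (C $ i $ i / 2) + r * s * C $ i $ j + s\<^sup>2 * (C $ j $ j / 2)"
proof -
  have sym: "C $ j $ i = C $ i $ j"
    using arg_cong[OF assms, of "\<lambda>A. A $ i $ j"] by (simp add: transpose_def)
  show ?thesis
    unfolding gauss_exponent_expand[OF assms]
    using shifted_quad_at[of 0 "const_coeff q p C \<zeta>" "lin_coeff q p C" "\<lambda>i j. C $ i $ j / 2" r i s j]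
    by (simp add: sym)
qed

lemma quadratic_form_bound:
  fixes A :: "real^'n^'n"
  shows "\<bar>v \<bullet> (A *v v)\<bar> \<le> (\<Sum>i\<in>UNIV. \<Sum>j\<in>UNIV. \<bar>A $ i $ j\<bar>) * (norm v)\<^sup>2"
proof -
  have "\<bar>v \<bullet> (A *v v)\<bar> = \<bar>\<Sum>i\<in>UNIV. \<Sum>j\<in>UNIV. v $ i * (A $ i $ j * v $ j)\<bar>"
    by (simp add: inner_vec_def matrix_vector_mult_def sum_distrib_left)
  also have "\<dots> \<le> (\<Sum>i\<in>UNIV. \<Sum>j\<in>UNIV. \<bar>v $ i * (A $ i $ j * v $ j)\<bar>)"
    by (intro order_trans[OF sum_abs] sum_mono sum_abs)
  also have "\<dots> \<le> (\<Sum>i\<in>UNIV. \<Sum>j\<in>UNIV. \<bar>A $ i $ j\<bar> * (norm v)\<^sup>2)"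
  proof (intro sum_mono)
    fix i j
    have "\<bar>v $ i * (A $ i $ j * v $ j)\<bar> = \<bar>A $ i $ j\<bar> * (\<bar>v $ i\<bar> * \<bar>v $ j\<bar>)"
      by (simp add: abs_mult mult_ac)
    also have "\<dots> \<le> \<bar>A $ i $ j\<bar> * (norm v * norm v)"
      by (intro mult_left_mono mult_mono component_le_norm_cart) auto
    finally show "\<bar>v $ i * (A $ i $ j * v $ j)\<bar> \<le> \<bar>A $ i $ j\<bar> * (norm v)\<^sup>2"
      by (simp add: power2_eq_square)
  qed
  also have "\<dots> = (\<Sum>i\<in>UNIV. \<Sum>j\<in>UNIV. \<bar>A $ i $ j\<bar>) * (norm v)\<^sup>2"
    by (simp add: sum_distrib_right)
  finally show ?thesis .
qed

lemma coercive_nearby: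
  fixes A A' :: "real^'n^'n"
  assumes "\<And>v. c * (norm v)\<^sup>2 \<le> v \<bullet> (A *v v)"
    and "(\<Sum>i\<in>UNIV. \<Sum>j\<in>UNIV. \<bar>(A' - A) $ i $ j\<bar>) \<le> c / 2"
  shows "c / 2 * (norm v)\<^sup>2 \<le> v \<bullet> (A' *v v)"
proof -
  have "v \<bullet> (A' *v v) = v \<bullet> (A *v v) + v \<bullet> ((A' - A) *v v)"
    by (simp add: matrix_vector_mult_diff_rdistrib inner_diff_right)
  moreover have "\<bar>v \<bullet> ((A' - A) *v v)\<bar> \<le> c / 2 * (norm v)\<^sup>2"
    by (rule order_trans[OF quadratic_form_bound mult_right_mono[OF assms(2)]]) simp
  ultimately show ?thesis using assms(1)[of v] by (simp add: abs_le_iff)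
qed

lemma width_matrix_sym: "width_matrix C \<Longrightarrow> transpose C = C"
  by (simp add: width_matrix_def)

lemma width_matrix_coercive:
  assumes "width_matrix C"
  obtains c where "c > 0" "\<And>v. c * (norm v)\<^sup>2 \<le> v \<bullet> (Im_mat C *v v)"
  using assms positive_definite_coercive[of "Im_mat C"] unfolding width_matrix_def by metis

lemma gauss_ratio: "gauss \<epsilon> q p C \<zeta> x / gauss \<epsilon> q' p' C' \<zeta>' x
    = exp (\<i> / \<epsilon> * (gauss_exponent q p C \<zeta> x - gauss_exponent q' p' C' \<zeta>' x))"
  by (simp add: gauss_eq right_diff_distrib exp_diff)

lemma gauss_nonzero: "gauss \<epsilon> q p C \<zeta> x \<noteq> 0"
  by (simp add: gauss_def)

lemma coercive_eventually:
  fixes A :: "'b \<Rightarrow> real^'n^'n"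
  assumes "c > 0" "\<And>v. c * (norm v)\<^sup>2 \<le> v \<bullet> (A0 *v v)" and A: "(A \<longlongrightarrow> A0) F"
  shows "\<forall>\<^sub>F n in F. \<forall>v. c / 2 * (norm v)\<^sup>2 \<le> v \<bullet> (A n *v v)"
proof -
  have "((\<lambda>n. \<Sum>i\<in>UNIV. \<Sum>j\<in>UNIV. \<bar>(A n - A0) $ i $ j\<bar>) \<longlongrightarrow> (\<Sum>i\<in>UNIV. \<Sum>j\<in>UNIV. \<bar>(A0 - A0) $ i $ j\<bar>)) F"
    by (intro tendsto_intros A)
  then have "((\<lambda>n. \<Sum>i\<in>UNIV. \<Sum>j\<in>UNIV. \<bar>(A n - A0) $ i $ j\<bar>) \<longlongrightarrow> 0) F" by simp
  then have "\<forall>\<^sub>F n in F. (\<Sum>i\<in>UNIV. \<Sum>j\<in>UNIV. \<bar>(A n - A0) $ i $ j\<bar>) < c / 2"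
    by (rule order_tendstoD) (use assms(1) in simp)
  then show ?thesis
    by eventually_elim (use coercive_nearby[OF assms(2)] in auto)
qed

text \<open>The exponents are known only modulo \<open>2 \<pi> \<epsilon>\<close>, so their finite
  differences are formed multiplicatively, as products and quotients of Gaussian ratios. This yields
  C first, then p - C q, and from it q by imaginary parts and p by real parts. The parameter \<zeta>
  is absent since its branch is undetermined.\<close>

theorem gauss_tendsto_params:
  fixes q p :: "nat \<Rightarrow> real^'n"
  assumes eps: "\<epsilon> > 0" and w: "\<And>n. width_matrix (C n)" "width_matrix C0"
    and lim: "\<And>x. (\<lambda>n. gauss \<epsilon> (q n) (p n) (C n) (\<zeta> n) x) \<longlonglongrightarrow> gauss \<epsilon> q0 p0 C0 \<zeta>0 x"
  shows "C \<longlonglongrightarrow> C0" "q \<longlonglongrightarrow> q0" "p \<longlonglongrightarrow> p0"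
proof -
  define E where "E n x = gauss_exponent (q n) (p n) (C n) (\<zeta> n) x - gauss_exponent q0 p0 C0 \<zeta>0 x" for n x
  have g: "(\<lambda>n. exp (\<i> / \<epsilon> * E n x)) \<longlonglongrightarrow> 1" for x
    using tendsto_divide[OF lim[of x] tendsto_const[of "gauss \<epsilon> q0 p0 C0 \<zeta>0 x"] gauss_nonzero]
    unfolding gauss_ratio E_def by simp
  have E_at: "E n (r *\<^sub>R axis i 1 + s *\<^sub>R axis j 1) = (const_coeff (q n) (p n) (C n) (\<zeta> n) - const_coeff q0 p0 C0 \<zeta>0)
    + r * (lin_coeff (q n) (p n) (C n) i - lin_coeff q0 p0 C0 i) + s * (lin_coeff (q n) (p n) (C n) j - lin_coeff q0 p0 C0 j)
    + r\<^sup>2 * ((C n $ i $ i - C0 $ i $ i) / 2) + r * s * (C n $ i $ j - C0 $ i $ j) + s\<^sup>2 * ((C n $ j $ j - C0 $ j $ j) / 2)"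
    for n r i s j
    unfolding E_def gauss_exponent_at[OF width_matrix_sym[OF w(1)]] gauss_exponent_at[OF width_matrix_sym[OF w(2)]]
    by (simp add: algebra_simps diff_divide_distrib)
  have C_lim: "(\<lambda>n. C n $ i $ j - C0 $ i $ j) \<longlonglongrightarrow> 0" for i j
  proof -
    have "(\<lambda>n. (C n $ i $ j - C0 $ i $ j) / \<epsilon>) \<longlonglongrightarrow> 0"
    proof (rule characters_tendsto)
      fix l :: real
      \<comment> \<open>Mixed second difference with step \<open>l\<close> along \<open>i\<close>
        and step 1 along \<open>j\<close>: everything cancels except \<open>l\<close> times the
        entry of C, so every real \<open>l\<close> gives one character.\<close>
      have "(\<lambda>n. exp (\<i> / \<epsilon> * E n (l *\<^sub>R axis i 1 + 1 *\<^sub>R axis j 1)) * exp (\<i> / \<epsilon> * E n (0 *\<^sub>R axis i 1 + 0 *\<^sub>R axis j 1))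
        / (exp (\<i> / \<epsilon> * E n (l *\<^sub>R axis i 1 + 0 *\<^sub>R axis j 1)) * exp (\<i> / \<epsilon> * E n (0 *\<^sub>R axis i 1 + 1 *\<^sub>R axis j 1)))) \<longlonglongrightarrow> 1 * 1 / (1 * 1)"
        by (intro tendsto_mult tendsto_divide g) simp
      moreover have "exp (\<i> / \<epsilon> * E n (l *\<^sub>R axis i 1 + 1 *\<^sub>R axis j 1)) * exp (\<i> / \<epsilon> * E n (0 *\<^sub>R axis i 1 + 0 *\<^sub>R axis j 1))
        / (exp (\<i> / \<epsilon> * E n (l *\<^sub>R axis i 1 + 0 *\<^sub>R axis j 1)) * exp (\<i> / \<epsilon> * E n (0 *\<^sub>R axis i 1 + 1 *\<^sub>R axis j 1)))
        = exp (\<i> * (complex_of_real l * ((C n $ i $ j - C0 $ i $ j) / \<epsilon>)))" for n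
      proof -
        have "\<i> / \<epsilon> * E n (l *\<^sub>R axis i 1 + 1 *\<^sub>R axis j 1) + \<i> / \<epsilon> * E n (0 *\<^sub>R axis i 1 + 0 *\<^sub>R axis j 1)
          - (\<i> / \<epsilon> * E n (l *\<^sub>R axis i 1 + 0 *\<^sub>R axis j 1) + \<i> / \<epsilon> * E n (0 *\<^sub>R axis i 1 + 1 *\<^sub>R axis j 1))
          = \<i> / \<epsilon> * (E n (l *\<^sub>R axis i 1 + 1 *\<^sub>R axis j 1) + E n (0 *\<^sub>R axis i 1 + 0 *\<^sub>R axis j 1)
          - E n (l *\<^sub>R axis i 1 + 0 *\<^sub>R axis j 1) - E n (0 *\<^sub>R axis i 1 + 1 *\<^sub>R axis j 1))"
          by (simp only: right_diff_distrib distrib_left diff_diff_eq)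
        also have "\<dots> = \<i> / \<epsilon> * (complex_of_real l * (C n $ i $ j - C0 $ i $ j))"
          unfolding E_at by simp
        finally have e: "\<i> / \<epsilon> * E n (l *\<^sub>R axis i 1 + 1 *\<^sub>R axis j 1) + \<i> / \<epsilon> * E n (0 *\<^sub>R axis i 1 + 0 *\<^sub>R axis j 1)
          - (\<i> / \<epsilon> * E n (l *\<^sub>R axis i 1 + 0 *\<^sub>R axis j 1) + \<i> / \<epsilon> * E n (0 *\<^sub>R axis i 1 + 1 *\<^sub>R axis j 1))
          = \<i> * (complex_of_real l * ((C n $ i $ j - C0 $ i $ j) / \<epsilon>))" by simp
        show ?thesis unfolding exp_add[symmetric] exp_diff[symmetric] e ..
      qed
      ultimately show "(\<lambda>n. exp (\<i> * (complex_of_real l * ((C n $ i $ j - C0 $ i $ j) / \<epsilon>)))) \<longlonglongrightarrow> 1"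
        by simp
    qed
    from tendsto_mult[OF this tendsto_const[of "complex_of_real \<epsilon>"]] show ?thesis using eps by simp
  qed
  have b_lim: "(\<lambda>n. lin_coeff (q n) (p n) (C n) i - lin_coeff q0 p0 C0 i) \<longlonglongrightarrow> 0" for i
  proof -
    have "(\<lambda>n. (lin_coeff (q n) (p n) (C n) i - lin_coeff q0 p0 C0 i) / \<epsilon>) \<longlonglongrightarrow> 0"
    proof (rule characters_tendsto)
      fix l :: real
      \<comment> \<open>A first difference from the origin. Its quadratic contribution is already
        known to converge and is divided out, leaving \<open>l\<close> times the linear
        coefficient.\<close>
      have "(\<lambda>n. exp (\<i> / \<epsilon> * E n (l *\<^sub>R axis i 1 + 0 *\<^sub>R axis i 1)) / (exp (\<i> / \<epsilon> * E n (0 *\<^sub>R axis i 1 + 0 *\<^sub>R axis i 1))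
         * exp (\<i> / \<epsilon> * (l\<^sup>2 * ((C n $ i $ i - C0 $ i $ i) / 2))))) \<longlonglongrightarrow> 1 / (1 * exp (\<i> / \<epsilon> * (l\<^sup>2 * (0 / 2))))"
        by (intro tendsto_mult tendsto_divide tendsto_exp tendsto_const g C_lim) (use eps in \<open>simp_all add: tendsto_mult_right_zero C_lim\<close>)
      moreover have "exp (\<i> / \<epsilon> * E n (l *\<^sub>R axis i 1 + 0 *\<^sub>R axis i 1)) / (exp (\<i> / \<epsilon> * E n (0 *\<^sub>R axis i 1 + 0 *\<^sub>R axis i 1))
         * exp (\<i> / \<epsilon> * (l\<^sup>2 * ((C n $ i $ i - C0 $ i $ i) / 2))))
         = exp (\<i> * (complex_of_real l * ((lin_coeff (q n) (p n) (C n) i - lin_coeff q0 p0 C0 i) / \<epsilon>)))" for n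
      proof -
        have "\<i> / \<epsilon> * E n (l *\<^sub>R axis i 1 + 0 *\<^sub>R axis i 1) - (\<i> / \<epsilon> * E n (0 *\<^sub>R axis i 1 + 0 *\<^sub>R axis i 1)
           + \<i> / \<epsilon> * (l\<^sup>2 * ((C n $ i $ i - C0 $ i $ i) / 2)))
          = \<i> / \<epsilon> * (E n (l *\<^sub>R axis i 1 + 0 *\<^sub>R axis i 1) - E n (0 *\<^sub>R axis i 1 + 0 *\<^sub>R axis i 1) - l\<^sup>2 * ((C n $ i $ i - C0 $ i $ i) / 2))"
          by (simp only: right_diff_distrib distrib_left diff_diff_eq)
        also have "\<dots> = \<i> / \<epsilon> * (complex_of_real l * (lin_coeff (q n) (p n) (C n) i - lin_coeff q0 p0 C0 i))"
          unfolding E_at by simp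
        finally have e: "\<i> / \<epsilon> * E n (l *\<^sub>R axis i 1 + 0 *\<^sub>R axis i 1) - (\<i> / \<epsilon> * E n (0 *\<^sub>R axis i 1 + 0 *\<^sub>R axis i 1)
           + \<i> / \<epsilon> * (l\<^sup>2 * ((C n $ i $ i - C0 $ i $ i) / 2)))
          = \<i> * (complex_of_real l * ((lin_coeff (q n) (p n) (C n) i - lin_coeff q0 p0 C0 i) / \<epsilon>))" by simp
        show ?thesis unfolding exp_add[symmetric] exp_diff[symmetric] e ..
      qed
      ultimately show "(\<lambda>n. exp (\<i> * (complex_of_real l * ((lin_coeff (q n) (p n) (C n) i - lin_coeff q0 p0 C0 i) / \<epsilon>)))) \<longlonglongrightarrow> 1"
        by simp
    qed
    from tendsto_mult[OF this tendsto_const[of "complex_of_real \<epsilon>"]] show ?thesis using eps by simp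
  qed
  have C_lim': "(\<lambda>n. C n $ i $ j) \<longlonglongrightarrow> C0 $ i $ j" for i j
    using C_lim by (simp add: LIM_zero_iff)
  have b_lim': "(\<lambda>n. lin_coeff (q n) (p n) (C n) j) \<longlonglongrightarrow> lin_coeff q0 p0 C0 j" for j
    using b_lim by (simp add: LIM_zero_iff)
  show "C \<longlonglongrightarrow> C0"
    by (intro vec_tendstoI C_lim')
  have Im_lim: "(\<lambda>n. Im_mat (C n)) \<longlonglongrightarrow> Im_mat C0"
    by (intro vec_tendstoI) (simp add: Im_mat_def tendsto_Im C_lim')
  obtain c where c: "c > 0" "\<And>v. c * (norm v)\<^sup>2 \<le> v \<bullet> (Im_mat C0 *v v)"
    using width_matrix_coercive[OF w(2)] by blast
  \<comment> \<open>Since \<open>p\<close> and \<open>q\<close> are real, the imaginary part of p -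
    C q is -(Im C) q. Hence \<open>y\<close> tends to 0, and coercivity of Im C with one constant
    for all large \<open>n\<close> transfers this to \<open>q n - q0\<close>.\<close>
  define y where "y n = Im_mat (C n) *v (q n - q0)" for n
  have y_lim: "y \<longlonglongrightarrow> 0"
  proof (rule vec_tendstoI)
    fix j
    have "y n $ j = - Im (lin_coeff (q n) (p n) (C n) j) - (\<Sum>l\<in>UNIV. Im (C n $ j $ l) * q0 $ l)" for n
      by (simp add: y_def matrix_vector_mult_def Im_mat_def lin_coeff_def Im_sum right_diff_distrib sum_subtractf)
    moreover have "(\<lambda>n. - Im (lin_coeff (q n) (p n) (C n) j) - (\<Sum>l\<in>UNIV. Im (C n $ j $ l) * q0 $ l))
      \<longlonglongrightarrow> - Im (lin_coeff q0 p0 C0 j) - (\<Sum>l\<in>UNIV. Im (C0 $ j $ l) * q0 $ l)"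
      by (intro tendsto_intros b_lim' C_lim')
    moreover have "- Im (lin_coeff q0 p0 C0 j) - (\<Sum>l\<in>UNIV. Im (C0 $ j $ l) * q0 $ l) = 0"
      by (simp add: lin_coeff_def Im_sum)
    ultimately show "(\<lambda>n. y n $ j) \<longlonglongrightarrow> 0 $ j" by simp
  qed
  have "(\<lambda>n. q n - q0) \<longlonglongrightarrow> 0"
  proof (rule Lim_null_comparison)
    show "\<forall>\<^sub>F n in sequentially. norm (q n - q0) \<le> 2 / c * norm (y n)"
      using coercive_eventually[OF c Im_lim]
    proof eventually_elim
      case (elim n)
      have "c / 2 * (norm (q n - q0))\<^sup>2 \<le> (q n - q0) \<bullet> y n"
        using elim unfolding y_def by blast
      also have "\<dots> \<le> norm (q n - q0) * norm (y n)" by (rule norm_cauchy_schwarz)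
      finally have "norm (q n - q0) * (c / 2 * norm (q n - q0)) \<le> norm (q n - q0) * norm (y n)"
        by (simp add: power2_eq_square mult_ac)
      then show ?case
        using c(1) by (cases "q n = q0") (auto simp: field_simps)
    qed
    show "(\<lambda>n. 2 / c * norm (y n)) \<longlonglongrightarrow> 0"
      using tendsto_mult[OF tendsto_const[of "2 / c"] tendsto_norm[OF y_lim]] by simp
  qed
  then show q_lim: "q \<longlonglongrightarrow> q0" by (simp add: LIM_zero_iff)
  show "p \<longlonglongrightarrow> p0"
  proof (rule vec_tendstoI)
    fix j
    have p: "p $ j = Re (lin_coeff q p C j + (\<Sum>l\<in>UNIV. C $ j $ l * complex_of_real (q $ l)))" for q p :: "real^'n" and C
      by (simp add: lin_coeff_def)
    have "(\<lambda>n. Re (lin_coeff (q n) (p n) (C n) j + (\<Sum>l\<in>UNIV. C n $ j $ l * complex_of_real (q n $ l))))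
      \<longlonglongrightarrow> Re (lin_coeff q0 p0 C0 j + (\<Sum>l\<in>UNIV. C0 $ j $ l * complex_of_real (q0 $ l)))"
      by (intro tendsto_intros b_lim' C_lim' q_lim)
    then show "(\<lambda>n. p n $ j) \<longlonglongrightarrow> p0 $ j"
      by (simp only: p[symmetric])
  qed
qed

lemma tendsto_within_sequentiallyI:
  fixes f :: "real \<Rightarrow> 'a::topological_space"
  assumes "\<And>X. (\<And>n. X n \<in> S) \<Longrightarrow> (\<And>n. X n \<noteq> t) \<Longrightarrow> X \<longlonglongrightarrow> t \<Longrightarrow> (\<lambda>n. f (X n)) \<longlonglongrightarrow> l"
  shows "(f \<longlongrightarrow> l) (at t within S)"
  using assms by (auto simp: tendsto_at_iff_sequentially o_def)

text \<open>On the segment the real part stays below the larger endpoint value. The moduli are kept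
  in the bound, rather than a constant, so that differences of Gaussians inherit Gaussian
  decay.\<close>

lemma norm_exp_diff_le:
  fixes a b :: complex
  shows "cmod (exp a - exp b) \<le> (cmod (exp a) + cmod (exp b)) * cmod (a - b)"
proof (rule field_differentiable_bound[of "closed_segment a b" exp exp])
  show "(exp has_field_derivative exp z) (at z within closed_segment a b)" for z
    by (rule DERIV_subset[OF DERIV_exp]) simp
  fix z assume "z \<in> closed_segment a b"
  then obtain r where r: "0 \<le> r" "r \<le> 1" "z = (1 - r) *\<^sub>R a + r *\<^sub>R b"
    by (auto simp: closed_segment_def)
  have "Re z = (1 - r) * Re a + r * Re b" by (simp add: r(3))
  also have "\<dots> \<le> (1 - r) * max (Re a) (Re b) + r * max (Re a) (Re b)"
    using r by (intro add_mono mult_left_mono) auto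
  finally have "Re z \<le> max (Re a) (Re b)" by (simp add: algebra_simps)
  then have "cmod (exp z) \<le> exp (max (Re a) (Re b))" by simp
  also have "\<dots> \<le> exp (Re a) + exp (Re b)" by (simp add: max_def)
  finally show "norm (exp z) \<le> cmod (exp a) + cmod (exp b)" by simp
qed (auto intro: convex_closed_segment)

lemma shifted_quad_bound:
  "cmod (shifted_quad 0 c b A x) \<le> (cmod c + (\<Sum>j\<in>UNIV. cmod (b j)) + (\<Sum>i\<in>UNIV. \<Sum>j\<in>UNIV. cmod (A i j))) * (1 + norm x)\<^sup>2"
proof -
  let ?r = "1 + norm x"
  have Y: "cmod (centered 0 j x) \<le> ?r" for j
    using component_le_norm_cart[of x j] by (simp add: centered_def)
  have r: "1 \<le> ?r\<^sup>2" "?r \<le> ?r\<^sup>2"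
    by (simp_all add: power2_eq_square algebra_simps)
  have 1: "cmod c \<le> cmod c * ?r\<^sup>2"
    using mult_left_mono[OF r(1), of "cmod c"] by simp
  have 2: "cmod (\<Sum>j\<in>UNIV. b j * centered 0 j x) \<le> (\<Sum>j\<in>UNIV. cmod (b j)) * ?r\<^sup>2"
    unfolding sum_distrib_right
    by (intro order_trans[OF norm_sum] sum_mono) (auto simp: norm_mult intro!: mult_left_mono order_trans[OF Y r(2)])
  have 3: "cmod (\<Sum>i\<in>UNIV. \<Sum>j\<in>UNIV. A i j * (centered 0 i x * centered 0 j x)) \<le> (\<Sum>i\<in>UNIV. \<Sum>j\<in>UNIV. cmod (A i j)) * ?r\<^sup>2"
    unfolding sum_distrib_right
  proof (intro order_trans[OF norm_sum] sum_mono)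
    fix i j
    have "cmod (centered 0 i x) * cmod (centered 0 j x) \<le> ?r * ?r"
      by (intro mult_mono Y) auto
    then show "cmod (A i j * (centered 0 i x * centered 0 j x)) \<le> cmod (A i j) * ?r\<^sup>2"
      by (simp add: norm_mult power2_eq_square mult_left_mono)
  qed
  show ?thesis
    unfolding shifted_quad_def distrib_right
    by (intro order_trans[OF norm_triangle_ineq] add_mono 1 2 3)
qed

section \<open>Curves in the manifold of wave packets\<close>

locale packet_curve =
  fixes \<epsilon> :: real and I :: "real set" and u :: "real \<Rightarrow> real^'n \<Rightarrow> complex"
    and q p :: "real \<Rightarrow> real^'n" and C :: "real \<Rightarrow> complex^'n^'n" and \<zeta> :: "real \<Rightarrow> complex"
  assumes eps: "\<epsilon> > 0" and params: "packet_params \<epsilon> I u q p C \<zeta>"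
    and u_cont: "continuous_on I (\<lambda>s. u s x)"
begin

lemma u_eq: "s \<in> I \<Longrightarrow> u s = gauss \<epsilon> (q s) (p s) (C s) (\<zeta> s)"
  and width: "s \<in> I \<Longrightarrow> width_matrix (C s)"
  and \<zeta>_cont: "continuous_on I \<zeta>"
  using params by (auto simp: packet_params_def)

lemma params_tendsto:
  assumes "t \<in> I"
  shows "(C \<longlongrightarrow> C t) (at t within I)" "(q \<longlongrightarrow> q t) (at t within I)" "(p \<longlongrightarrow> p t) (at t within I)"
    "(\<zeta> \<longlongrightarrow> \<zeta> t) (at t within I)"
proof -
  have "(\<lambda>n. C (X n)) \<longlonglongrightarrow> C t \<and> (\<lambda>n. q (X n)) \<longlonglongrightarrow> q t \<and> (\<lambda>n. p (X n)) \<longlonglongrightarrow> p t"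
    if X: "\<And>n. X n \<in> I" "X \<longlonglongrightarrow> t" for X
  proof -
    have lim: "(\<lambda>n. gauss \<epsilon> (q (X n)) (p (X n)) (C (X n)) (\<zeta> (X n)) x) \<longlonglongrightarrow> gauss \<epsilon> (q t) (p t) (C t) (\<zeta> t) x" for x
      using continuous_on_tendsto_compose[OF u_cont X(2) assms always_eventually, of x] X(1) u_eq assms by simp
    show ?thesis
      using gauss_tendsto_params[OF eps width[OF X(1)] width[OF assms] lim] by blast
  qed
  then show "(C \<longlongrightarrow> C t) (at t within I)" "(q \<longlongrightarrow> q t) (at t within I)" "(p \<longlongrightarrow> p t) (at t within I)"
    by (auto intro!: tendsto_within_sequentiallyI)
  show "(\<zeta> \<longlongrightarrow> \<zeta> t) (at t within I)"
    using \<zeta>_cont assms by (simp add: continuous_on_def)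
qed

definition expo :: "real \<Rightarrow> real^'n \<Rightarrow> complex" where
  "expo s x = gauss_exponent (q s) (p s) (C s) (\<zeta> s) x"

lemma u_expo: "s \<in> I \<Longrightarrow> u s x = exp (\<i> / \<epsilon> * expo s x)"
  by (simp add: u_eq gauss_eq expo_def)

lemma expo_tendsto: "t \<in> I \<Longrightarrow> ((\<lambda>s. expo s x) \<longlongrightarrow> expo t x) (at t within I)"
  unfolding expo_def gauss_exponent_def centered_def
  by (intro tendsto_intros params_tendsto)

text \<open>Continuity of the parameters selects the branch: near \<open>t\<close> the exponent
  difference has modulus below \<pi>, so it is the principal logarithm of
  \<open>u s x / u t x\<close>, and the chain rule applies at 1.\<close>

lemma expo_derivative:
  assumes t: "t \<in> I" and D: "((\<lambda>s. u s x) has_vector_derivative D) (at t within I)"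
  shows "((\<lambda>s. expo s x) has_vector_derivative - \<i> * \<epsilon> * (D / u t x)) (at t within I)"
proof -
  let ?F = "at t within I"
  have ut: "u t x \<noteq> 0" using u_expo[OF t] by simp
  have "((\<lambda>s. u s x * inverse (u t x)) has_vector_derivative D * inverse (u t x)) ?F"
    using has_vector_derivative_mult[OF D has_vector_derivative_const[of "inverse (u t x)"]] by simp
  then have G: "((\<lambda>s. u s x / u t x) has_vector_derivative D / u t x) ?F"
    by (simp add: divide_inverse)
  have "(Ln has_field_derivative inverse 1) (at 1 within A)" for A
    by (rule has_field_derivative_at_within[OF has_field_derivative_Ln]) simp
  then have "((Ln \<circ> (\<lambda>s. u s x / u t x)) has_vector_derivative (D / u t x) * inverse 1) ?F"
    using field_vector_diff_chain_within[OF G, of Ln "inverse 1"] ut by simp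
  then have L: "((\<lambda>s. (Ln (u s x / u t x) - Ln 1) /\<^sub>R (s - t)) \<longlongrightarrow> D / u t x) ?F"
    using ut unfolding has_vector_derivative_iff_quotient by simp
  have "((\<lambda>s. \<i> / \<epsilon> * (expo s x - expo t x)) \<longlongrightarrow> \<i> / \<epsilon> * (expo t x - expo t x)) ?F"
    by (intro tendsto_intros expo_tendsto[OF t])
  then have "((\<lambda>s. \<i> / \<epsilon> * (expo s x - expo t x)) \<longlongrightarrow> 0) ?F" by simp
  from tendstoD[OF this pi_gt_zero] have small: "\<forall>\<^sub>F s in ?F. cmod (\<i> / \<epsilon> * (expo s x - expo t x)) < pi"
    by (simp only: dist_norm diff_zero)
  have "\<forall>\<^sub>F s in ?F. s \<in> I" by (auto simp: eventually_at_filter intro!: always_eventually)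
  with small have "\<forall>\<^sub>F s in ?F. (Ln (u s x / u t x) - Ln 1) /\<^sub>R (s - t) = \<i> / \<epsilon> * ((expo s x - expo t x) /\<^sub>R (s - t))"
  proof eventually_elim
    case (elim s)
    have "u s x / u t x = exp (\<i> / \<epsilon> * (expo s x - expo t x))"
      using elim t by (simp add: u_expo right_diff_distrib exp_diff diff_divide_distrib)
    moreover have "Ln (exp (\<i> / \<epsilon> * (expo s x - expo t x))) = \<i> / \<epsilon> * (expo s x - expo t x)"
      using elim(1) abs_Im_le_cmod[of "\<i> / \<epsilon> * (expo s x - expo t x)"] by (intro Ln_exp) (simp_all only: abs_le_iff, linarith+)
    ultimately have "(Ln (u s x / u t x) - Ln 1) /\<^sub>R (s - t) = (\<i> / \<epsilon> * (expo s x - expo t x)) /\<^sub>R (s - t)"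
      by (simp only: Ln_1 diff_zero)
    then show ?case by (simp only: mult_scaleR_right)
  qed
  from Lim_transform_eventually[OF L this]
  have "((\<lambda>s. (- \<i> * \<epsilon>) * (\<i> / \<epsilon> * ((expo s x - expo t x) /\<^sub>R (s - t)))) \<longlongrightarrow> (- \<i> * \<epsilon>) * (D / u t x)) ?F"
    by (rule tendsto_mult[OF tendsto_const])
  moreover have "(- \<i> * \<epsilon>) * (\<i> / \<epsilon> * z) = z" for z
    using eps by simp
  ultimately show ?thesis
    unfolding has_vector_derivative_iff_quotient by (simp only:)
qed

text \<open>Second differences of the exponent at fixed points, which therefore inherit
  differentiability in time.\<close>

lemma C_entries: "s \<in> I \<Longrightarrow> C s $ i $ j = expo s (1 *\<^sub>R axis i 1 + 1 *\<^sub>R axis j 1) - expo s (1 *\<^sub>R axis i 1 + 0 *\<^sub>R axis j 1)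
    - expo s (0 *\<^sub>R axis i 1 + 1 *\<^sub>R axis j 1) + expo s (0 *\<^sub>R axis i 1 + 0 *\<^sub>R axis j 1)"
  unfolding expo_def gauss_exponent_at[OF width_matrix_sym[OF width]] by simp

lemma lin_entries: "s \<in> I \<Longrightarrow> lin_coeff (q s) (p s) (C s) j = expo s (1 *\<^sub>R axis j 1 + 0 *\<^sub>R axis j 1)
    - expo s (0 *\<^sub>R axis j 1 + 0 *\<^sub>R axis j 1) - C s $ j $ j / 2"
  unfolding expo_def gauss_exponent_at[OF width_matrix_sym[OF width]] by simp

lemma differentiable_cong_on:
  assumes "f differentiable (at t within S)" "t \<in> S" "\<And>s. s \<in> S \<Longrightarrow> g s = f s"
  shows "g differentiable (at t within S)"
proof -
  obtain D where "(f has_derivative D) (at t within S)"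
    using assms(1) unfolding differentiable_def by blast
  then have "(g has_derivative D) (at t within S)"
    using has_derivative_transform[of t S g f D] assms(2,3) by simp
  then show ?thesis unfolding differentiable_def by blast
qed

lemma params_differentiable:
  assumes t: "t \<in> I" and u_diff: "\<And>x. (\<lambda>s. u s x) differentiable (at t within I)"
  shows "(\<lambda>s. C s $ i $ j) differentiable (at t within I)"
    "(\<lambda>s. q s $ j) differentiable (at t within I)"
    "(\<lambda>s. p s $ j) differentiable (at t within I)"
    "\<zeta> differentiable (at t within I)"
    "(\<lambda>s. lin_coeff (q s) (p s) (C s) j) differentiable (at t within I)"
    "(\<lambda>s. const_coeff (q s) (p s) (C s) (\<zeta> s)) differentiable (at t within I)"
proof -
  let ?F = "at t within I"
  have E: "(\<lambda>s. expo s x) differentiable ?F" for x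
    by (rule differentiableI_vector[OF expo_derivative[OF t u_diff[of x, unfolded vector_derivative_works]]])
  show const: "(\<lambda>s. const_coeff (q s) (p s) (C s) (\<zeta> s)) differentiable ?F"
    using E[of 0] by (simp add: expo_def const_coeff_def)
  have C: "(\<lambda>s. C s $ i $ j) differentiable ?F" for i j
    by (rule differentiable_cong_on[OF _ t C_entries]) (intro derivative_intros E)
  then show "(\<lambda>s. C s $ i $ j) differentiable ?F" .
  have lin: "(\<lambda>s. lin_coeff (q s) (p s) (C s) j) differentiable ?F" for j
    by (rule differentiable_cong_on[OF _ t lin_entries]) (intro derivative_intros E C, simp)
  then show "(\<lambda>s. lin_coeff (q s) (p s) (C s) j) differentiable ?F" .
  have Re_Im: "(\<lambda>s. Re (f s)) differentiable ?F" "(\<lambda>s. Im (f s)) differentiable ?F" if f: "f differentiable ?F" for f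
  proof -
    obtain D where D: "(f has_derivative D) ?F"
      using f unfolding differentiable_def by blast
    show "(\<lambda>s. Re (f s)) differentiable ?F" "(\<lambda>s. Im (f s)) differentiable ?F"
      by (rule differentiableI bounded_linear.has_derivative[OF bounded_linear_Re D] bounded_linear.has_derivative[OF bounded_linear_Im D])+
  qed
  have of_real: "(\<lambda>s. complex_of_real (f s)) differentiable ?F" if f: "f differentiable ?F" for f
  proof -
    obtain D where D: "(f has_derivative D) ?F"
      using f unfolding differentiable_def by blast
    show ?thesis
      by (rule differentiableI[OF bounded_linear.has_derivative[OF bounded_linear_of_real D]])
  qed
  define b' where "b' j = vector_derivative (\<lambda>s. Im (lin_coeff (q s) (p s) (C s) j)) ?F" for j
  have b': "((\<lambda>s. Im (lin_coeff (q s) (p s) (C s) j)) has_vector_derivative b' j) ?F" for j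
    unfolding b'_def
    using Re_Im(2)[OF lin, unfolded vector_derivative_works] .
  define A' where "A' i j = vector_derivative (\<lambda>s. Im (C s $ i $ j)) ?F" for i j
  have A': "((\<lambda>s. Im (C s $ i $ j)) has_vector_derivative A' i j) ?F" for i j
    unfolding A'_def
    using Re_Im(2)[OF C, unfolded vector_derivative_works] .
  let ?S = "matrix_inv (Im_mat (C t))"
  interpret g: gaussian \<epsilon> "q t" "p t" "C t" "\<zeta> t"
    by unfold_locales (use eps width[OF t] in auto)
  define r where "r j = - b' j - (\<Sum>l\<in>UNIV. A' j l * q t $ l)" for j
  have Im_lin: "(\<Sum>l\<in>UNIV. Im (C s $ j $ l) * q s $ l) = - Im (lin_coeff (q s) (p s) (C s) j)" for s j
    by (simp add: lin_coeff_def Im_sum)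
  \<comment> \<open>Differentiates the relation Im C q = -Im \<open>lin_coeff\<close> before
    \<open>q\<close> is known to be differentiable. The quotient of \<open>q\<close> is multiplied
    by Im C at the fixed time \<open>t\<close>; the only other \<open>q s\<close> stands in a
    product where continuity is enough.\<close>
  have q_der: "((\<lambda>s. q s $ k) has_vector_derivative (\<Sum>j\<in>UNIV. ?S $ k $ j * r j)) ?F" for k
    unfolding has_vector_derivative_iff_quotient
  proof -
    have inv: "(\<Sum>j\<in>UNIV. ?S $ k $ j * (\<Sum>l\<in>UNIV. Im (C t $ j $ l) * v l)) = v k" for v
    proof -
      have "(\<Sum>j\<in>UNIV. ?S $ k $ j * (\<Sum>l\<in>UNIV. Im (C t $ j $ l) * v l)) = (\<Sum>l\<in>UNIV. (\<Sum>j\<in>UNIV. ?S $ k $ j * Im_mat (C t) $ j $ l) * v l)"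
        unfolding sum_distrib_left sum_distrib_right by (subst sum.swap) (simp add: Im_mat_def mult_ac)
      then show ?thesis
        unfolding matrix_inv_entries[OF g.Im_C_invertible] by (simp add: if_distrib[of "\<lambda>x. x * _"] cong: if_cong)
    qed
    have y: "(\<Sum>l\<in>UNIV. Im (C t $ j $ l) * (q s $ l - q t $ l)) = - (Im (lin_coeff (q s) (p s) (C s) j) - Im (lin_coeff (q t) (p t) (C t) j))
       - (\<Sum>l\<in>UNIV. (Im (C s $ j $ l) - Im (C t $ j $ l)) * q s $ l)" for s j
      using Im_lin[of s j] Im_lin[of t j] by (simp add: right_diff_distrib left_diff_distrib sum_subtractf)
    have "((\<lambda>s. \<Sum>j\<in>UNIV. ?S $ k $ j * (- ((Im (lin_coeff (q s) (p s) (C s) j) - Im (lin_coeff (q t) (p t) (C t) j)) /\<^sub>R (s - t))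
       - (\<Sum>l\<in>UNIV. ((Im (C s $ j $ l) - Im (C t $ j $ l)) /\<^sub>R (s - t)) * q s $ l))) \<longlongrightarrow> (\<Sum>j\<in>UNIV. ?S $ k $ j * r j)) ?F"
      unfolding r_def
      by (intro tendsto_intros b'[unfolded has_vector_derivative_iff_quotient] A'[unfolded has_vector_derivative_iff_quotient] params_tendsto t)
    moreover have "(\<Sum>j\<in>UNIV. ?S $ k $ j * (- ((Im (lin_coeff (q s) (p s) (C s) j) - Im (lin_coeff (q t) (p t) (C t) j)) /\<^sub>R (s - t))
       - (\<Sum>l\<in>UNIV. ((Im (C s $ j $ l) - Im (C t $ j $ l)) /\<^sub>R (s - t)) * q s $ l))) = (q s $ k - q t $ k) /\<^sub>R (s - t)" for s
    proof -
      have "(\<Sum>j\<in>UNIV. ?S $ k $ j * (- ((Im (lin_coeff (q s) (p s) (C s) j) - Im (lin_coeff (q t) (p t) (C t) j)) /\<^sub>R (s - t))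
         - (\<Sum>l\<in>UNIV. ((Im (C s $ j $ l) - Im (C t $ j $ l)) /\<^sub>R (s - t)) * q s $ l)))
        = inverse (s - t) * (\<Sum>j\<in>UNIV. ?S $ k $ j * (\<Sum>l\<in>UNIV. Im (C t $ j $ l) * (q s $ l - q t $ l)))"
        unfolding y by (simp add: sum_distrib_left right_diff_distrib mult_ac)
      then show ?thesis
        unfolding inv[of "\<lambda>l. q s $ l - q t $ l"] by simp
    qed
    ultimately show "((\<lambda>s. (q s $ k - q t $ k) /\<^sub>R (s - t)) \<longlongrightarrow> (\<Sum>j\<in>UNIV. ?S $ k $ j * r j)) ?F"
      by simp
  qed
  have q: "(\<lambda>s. q s $ j) differentiable ?F" for j
    using q_der differentiableI_vector by blast
  then show "(\<lambda>s. q s $ j) differentiable ?F" .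
  have p: "(\<lambda>s. p s $ j) differentiable ?F" for j
  proof -
    have "(\<lambda>s. p s $ j) = (\<lambda>s. Re (lin_coeff (q s) (p s) (C s) j + (\<Sum>l\<in>UNIV. C s $ j $ l * complex_of_real (q s $ l))))"
      by (simp add: lin_coeff_def)
    then show ?thesis
      by (simp only:) (intro Re_Im(1) differentiable_add lin differentiable_sum ballI differentiable_mult C of_real q finite_class.finite)
  qed
  then show "(\<lambda>s. p s $ j) differentiable ?F" .
  have "\<zeta> = (\<lambda>s. const_coeff (q s) (p s) (C s) (\<zeta> s) - (1/2 * (\<Sum>i\<in>UNIV. \<Sum>l\<in>UNIV. C s $ i $ l * complex_of_real (0 - q s $ i) * complex_of_real (0 - q s $ l))
     + (\<Sum>i\<in>UNIV. complex_of_real (p s $ i) * complex_of_real (0 - q s $ i))))"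
    by (rule ext) (simp add: const_coeff_def gauss_exponent_def centered_def)
  moreover have "(\<lambda>s. const_coeff (q s) (p s) (C s) (\<zeta> s) - (1/2 * (\<Sum>i\<in>UNIV. \<Sum>l\<in>UNIV. C s $ i $ l * complex_of_real (0 - q s $ i) * complex_of_real (0 - q s $ l))
     + (\<Sum>i\<in>UNIV. complex_of_real (p s $ i) * complex_of_real (0 - q s $ i)))) differentiable ?F"
    by (intro differentiable_diff const differentiable_add differentiable_mult differentiable_const differentiable_sum ballI C of_real q p finite_class.finite)
  ultimately show "\<zeta> differentiable ?F" by simp
qed

text \<open>The two terms in which one of the factors x - q is differentiated coincide by symmetry
  of C, and this cancels the factor 1/2 of the exponent.\<close>

lemma expo_derivative_params:
  assumes t: "t \<in> I"
    and C': "\<And>i j. ((\<lambda>s. C s $ i $ j) has_vector_derivative C' i j) (at t within I)"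
    and q': "\<And>j. ((\<lambda>s. q s $ j) has_vector_derivative q' j) (at t within I)"
    and p': "\<And>j. ((\<lambda>s. p s $ j) has_vector_derivative p' j) (at t within I)"
    and \<zeta>': "(\<zeta> has_vector_derivative \<zeta>') (at t within I)"
  shows "((\<lambda>s. expo s x) has_vector_derivative
    shifted_quad (q t) (\<zeta>' - (\<Sum>i\<in>UNIV. complex_of_real (p t $ i * q' i)))
      (\<lambda>j. complex_of_real (p' j) - (\<Sum>i\<in>UNIV. C t $ i $ j * complex_of_real (q' i))) (\<lambda>i j. C' i j / 2) x) (at t within I)"
proof -
  let ?F = "at t within I"
  have sym: "C t $ i $ j = C t $ j $ i" for i j
    using arg_cong[OF width_matrix_sym[OF width[OF t]], of "\<lambda>A. A $ j $ i"] by (simp add: transpose_def)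
  let ?Y = "\<lambda>i. centered (q t) i x"
  have Y': "((\<lambda>s. centered (q s) i x) has_vector_derivative - complex_of_real (q' i)) ?F" for i
  proof -
    have "((\<lambda>s. x $ i - q s $ i) has_vector_derivative 0 - q' i) ?F"
      by (intro has_vector_derivative_diff has_vector_derivative_const q')
    from bounded_linear.has_vector_derivative[OF bounded_linear_of_real this] show ?thesis
      by (simp add: centered_def)
  qed
  have pc': "((\<lambda>s. complex_of_real (p s $ i)) has_vector_derivative complex_of_real (p' i)) ?F" for i
    by (rule bounded_linear.has_vector_derivative[OF bounded_linear_of_real p'])
  have "((\<lambda>s. expo s x) has_vector_derivative (1/2 * (\<Sum>i\<in>UNIV. \<Sum>l\<in>UNIV. (C t $ i $ l * ?Y i) * (- complex_of_real (q' l))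
      + (C t $ i $ l * (- complex_of_real (q' i)) + C' i l * ?Y i) * ?Y l)
      + (\<Sum>i\<in>UNIV. complex_of_real (p t $ i) * (- complex_of_real (q' i)) + complex_of_real (p' i) * ?Y i)) + \<zeta>') ?F"
    unfolding expo_def gauss_exponent_def
    by (intro has_vector_derivative_add has_vector_derivative_sum has_vector_derivative_mult_right has_vector_derivative_mult
        C' Y' pc' \<zeta>')
  moreover have "(1/2 * (\<Sum>i\<in>UNIV. \<Sum>l\<in>UNIV. (C t $ i $ l * ?Y i) * (- complex_of_real (q' l))
      + (C t $ i $ l * (- complex_of_real (q' i)) + C' i l * ?Y i) * ?Y l)
      + (\<Sum>i\<in>UNIV. complex_of_real (p t $ i) * (- complex_of_real (q' i)) + complex_of_real (p' i) * ?Y i)) + \<zeta>'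
    = shifted_quad (q t) (\<zeta>' - (\<Sum>i\<in>UNIV. complex_of_real (p t $ i * q' i)))
      (\<lambda>j. complex_of_real (p' j) - (\<Sum>i\<in>UNIV. C t $ i $ j * complex_of_real (q' i))) (\<lambda>i j. C' i j / 2) x"
  proof -
    let ?X = "\<Sum>j\<in>UNIV. (\<Sum>i\<in>UNIV. C t $ i $ j * complex_of_real (q' i)) * ?Y j"
    have 1: "(\<Sum>i\<in>UNIV. \<Sum>l\<in>UNIV. (C t $ i $ l * ?Y i) * (- complex_of_real (q' l))) = - ?X"
    proof -
      have "?X = (\<Sum>j\<in>UNIV. \<Sum>i\<in>UNIV. (C t $ j $ i * ?Y j) * complex_of_real (q' i))"
        by (intro sum.cong refl, subst sum_distrib_right, intro sum.cong refl) (simp add: sym mult_ac)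
      then show ?thesis by (simp add: sum_negf)
    qed
    have 2: "(\<Sum>i\<in>UNIV. \<Sum>l\<in>UNIV. (C t $ i $ l * (- complex_of_real (q' i))) * ?Y l) = - ?X"
    proof -
      have X: "?X = (\<Sum>j\<in>UNIV. \<Sum>i\<in>UNIV. (C t $ i $ j * complex_of_real (q' i)) * ?Y j)"
        by (simp only: sum_distrib_right)
      show ?thesis unfolding X by (subst sum.swap) (simp add: sum_negf mult_ac)
    qed
    have 3: "(\<Sum>i\<in>UNIV. \<Sum>l\<in>UNIV. (C t $ i $ l * ?Y i) * (- complex_of_real (q' l))
      + (C t $ i $ l * (- complex_of_real (q' i)) + C' i l * ?Y i) * ?Y l) = - ?X + (- ?X + (\<Sum>i\<in>UNIV. \<Sum>l\<in>UNIV. C' i l * ?Y i * ?Y l))"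
      unfolding distrib_right sum.distrib 1 2 ..
    show ?thesis
      unfolding 3 shifted_quad_def
      by (simp add: sum.distrib sum_subtractf left_diff_distrib sum_negf sum_divide_distrib[symmetric] mult.assoc algebra_simps)
  qed
  ultimately show ?thesis by (simp only:)
qed

end

subsection \<open>Conservation of the norm and continuity of averages\<close>

context packet_curve
begin

text \<open>\<open>schwartz_class\<close> asks for bounds at every index, whereas the parameters are
  controlled only near \<open>t\<close>. Resetting all other times to \<open>t\<close> gives a
  family indexed by all reals that agrees with the curve nearby.\<close>

definition clamp :: "real \<Rightarrow> real \<Rightarrow> real \<Rightarrow> real" where
  "clamp t \<delta> s = (if s \<in> I \<and> dist s t < \<delta> then s else t)"

definition clamped :: "real \<Rightarrow> real \<Rightarrow> real \<Rightarrow> real^'n \<Rightarrow> complex" where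
  "clamped t \<delta> s = gauss \<epsilon> (q (clamp t \<delta> s)) (p (clamp t \<delta> s)) (C (clamp t \<delta> s)) (\<zeta> (clamp t \<delta> s))"

lemma clamped_eq: "s \<in> I \<Longrightarrow> dist s t < \<delta> \<Longrightarrow> clamped t \<delta> s = u s"
  by (simp add: clamped_def clamp_def u_eq)

lemma clamped_schwartz:
  assumes t: "t \<in> I"
  obtains \<delta> where "\<delta> > 0" "schwartz_class (packets (clamped t \<delta>)) \<epsilon>"
proof -
  let ?F = "at t within I"
  \<comment> \<open>The summand 1 makes the inequalities at \<open>t\<close> strict, so that they
    persist in a neighbourhood.\<close>
  define R where "R = 1 + norm (q t) + norm (p t) + norm (C t) + norm (\<zeta> t)"
  obtain c where c: "c > 0" "\<And>v. c * (norm v)\<^sup>2 \<le> v \<bullet> (Im_mat (C t) *v v)"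
    using width_matrix_coercive[OF width[OF t]] by blast
  define P where "P s \<longleftrightarrow> (norm (q s) < R \<and> norm (p s) < R \<and> norm (C s) < R \<and> norm (\<zeta> s) < R)
    \<and> (\<forall>v. c / 2 * (norm v)\<^sup>2 \<le> v \<bullet> (Im_mat (C s) *v v))" for s
  have "((\<lambda>s. Im_mat (C s)) \<longlongrightarrow> Im_mat (C t)) ?F"
    by (intro vec_tendstoI) (simp add: Im_mat_def, intro tendsto_intros params_tendsto t)
  note coercive = coercive_eventually[OF c this]
  have R: "norm (q t) < R" "norm (p t) < R" "norm (C t) < R" "norm (\<zeta> t) < R"
    unfolding R_def using norm_ge_zero[of "q t"] norm_ge_zero[of "p t"] norm_ge_zero[of "C t"] norm_ge_zero[of "\<zeta> t"]
    by linarith+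
  have "\<forall>\<^sub>F s in ?F. P s"
    unfolding P_def
    using coercive order_tendstoD(2)[OF tendsto_norm[OF params_tendsto(1)[OF t]] R(3)]
      order_tendstoD(2)[OF tendsto_norm[OF params_tendsto(2)[OF t]] R(1)]
      order_tendstoD(2)[OF tendsto_norm[OF params_tendsto(3)[OF t]] R(2)]
      order_tendstoD(2)[OF tendsto_norm[OF params_tendsto(4)[OF t]] R(4)]
    by eventually_elim simp
  then obtain \<delta> where \<delta>: "\<delta> > 0" "\<And>s. s \<in> I \<Longrightarrow> s \<noteq> t \<Longrightarrow> dist s t < \<delta> \<Longrightarrow> P s"
    unfolding eventually_at by blast
  have "P t"
  proof -
    have "c / 2 * (norm v)\<^sup>2 \<le> v \<bullet> (Im_mat (C t) *v v)" for v
      by (rule order_trans[OF _ c(2)]) (use c(1) in \<open>auto intro: mult_right_mono\<close>)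
    then show ?thesis unfolding P_def using R by blast
  qed
  then have Pc: "P (clamp t \<delta> s)" for s
    using \<delta>(2)[of s] by (cases "s = t") (auto simp: clamp_def)
  have Ic: "clamp t \<delta> s \<in> I" for s using t by (simp add: clamp_def)
  have "schwartz_class (packets (\<lambda>s. gauss \<epsilon> (q (clamp t \<delta> s)) (p (clamp t \<delta> s)) (C (clamp t \<delta> s)) (\<zeta> (clamp t \<delta> s)))) \<epsilon>"
  proof (rule packets_schwartz[OF eps])
    show "c / 2 > 0" using c by simp
    show "transpose (C (clamp t \<delta> s)) = C (clamp t \<delta> s)" for s
      by (rule width_matrix_sym[OF width[OF Ic]])
    show "c / 2 * (norm v)\<^sup>2 \<le> v \<bullet> (Im_mat (C (clamp t \<delta> s)) *v v)" for s v
      using Pc[of s] unfolding P_def by blast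
    show "norm (q (clamp t \<delta> s)) \<le> R" "norm (p (clamp t \<delta> s)) \<le> R" "norm (C (clamp t \<delta> s)) \<le> R" "cmod (\<zeta> (clamp t \<delta> s)) \<le> R" for s
      using Pc[of s] unfolding P_def by auto
  qed
  then have "schwartz_class (packets (clamped t \<delta>)) \<epsilon>"
    by (simp add: clamped_def[abs_def])
  then show ?thesis using that \<delta>(1) by blast
qed

lemma avg_tendsto:
  assumes t: "t \<in> I" and a: "symbol_family a" and lim: "\<And>X z. X \<longlonglongrightarrow> t \<Longrightarrow> (\<lambda>n. a (X n) z) \<longlonglongrightarrow> a t z"
  shows "((\<lambda>s. avg \<epsilon> (u s) (a s)) \<longlongrightarrow> avg \<epsilon> (u t) (a t)) (at t within I)"
proof (rule tendsto_within_sequentiallyI)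
  obtain \<delta> where \<delta>: "\<delta> > 0" "schwartz_class (packets (clamped t \<delta>)) \<epsilon>"
    using clamped_schwartz[OF t] by blast
  interpret sc: schwartz_class "packets (clamped t \<delta>)" \<epsilon> by (rule \<delta>(2))
  have ut: "clamped t \<delta> t = u t" using clamped_eq[OF t] \<delta>(1) by simp
  fix X assume X: "\<And>n. X n \<in> I" "X \<longlonglongrightarrow> t"
  have near: "\<forall>\<^sub>F n in sequentially. clamped t \<delta> (X n) = u (X n)"
    using tendstoD[OF X(2) \<delta>(1)] by eventually_elim (use X(1) clamped_eq in auto)
  have "(\<lambda>n. u (X n) x) \<longlonglongrightarrow> u t x" for x
    using continuous_on_tendsto_compose[OF u_cont X(2) t always_eventually] X(1) by simp
  then have w: "(\<lambda>n. clamped t \<delta> (X n) x) \<longlonglongrightarrow> clamped t \<delta> t x" for x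
    unfolding ut by (rule Lim_transform_eventually) (use near in eventually_elim, simp)
  have "(\<lambda>n. weyl_form \<epsilon> (a (X n)) (clamped t \<delta> (X n)) (clamped t \<delta> (X n))) \<longlonglongrightarrow> weyl_form \<epsilon> (a t) (clamped t \<delta> t) (clamped t \<delta> t)"
    by (rule sc.weyl_form_tendsto[OF a packets_base packets_base lim[OF X(2)] w w])
  then have "(\<lambda>n. weyl_form \<epsilon> (a (X n)) (clamped t \<delta> (X n)) (clamped t \<delta> (X n))) \<longlonglongrightarrow> avg \<epsilon> (u t) (a t)"
    by (simp only: ut avg_weyl_form)
  then show "(\<lambda>n. avg \<epsilon> (u (X n)) (a (X n))) \<longlonglongrightarrow> avg \<epsilon> (u t) (a t)"
    by (rule Lim_transform_eventually) (use near in eventually_elim, simp add: avg_weyl_form)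
qed

lemma gaussian_at: "s \<in> I \<Longrightarrow> gaussian \<epsilon> (C s)"
  by unfold_locales (use eps width in auto)

text \<open>Dominated convergence of difference quotients. The coefficients of the exponent are
  differentiable in time, so exponents at two times differ by a multiple of the time step times (1 +
  norm x)^2, and Gaussian decay absorbs the weight.\<close>

lemma norm_derivative:
  assumes t: "t \<in> I" and D: "\<And>x. ((\<lambda>s. u s x) has_vector_derivative D x) (at t within I)"
    and D_cont: "continuous_on UNIV D"
  shows "((\<lambda>s. L2_inner (u s) (u s)) has_vector_derivative
     (\<integral>x. cnj (u t x) * D x + cnj (D x) * u t x \<partial>lborel)) (at t within I)"
proof -
  obtain \<delta> where \<delta>: "\<delta> > 0" "schwartz_class (packets (clamped t \<delta>)) \<epsilon>"
    using clamped_schwartz[OF t] by blast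
  interpret sc: schwartz_class "packets (clamped t \<delta>)" \<epsilon> by (rule \<delta>(2))
  let ?J = "I \<inter> ball t \<delta>"
  have at_eq: "at t within I = at t within ?J"
    by (rule at_within_nhd[of t "ball t \<delta>"]) (use \<delta>(1) in auto)
  have uJ: "u s = clamped t \<delta> s" if "s \<in> ?J" for s
    using clamped_eq[of s] that by (auto simp: dist_commute)
  have u_cont': "continuous_on UNIV (u s)" if "s \<in> I" for s
    using gauss_continuous[of UNIV \<epsilon> "q s" "p s" "C s" "\<zeta> s"] u_eq[OF that] by simp
  \<comment> \<open>The summand 2 pays for the quadratic weight in the difference of
    exponents.\<close>
  let ?M = "2 * DIM(real^'n) + 2"
  obtain L where L: "\<And>k x. (1 + norm x) ^ ?M * cmod (clamped t \<delta> k x) \<le> L"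
    using sc.W_rapid[OF packets_base, of ?M] by blast
  have L0: "L \<ge> 0" using order_trans[OF _ L[of 0 t]] by simp
  have u_diff: "(\<lambda>s. u s x) differentiable (at t within I)" for x
    using D differentiableI_vector by blast
  note diff = params_differentiable[OF t u_diff, unfolded vector_derivative_works has_vector_derivative_iff_quotient at_eq]
  show ?thesis
    unfolding has_vector_derivative_iff_quotient at_eq
  proof (rule tendsto_within_sequentiallyI)
    fix X assume X: "\<And>n. X n \<in> ?J" "\<And>n. X n \<noteq> t" "X \<longlonglongrightarrow> t"
    have XI: "X n \<in> I" for n using X(1)[of n] by simp
    have seq: "(\<lambda>n. f (X n)) \<longlonglongrightarrow> l" if "(f \<longlongrightarrow> l) (at t within ?J)" for f :: "real \<Rightarrow> complex" and l
    proof -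
      have "filterlim X (at t within ?J) sequentially"
        unfolding filterlim_at using X by (auto intro!: always_eventually)
      then show ?thesis by (rule filterlim_compose[OF that])
    qed
    \<comment> \<open>Sum of the coefficient differences of the exponent. Divided by the time step
      it converges along the sequence, hence is bounded there; this replaces a Lipschitz estimate in
      time.\<close>
    define K where "K s = cmod (const_coeff (q s) (p s) (C s) (\<zeta> s) - const_coeff (q t) (p t) (C t) (\<zeta> t))
      + (\<Sum>j\<in>UNIV. cmod (lin_coeff (q s) (p s) (C s) j - lin_coeff (q t) (p t) (C t) j))
      + (\<Sum>i\<in>UNIV. \<Sum>j\<in>UNIV. cmod ((C s $ i $ j - C t $ i $ j) / 2))" for s
    have c1: "convergent (\<lambda>n. cmod ((const_coeff (q (X n)) (p (X n)) (C (X n)) (\<zeta> (X n)) - const_coeff (q t) (p t) (C t) (\<zeta> t)) /\<^sub>R (X n - t)))"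
      by (rule convergentI[OF tendsto_norm[OF seq[OF diff(6)]]])
    have c2: "convergent (\<lambda>n. cmod ((lin_coeff (q (X n)) (p (X n)) (C (X n)) j - lin_coeff (q t) (p t) (C t) j) /\<^sub>R (X n - t)))" for j
      by (rule convergentI[OF tendsto_norm[OF seq[OF diff(5)[of j]]]])
    have c3: "convergent (\<lambda>n. cmod (((C (X n) $ i $ j - C t $ i $ j) /\<^sub>R (X n - t)) / 2))" for i j
      by (rule convergentI[OF tendsto_norm[OF tendsto_divide[OF seq[OF diff(1)[of i j]] tendsto_const]]]) simp
    have "convergent (\<lambda>n. cmod ((const_coeff (q (X n)) (p (X n)) (C (X n)) (\<zeta> (X n)) - const_coeff (q t) (p t) (C t) (\<zeta> t)) /\<^sub>R (X n - t))
      + (\<Sum>j\<in>UNIV. cmod ((lin_coeff (q (X n)) (p (X n)) (C (X n)) j - lin_coeff (q t) (p t) (C t) j) /\<^sub>R (X n - t)))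
      + (\<Sum>i\<in>UNIV. \<Sum>j\<in>UNIV. cmod (((C (X n) $ i $ j - C t $ i $ j) /\<^sub>R (X n - t)) / 2)))"
      by (intro convergent_add convergent_sum c1 c2 c3)
    moreover have "cmod ((const_coeff (q (X n)) (p (X n)) (C (X n)) (\<zeta> (X n)) - const_coeff (q t) (p t) (C t) (\<zeta> t)) /\<^sub>R (X n - t))
      + (\<Sum>j\<in>UNIV. cmod ((lin_coeff (q (X n)) (p (X n)) (C (X n)) j - lin_coeff (q t) (p t) (C t) j) /\<^sub>R (X n - t)))
      + (\<Sum>i\<in>UNIV. \<Sum>j\<in>UNIV. cmod (((C (X n) $ i $ j - C t $ i $ j) /\<^sub>R (X n - t)) / 2)) = K (X n) / \<bar>X n - t\<bar>" for n
    proof -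
      have n: "cmod (z /\<^sub>R r) = cmod z / \<bar>r\<bar>" for z :: complex and r :: real
        by (simp only: norm_scaleR abs_inverse divide_inverse_commute)
      have h: "(z /\<^sub>R r) / 2 = (z / 2) /\<^sub>R r" for z :: complex and r :: real
        by (simp only: scaleR_conv_of_real times_divide_eq_right)
      show ?thesis
        unfolding h n K_def add_divide_distrib sum_divide_distrib ..
    qed
    ultimately have "convergent (\<lambda>n. K (X n) / \<bar>X n - t\<bar>)" by (simp only:)
    then have "Bseq (\<lambda>n. K (X n) / \<bar>X n - t\<bar>)"
      by (rule convergent_imp_Bseq)
    then obtain K0 where K0: "\<And>n. norm (K (X n) / \<bar>X n - t\<bar>) \<le> K0"
      unfolding Bseq_def by blast
    have K0': "K (X n) \<le> K0 * \<bar>X n - t\<bar>" for n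
      using K0[of n] X(2)[of n] by (simp add: abs_le_iff field_simps)
    have "K0 \<ge> 0" using order_trans[OF norm_ge_zero K0] .
    have expo_diff: "cmod (expo (X n) x - expo t x) \<le> K0 * \<bar>X n - t\<bar> * (1 + norm x)\<^sup>2" for n x
    proof -
      have eq: "expo (X n) x - expo t x = shifted_quad 0 (const_coeff (q (X n)) (p (X n)) (C (X n)) (\<zeta> (X n)) - const_coeff (q t) (p t) (C t) (\<zeta> t))
        (\<lambda>j. lin_coeff (q (X n)) (p (X n)) (C (X n)) j - lin_coeff (q t) (p t) (C t) j) (\<lambda>i j. (C (X n) $ i $ j - C t $ i $ j) / 2) x"
        unfolding expo_def gauss_exponent_expand[OF width_matrix_sym[OF width[OF XI]]] gauss_exponent_expand[OF width_matrix_sym[OF width[OF t]]]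
        by (simp add: shifted_quad_def left_diff_distrib sum_subtractf diff_divide_distrib)
      have "cmod (expo (X n) x - expo t x) \<le> K (X n) * (1 + norm x)\<^sup>2"
        unfolding eq K_def by (rule shifted_quad_bound)
      also have "\<dots> \<le> K0 * \<bar>X n - t\<bar> * (1 + norm x)\<^sup>2"
        by (intro mult_right_mono K0') simp
      finally show ?thesis .
    qed
    let ?f = "\<lambda>s x. cnj (u s x) * u s x"
    have int: "integrable lborel (?f s)" if "s \<in> I" for s
    proof -
      interpret g: gaussian \<epsilon> "q s" "p s" "C s" "\<zeta> s" by (rule gaussian_at[OF that])
      show ?thesis unfolding u_eq[OF that] by (rule g.pk_integrable[OF g.pk_u g.pk_u])
    qed
    let ?w = "\<lambda>x::real^'n. (1 / \<epsilon> * K0 * (2 * L)\<^sup>2) * inverse ((1 + norm x) ^ (2 * DIM(real^'n)))"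
    have "(\<lambda>n. \<integral>x. (?f (X n) x - ?f t x) /\<^sub>R (X n - t) \<partial>lborel) \<longlonglongrightarrow> (\<integral>x. cnj (u t x) * D x + cnj (D x) * u t x \<partial>lborel)"
    proof (rule integral_dominated_convergence[where w = ?w])
      show "integrable lborel ?w"
        by (intro integrable_mult_right integrable_norm_weight)
      show "(\<lambda>x. cnj (u t x) * D x + cnj (D x) * u t x) \<in> borel_measurable lborel"
        using u_cont'[OF t] D_cont by (auto intro!: borel_measurable_continuous_onI continuous_intros)
      show "(\<lambda>x. (?f (X n) x - ?f t x) /\<^sub>R (X n - t)) \<in> borel_measurable lborel" for n
        using u_cont'[OF t] u_cont'[OF XI] by (auto intro!: borel_measurable_continuous_onI continuous_intros)
      show "AE x in lborel. (\<lambda>n. (?f (X n) x - ?f t x) /\<^sub>R (X n - t)) \<longlonglongrightarrow> cnj (u t x) * D x + cnj (D x) * u t x"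
      proof (rule AE_I2)
        fix x
        have "((\<lambda>s. ?f s x) has_vector_derivative cnj (u t x) * D x + cnj (D x) * u t x) (at t within I)"
          by (intro has_vector_derivative_mult has_vector_derivative_cnj D)
        then show "(\<lambda>n. (?f (X n) x - ?f t x) /\<^sub>R (X n - t)) \<longlonglongrightarrow> cnj (u t x) * D x + cnj (D x) * u t x"
          unfolding has_vector_derivative_iff_quotient at_eq by (rule seq)
      qed
      show "AE x in lborel. norm ((?f (X n) x - ?f t x) /\<^sub>R (X n - t)) \<le> ?w x" for n
      proof (rule AE_I2)
        fix x :: "real^'n"
        let ?r = "1 + norm x" and ?a = "u (X n) x" and ?b = "u t x"
        have r: "?r > 0" by (rule add_pos_nonneg) auto
        have "?r ^ ?M * (cmod ?a + cmod ?b) \<le> 2 * L"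
          using L[of x "X n"] L[of x t] uJ[OF X(1)[of n]] clamped_eq[OF t, of t \<delta>] \<delta>(1) by (simp add: distrib_left)
        moreover have "z \<le> w * inverse R" if "R * z \<le> w" "R > 0" for z w R :: real
          using that by (simp add: field_simps)
        ultimately have ab: "cmod ?a + cmod ?b \<le> 2 * L * inverse (?r ^ ?M)"
          using zero_less_power[OF r] by blast
        have diff_ab: "cmod (?a - ?b) \<le> (cmod ?a + cmod ?b) * (1 / \<epsilon> * (K0 * \<bar>X n - t\<bar> * ?r\<^sup>2))"
        proof -
          have "cmod (\<i> / \<epsilon> * expo (X n) x - \<i> / \<epsilon> * expo t x) = 1 / \<epsilon> * cmod (expo (X n) x - expo t x)"
            unfolding right_diff_distrib[symmetric] norm_mult using eps by (simp add: norm_divide)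
          then have "cmod (?a - ?b) \<le> (cmod ?a + cmod ?b) * (1 / \<epsilon> * cmod (expo (X n) x - expo t x))"
            using norm_exp_diff_le[of "\<i> / \<epsilon> * expo (X n) x" "\<i> / \<epsilon> * expo t x"]
            by (simp only: u_expo[OF XI] u_expo[OF t])
          also have "\<dots> \<le> (cmod ?a + cmod ?b) * (1 / \<epsilon> * (K0 * \<bar>X n - t\<bar> * ?r\<^sup>2))"
            using eps by (intro mult_left_mono expo_diff) auto
          finally show ?thesis .
        qed
        have pw: "(inverse (z ^ (m + 2)))\<^sup>2 * z\<^sup>2 \<le> inverse (z ^ m)" if "z \<ge> 1" for z :: real and m
        proof -
          have "(inverse (z ^ (m + 2)))\<^sup>2 * z\<^sup>2 = inverse (z ^ m) * inverse (z ^ (m + 2))"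
            using that by (simp add: power_add power2_eq_square) (simp add: field_simps)
          also have "\<dots> \<le> inverse (z ^ m) * 1"
            using that one_le_power[of z "m + 2"] by (intro mult_left_mono) (auto simp: inverse_le_1_iff simp del: power_Suc)
          finally show ?thesis by simp
        qed
        have "?f (X n) x - ?f t x = cnj ?a * (?a - ?b) + cnj (?a - ?b) * ?b"
          by (simp add: algebra_simps)
        then have "cmod (?f (X n) x - ?f t x) \<le> cmod ?a * cmod (?a - ?b) + cmod (?a - ?b) * cmod ?b"
          using norm_triangle_ineq[of "cnj ?a * (?a - ?b)" "cnj (?a - ?b) * ?b"]
          by (simp only: norm_mult complex_mod_cnj)
        also have "\<dots> = (cmod ?a + cmod ?b) * cmod (?a - ?b)"
          by algebra
        also have "\<dots> \<le> (cmod ?a + cmod ?b) * ((cmod ?a + cmod ?b) * (1 / \<epsilon> * (K0 * \<bar>X n - t\<bar> * ?r\<^sup>2)))"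
          by (intro mult_left_mono diff_ab) auto
        also have "\<dots> = (cmod ?a + cmod ?b)\<^sup>2 * (1 / \<epsilon> * (K0 * \<bar>X n - t\<bar> * ?r\<^sup>2))"
          by (simp only: power2_eq_square mult.assoc)
        also have "\<dots> \<le> (2 * L * inverse (?r ^ ?M))\<^sup>2 * (1 / \<epsilon> * (K0 * \<bar>X n - t\<bar> * ?r\<^sup>2))"
          using eps \<open>K0 \<ge> 0\<close> by (intro mult_right_mono power_mono ab) auto
        also have "\<dots> = \<bar>X n - t\<bar> * ((1 / \<epsilon> * K0 * (2 * L)\<^sup>2) * ((inverse (?r ^ ?M))\<^sup>2 * ?r\<^sup>2))"
          by (simp only: power_mult_distrib mult_ac)
        also have "\<dots> \<le> \<bar>X n - t\<bar> * ?w x"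
          using eps \<open>K0 \<ge> 0\<close> by (intro mult_left_mono pw) auto
        finally have *: "cmod (?f (X n) x - ?f t x) \<le> \<bar>X n - t\<bar> * ?w x" .
        have quot: "cmod (z /\<^sub>R r) \<le> w" if "cmod z \<le> \<bar>r\<bar> * w" "r \<noteq> 0" for z :: complex and r w :: real
          using that by (simp add: field_simps)
        show "norm ((?f (X n) x - ?f t x) /\<^sub>R (X n - t)) \<le> ?w x"
          by (rule quot[OF *]) (use X(2)[of n] in simp)
      qed
    qed
    moreover have "(\<integral>x. (?f (X n) x - ?f t x) /\<^sub>R (X n - t) \<partial>lborel) = (L2_inner (u (X n)) (u (X n)) - L2_inner (u t) (u t)) /\<^sub>R (X n - t)" for n
      unfolding L2_inner_def using int[OF XI[of n]] int[OF t] by simp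
    ultimately show "(\<lambda>n. (L2_inner (u (X n)) (u (X n)) - L2_inner (u t) (u t)) /\<^sub>R (X n - t))
      \<longlonglongrightarrow> (\<integral>x. cnj (u t x) * D x + cnj (D x) * u t x \<partial>lborel)"
      by (simp only:)
  qed
qed

end

subsection \<open>Linear differential equations\<close>

text \<open>\<open>I\<close> may be open, half-open, unbounded or a single point. A compact
  subinterval containing 0 and coinciding with \<open>I\<close> near \<open>t\<close> has the same
  one-sided derivatives at \<open>t\<close>, so results on compact intervals apply.\<close>

lemma interval_neighbourhood:
  fixes I :: "real set"
  assumes "is_interval I" "0 \<in> I" "t \<in> I"
  obtains a b where "0 \<in> {a..b}" "t \<in> {a..b}" "{a..b} \<subseteq> I" "at t within I = at t within {a..b}"
proof -
  have "\<exists>b\<in>I. max 0 t \<le> b \<and> (\<exists>S. open S \<and> t \<in> S \<and> (\<forall>s\<in>I \<inter> S. s \<le> b))"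
  proof (cases "\<exists>b\<in>I. max 0 t < b")
    case True
    then obtain b where "b \<in> I" "max 0 t < b" by blast
    then show ?thesis
      by (intro bexI[of _ b] conjI exI[of _ "{..<b}"]) auto
  next
    case False
    then show ?thesis
      using assms by (intro bexI[of _ "max 0 t"] conjI exI[of _ UNIV]) (auto simp: max_def not_less split: if_splits)
  qed
  then obtain b S where b: "b \<in> I" "max 0 t \<le> b" "open S" "t \<in> S" "\<And>s. s \<in> I \<Longrightarrow> s \<in> S \<Longrightarrow> s \<le> b" by blast
  have "\<exists>a\<in>I. a \<le> min 0 t \<and> (\<exists>S. open S \<and> t \<in> S \<and> (\<forall>s\<in>I \<inter> S. a \<le> s))"
  proof (cases "\<exists>a\<in>I. a < min 0 t")
    case True
    then obtain a where "a \<in> I" "a < min 0 t" by blast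
    then show ?thesis
      by (intro bexI[of _ a] conjI exI[of _ "{a<..}"]) auto
  next
    case False
    then show ?thesis
      using assms by (intro bexI[of _ "min 0 t"] conjI exI[of _ UNIV]) (auto simp: min_def not_less split: if_splits)
  qed
  then obtain a S' where a: "a \<in> I" "a \<le> min 0 t" "open S'" "t \<in> S'" "\<And>s. s \<in> I \<Longrightarrow> s \<in> S' \<Longrightarrow> a \<le> s" by blast
  have sub: "{a..b} \<subseteq> I"
    using mem_is_interval_1_I[OF assms(1) a(1) b(1)] by auto
  have eq: "I \<inter> (S \<inter> S') = {a..b} \<inter> (S \<inter> S')"
    using sub a(5) b(5) by auto
  have "at t within I = at t within {a..b}"
  proof (rule at_within_nhd)
    show "t \<in> S \<inter> S'" using a(4) b(4) by blast
    show "open (S \<inter> S')" using a(3) b(3) by blast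
    show "I \<inter> (S \<inter> S') - {t} = {a..b} \<inter> (S \<inter> S') - {t}" unfolding eq ..
  qed
  moreover have "0 \<in> {a..b}" "t \<in> {a..b}" using a(2) b(2) by auto
  ultimately show ?thesis using that sub by blast
qed

text \<open>One step of Picard's factorial estimate, on either side of \<open>t0\<close>. It is the
  common induction step for uniqueness and for convergence of the iteration.\<close>

lemma iterated_bound:
  fixes f f' :: "real \<Rightarrow> 'a::real_normed_vector"
  assumes f: "\<And>s. s \<in> {a..b} \<Longrightarrow> (f has_vector_derivative f' s) (at s within {a..b})"
    and zero: "f t0 = 0" "t0 \<in> {a..b}" and t: "t \<in> {a..b}"
    and bd: "\<And>s. s \<in> {a..b} \<Longrightarrow> norm (f' s) \<le> M * (K * (M * \<bar>s - t0\<bar>) ^ k / fact k)"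
  shows "norm (f t) \<le> K * (M * \<bar>t - t0\<bar>) ^ Suc k / fact (Suc k)"
proof -
  have f_cont: "continuous_on {c..d} f" if "{c..d} \<subseteq> {a..b}" for c d
    using f that by (meson continuous_on_eq_continuous_within continuous_on_subset has_vector_derivative_continuous)
  have f_at: "(f has_vector_derivative f' s) (at s)" if "c < s" "s < d" "{c..d} \<subseteq> {a..b}" for c d s
  proof -
    have "s \<in> {a<..<b}" using that by auto
    then show ?thesis using f[of s] at_within_interior[of s "{a..b}"] by (simp add: interior_atLeastAtMost_real)
  qed
  have der: "((\<lambda>s. r * (K * g s ^ Suc k / fact (Suc k))) has_real_derivative r * (g' * (K * g s ^ k / fact k))) (at s)"
    if "(g has_real_derivative g') (at s)" for g g' s and r :: real
  proof -
    have "K * (real (Suc k) * (g' * g s ^ k)) / fact (Suc k) = g' * (K * g s ^ k / fact k)"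
      unfolding fact_Suc by (simp del: of_nat_Suc)
    moreover have "((\<lambda>s. r * (K * g s ^ Suc k / fact (Suc k))) has_real_derivative
        r * (K * (real (Suc k) * (g' * g s ^ (Suc k - Suc 0))) / fact (Suc k))) (at s)"
      by (intro DERIV_cmult DERIV_cdivide DERIV_power that)
    ultimately show ?thesis by (simp only: diff_Suc_Suc diff_zero)
  qed
  have gen: "((\<lambda>s. K * (M * (s - t0)) ^ Suc k / fact (Suc k)) has_real_derivative M * (K * (M * (s - t0)) ^ k / fact k)) (at s)" for s
  proof -
    have "((\<lambda>s. M * (s - t0)) has_real_derivative M) (at s)" by (auto intro!: derivative_eq_intros)
    from der[OF this, of 1] show ?thesis by simp
  qed
  have gen': "((\<lambda>s. - (K * (M * (t0 - s)) ^ Suc k / fact (Suc k))) has_real_derivative M * (K * (M * (t0 - s)) ^ k / fact k)) (at s)" for s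
  proof -
    have "((\<lambda>s. M * (t0 - s)) has_real_derivative - M) (at s)" by (auto intro!: derivative_eq_intros)
    from der[OF this, of "-1"] show ?thesis by simp
  qed
  consider "t = t0" | "t0 < t" | "t < t0" by linarith
  then show ?thesis
  proof cases
    case 1
    then show ?thesis using zero by simp
  next
    case 2
    have sub: "{t0..t} \<subseteq> {a..b}" using zero t by auto
    have "norm (f t - f t0) \<le> K * (M * (t - t0)) ^ Suc k / fact (Suc k) - K * (M * (t0 - t0)) ^ Suc k / fact (Suc k)"
    proof (rule differentiable_bound_general[OF 2 f_cont[OF sub]])
      show "continuous_on {t0..t} (\<lambda>s. K * (M * (s - t0)) ^ Suc k / fact (Suc k))"
        by (intro continuous_intros) auto
      fix s assume s: "t0 < s" "s < t"
      show "(f has_vector_derivative f' s) (at s)" by (rule f_at[OF s sub])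
      show "((\<lambda>s. K * (M * (s - t0)) ^ Suc k / fact (Suc k)) has_vector_derivative M * (K * (M * (s - t0)) ^ k / fact k)) (at s)"
        using gen by (simp add: has_real_derivative_iff_has_vector_derivative)
      show "norm (f' s) \<le> M * (K * (M * (s - t0)) ^ k / fact k)"
        using bd[of s] s sub by auto
    qed
    then show ?thesis using 2 zero by simp
  next
    case 3
    have sub: "{t..t0} \<subseteq> {a..b}" using zero t by auto
    have "norm (f t0 - f t) \<le> - (K * (M * (t0 - t0)) ^ Suc k / fact (Suc k)) - - (K * (M * (t0 - t)) ^ Suc k / fact (Suc k))"
    proof (rule differentiable_bound_general[OF 3 f_cont[OF sub]])
      show "continuous_on {t..t0} (\<lambda>s. - (K * (M * (t0 - s)) ^ Suc k / fact (Suc k)))"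
        by (intro continuous_intros) auto
      fix s assume s: "t < s" "s < t0"
      show "(f has_vector_derivative f' s) (at s)" by (rule f_at[OF s sub])
      show "((\<lambda>s. - (K * (M * (t0 - s)) ^ Suc k / fact (Suc k))) has_vector_derivative M * (K * (M * (t0 - s)) ^ k / fact k)) (at s)"
        using gen' by (simp add: has_real_derivative_iff_has_vector_derivative)
      show "norm (f' s) \<le> M * (K * (M * (t0 - s)) ^ k / fact k)"
        using bd[of s] s sub by auto
    qed
    then show ?thesis using 3 zero by simp
  qed
qed

text \<open>Feeding a bound on the solution back into the equation improves it by one factor
  \<open>M' * \<bar>t - t0\<bar> / (k + 1)\<close> each time; the resulting factorial bounds tend to
  0.\<close>

lemma linear_ode_zero:
  fixes x :: "real \<Rightarrow> 'a::real_normed_vector"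
  assumes x: "\<And>s. s \<in> {a..b} \<Longrightarrow> (x has_vector_derivative L s (x s)) (at s within {a..b})"
    and M: "\<And>s v. s \<in> {a..b} \<Longrightarrow> norm (L s v) \<le> M * norm v"
    and zero: "x t0 = 0" "t0 \<in> {a..b}" and t: "t \<in> {a..b}"
  shows "x t = 0"
proof -
  define M' where "M' = \<bar>M\<bar>"
  have M': "norm (L s v) \<le> M' * norm v" if "s \<in> {a..b}" for s v
    by (rule order_trans[OF M[OF that]]) (auto simp: M'_def intro!: mult_right_mono)
  have "continuous_on {a..b} x"
    using x by (meson continuous_on_eq_continuous_within has_vector_derivative_continuous)
  then have "bounded (x ` {a..b})"
    by (intro compact_imp_bounded compact_continuous_image) auto
  then obtain K where "\<forall>y\<in>x ` {a..b}. norm y \<le> K"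
    unfolding bounded_iff by blast
  then have K: "norm (x s) \<le> K" if "s \<in> {a..b}" for s
    using that by blast
  have "\<forall>t\<in>{a..b}. norm (x t) \<le> K * (M' * \<bar>t - t0\<bar>) ^ k / fact k" for k
  proof (induction k)
    case 0
    then show ?case using K by simp
  next
    case (Suc k)
    show ?case
    proof
      fix t assume t: "t \<in> {a..b}"
      show "norm (x t) \<le> K * (M' * \<bar>t - t0\<bar>) ^ Suc k / fact (Suc k)"
      proof (rule iterated_bound[OF x zero t])
        fix s assume s: "s \<in> {a..b}"
        show "norm (L s (x s)) \<le> M' * (K * (M' * \<bar>s - t0\<bar>) ^ k / fact k)"
          using Suc.IH s by (intro order_trans[OF M'[OF s]] mult_left_mono) (auto simp: M'_def)
      qed
    qed
  qed
  then have bd: "norm (x t) \<le> K * ((M' * \<bar>t - t0\<bar>) ^ k / fact k)" for k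
    using t by simp
  have "(\<lambda>k. (M' * \<bar>t - t0\<bar>) ^ k / fact k) \<longlonglongrightarrow> 0"
    using summable_LIMSEQ_zero[OF summable_exp[of "M' * \<bar>t - t0\<bar>"]] by (simp add: divide_inverse mult.commute)
  from tendsto_mult[OF tendsto_const[of K] this] have "(\<lambda>k. K * ((M' * \<bar>t - t0\<bar>) ^ k / fact k)) \<longlonglongrightarrow> 0"
    by simp
  from LIMSEQ_le_const[OF this] bd have "norm (x t) \<le> 0" by blast
  then show ?thesis by simp
qed

lemma linear_ode_exists_compact:
  fixes L :: "real \<Rightarrow> 'a::euclidean_space \<Rightarrow> 'a"
  assumes L_cont: "\<And>x. continuous_on {a..b} x \<Longrightarrow> continuous_on {a..b} (\<lambda>s. L s (x s))"
    and L_lin: "\<And>s. s \<in> {a..b} \<Longrightarrow> bounded_linear (L s)"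
    and M: "\<And>s v. s \<in> {a..b} \<Longrightarrow> norm (L s v) \<le> M * norm v"
    and 0: "0 \<in> {a..b}"
  shows "\<exists>x. x 0 = x0 \<and> (\<forall>s\<in>{a..b}. (x has_vector_derivative L s (x s)) (at s within {a..b}))"
proof -
  define M' where "M' = \<bar>M\<bar>"
  have M': "norm (L s v) \<le> M' * norm v" if "s \<in> {a..b}" for s v
    by (rule order_trans[OF M[OF that]]) (auto simp: M'_def intro!: mult_right_mono)
  let ?d = "\<lambda>f f'. \<forall>s\<in>{a..b}. (f has_vector_derivative f' s) (at s within {a..b})"
  have antideriv: "\<exists>F. F 0 = 0 \<and> ?d F f" if "continuous_on {a..b} f" for f :: "real \<Rightarrow> 'a"
  proof (intro exI[of _ "\<lambda>s. integral {a..s} f - integral {a..0} f"] conjI ballI)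
    show "integral {a..0} f - integral {a..0} f = 0" by simp
    fix s assume "s \<in> {a..b}"
    from has_vector_derivative_diff[OF integral_has_vector_derivative[OF that this] has_vector_derivative_const]
    show "((\<lambda>s. integral {a..s} f - integral {a..0} f) has_vector_derivative f s) (at s within {a..b})"
      by simp
  qed
  \<comment> \<open>The increments of Picard iteration: the constant \<open>x0\<close> first, then
    antiderivatives of \<open>L\<close> applied to the previous increment, normalised to vanish at
    0. Their sum is the solution.\<close>
  have "\<exists>\<phi>. \<forall>k. (continuous_on {a..b} (\<phi> k) \<and> (k = 0 \<longrightarrow> \<phi> k = (\<lambda>_. x0)))
     \<and> (\<phi> (Suc k) 0 = 0 \<and> ?d (\<phi> (Suc k)) (\<lambda>s. L s (\<phi> k s)))"
  proof (rule dependent_nat_choice[where P = "\<lambda>k f. continuous_on {a..b} f \<and> (k = 0 \<longrightarrow> f = (\<lambda>_. x0))"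
      and Q = "\<lambda>k f F. F 0 = 0 \<and> ?d F (\<lambda>s. L s (f s))"])
    show "\<exists>f. continuous_on {a..b} f \<and> (0 = (0::nat) \<longrightarrow> f = (\<lambda>_. x0))"
      by (intro exI[of _ "\<lambda>_. x0"]) auto
    fix f :: "real \<Rightarrow> 'a" and k :: nat
    assume "continuous_on {a..b} f \<and> (k = 0 \<longrightarrow> f = (\<lambda>_. x0))"
    then obtain F where F: "F 0 = 0" "?d F (\<lambda>s. L s (f s))"
      using antideriv[OF L_cont] by blast
    then have "continuous_on {a..b} F"
      by (meson continuous_on_eq_continuous_within has_vector_derivative_continuous)
    then show "\<exists>F. (continuous_on {a..b} F \<and> (Suc k = 0 \<longrightarrow> F = (\<lambda>_. x0))) \<and> (F 0 = 0 \<and> ?d F (\<lambda>s. L s (f s)))"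
      using F by blast
  qed
  then obtain \<phi> where \<phi>0: "\<phi> 0 = (\<lambda>_. x0)" and \<phi>_cont: "\<And>k. continuous_on {a..b} (\<phi> k)"
    and \<phi>S: "\<And>k. \<phi> (Suc k) 0 = 0" "\<And>k. ?d (\<phi> (Suc k)) (\<lambda>s. L s (\<phi> k s))"
    by blast
  have bd: "\<forall>t\<in>{a..b}. norm (\<phi> k t) \<le> norm x0 * (M' * \<bar>t - 0\<bar>) ^ k / fact k" for k
  proof (induction k)
    case 0
    then show ?case by (simp add: \<phi>0)
  next
    case (Suc k)
    show ?case
    proof
      fix t assume t: "t \<in> {a..b}"
      show "norm (\<phi> (Suc k) t) \<le> norm x0 * (M' * \<bar>t - 0\<bar>) ^ Suc k / fact (Suc k)"
      proof (rule iterated_bound[where f = "\<phi> (Suc k)" and f' = "\<lambda>s. L s (\<phi> k s)", OF _ \<phi>S(1) 0 t])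
        show "(\<phi> (Suc k) has_vector_derivative L s (\<phi> k s)) (at s within {a..b})" if "s \<in> {a..b}" for s
          using \<phi>S(2) that by blast
        show "norm (L s (\<phi> k s)) \<le> M' * (norm x0 * (M' * \<bar>s - 0\<bar>) ^ k / fact k)" if "s \<in> {a..b}" for s
          using Suc.IH that by (intro order_trans[OF M'[OF that]] mult_left_mono) (auto simp: M'_def)
      qed
    qed
  qed
  define c where "c = M' * max \<bar>a\<bar> \<bar>b\<bar>"
  have c: "M' * \<bar>t\<bar> \<le> c" if "t \<in> {a..b}" for t
    unfolding c_def by (rule mult_left_mono) (use that in \<open>auto simp: M'_def\<close>)
  have bd': "norm (\<phi> k t) \<le> norm x0 * (c ^ k / fact k)" if "t \<in> {a..b}" for k t
  proof -
    have "norm (\<phi> k t) \<le> norm x0 * ((M' * \<bar>t\<bar>) ^ k / fact k)" using bd[of k] that by simp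
    also have "\<dots> \<le> norm x0 * (c ^ k / fact k)"
      by (intro mult_left_mono divide_right_mono power_mono c that) (auto simp: M'_def)
    finally show ?thesis .
  qed
  have summ: "summable (\<lambda>k. norm x0 * (c ^ k / fact k))"
    using summable_mult[OF summable_exp[of c], of "norm x0"] by (simp add: divide_inverse mult_ac)
  \<comment> \<open>The derivative of the increment \<open>\<phi> k\<close>. The index shift is what
    makes the differentiated series equal to \<open>L\<close> applied to the original one.\<close>
  define \<psi> where "\<psi> k s = (case k of 0 \<Rightarrow> 0 | Suc j \<Rightarrow> L s (\<phi> j s))" for k s
  have \<psi>_der: "?d (\<phi> k) (\<psi> k)" for k
    using \<phi>S(2) by (cases k) (auto simp: \<psi>_def \<phi>0)
  have summ\<phi>: "summable (\<lambda>k. \<phi> k t)" if "t \<in> {a..b}" for t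
    by (rule summable_comparison_test'[OF summ]) (rule bd'[OF that])
  define g' where "g' s = (\<Sum>k. \<psi> k s)" for s
  define x where "x s = (\<Sum>k. \<phi> k s)" for s
  have unif: "uniform_limit {a..b} (\<lambda>n s. \<Sum>k<n. \<psi> k s) g' sequentially"
    unfolding g'_def
  proof (rule Weierstrass_m_test)
    show "norm (\<psi> k s) \<le> (case k of 0 \<Rightarrow> 0 | Suc j \<Rightarrow> M' * (norm x0 * (c ^ j / fact j)))" if "s \<in> {a..b}" for k s
      using order_trans[OF M'[OF that] mult_left_mono[OF bd'[OF that]]]
      by (cases k) (auto simp: \<psi>_def M'_def)
    have "summable (\<lambda>j. M' * (norm x0 * (c ^ j / fact j)))"
      using summ by (rule summable_mult)
    then show "summable (\<lambda>k. case k of 0 \<Rightarrow> 0 | Suc j \<Rightarrow> M' * (norm x0 * (c ^ j / fact j)))"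
      by (subst summable_Suc_iff[symmetric]) simp
  qed
  have "\<exists>g. \<forall>s\<in>{a..b}. (\<lambda>n. \<phi> n s) sums g s \<and> (g has_derivative (\<lambda>h. h *\<^sub>R g' s)) (at s within {a..b})"
  proof (rule has_derivative_series[where f' = "\<lambda>n s h. h *\<^sub>R \<psi> n s" and x = 0])
    show "(\<phi> n has_derivative (\<lambda>h. h *\<^sub>R \<psi> n s)) (at s within {a..b})" if "s \<in> {a..b}" for n s
      using \<psi>_der that unfolding has_vector_derivative_def by blast
    show "\<forall>\<^sub>F n in sequentially. \<forall>s\<in>{a..b}. \<forall>h. norm ((\<Sum>i<n. h *\<^sub>R \<psi> i s) - h *\<^sub>R g' s) \<le> e * norm h" if "e > 0" for e
      using uniform_limitD[OF unif that]
    proof eventually_elim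
      case (elim n)
      show ?case
      proof (intro ballI allI)
        fix s h assume s: "s \<in> {a..b}"
        have "norm ((\<Sum>i<n. h *\<^sub>R \<psi> i s) - h *\<^sub>R g' s) = \<bar>h\<bar> * dist (\<Sum>i<n. \<psi> i s) (g' s)"
          by (simp add: dist_norm scaleR_sum_right[symmetric] scaleR_diff_right[symmetric])
        also have "\<dots> \<le> \<bar>h\<bar> * e" using elim s by (intro mult_left_mono) (auto intro: less_imp_le)
        finally show "norm ((\<Sum>i<n. h *\<^sub>R \<psi> i s) - h *\<^sub>R g' s) \<le> e * norm h" by (simp add: mult.commute)
      qed
    qed
    show "(\<lambda>n. \<phi> n 0) sums (\<Sum>n. \<phi> n 0)" using summ\<phi>[OF 0] by (rule summable_sums)
  qed (use 0 in auto)
  then obtain g where g: "\<And>s. s \<in> {a..b} \<Longrightarrow> (\<lambda>n. \<phi> n s) sums g s"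
    "\<And>s. s \<in> {a..b} \<Longrightarrow> (g has_derivative (\<lambda>h. h *\<^sub>R g' s)) (at s within {a..b})" by blast
  have "g' s = L s (g s)" if s: "s \<in> {a..b}" for s
  proof -
    have "(\<lambda>j. L s (\<phi> j s)) sums L s (g s)"
      by (rule bounded_linear.sums[OF L_lin[OF s] g(1)[OF s]])
    then have "(\<lambda>j. \<psi> (Suc j) s) sums L s (g s)" by (simp add: \<psi>_def)
    then have "(\<lambda>k. \<psi> k s) sums (L s (g s) + \<psi> 0 s)" by (rule sums_Suc)
    then show ?thesis unfolding g'_def by (simp add: \<psi>_def sums_iff)
  qed
  moreover have "g 0 = x0"
  proof -
    have "(\<lambda>j. \<phi> (Suc j) 0) sums 0" by (simp add: \<phi>S(1))
    then have "(\<lambda>j. \<phi> j 0) sums (0 + \<phi> 0 0)" by (rule sums_Suc)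
    then show ?thesis using g(1)[OF 0] by (simp add: sums_unique2[of _ "g 0" x0] \<phi>0)
  qed
  ultimately show ?thesis
    using g(2) unfolding has_vector_derivative_def by (intro exI[of _ g]) auto
qed

text \<open>Local solutions agree on overlaps by uniqueness, so they glue to a solution on \<open>I\<close>.\<close>

lemma linear_ode_exists:
  fixes L :: "real \<Rightarrow> 'a::euclidean_space \<Rightarrow> 'a"
  assumes I: "is_interval I" "0 \<in> I"
    and L_cont: "\<And>a b x. {a..b} \<subseteq> I \<Longrightarrow> continuous_on {a..b} x \<Longrightarrow> continuous_on {a..b} (\<lambda>s. L s (x s))"
    and L_lin: "\<And>s. s \<in> I \<Longrightarrow> bounded_linear (L s)"
    and L_bd: "\<And>a b. {a..b} \<subseteq> I \<Longrightarrow> \<exists>M. \<forall>s\<in>{a..b}. \<forall>v. norm (L s v) \<le> M * norm v"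
  shows "\<exists>x. x 0 = x0 \<and> (\<forall>s\<in>I. (x has_vector_derivative L s (x s)) (at s within I))"
proof -
  let ?sol = "\<lambda>a b x. x 0 = x0 \<and> (\<forall>s\<in>{a..b}. (x has_vector_derivative L s (x s)) (at s within {a..b}))"
  have ex: "\<exists>x. ?sol a b x" if ab: "0 \<in> {a..b}" "{a..b} \<subseteq> I" for a b
  proof -
    obtain M where M: "\<And>s v. s \<in> {a..b} \<Longrightarrow> norm (L s v) \<le> M * norm v"
      using L_bd[OF ab(2)] by blast
    show ?thesis
      by (rule linear_ode_exists_compact[OF L_cont[OF ab(2)] L_lin M ab(1)]) (use ab in auto)
  qed
  have unique: "x s = y s" if ab: "0 \<in> {a..b}" "{a..b} \<subseteq> I" "?sol a b x" "?sol a b y" "s \<in> {a..b}" for a b x y s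
  proof -
    obtain M where M: "\<And>s v. s \<in> {a..b} \<Longrightarrow> norm (L s v) \<le> M * norm v"
      using L_bd[OF ab(2)] by blast
    have "(\<lambda>s. x s - y s) s = 0"
    proof (rule linear_ode_zero[where L = L and M = M, OF _ M _ ab(1) ab(5)])
      fix r assume r: "r \<in> {a..b}"
      then have "bounded_linear (L r)" using L_lin ab(2) by blast
      then have "L r (x r - y r) = L r (x r) - L r (y r)"
        by (simp add: bounded_linear.linear linear_diff)
      moreover have "((\<lambda>s. x s - y s) has_vector_derivative L r (x r) - L r (y r)) (at r within {a..b})"
        using ab(3,4) r by (intro has_vector_derivative_diff) blast+
      ultimately show "((\<lambda>s. x s - y s) has_vector_derivative L r (x r - y r)) (at r within {a..b})" by simp
    qed (use ab in auto)
    then show ?thesis by simp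
  qed
  define sol where "sol a b = (SOME x. ?sol a b x)" for a b
  have sol: "?sol a b (sol a b)" if "0 \<in> {a..b}" "{a..b} \<subseteq> I" for a b
    unfolding sol_def by (rule someI_ex[OF ex[OF that]])
  \<comment> \<open>At each \<open>t\<close> the solution on the smallest interval containing 0 and
    \<open>t\<close> is used; uniqueness makes it agree with the solution on any larger
    interval.\<close>
  define X where "X t = sol (min 0 t) (max 0 t) t" for t
  have X_eq: "X t = sol a b t" if ab: "0 \<in> {a..b}" "{a..b} \<subseteq> I" "t \<in> {a..b}" for a b t
  proof -
    let ?a = "min 0 t" and ?b = "max 0 t"
    have sub: "{?a..?b} \<subseteq> {a..b}" using ab by auto
    have in_ab: "0 \<in> {?a..?b}" "t \<in> {?a..?b}" by auto
    have "?sol ?a ?b (sol a b)"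
      using sol[OF ab(1,2)] sub by (meson has_vector_derivative_within_subset subsetD)
    moreover have "?sol ?a ?b (sol ?a ?b)"
      by (rule sol[OF in_ab(1)]) (use sub ab in blast)
    ultimately show ?thesis
      unfolding X_def using unique[OF in_ab(1) order_trans[OF sub ab(2)] _ _ in_ab(2)] by blast
  qed
  show ?thesis
  proof (intro exI[of _ X] conjI ballI)
    have "{0..0} \<subseteq> I" using I by auto
    then show "X 0 = x0" using X_eq[of 0 0 0] sol[of 0 0] by auto
    fix t assume "t \<in> I"
    then obtain a b where ab: "0 \<in> {a..b}" "t \<in> {a..b}" "{a..b} \<subseteq> I" "at t within I = at t within {a..b}"
      using interval_neighbourhood[OF I] by metis
    have "(sol a b has_vector_derivative L t (sol a b t)) (at t within {a..b})"
      using sol[OF ab(1,3)] ab(2) by blast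
    then have "(X has_vector_derivative L t (sol a b t)) (at t within {a..b})"
      by (rule has_vector_derivative_transform[OF ab(2), rotated]) (rule X_eq[OF ab(1,3)])
    then show "(X has_vector_derivative L t (X t)) (at t within I)"
      unfolding ab(4) X_eq[OF ab(1,3,2)] .
  qed
qed

subsection \<open>Equations of motion\<close>

lemma L2_inner_self: "L2_inner f f = complex_of_real ((L2_norm f)\<^sup>2)"
proof -
  have "cnj (f x) * f x = complex_of_real ((cmod (f x))\<^sup>2)" for x
    by (simp only: complex_norm_square mult.commute)
  then have "L2_inner f f = complex_of_real (\<integral>x. (cmod (f x))\<^sup>2 \<partial>lborel)"
    unfolding L2_inner_def by (simp del: of_real_power)
  then show ?thesis
    by (simp add: L2_norm_def del: of_real_power)
qed

lemma bounded_bilinear_matrix_mult: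
  "bounded_bilinear ((**) :: complex^'n^'m \<Rightarrow> complex^'k^'n \<Rightarrow> complex^'k^'m)"
  unfolding bilinear_conv_bounded_bilinear[symmetric] bilinear_def
  by (auto intro!: linearI simp: matrix_matrix_mult_def vec_eq_iff sum.distrib algebra_simps scaleR_sum_right)

lemmas matrix_mult_has_vector_derivative = bounded_bilinear.has_vector_derivative[OF bounded_bilinear_matrix_mult]
lemmas matrix_mult_continuous_on = bounded_bilinear.continuous_on[OF bounded_bilinear_matrix_mult]

lemma avg_mat_hess_entries:
  "avg_mat \<epsilon> u (hess_qq h) $ i $ j = avg \<epsilon> u (pderiv_at (axis i 1, 0) (pderiv_at (axis j 1, 0) h))"
  "avg_mat \<epsilon> u (hess_qp h) $ i $ j = avg \<epsilon> u (pderiv_at (axis i 1, 0) (pderiv_at (0, axis j 1) h))"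
  "avg_mat \<epsilon> u (hess_pq h) $ i $ j = avg \<epsilon> u (pderiv_at (0, axis i 1) (pderiv_at (axis j 1, 0) h))"
  "avg_mat \<epsilon> u (hess_pp h) $ i $ j = avg \<epsilon> u (pderiv_at (0, axis i 1) (pderiv_at (0, axis j 1) h))"
  by (simp_all add: avg_mat_def hess_qq_def hess_qp_def hess_pq_def hess_pp_def hess_def)

text \<open>Identifies the right-hand side of the Riccati equation for C as -B.\<close>

lemma B_mat_blocks:
  "B_mat \<epsilon> u h C = avg_mat \<epsilon> u (hess_qq h) + avg_mat \<epsilon> u (hess_qp h) ** C + C ** avg_mat \<epsilon> u (hess_pq h)
    + C ** avg_mat \<epsilon> u (hess_pp h) ** C"
  by (simp add: vec_eq_iff B_mat_entry avg_mat_hess_entries matrix_matrix_mult_def distrib_right sum.distrib)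

lemma has_vector_derivative_bot: "at t within S = bot \<Longrightarrow> (f has_vector_derivative D) (at t within S)"
  unfolding has_vector_derivative_iff_quotient by simp

locale variational_flow =
  fixes \<epsilon> :: real and h :: "real \<Rightarrow> (real^'n) \<times> (real^'n) \<Rightarrow> real" and I :: "real set"
    and u :: "real \<Rightarrow> real^'n \<Rightarrow> complex" and q0 p0 :: "real^'n" and C0 :: "complex^'n^'n" and \<zeta>0 :: complex
  assumes eps: "0 < \<epsilon>"
    and h_time: "\<And>z. continuous_on UNIV (\<lambda>t. h t z)"
    and h_smooth: "\<And>t. smooth_fun (h t)"
    and h_growth: "subquadratic h"
    and interval: "is_interval I" "0 \<in> I"
    and initial_width: "width_matrix C0"
    and initial: "u 0 = gauss \<epsilon> q0 p0 C0 \<zeta>0"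
    and normalized: "L2_norm (u 0) = 1"
    and variational: "variational_solution \<epsilon> h I u"
begin

lemma h_symbol: "symbol_family (\<lambda>_. h t)"
  by (rule subquadratic_symbol[OF h_smooth h_growth])

lemma u_continuous: "continuous_on I (\<lambda>s. u s x)"
  unfolding continuous_on_eq_continuous_within
proof
  fix t assume "t \<in> I"
  then obtain D where "((\<lambda>s. u s x) has_vector_derivative D) (at t within I)"
    using variational unfolding variational_solution_def by blast
  then show "continuous (at t within I) (\<lambda>s. u s x)"
    by (rule has_vector_derivative_continuous)
qed

lemma curve: "packet_params \<epsilon> I u q p C \<zeta> \<Longrightarrow> packet_curve \<epsilon> I u q p C \<zeta>"
  by unfold_locales (use eps u_continuous in auto)

text \<open>The convergence theorem for parameters, applied to a constant sequence.\<close>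

lemma params_unique:
  assumes "gauss \<epsilon> q p C \<zeta> = gauss \<epsilon> q' p' C' \<zeta>'" "width_matrix C" "width_matrix C'"
  shows "C = C'" "q = q'" "p = p'"
proof -
  have "(\<lambda>n::nat. gauss \<epsilon> q p C \<zeta> x) \<longlonglongrightarrow> gauss \<epsilon> q' p' C' \<zeta>' x" for x
    using assms(1) by simp
  note lim = gauss_tendsto_params[OF eps assms(2,3) this]
  show "C = C'" "q = q'" "p = p'"
    using lim by (simp_all add: LIMSEQ_const_iff)
qed

text \<open>The packets provide parameters at each time separately. For q, p and C this choice is
  automatically continuous; for \<zeta> it is replaced by a continuous logarithm, which exists
  because the interval is contractible.\<close>

lemma exists_params: "\<exists>q p C \<zeta>. packet_params \<epsilon> I u q p C \<zeta> \<and> \<zeta> 0 = \<zeta>0"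
proof -
  have "\<forall>t\<in>I. \<exists>z. width_matrix (fst (snd (snd z))) \<and> u t = gauss \<epsilon> (fst z) (fst (snd z)) (fst (snd (snd z))) (snd (snd (snd z)))"
  proof
    fix t assume "t \<in> I"
    then have "u t \<in> wave_packets \<epsilon>"
      using variational unfolding variational_solution_def by blast
    then obtain q p C \<zeta> where "width_matrix C" "u t = gauss \<epsilon> q p C \<zeta>"
      unfolding wave_packets_def by blast
    then show "\<exists>z. width_matrix (fst (snd (snd z))) \<and> u t = gauss \<epsilon> (fst z) (fst (snd z)) (fst (snd (snd z))) (snd (snd (snd z)))"
      by (intro exI[of _ "(q, p, C, \<zeta>)"]) simp
  qed
  from bchoice[OF this] obtain z where z: "\<And>t. t \<in> I \<Longrightarrow> width_matrix (fst (snd (snd (z t))))"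
    "\<And>t. t \<in> I \<Longrightarrow> u t = gauss \<epsilon> (fst (z t)) (fst (snd (z t))) (fst (snd (snd (z t)))) (snd (snd (snd (z t))))"
    by blast
  define q p C \<zeta>' where "q t = fst (z t)" and "p t = fst (snd (z t))" and "C t = fst (snd (snd (z t)))" and "\<zeta>' t = snd (snd (snd (z t)))" for t
  have width: "width_matrix (C t)" and u_eq: "u t = gauss \<epsilon> (q t) (p t) (C t) (\<zeta>' t)" if "t \<in> I" for t
    using z[OF that] by (simp_all add: q_def p_def C_def \<zeta>'_def)
  have lim: "(C \<longlongrightarrow> C t) (at t within I)" "(q \<longlongrightarrow> q t) (at t within I)" "(p \<longlongrightarrow> p t) (at t within I)" if t: "t \<in> I" for t
  proof -
    have "(\<lambda>n. C (X n)) \<longlonglongrightarrow> C t \<and> (\<lambda>n. q (X n)) \<longlonglongrightarrow> q t \<and> (\<lambda>n. p (X n)) \<longlonglongrightarrow> p t"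
      if X: "\<And>n. X n \<in> I" "X \<longlonglongrightarrow> t" for X
    proof -
      have "(\<lambda>n. gauss \<epsilon> (q (X n)) (p (X n)) (C (X n)) (\<zeta>' (X n)) x) \<longlonglongrightarrow> gauss \<epsilon> (q t) (p t) (C t) (\<zeta>' t) x" for x
        using continuous_on_tendsto_compose[OF u_continuous X(2) t always_eventually, of x] X(1) u_eq t by simp
      from gauss_tendsto_params[OF eps width[OF X(1)] width[OF t] this] show ?thesis by blast
    qed
    then show "(C \<longlongrightarrow> C t) (at t within I)" "(q \<longlongrightarrow> q t) (at t within I)" "(p \<longlongrightarrow> p t) (at t within I)"
      by (auto intro!: tendsto_within_sequentiallyI)
  qed
  \<comment> \<open>The factor exp(i \<zeta> / \<epsilon>), isolated by dividing by the packet with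
    \<zeta> = 0. It is independent of the branch of \<zeta> and continuous since u, q, p and C
    are.\<close>
  define w where "w s = u s 0 / gauss \<epsilon> (q s) (p s) (C s) 0 0" for s
  have split: "gauss \<epsilon> q p C \<zeta> x = gauss \<epsilon> q p C 0 x * exp (\<i> / \<epsilon> * \<zeta>)" for q p :: "real^'n" and C \<zeta> x
    unfolding gauss_eq gauss_exponent_def by (simp add: exp_add[symmetric] distrib_left)
  have w_eq: "w s = exp (\<i> / \<epsilon> * \<zeta>' s)" if "s \<in> I" for s
    unfolding w_def using u_eq[OF that] split[of "q s" "p s" "C s" "\<zeta>' s" 0] gauss_nonzero by simp
  have "continuous_on I w"
    unfolding w_def continuous_on_def
  proof
    fix t assume t: "t \<in> I"
    have "((\<lambda>s. gauss \<epsilon> (q s) (p s) (C s) 0 0) \<longlongrightarrow> gauss \<epsilon> (q t) (p t) (C t) 0 0) (at t within I)"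
      unfolding gauss_eq gauss_exponent_def centered_def by (intro tendsto_intros lim t)
    moreover have "((\<lambda>s. u s 0) \<longlongrightarrow> u t 0) (at t within I)"
      using u_continuous t unfolding continuous_on_def by blast
    ultimately show "((\<lambda>s. u s 0 / gauss \<epsilon> (q s) (p s) (C s) 0 0) \<longlongrightarrow> u t 0 / gauss \<epsilon> (q t) (p t) (C t) 0 0) (at t within I)"
      by (intro tendsto_divide gauss_nonzero)
  qed
  moreover have "contractible I"
    using interval(1) by (simp add: convex_imp_contractible is_interval_convex)
  moreover have "w s \<noteq> 0" if "s \<in> I" for s
    using w_eq[OF that] by simp
  ultimately obtain l where l: "continuous_on I l" "\<And>s. s \<in> I \<Longrightarrow> w s = exp (l s)"
    using continuous_logarithm_on_contractible by blast
  \<comment> \<open>Both \<open>l 0\<close> and i \<zeta>0 / \<epsilon> are logarithms of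
    \<open>w 0\<close>. Replacing one by the other keeps the exponential and fixes the initial
    value.\<close>
  define \<zeta> where "\<zeta> s = - \<i> * \<epsilon> * (l s - l 0) + \<zeta>0" for s
  have at0: "C 0 = C0" "q 0 = q0" "p 0 = p0"
    using params_unique[OF _ width[OF interval(2)] initial_width, of "q 0" "p 0" "\<zeta>' 0" q0 p0 \<zeta>0] initial u_eq[OF interval(2)]
    by auto
  have w0: "w 0 = exp (\<i> / \<epsilon> * \<zeta>0)"
    unfolding w_def initial at0 using split[of q0 p0 C0 \<zeta>0 0] gauss_nonzero by simp
  have exp_\<zeta>: "exp (\<i> / \<epsilon> * \<zeta> s) = w s" if "s \<in> I" for s
  proof -
    have "\<i> / \<epsilon> * \<zeta> s = l s - l 0 + \<i> / \<epsilon> * \<zeta>0"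
      unfolding \<zeta>_def distrib_left using eps by simp
    then have "exp (\<i> / \<epsilon> * \<zeta> s) = exp (l s) / exp (l 0) * exp (\<i> / \<epsilon> * \<zeta>0)"
      by (simp only: exp_add exp_diff)
    then show ?thesis
      using l(2)[OF that] l(2)[OF interval(2)] w0 by simp
  qed
  have "u s = gauss \<epsilon> (q s) (p s) (C s) (\<zeta> s)" if "s \<in> I" for s
  proof
    fix x
    have "u s x = gauss \<epsilon> (q s) (p s) (C s) 0 x * exp (\<i> / \<epsilon> * \<zeta>' s)"
      unfolding u_eq[OF that] by (rule split)
    also have "exp (\<i> / \<epsilon> * \<zeta>' s) = exp (\<i> / \<epsilon> * \<zeta> s)"
      using w_eq[OF that] exp_\<zeta>[OF that] by simp
    finally show "u s x = gauss \<epsilon> (q s) (p s) (C s) (\<zeta> s) x"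
      using split[of "q s" "p s" "C s" "\<zeta> s" x] by simp
  qed
  moreover have "continuous_on I \<zeta>"
    unfolding \<zeta>_def by (intro continuous_intros l)
  ultimately have "packet_params \<epsilon> I u q p C \<zeta>"
    unfolding packet_params_def using width by blast
  moreover have "\<zeta> 0 = \<zeta>0" by (simp add: \<zeta>_def)
  ultimately show ?thesis by blast
qed

lemma u_derivative:
  assumes "packet_params \<epsilon> I u q p C \<zeta>" "t \<in> I"
  shows "((\<lambda>s. u s x) has_vector_derivative
     - \<i> / \<epsilon> * (gaussian.proj_poly \<epsilon> (q t) (p t) (C t) (\<zeta> t) (h t) x * u t x)) (at t within I)"
proof -
  interpret pc: packet_curve \<epsilon> I u q p C \<zeta> by (rule curve[OF assms(1)])
  interpret g: gaussian \<epsilon> "q t" "p t" "C t" "\<zeta> t" by (rule pc.gaussian_at[OF assms(2)])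
  obtain D where D: "((\<lambda>s. u s x) has_vector_derivative D) (at t within I)"
    "\<i> * complex_of_real \<epsilon> * D = tangent_proj (u t) (op_weyl \<epsilon> (h t) (u t)) x"
    using variational assms(2) unfolding variational_solution_def by blast
  have "\<i> * complex_of_real \<epsilon> * D = g.proj_poly (h t) x * u t x"
    unfolding D(2) pc.u_eq[OF assms(2)] g.tangent_proj_gauss[OF h_symbol] ..
  then have "- \<i> / \<epsilon> * (g.proj_poly (h t) x * u t x) = - \<i> / \<epsilon> * (\<i> * complex_of_real \<epsilon> * D)"
    by simp
  also have "\<dots> = D" using eps by simp
  finally show ?thesis using D(1) by simp
qed

text \<open>The packet lies in its own tangent space, so projecting does not change the inner
  product of u with op(h) u. That number is real, and multiplied by -i/\<epsilon> it contributes
  nothing to the derivative. The result sets \<open>N = 1\<close> in the projection.\<close>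

lemma norm_conserved:
  assumes t: "t \<in> I"
  shows "L2_inner (u t) (u t) = 1"
proof -
  obtain q p C \<zeta> where params: "packet_params \<epsilon> I u q p C \<zeta>"
    using exists_params by blast
  interpret pc: packet_curve \<epsilon> I u q p C \<zeta> by (rule curve[OF params])
  have "((\<lambda>s. L2_inner (u s) (u s)) has_vector_derivative 0) (at t within I)" if t: "t \<in> I" for t
  proof -
    interpret g: gaussian \<epsilon> "q t" "p t" "C t" "\<zeta> t" by (rule pc.gaussian_at[OF t])
    define D where "D x = - \<i> / \<epsilon> * (g.proj_poly (h t) x * u t x)" for x
    have pk_D: "g.pk D"
      unfolding D_def g.proj_poly_def pc.u_eq[OF t] by (intro g.pk_cmult g.pk_poly)
    have int: "integrable lborel (\<lambda>x. cnj (u t x) * D x)"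
      unfolding pc.u_eq[OF t] by (rule g.pk_integrable[OF g.pk_u pk_D])
    have "((\<lambda>s. L2_inner (u s) (u s)) has_vector_derivative (\<integral>x. cnj (u t x) * D x + cnj (D x) * u t x \<partial>lborel)) (at t within I)"
      by (rule pc.norm_derivative[OF t _ g.pk_continuous[OF pk_D]]) (unfold D_def, rule u_derivative[OF params t])
    moreover have "(\<integral>x. cnj (u t x) * D x + cnj (D x) * u t x \<partial>lborel) = L2_inner (u t) D + cnj (L2_inner (u t) D)"
    proof -
      have int': "integrable lborel (\<lambda>x. cnj (D x) * u t x)"
        using integrable_cnj[of lborel "\<lambda>x. cnj (u t x) * D x"] int by (simp add: mult.commute)
      have "(\<integral>x. cnj (D x) * u t x \<partial>lborel) = cnj (\<integral>x. cnj (u t x) * D x \<partial>lborel)"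
        using Bochner_Integration.integral_cnj[of lborel "\<lambda>x. cnj (u t x) * D x"] by (simp add: mult.commute)
      then show ?thesis
        unfolding L2_inner_def Bochner_Integration.integral_add[OF int int'] by simp
    qed
    moreover have "L2_inner (u t) D = - \<i> / \<epsilon> * avg \<epsilon> (u t) (h t)"
    proof -
      have "L2_inner (u t) D = - \<i> / \<epsilon> * L2_inner (u t) (\<lambda>x. g.proj_poly (h t) x * u t x)"
        by (simp add: L2_inner_def D_def mult.left_commute)
      then show ?thesis
        unfolding pc.u_eq[OF t] g.proj_poly_moments(1)[OF h_symbol] avg_weyl_form .
    qed
    moreover have "cnj (avg \<epsilon> (u t) (h t)) = avg \<epsilon> (u t) (h t)"
      unfolding pc.u_eq[OF t] by (rule g.avg_real[OF h_symbol])
    ultimately show ?thesis by simp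
  qed
  then obtain c where "\<And>s. s \<in> I \<Longrightarrow> L2_inner (u s) (u s) = c"
    using has_vector_derivative_zero_constant[of I "\<lambda>s. L2_inner (u s) (u s)"] interval(1) is_interval_convex by blast
  then have "L2_inner (u t) (u t) = L2_inner (u 0) (u 0)"
    using t interval(2) by simp
  also have "\<dots> = 1"
    using normalized by (simp add: L2_inner_self)
  finally show ?thesis .
qed

theorem equations_of_motion:
  assumes params: "packet_params \<epsilon> I u q p C \<zeta>"
  shows "parameter_equations \<epsilon> h I u q p C \<zeta>"
  unfolding parameter_equations_def
proof
  fix t assume t: "t \<in> I"
  interpret pc: packet_curve \<epsilon> I u q p C \<zeta> by (rule curve[OF params])
  interpret g: gaussian \<epsilon> "q t" "p t" "C t" "\<zeta> t" by (rule pc.gaussian_at[OF t])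
  let ?F = "at t within I"
  let ?C' = "- avg_mat \<epsilon> (u t) (hess_qq (h t)) - avg_mat \<epsilon> (u t) (hess_qp (h t)) ** C t
      - C t ** avg_mat \<epsilon> (u t) (hess_pq (h t)) - C t ** avg_mat \<epsilon> (u t) (hess_pp (h t)) ** C t"
  let ?\<zeta>' = "- avg \<epsilon> (u t) (h t) + complex_of_real (\<epsilon> / 4) *
      trace (B_mat \<epsilon> (u t) (h t) (C t) ** cmat (matrix_inv (Im_mat (C t)))) + bdot (cvec (p t)) (avg_vec \<epsilon> (u t) (grad_p (h t)))"
  show "((\<lambda>s. cvec (q s)) has_vector_derivative avg_vec \<epsilon> (u t) (grad_p (h t))) ?F \<and>
    ((\<lambda>s. cvec (p s)) has_vector_derivative - avg_vec \<epsilon> (u t) (grad_q (h t))) ?F \<and>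
    (C has_vector_derivative ?C') ?F \<and> (\<zeta> has_vector_derivative ?\<zeta>') ?F"
  \<comment> \<open>If \<open>I\<close> is the single point 0, the filter is trivial: every
    derivative claim holds, but derivatives are no longer unique and coefficients cannot be
    compared.\<close>
  proof (cases "?F = bot")
    case True
    then show ?thesis by (intro conjI has_vector_derivative_bot)
  next
    case nonbot: False
    have ut: "u t = gauss \<epsilon> (q t) (p t) (C t) (\<zeta> t)" by (rule pc.u_eq[OF t])
    have N: "L2_inner (gauss \<epsilon> (q t) (p t) (C t) (\<zeta> t)) (gauss \<epsilon> (q t) (p t) (C t) (\<zeta> t)) = 1"
      using norm_conserved[OF t] unfolding ut .
    have u_diff: "(\<lambda>s. u s x) differentiable ?F" for x
      using u_derivative[OF params t] differentiableI_vector by blast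
    note diff = pc.params_differentiable[OF t u_diff, unfolded vector_derivative_works]
    define C' where "C' i j = vector_derivative (\<lambda>s. C s $ i $ j) ?F" for i j
    define q' where "q' j = vector_derivative (\<lambda>s. q s $ j) ?F" for j
    define p' where "p' j = vector_derivative (\<lambda>s. p s $ j) ?F" for j
    define \<zeta>' where "\<zeta>' = vector_derivative \<zeta> ?F"
    note ders = diff(1)[folded C'_def] diff(2)[folded q'_def] diff(3)[folded p'_def] diff(4)[folded \<zeta>'_def]
    \<comment> \<open>Comparison of polynomials determines only the symmetric part of the quadratic
      coefficients; symmetry of the derivative recovers all of it.\<close>
    have C'_sym: "C' i j = C' j i" for i j
    proof (rule vector_derivative_unique_within[OF nonbot ders(1)])
      have "C s $ i $ j = C s $ j $ i" if "s \<in> I" for s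
        using arg_cong[OF width_matrix_sym[OF pc.width[OF that]], of "\<lambda>A. A $ j $ i"] by (simp add: transpose_def)
      then show "((\<lambda>s. C s $ i $ j) has_vector_derivative C' j i) ?F"
        by (intro has_vector_derivative_transform[OF t _ ders(1)])
    qed
    have quad: "shifted_quad (q t) (\<zeta>' - (\<Sum>i\<in>UNIV. complex_of_real (p t $ i * q' i)))
        (\<lambda>j. complex_of_real (p' j) - (\<Sum>i\<in>UNIV. C t $ i $ j * complex_of_real (q' i))) (\<lambda>i j. C' i j / 2) x
      = shifted_quad (q t) (- g.proj_const (h t)) (\<lambda>j. - g.grad_form (h t) j) (\<lambda>i j. - g.B (h t) i j / 2) x" for x
    proof -
      have e: "- \<i> * \<epsilon> * (- \<i> / \<epsilon> * (g.proj_poly (h t) x * u t x) / u t x) = - g.proj_poly (h t) x"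
        using eps pc.u_expo[OF t] by simp
      then have "((\<lambda>s. pc.expo s x) has_vector_derivative - g.proj_poly (h t) x) ?F"
        using pc.expo_derivative[OF t u_derivative[OF params t], of x] by (simp only: e)
      from vector_derivative_unique_within[OF nonbot pc.expo_derivative_params[OF t ders] this]
      show ?thesis
        by (simp add: g.proj_poly_def N shifted_quad_def sum_negf)
    qed
    have \<zeta>'_eq: "\<zeta>' - (\<Sum>i\<in>UNIV. complex_of_real (p t $ i * q' i)) = - g.proj_const (h t)"
      by (rule shifted_quad_unique(1)[OF quad])
    have lin_eq: "complex_of_real (p' j) - (\<Sum>i\<in>UNIV. C t $ i $ j * complex_of_real (q' i)) = - g.grad_form (h t) j" for j
      using fun_cong[OF shifted_quad_unique(2)[OF quad], of j] .
    have C'_eq: "C' i j = - g.B (h t) i j" for i j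
      using shifted_quad_unique(3)[OF quad, of i j] C'_sym[of j i] g.B_symmetric[OF h_symbol, of t j i]
      by (simp add: field_simps)
    define gp where "gp l = Re (avg \<epsilon> (u t) (pderiv_at (0, axis l 1) (h t)))" for l
    define gq where "gq l = Re (avg \<epsilon> (u t) (pderiv_at (axis l 1, 0) (h t)))" for l
    have real_avg: "complex_of_real (Re z) = z" if "cnj z = z" for z
      using that by (simp add: complex_eq_iff)
    have gp: "avg \<epsilon> (u t) (pderiv_at (0, axis l 1) (h t)) = complex_of_real (gp l)" for l
      unfolding gp_def ut by (rule real_avg[OF g.avg_real[OF g.sym_dp[OF h_symbol]], symmetric])
    have gq: "avg \<epsilon> (u t) (pderiv_at (axis l 1, 0) (h t)) = complex_of_real (gq l)" for l
      unfolding gq_def ut by (rule real_avg[OF g.avg_real[OF g.sym_dq[OF h_symbol]], symmetric])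
    have lin: "complex_of_real (p' j) - (\<Sum>l\<in>UNIV. C t $ j $ l * complex_of_real (q' l))
      = - (complex_of_real (gq j) + (\<Sum>l\<in>UNIV. C t $ j $ l * complex_of_real (gp l)))" for j
      using lin_eq[of j] unfolding g.grad_form_def ut[symmetric] gp gq g.C_symmetric(2)[of _ j] .
    \<comment> \<open>The single complex equation p' - C q' = -(averaged gradient form) carries both
      real equations. The derivatives and averages are real, so its imaginary part determines
      \<open>q'\<close> by invertibility of Im C, and its real part then gives
      \<open>p'\<close>.\<close>
    have "(\<Sum>l\<in>UNIV. Im (C t $ j $ l) * (q' l - gp l)) = 0" for j
      using arg_cong[OF lin[of j], of Im] by (simp add: Im_sum right_diff_distrib sum_subtractf)
    then have "complex_of_real (q' k - gp k) = 0" for k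
      using g.S_solve[of "\<lambda>l. complex_of_real (q' l - gp l)" "\<lambda>_. 0" k]
      by (simp flip: of_real_mult of_real_sum of_real_diff)
    then have q'_eq: "q' k = gp k" for k by simp
    have p'_eq: "p' j = - gq j" for j
      using arg_cong[OF lin[of j], of Re] by (simp add: q'_eq)
    have of_real: "((\<lambda>s. complex_of_real (f s)) has_vector_derivative complex_of_real D) ?F" if "(f has_vector_derivative D) ?F" for f D
      by (rule bounded_linear.has_vector_derivative[OF bounded_linear_of_real that])
    have avg_p: "avg_vec \<epsilon> (u t) (grad_p (h t)) $ i = complex_of_real (gp i)" for i
      by (simp add: avg_vec_def grad_p_def gp)
    have avg_q: "avg_vec \<epsilon> (u t) (grad_q (h t)) $ i = complex_of_real (gq i)" for i
      by (simp add: avg_vec_def grad_q_def gq)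
    show ?thesis
    proof (intro conjI has_vector_derivative_vecI)
      show "((\<lambda>s. cvec (q s) $ i) has_vector_derivative avg_vec \<epsilon> (u t) (grad_p (h t)) $ i) ?F" for i
        using of_real[OF ders(2)[of i]] by (simp add: cvec_def avg_p q'_eq)
      show "((\<lambda>s. cvec (p s) $ i) has_vector_derivative (- avg_vec \<epsilon> (u t) (grad_q (h t))) $ i) ?F" for i
        using of_real[OF ders(3)[of i]] by (simp add: cvec_def avg_q p'_eq)
      have "?C' = - B_mat \<epsilon> (u t) (h t) (C t)"
        unfolding B_mat_blocks by simp
      then show "((\<lambda>s. C s $ i $ j) has_vector_derivative ?C' $ i $ j) ?F" for i j
        using ders(1)[of i j] by (simp add: C'_eq ut)
      have "trace (B_mat \<epsilon> (u t) (h t) (C t) ** cmat (matrix_inv (Im_mat (C t)))) = (\<Sum>i\<in>UNIV. \<Sum>j\<in>UNIV. g.B (h t) i j * g.S i j)"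
        unfolding ut by (simp add: trace_def matrix_matrix_mult_def cmat_def g.S_symmetric)
      moreover have "bdot (cvec (p t)) (avg_vec \<epsilon> (u t) (grad_p (h t))) = (\<Sum>i\<in>UNIV. complex_of_real (p t $ i * q' i))"
        by (simp add: bdot_def cvec_def avg_p q'_eq)
      ultimately have "?\<zeta>' = \<zeta>'"
        using \<zeta>'_eq unfolding g.proj_const_def ut[symmetric] by (simp add: field_simps)
      then show "(\<zeta> has_vector_derivative ?\<zeta>') ?F"
        using ders(4) by simp
    qed
  qed
qed

end

subsection \<open>The Hagedorn factors\<close>

lemmas matrix_mult_bilinear_simps =
  bounded_bilinear.add_left[OF bounded_bilinear_matrix_mult] bounded_bilinear.add_right[OF bounded_bilinear_matrix_mult]
  bounded_bilinear.diff_left[OF bounded_bilinear_matrix_mult] bounded_bilinear.diff_right[OF bounded_bilinear_matrix_mult]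
  bounded_bilinear.minus_left[OF bounded_bilinear_matrix_mult] bounded_bilinear.minus_right[OF bounded_bilinear_matrix_mult]

text \<open>The known zero may lie on either side of \<open>t\<close>: it is at time 0 for P - C Q,
  and at the later or earlier time in question when a kernel vector of Q is traced back to
  0.\<close>

lemma linear_matrix_ode_zero:
  fixes A X :: "real \<Rightarrow> complex^'n^'n"
  assumes I: "is_interval I" and A: "continuous_on I A"
    and X: "\<And>s. s \<in> I \<Longrightarrow> (X has_vector_derivative A s ** X s) (at s within I)"
    and zero: "X r = 0" "r \<in> I" and t: "t \<in> I"
  shows "X t = 0"
proof -
  let ?a = "min r t" and ?b = "max r t"
  have sub: "{?a..?b} \<subseteq> I"
    using mem_is_interval_1_I[OF I zero(2) t] mem_is_interval_1_I[OF I t zero(2)] by (auto simp: min_def max_def split: if_splits)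
  obtain K where K: "K > 0" "\<And>(a::complex^'n^'n) (b::complex^'n^'n). norm (a ** b) \<le> norm a * norm b * K"
    using bounded_bilinear.pos_bounded[OF bounded_bilinear_matrix_mult] by metis
  have "bounded (A ` {?a..?b})"
    by (intro compact_imp_bounded compact_continuous_image continuous_on_subset[OF A sub]) auto
  then obtain R where "\<forall>y\<in>A ` {?a..?b}. norm y \<le> R"
    unfolding bounded_iff by blast
  then have R: "norm (A s) \<le> R" if "s \<in> {?a..?b}" for s
    using that by blast
  show ?thesis
  proof (rule linear_ode_zero[where L = "\<lambda>s v. A s ** v" and M = "R * K" and x = X, OF _ _ zero(1)])
    show "(X has_vector_derivative A s ** X s) (at s within {?a..?b})" if "s \<in> {?a..?b}" for s
      using X[of s] that sub by (meson has_vector_derivative_within_subset subsetD)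
    show "norm (A s ** v) \<le> R * K * norm v" if "s \<in> {?a..?b}" for s and v :: "complex^'n^'n"
    proof -
      have "norm (A s ** v) \<le> norm (A s) * norm v * K" by (rule K(2))
      also have "\<dots> \<le> R * norm v * K"
        using R[OF that] K(1) by (intro mult_right_mono) auto
      finally show ?thesis by (simp add: mult_ac)
    qed
  qed auto
qed

context variational_flow
begin

abbreviation qq :: "real \<Rightarrow> complex^'n^'n" where "qq t \<equiv> avg_mat \<epsilon> (u t) (hess_qq (h t))"
abbreviation qp :: "real \<Rightarrow> complex^'n^'n" where "qp t \<equiv> avg_mat \<epsilon> (u t) (hess_qp (h t))"
abbreviation pq :: "real \<Rightarrow> complex^'n^'n" where "pq t \<equiv> avg_mat \<epsilon> (u t) (hess_pq (h t))"
abbreviation pp :: "real \<Rightarrow> complex^'n^'n" where "pp t \<equiv> avg_mat \<epsilon> (u t) (hess_pp (h t))"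

lemma avg_hess_continuous:
  assumes b: "b \<in> Basis" "c \<in> Basis"
  shows "continuous_on I (\<lambda>s. avg \<epsilon> (u s) (pderiv_at b (pderiv_at c (h s))))"
  unfolding continuous_on_def
proof
  fix t assume t: "t \<in> I"
  obtain q p C \<zeta> where "packet_params \<epsilon> I u q p C \<zeta>"
    using exists_params by blast
  then interpret pc: packet_curve \<epsilon> I u q p C \<zeta> by (rule curve)
  show "((\<lambda>s. avg \<epsilon> (u s) (pderiv_at b (pderiv_at c (h s)))) \<longlongrightarrow> avg \<epsilon> (u t) (pderiv_at b (pderiv_at c (h t)))) (at t within I)"
  proof (rule pc.avg_tendsto[OF t])
    show "symbol_family (\<lambda>s. pderiv_at b (pderiv_at c (h s)))"
      by (rule subquadratic_symbol_hess[OF h_smooth h_growth b])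
    show "(\<lambda>n. pderiv_at b (pderiv_at c (h (X n))) z) \<longlonglongrightarrow> pderiv_at b (pderiv_at c (h t)) z" if "X \<longlonglongrightarrow> t" for X z
      by (rule subquadratic_hess_tendsto[OF h_smooth h_growth h_time b that])
  qed
qed

lemma matrix_continuous_on:
  fixes A :: "real \<Rightarrow> complex^'k^'l"
  assumes "\<And>i j. continuous_on I (\<lambda>s. A s $ i $ j)"
  shows "continuous_on I A"
proof -
  have "continuous_on I (\<lambda>s. \<chi> i j. A s $ i $ j)"
    by (intro continuous_on_vec_lambda assms)
  then show ?thesis by simp
qed

lemma blocks_continuous:
  "continuous_on I qq" "continuous_on I qp" "continuous_on I pq" "continuous_on I pp"
  by (rule matrix_continuous_on, simp only: avg_mat_hess_entries,
      rule avg_hess_continuous; rule axis_Basis_phase)+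

lemma avg_hess_real:
  assumes t: "t \<in> I" and b: "b \<in> Basis" "c \<in> Basis"
  shows "cnj (avg \<epsilon> (u t) (pderiv_at b (pderiv_at c (h t)))) = avg \<epsilon> (u t) (pderiv_at b (pderiv_at c (h t)))"
proof -
  obtain q p C \<zeta> where "packet_params \<epsilon> I u q p C \<zeta>"
    using exists_params by blast
  then interpret pc: packet_curve \<epsilon> I u q p C \<zeta> by (rule curve)
  interpret g: gaussian \<epsilon> "q t" "p t" "C t" "\<zeta> t" by (rule pc.gaussian_at[OF t])
  show ?thesis
    unfolding pc.u_eq[OF t] by (rule g.avg_real) (rule symbol_family_pderiv[OF symbol_family_pderiv[OF h_symbol b(2)] b(1)])
qed

lemma avg_hess_symmetric:
  assumes "b \<in> Basis" "c \<in> Basis"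
  shows "avg \<epsilon> (u t) (pderiv_at b (pderiv_at c (h t))) = avg \<epsilon> (u t) (pderiv_at c (pderiv_at b (h t)))"
  using pderiv_at_commute[OF h_smooth[of t] assms] by (intro arg_cong[of _ _ "avg \<epsilon> (u t)"] ext)

lemma blocks_transpose:
  "transpose (qq t) = qq t" "transpose (pp t) = pp t" "transpose (qp t) = pq t" "transpose (pq t) = qp t"
  by (simp_all add: transpose_def vec_eq_iff avg_mat_hess_entries avg_hess_symmetric axis_Basis_phase)

lemma blocks_conj_transpose:
  assumes "t \<in> I"
  shows "conj_transpose (qq t) = qq t" "conj_transpose (pp t) = pp t" "conj_transpose (qp t) = pq t" "conj_transpose (pq t) = qp t"
  using avg_hess_real[OF assms]
  by (simp_all add: conj_transpose_def vec_eq_iff avg_mat_hess_entries axis_Basis_phase)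
    (simp_all add: avg_hess_symmetric axis_Basis_phase)

text \<open>The curve \<open>u\<close> is given, so the averaged Hessian blocks are known continuous
  coefficients and the system is linear in the pair (Q, P). It therefore has a solution on all of
  \<open>I\<close>.\<close>

lemma hagedorn_exists: "\<exists>Q P. Q 0 = Q0 \<and> P 0 = P0 \<and> hagedorn_equations \<epsilon> h I u Q P"
proof -
  define L where "L s z = (pq s ** fst z + pp s ** snd z, - qq s ** fst z - qp s ** snd z)" for s and z :: "(complex^'n^'n) \<times> (complex^'n^'n)"
  have "\<exists>x. x 0 = (Q0, P0) \<and> (\<forall>s\<in>I. (x has_vector_derivative L s (x s)) (at s within I))"
  proof (rule linear_ode_exists[OF interval])
    show "continuous_on {a..b} (\<lambda>s. L s (x s))" if ab: "{a..b} \<subseteq> I" "continuous_on {a..b} x" for a b x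
      unfolding L_def using ab
      by (intro continuous_intros matrix_mult_continuous_on continuous_on_minus)
        (auto intro!: continuous_intros blocks_continuous[THEN continuous_on_subset])
    have lin: "bounded_linear (\<lambda>z. A ** fst z + B ** snd z)" for A B :: "complex^'n^'n"
      by (intro bounded_linear_add bounded_linear_compose[OF bounded_bilinear.bounded_linear_right[OF bounded_bilinear_matrix_mult]]
          bounded_linear_fst bounded_linear_snd)
    have lin': "bounded_linear (\<lambda>z. A ** fst z - B ** snd z)" for A B :: "complex^'n^'n"
      by (intro bounded_linear_sub bounded_linear_compose[OF bounded_bilinear.bounded_linear_right[OF bounded_bilinear_matrix_mult]]
          bounded_linear_fst bounded_linear_snd)
    show "bounded_linear (L s)" for s
      unfolding L_def by (intro bounded_linear_Pair lin lin')
    show "\<exists>M. \<forall>s\<in>{a..b}. \<forall>v. norm (L s v) \<le> M * norm v" if ab: "{a..b} \<subseteq> I" for a b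
    proof -
      obtain K where K: "K > 0" "\<And>(a::complex^'n^'n) (b::complex^'n^'n). norm (a ** b) \<le> norm a * norm b * K"
        using bounded_bilinear.pos_bounded[OF bounded_bilinear_matrix_mult] by metis
      define r where "r s = norm (pq s) + norm (pp s) + norm (qq s) + norm (qp s)" for s
      have "continuous_on {a..b} r"
        unfolding r_def using ab by (intro continuous_intros continuous_on_subset[OF blocks_continuous(1)]
          continuous_on_subset[OF blocks_continuous(2)] continuous_on_subset[OF blocks_continuous(3)]
          continuous_on_subset[OF blocks_continuous(4)])
      then have "bounded (r ` {a..b})"
        by (intro compact_imp_bounded compact_continuous_image) auto
      then obtain R where "\<forall>y\<in>r ` {a..b}. norm y \<le> R"
        unfolding bounded_iff by blast
      then have R': "norm (r s) \<le> R" if "s \<in> {a..b}" for s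
        using that by blast
      have R: "r s \<le> R" if "s \<in> {a..b}" for s
        using R'[OF that] by (simp add: abs_le_iff)
      have "norm (L s v) \<le> R * K * norm v" if s: "s \<in> {a..b}" for s v
      proof -
        have f: "norm (A ** fst v) \<le> norm A * (K * norm v)" for A :: "complex^'n^'n"
        proof -
          have "norm (A ** fst v) \<le> norm A * norm (fst v) * K" by (rule K(2))
          also have "\<dots> \<le> norm A * norm v * K"
            using K(1) norm_fst_le[of "fst v" "snd v"] by (intro mult_right_mono mult_left_mono) auto
          finally show ?thesis by (simp add: mult_ac)
        qed
        have g: "norm (A ** snd v) \<le> norm A * (K * norm v)" for A :: "complex^'n^'n"
        proof -
          have "norm (A ** snd v) \<le> norm A * norm (snd v) * K" by (rule K(2))
          also have "\<dots> \<le> norm A * norm v * K"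
            using K(1) norm_snd_le[of "snd v" "fst v"] by (intro mult_right_mono mult_left_mono) auto
          finally show ?thesis by (simp add: mult_ac)
        qed
        have "norm (L s v) \<le> norm (pq s ** fst v + pp s ** snd v) + norm (- qq s ** fst v - qp s ** snd v)"
          unfolding L_def by (rule norm_Pair_le)
        also have "\<dots> \<le> (norm (pq s ** fst v) + norm (pp s ** snd v)) + (norm (- qq s ** fst v) + norm (qp s ** snd v))"
          by (intro add_mono norm_triangle_ineq norm_triangle_ineq4)
        also have "\<dots> \<le> (norm (pq s) * (K * norm v) + norm (pp s) * (K * norm v)) + (norm (- qq s) * (K * norm v) + norm (qp s) * (K * norm v))"
          by (intro add_mono f g)
        also have "\<dots> = r s * (K * norm v)"
          by (simp add: r_def distrib_right)
        also have "\<dots> \<le> R * (K * norm v)"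
          using R[OF s] K(1) by (intro mult_right_mono) auto
        finally show ?thesis by (simp add: mult_ac)
      qed
      then show ?thesis by blast
    qed
  qed
  then obtain x where x: "x 0 = (Q0, P0)" "\<And>s. s \<in> I \<Longrightarrow> (x has_vector_derivative L s (x s)) (at s within I)"
    by blast
  have "hagedorn_equations \<epsilon> h I u (\<lambda>s. fst (x s)) (\<lambda>s. snd (x s))"
    unfolding hagedorn_equations_def
  proof (intro ballI conjI)
    fix t assume t: "t \<in> I"
    show "((\<lambda>s. fst (x s)) has_vector_derivative pq t ** fst (x t) + pp t ** snd (x t)) (at t within I)"
      using bounded_linear.has_vector_derivative[OF bounded_linear_fst x(2)[OF t]] by (simp add: L_def)
    show "((\<lambda>s. snd (x s)) has_vector_derivative - qq t ** fst (x t) - qp t ** snd (x t)) (at t within I)"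
      using bounded_linear.has_vector_derivative[OF bounded_linear_snd x(2)[OF t]] by (simp add: L_def)
  qed
  then show ?thesis
    using x(1) by (intro exI[of _ "\<lambda>s. fst (x s)"] exI[of _ "\<lambda>s. snd (x s)"]) simp
qed

lemma hagedorn_derivatives:
  assumes "hagedorn_equations \<epsilon> h I u Q P" "t \<in> I"
  shows "(P has_vector_derivative - qq t ** Q t - qp t ** P t) (at t within I)"
    "(Q has_vector_derivative pq t ** Q t + pp t ** P t) (at t within I)"
  using assms unfolding hagedorn_equations_def by blast+

text \<open>By the Riccati equation P - C Q solves a homogeneous linear equation and vanishes at 0.
  With P = C Q inserted, Q itself solves such an equation, so a kernel vector of Q at any time would
  be a kernel vector of \<open>Q0\<close>.\<close>

theorem hagedorn_factorizes:
  assumes params: "packet_params \<epsilon> I u q p C \<zeta>" and C0: "C 0 = C0"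
    and fact0: "factorizes C0 Q0 P0" and init: "Q 0 = Q0" "P 0 = P0"
    and hag: "hagedorn_equations \<epsilon> h I u Q P" and t: "t \<in> I"
  shows "factorizes (C t) (Q t) (P t)"
proof -
  interpret pc: packet_curve \<epsilon> I u q p C \<zeta> by (rule curve[OF params])
  have inv0: "invertible Q0" and P0: "P0 = C0 ** Q0"
    using fact0 unfolding factorizes_def by (auto simp: matrix_mul_assoc[symmetric] matrix_inv_left)
  have C_der: "(C has_vector_derivative - qq s - qp s ** C s - C s ** pq s - C s ** pp s ** C s) (at s within I)" if "s \<in> I" for s
    using equations_of_motion[OF params] that unfolding parameter_equations_def by blast
  have C_cont: "continuous_on I C"
    using pc.params_tendsto(1) by (simp add: continuous_on_def)
  have P_eq: "P s = C s ** Q s" if s: "s \<in> I" for s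
  proof -
    have "(\<lambda>s. P s - C s ** Q s) s = 0"
    proof (rule linear_matrix_ode_zero[OF interval(1) _ _ _ interval(2) s])
      show "continuous_on I (\<lambda>s. - (qp s + C s ** pp s))"
        by (intro continuous_intros matrix_mult_continuous_on blocks_continuous C_cont)
      show "P 0 - C 0 ** Q 0 = 0"
        unfolding C0 init P0 by simp
      fix s assume s: "s \<in> I"
      have "((\<lambda>s. P s - C s ** Q s) has_vector_derivative (- qq s ** Q s - qp s ** P s)
        - (C s ** (pq s ** Q s + pp s ** P s) + (- qq s - qp s ** C s - C s ** pq s - C s ** pp s ** C s) ** Q s)) (at s within I)"
        by (intro has_vector_derivative_diff matrix_mult_has_vector_derivative hagedorn_derivatives[OF hag s] C_der[OF s])
      also have "(- qq s ** Q s - qp s ** P s)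
        - (C s ** (pq s ** Q s + pp s ** P s) + (- qq s - qp s ** C s - C s ** pq s - C s ** pp s ** C s) ** Q s)
        = - (qp s + C s ** pp s) ** (P s - C s ** Q s)"
        by (simp add: matrix_mult_bilinear_simps matrix_mul_assoc)
      finally show "((\<lambda>s. P s - C s ** Q s) has_vector_derivative - (qp s + C s ** pp s) ** (P s - C s ** Q s)) (at s within I)" .
    qed
    then show ?thesis by simp
  qed
  have "v = 0" if v: "Q t *v v = 0" for v
  proof -
    \<comment> \<open>The vector repeated in every column, so that the uniqueness lemma for square
      matrices applies to Q V.\<close>
    define V :: "complex^'n^'n" where "V = (\<chi> i j. v $ i)"
    have QV: "(A ** V) $ i $ j = (A *v v) $ i" for A i j
      by (simp add: V_def matrix_matrix_mult_def matrix_vector_mult_def)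
    have "(\<lambda>s. Q s ** V) 0 = 0"
    proof (rule linear_matrix_ode_zero[OF interval(1) _ _ _ t interval(2)])
      show "continuous_on I (\<lambda>s. pq s + pp s ** C s)"
        by (intro continuous_intros matrix_mult_continuous_on blocks_continuous C_cont)
      show "Q t ** V = 0"
        by (simp add: vec_eq_iff QV v)
      fix s assume s: "s \<in> I"
      have "((\<lambda>s. Q s ** V) has_vector_derivative Q s ** 0 + (pq s ** Q s + pp s ** P s) ** V) (at s within I)"
        by (intro matrix_mult_has_vector_derivative hagedorn_derivatives[OF hag s] has_vector_derivative_const)
      also have "Q s ** 0 + (pq s ** Q s + pp s ** P s) ** V = (pq s + pp s ** C s) ** (Q s ** V)"
        by (simp add: P_eq[OF s] matrix_mult_bilinear_simps matrix_mul_assoc bounded_bilinear.zero_right[OF bounded_bilinear_matrix_mult])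
      finally show "((\<lambda>s. Q s ** V) has_vector_derivative (pq s + pp s ** C s) ** (Q s ** V)) (at s within I)" .
    qed
    then have "matrix_inv Q0 ** (Q0 ** V) = matrix_inv Q0 ** 0"
      using init by simp
    then have "V = 0"
      by (simp add: matrix_mul_assoc matrix_inv_left[OF inv0] bounded_bilinear.zero_right[OF bounded_bilinear_matrix_mult])
    then show ?thesis
      by (simp add: V_def vec_eq_iff)
  qed
  then have inv: "invertible (Q t)"
    using invertible_left_inverse matrix_left_invertible_ker by blast
  then have "C t = P t ** matrix_inv (Q t)"
    by (simp add: P_eq[OF t] matrix_mul_assoc[symmetric] matrix_inv_right)
  then show ?thesis
    using inv by (simp add: factorizes_def)
qed

text \<open>Both symplecticity relations are conserved quantities of the same form, with
  \<open>\<sigma>\<close> the transpose or the conjugate transpose.\<close>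

lemma antiinvolution_conserved:
  assumes hag: "hagedorn_equations \<epsilon> h I u Q P" and t: "t \<in> I"
    and lin: "bounded_linear \<sigma>" and mult: "\<And>A B :: complex^'n^'n. \<sigma> (A ** B) = \<sigma> B ** \<sigma> A"
    and \<sigma>: "\<And>t. t \<in> I \<Longrightarrow> \<sigma> (qq t) = qq t" "\<And>t. t \<in> I \<Longrightarrow> \<sigma> (pp t) = pp t"
      "\<And>t. t \<in> I \<Longrightarrow> \<sigma> (qp t) = pq t" "\<And>t. t \<in> I \<Longrightarrow> \<sigma> (pq t) = qp t"
  shows "\<sigma> (Q t) ** P t - \<sigma> (P t) ** Q t = \<sigma> (Q 0) ** P 0 - \<sigma> (P 0) ** Q 0"
proof -
  have "((\<lambda>s. \<sigma> (Q s) ** P s - \<sigma> (P s) ** Q s) has_vector_derivative 0) (at s within I)" if s: "s \<in> I" for s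
  proof -
    note der = hagedorn_derivatives[OF hag s]
    note \<sigma>_der = der[THEN bounded_linear.has_vector_derivative[OF lin]]
    have "((\<lambda>s. \<sigma> (Q s) ** P s - \<sigma> (P s) ** Q s) has_vector_derivative
      (\<sigma> (Q s) ** (- qq s ** Q s - qp s ** P s) + \<sigma> (pq s ** Q s + pp s ** P s) ** P s)
      - (\<sigma> (P s) ** (pq s ** Q s + pp s ** P s) + \<sigma> (- qq s ** Q s - qp s ** P s) ** Q s)) (at s within I)"
      by (intro has_vector_derivative_diff matrix_mult_has_vector_derivative der \<sigma>_der)
    also have "(\<sigma> (Q s) ** (- qq s ** Q s - qp s ** P s) + \<sigma> (pq s ** Q s + pp s ** P s) ** P s)
      - (\<sigma> (P s) ** (pq s ** Q s + pp s ** P s) + \<sigma> (- qq s ** Q s - qp s ** P s) ** Q s) = 0"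
      by (simp add: linear_add[OF bounded_linear.linear[OF lin]] linear_diff[OF bounded_linear.linear[OF lin]]
          linear_neg[OF bounded_linear.linear[OF lin]] mult \<sigma>[OF s] matrix_mult_bilinear_simps matrix_mul_assoc)
    finally show ?thesis .
  qed
  then obtain c where c: "\<And>s. s \<in> I \<Longrightarrow> \<sigma> (Q s) ** P s - \<sigma> (P s) ** Q s = c"
    using has_vector_derivative_zero_constant[of I "\<lambda>s. \<sigma> (Q s) ** P s - \<sigma> (P s) ** Q s"] interval(1) is_interval_convex by blast
  show ?thesis
    using c[OF t] c[OF interval(2)] by simp
qed

theorem hagedorn_symplectic:
  assumes hag: "hagedorn_equations \<epsilon> h I u Q P" and t: "t \<in> I" and sym: "symplectic_pair (Q 0) (P 0)"
  shows "symplectic_pair (Q t) (P t)"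
proof -
  have "bounded_linear (transpose :: complex^'n^'n \<Rightarrow> complex^'n^'n)"
    unfolding linear_conv_bounded_linear[symmetric] by (rule linearI) (simp_all add: transpose_def vec_eq_iff)
  note 1 = antiinvolution_conserved[OF hag t this matrix_transpose_mul blocks_transpose]
  have "bounded_linear (conj_transpose :: complex^'n^'n \<Rightarrow> complex^'n^'n)"
    unfolding linear_conv_bounded_linear[symmetric] by (rule linearI) (simp_all add: conj_transpose_def vec_eq_iff)
  moreover have "conj_transpose (A ** B) = conj_transpose B ** conj_transpose A" for A B :: "complex^'n^'n"
    by (simp add: conj_transpose_def matrix_matrix_mult_def vec_eq_iff mult.commute)
  ultimately have 2: "conj_transpose (Q t) ** P t - conj_transpose (P t) ** Q t = conj_transpose (Q 0) ** P 0 - conj_transpose (P 0) ** Q 0"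
    by (rule antiinvolution_conserved[OF hag t _ _ blocks_conj_transpose])
  show ?thesis
    using sym unfolding symplectic_pair_def 1 2 .
qed

end

text \<open>A wave packet fixes \<zeta> only modulo \<open>2 \<pi> \<epsilon>\<close>, so the
  equations are claimed for every parametrisation with continuous \<zeta> starting at
  \<open>\<zeta>0\<close>. Existence is stated separately, so that this claim is not vacuous; the
  Hagedorn factors are treated in the same way.\<close>

theorem theorem4p2:
  fixes \<epsilon> :: real
    and h :: "real \<Rightarrow> (real^'n) \<times> (real^'n) \<Rightarrow> real"
    and I :: "real set"
    and u :: "real \<Rightarrow> real^'n \<Rightarrow> complex"
    and q0 p0 :: "real^'n" and C0 :: "complex^'n^'n" and \<zeta>0 :: complex
  assumes eps: "0 < \<epsilon>" "\<epsilon> \<le> 1"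
    and h_time: "\<And>z. continuous_on UNIV (\<lambda>t. h t z)"
    and h_smooth: "\<And>t. smooth_fun (h t)"
    and h_growth: "subquadratic h"
    and interval: "is_interval I" "0 \<in> I"
    and initial_width: "width_matrix C0"
    and initial: "u 0 = gauss \<epsilon> q0 p0 C0 \<zeta>0"
    and normalized: "L2_norm (u 0) = 1"
    and variational: "variational_solution \<epsilon> h I u"
  shows "(\<exists>q p C \<zeta>. packet_params \<epsilon> I u q p C \<zeta> \<and> \<zeta> 0 = \<zeta>0) \<and>
    (\<forall>q p C \<zeta>. packet_params \<epsilon> I u q p C \<zeta> \<and> \<zeta> 0 = \<zeta>0 \<longrightarrow>
       parameter_equations \<epsilon> h I u q p C \<zeta> \<and>
       (q 0, p 0, C 0, \<zeta> 0) = (q0, p0, C0, \<zeta>0) \<and>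
       (\<forall>Q0 P0. factorizes C0 Q0 P0 \<longrightarrow>
          (\<exists>Q P. Q 0 = Q0 \<and> P 0 = P0 \<and> hagedorn_equations \<epsilon> h I u Q P) \<and>
          (\<forall>Q P. Q 0 = Q0 \<and> P 0 = P0 \<and> hagedorn_equations \<epsilon> h I u Q P \<longrightarrow>
             (\<forall>t\<in>I. factorizes (C t) (Q t) (P t)) \<and>
             (symplectic_pair Q0 P0 \<longrightarrow> (\<forall>t\<in>I. symplectic_pair (Q t) (P t))))))"
proof -
  interpret vf: variational_flow \<epsilon> h I u q0 p0 C0 \<zeta>0
    by unfold_locales (fact assms)+
  show ?thesis
  proof (intro conjI allI impI)
    show "\<exists>q p C \<zeta>. packet_params \<epsilon> I u q p C \<zeta> \<and> \<zeta> 0 = \<zeta>0"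
      by (rule vf.exists_params)
    fix q p C \<zeta> assume params: "packet_params \<epsilon> I u q p C \<zeta> \<and> \<zeta> 0 = \<zeta>0"
    then have pp: "packet_params \<epsilon> I u q p C \<zeta>" by simp
    show "parameter_equations \<epsilon> h I u q p C \<zeta>"
      by (rule vf.equations_of_motion[OF pp])
    have at0: "width_matrix (C 0)" "u 0 = gauss \<epsilon> (q 0) (p 0) (C 0) (\<zeta> 0)"
      using pp interval(2) unfolding packet_params_def by auto
    have eq0: "C 0 = C0" "q 0 = q0" "p 0 = p0"
      using vf.params_unique[OF _ at0(1) initial_width, of "q 0" "p 0" "\<zeta> 0" q0 p0 \<zeta>0] at0(2) initial by auto
    then show "(q 0, p 0, C 0, \<zeta> 0) = (q0, p0, C0, \<zeta>0)"
      using params by simp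
    fix Q0 P0 assume fact0: "factorizes C0 Q0 P0"
    show "\<exists>Q P. Q 0 = Q0 \<and> P 0 = P0 \<and> hagedorn_equations \<epsilon> h I u Q P"
      by (rule vf.hagedorn_exists)
    fix Q P assume QP: "Q 0 = Q0 \<and> P 0 = P0 \<and> hagedorn_equations \<epsilon> h I u Q P"
    show "\<forall>t\<in>I. factorizes (C t) (Q t) (P t)"
      using vf.hagedorn_factorizes[OF pp eq0(1) fact0] QP by blast
    assume "symplectic_pair Q0 P0"
    then show "\<forall>t\<in>I. symplectic_pair (Q t) (P t)"
      using vf.hagedorn_symplectic QP by blast
  qed
qed

end
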